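(* Let $k,l\in\mathbb{N}$ be fixed and let $A_0,A_1,\dots,A_l\in\mathbb{R}^{k\times k}$ be deterministic symmetric matrices (not assumed positive semi-definite). For each $n$ let $G_1,\dots,G_l\in\mathbb{R}^{n\times n}$ be independent matrices with independent standard normal entries, let $\bar G_i=\frac{1}{\sqrt 2}(G_i+G_i^T)$, and let $$H=A_0\otimes I_n+\frac{1}{\sqrt n}\sum_{i=1}^{l}A_i\otimes \bar G_i .$$ Then $$\lim_{n\to\infty}\mathbb{E}\,\lambda_n(H)\;\ge\;\rho_n,\qquad \rho_n=\inf_{Z=Z^T\succ 0}\lambda_n\Big(A_0+Z+\sum_{i=1}^{l}A_iZ^{-1}A_i\Big),$$ where the infimum is over symmetric positive definite $Z\in\mathbb{R}^{k\times k}$.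
   Context: For a symmetric matrix $M$ of any size, $\lambda_n(M)$ denotes its largest eigenvalue (the subscript $n$ in $\lambda_n(\cdot)$ and in $\rho_n$ is just notation for "largest" / "upper edge"). $\otimes$ is the Kronecker product and $I_n$ the $n\times n$ identity. *)

theory Defs
  imports
    "HOL-Probability.Probability"
    "Jordan_Normal_Form.Gauss_Jordan_Elimination"
    "Jordan_Normal_Form.Spectral_Radius"
begin

definition symmetric_mat :: "nat \<Rightarrow> real mat \<Rightarrow> bool" where
  "symmetric_mat m A \<longleftrightarrow> A \<in> carrier_mat m m \<and> transpose_mat A = A"

definition pos_def_mat :: "nat \<Rightarrow> real mat \<Rightarrow> bool" where
  "pos_def_mat m Z \<longleftrightarrow> symmetric_mat m Z \<and>
     (\<forall>v \<in> carrier_vec m. v \<noteq> 0\<^sub>v m \<longrightarrow> scalar_prod v (Z *\<^sub>v v) > 0)"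

text \<open>Only meaningful for symmetric matrices of positive dimension, whose real spectrum is
  finite and nonempty.\<close>

definition max_eigenvalue :: "real mat \<Rightarrow> real" where
  "max_eigenvalue M = Max (spectrum M)"

definition kronecker :: "real mat \<Rightarrow> real mat \<Rightarrow> real mat" where
  "kronecker A B = mat (dim_row A * dim_row B) (dim_col A * dim_col B)
     (\<lambda>(i, j). A $$ (i div dim_row B, j div dim_col B) * B $$ (i mod dim_row B, j mod dim_col B))"

text \<open>The library type of matrices carries its dimensions in the values and has no zero of
  unspecified size, so that \<open>sum\<close> is not available for it.\<close>

definition sum_of_mats :: "nat \<Rightarrow> (nat \<Rightarrow> real mat) \<Rightarrow> nat set \<Rightarrow> real mat" where
  "sum_of_mats m F I = mat m m (\<lambda>(a, b). \<Sum>i\<in>I. F i $$ (a, b))"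

text \<open>All entries of all the matrices are jointly independent: this is independence of
  \<open>G 1, \<dots>, G l\<close> together with independence of the entries within each of them.\<close>

definition indep_std_gaussian_mats ::
    "'w measure \<Rightarrow> nat \<Rightarrow> nat \<Rightarrow> (nat \<Rightarrow> 'w \<Rightarrow> real mat) \<Rightarrow> bool" where
  "indep_std_gaussian_mats M l n G \<longleftrightarrow>
     prob_space M \<and>
     (\<forall>i \<in> {1..l}. \<forall>\<omega> \<in> space M. G i \<omega> \<in> carrier_mat n n) \<and>
     (\<forall>i \<in> {1..l}. \<forall>a < n. \<forall>b < n.
        distributed M lborel (\<lambda>\<omega>. G i \<omega> $$ (a, b)) (\<lambda>x. ennreal (std_normal_density x))) \<and>
     prob_space.indep_vars M (\<lambda>_. borel) (\<lambda>(i, a, b) \<omega>. G i \<omega> $$ (a, b))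
       ({1..l} \<times> {..<n} \<times> {..<n})"

definition symmetrized :: "real mat \<Rightarrow> real mat" where
  "symmetrized G = (1 / sqrt 2) \<cdot>\<^sub>m (G + transpose_mat G)"

definition H_mat ::
    "nat \<Rightarrow> nat \<Rightarrow> (nat \<Rightarrow> real mat) \<Rightarrow> nat \<Rightarrow> (nat \<Rightarrow> real mat) \<Rightarrow> real mat" where
  "H_mat k l A n G = kronecker (A 0) (1\<^sub>m n) +
     (1 / sqrt (real n)) \<cdot>\<^sub>m
       sum_of_mats (k * n) (\<lambda>i. kronecker (A i) (symmetrized (G i))) {1..l}"

definition rho_edge :: "nat \<Rightarrow> nat \<Rightarrow> (nat \<Rightarrow> real mat) \<Rightarrow> real" where
  "rho_edge k l A = (INF Z \<in> {Z. pos_def_mat k Z}.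
     max_eigenvalue (A 0 + Z + sum_of_mats k (\<lambda>i. A i * the (mat_inverse Z) * A i) {1..l}))"

end

theory Submission
  imports Defs "HOL-Real_Asymp.Real_Asymp"
begin

text \<open>
  The limit exists because the mean largest eigenvalue in dimension \<open>n * N\<close> is close to the one in dimension \<open>n\<close>, and it is at least
  \<open>\<rho>\<close> because the function whose infimum is \<open>\<rho>\<close> takes values arbitrarily close to the limit.

  Let \<open>X\<close> be the random matrix with \<open>K\<close> times the identity added. For large \<open>K\<close> the largest eigenvalue is the operator
  norm of \<open>X\<close> minus \<open>K\<close>, up to \<open>O (1 / K)\<close> in mean (\<open>opnorm_shift_bounds\<close>), so it suffices to treat the norm for each fixed \<open>K\<close>
  (\<open>edge_limit\<close>). The norm is read off from \<open>Tr X\<^sup>2\<^sup>p\<close> with \<open>p\<close> a small power of \<open>n\<close>; by the Gaussian Poincare inequality (\<open>poincare\<close>)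
  this trace concentrates, so that its mean determines the mean norm.

  Convergence. \<open>N\<close> independent copies of the model of size \<open>n\<close> and the model of size \<open>n * N\<close> are the two ends of a path of variance profiles.
  Along the path the mean of \<open>Tr X\<^sup>2\<^sup>p\<close> changes by a small relative amount (\<open>interp_deriv_bound\<close>): its derivative is a sum of products of partial
  traces weighted by the derivative of the profile. The means of these partial traces are equal by exchangeability, and the weights sum to zero, so
  the leading part cancels, leaving covariances and a crossed contraction, both small. Therefore the mean norms at \<open>n\<close> and \<open>n * N\<close> agree
  asymptotically. Together with the monotonicity of the norm under passing to submatrices this makes the sequence Cauchy
  (\<open>edge_seq_convergent\<close>); call the limit \<open>\<alpha>\<close>.

  Lower bound. Integration by parts shows that the normalized partial traces of \<open>X ^ r\<close> converge to matrices \<open>\<mu> r\<close> of size \<open>k\<close>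
  satisfying the recursion of the operator-valued semicircle law. For \<open>z > \<alpha>\<close> the series \<open>Q = \<Sum>r. \<mu> r / z ^ (r + 1)\<close> converges, is symmetric positive
  definite, and solves \<open>(z - K - A 0 - \<Sum>i. A i Q A i) Q = 1\<close> (\<open>dyson_solution\<close>). Now \<open>Z = Q\<^sup>-\<^sup>1\<close> makes
  \<open>A 0 + Z + \<Sum>i. A i Z\<^sup>-\<^sup>1 A i\<close> equal to \<open>z - K\<close> times the identity, hence \<open>\<rho> \<le> z - K\<close> (\<open>rho_edge_le_of_dyson\<close>). Letting
  \<open>z\<close> decrease to \<open>\<alpha>\<close> and \<open>K\<close> grow gives the claim.
\<close>

section \<open>Polynomials in finitely many variables\<close>

text \<open>Polynomials are used as functions, closed under the operations that occur below, so that expectations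
  of all of them are determined by the joint moments of the variables.\<close>

inductive polyfun :: "'e set \<Rightarrow> (('e \<Rightarrow> real) \<Rightarrow> real) \<Rightarrow> bool" for E where
  const: "polyfun E (\<lambda>_. c)"
| var: "e \<in> E \<Longrightarrow> polyfun E (\<lambda>x. x e)"
| add: "polyfun E f \<Longrightarrow> polyfun E h \<Longrightarrow> polyfun E (\<lambda>x. f x + h x)"
| mult: "polyfun E f \<Longrightarrow> polyfun E h \<Longrightarrow> polyfun E (\<lambda>x. f x * h x)"

named_theorems polyI
declare polyfun.intros [polyI]

lemma polyfun_sum [polyI]:
  assumes "\<And>i. i \<in> I \<Longrightarrow> polyfun E (f i)"
  shows "polyfun E (\<lambda>x. \<Sum>i\<in>I. f i x)"
  using assms
proof (induction I rule: infinite_finite_induct)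
  case (insert i I)
  then show ?case by (simp add: polyI)
qed (auto intro: polyI)

lemma polyfun_prod [polyI]:
  assumes "\<And>i. i \<in> I \<Longrightarrow> polyfun E (f i)"
  shows "polyfun E (\<lambda>x. \<Prod>i\<in>I. f i x)"
  using assms
proof (induction I rule: infinite_finite_induct)
  case (insert i I)
  then show ?case by (simp add: polyI)
qed (auto intro: polyI)

lemma polyfun_power [polyI]: "polyfun E f \<Longrightarrow> polyfun E (\<lambda>x. f x ^ n)"
  by (induction n) (auto intro: polyI)

lemma polyfun_cmult [polyI]: "polyfun E f \<Longrightarrow> polyfun E (\<lambda>x. c * f x)"
  by (intro polyI)

lemma polyfun_divide [polyI]: "polyfun E f \<Longrightarrow> polyfun E (\<lambda>x. f x / c)"
  using polyfun_cmult[of E f "1/c"] by simp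

lemma polyfun_minus [polyI]: "polyfun E f \<Longrightarrow> polyfun E (\<lambda>x. - f x)"
  using polyfun_cmult[of E f "-1"] by simp

lemma polyfun_diff [polyI]: "polyfun E f \<Longrightarrow> polyfun E h \<Longrightarrow> polyfun E (\<lambda>x. f x - h x)"
  using polyfun.add[OF _ polyfun_minus, of E f h] by simp

lemma polyfun_subst:
  assumes "polyfun E f" "\<And>e. e \<in> E \<Longrightarrow> polyfun E' (\<lambda>x. s x e)"
  shows "polyfun E' (\<lambda>x. f (s x))"
  using assms(1) by induction (auto intro: polyI assms(2))

definition monomial :: "'e set \<Rightarrow> ('e \<Rightarrow> nat) \<Rightarrow> ('e \<Rightarrow> real) \<Rightarrow> real" where
  "monomial E k x = (\<Prod>e\<in>E. x e ^ k e)"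

lemma polyfun_monom [polyI]: "polyfun E (monomial E k)"
  unfolding monomial_def[abs_def] by (intro polyI)

inductive monom_span :: "'e set \<Rightarrow> (('e \<Rightarrow> real) \<Rightarrow> real) \<Rightarrow> bool" for E where
  monom: "monom_span E (monomial E k)"
| scale: "monom_span E f \<Longrightarrow> monom_span E (\<lambda>x. c * f x)"
| add: "monom_span E f \<Longrightarrow> monom_span E h \<Longrightarrow> monom_span E (\<lambda>x. f x + h x)"

lemma polyfun_monom_span: "monom_span E f \<Longrightarrow> polyfun E f"
  by (induction rule: monom_span.induct) (auto intro: polyI)

lemma monom_span_mult:
  assumes "monom_span E f" "monom_span E h"
  shows "monom_span E (\<lambda>x. f x * h x)"
  using assms(1)
proof induction
  case (monom k)
  from assms(2) show ?case
  proof induction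
    case (monom k')
    have "(\<lambda>x. monomial E k x * monomial E k' x) = monomial E (\<lambda>e. k e + k' e)"
      by (auto simp: monomial_def power_add prod.distrib)
    then show ?case by (simp add: monom_span.monom)
  next
    case (scale f c)
    from monom_span.scale[OF scale.IH, of c] show ?case by (simp add: algebra_simps)
  next
    case (add f h)
    from monom_span.add[OF add.IH] show ?case by (simp add: algebra_simps)
  qed
next
  case (scale f c)
  from monom_span.scale[OF scale.IH, of c] show ?case by (simp add: algebra_simps)
next
  case (add f h)
  from monom_span.add[OF add.IH] show ?case by (simp add: algebra_simps)
qed

lemma monom_span_polyfun:
  assumes "finite E" "polyfun E f"
  shows "monom_span E f"
  using assms(2)
proof induction
  case (const c)
  have "monomial E (\<lambda>_. 0) = (\<lambda>_. 1)" by (auto simp: monomial_def)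
  with monom_span.scale[OF monom_span.monom[of E "\<lambda>_. 0"], of c] show ?case by simp
next
  case (var a)
  have "monomial E (\<lambda>e. if e = a then 1 else 0) = (\<lambda>x. x a)"
  proof
    fix x :: "'a \<Rightarrow> real"
    have "monomial E (\<lambda>e. if e = a then 1 else 0) x = (\<Prod>e\<in>E. if e = a then x e else 1)"
      by (auto simp: monomial_def intro!: prod.cong)
    then show "monomial E (\<lambda>e. if e = a then 1 else 0) x = x a"
      using assms(1) var by simp
  qed
  then show ?case using monom_span.monom[of E "\<lambda>e. if e = a then 1 else 0"] by simp
qed (auto intro: monom_span.add monom_span_mult)

lemma polyfun_monom_induct [consumes 2, case_names monom scale add]:
  assumes "finite E" "polyfun E f"
    and "\<And>k. P (monomial E k)"
    and "\<And>c f. polyfun E f \<Longrightarrow> P f \<Longrightarrow> P (\<lambda>x. c * f x)"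
    and "\<And>f h. polyfun E f \<Longrightarrow> polyfun E h \<Longrightarrow> P f \<Longrightarrow> P h \<Longrightarrow> P (\<lambda>x. f x + h x)"
  shows "P f"
  using monom_span_polyfun[OF assms(1,2)]
  by (induction) (auto intro: assms(3-5) polyfun_monom_span)

definition partial :: "'e \<Rightarrow> (('e \<Rightarrow> real) \<Rightarrow> real) \<Rightarrow> ('e \<Rightarrow> real) \<Rightarrow> real" where
  "partial a f x = deriv (\<lambda>y. f (x(a := y))) (x a)"

lemma pdI: "((\<lambda>y. f (x(a := y))) has_real_derivative D) (at (x a)) \<Longrightarrow> partial a f x = D"
  unfolding partial_def by (rule DERIV_imp_deriv)

lemma partial_DERIV_aux:
  assumes "polyfun E f"
  shows "\<exists>D. polyfun E D \<and> (\<forall>x. ((\<lambda>y. f (x(a := y))) has_real_derivative D x) (at (x a)))"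
  using assms
proof induction
  case (const c)
  show ?case by (rule exI[of _ "\<lambda>_. 0"]) (auto intro: polyI)
next
  case (var e)
  show ?case
    by (rule exI[of _ "\<lambda>_. if e = a then 1 else 0"]) (auto intro: polyI)
next
  case (add f h)
  then obtain D D' where D: "polyfun E D" "polyfun E D'"
    "\<And>x. ((\<lambda>y. f (x(a := y))) has_real_derivative D x) (at (x a))"
    "\<And>x. ((\<lambda>y. h (x(a := y))) has_real_derivative D' x) (at (x a))"
    by blast
  show ?case
    by (rule exI[of _ "\<lambda>x. D x + D' x"]) (use D in \<open>auto intro!: polyI derivative_eq_intros simp del: fun_upd_apply\<close>)
next
  case (mult f h)
  then obtain D D' where D: "polyfun E D" "polyfun E D'"
    "\<And>x. ((\<lambda>y. f (x(a := y))) has_real_derivative D x) (at (x a))"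
    "\<And>x. ((\<lambda>y. h (x(a := y))) has_real_derivative D' x) (at (x a))"
    by blast
  show ?case
    by (rule exI[of _ "\<lambda>x. D x * h x + f x * D' x"])
       (use D mult in \<open>auto intro!: polyI derivative_eq_intros simp del: fun_upd_apply\<close>)
qed

lemma partial_DERIV:
  "polyfun E f \<Longrightarrow> ((\<lambda>y. f (x(a := y))) has_real_derivative partial a f x) (at (x a))"
  using partial_DERIV_aux[of E f a] pdI by metis

lemma polyfun_partial [polyI]:
  assumes "polyfun E f"
  shows "polyfun E (partial a f)"
proof -
  from partial_DERIV_aux[OF assms, of a] obtain D where
    D: "polyfun E D" "\<And>x. ((\<lambda>y. f (x(a := y))) has_real_derivative D x) (at (x a))"
    by blast
  have "partial a f = D"
    using D(2) by (intro ext pdI) 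
  with D show ?thesis by simp
qed

lemma partial_const [simp]: "partial a (\<lambda>_. c) = (\<lambda>_. 0)"
  by (rule ext, rule pdI) auto

lemma partial_var: "partial a (\<lambda>x. x e) = (\<lambda>_. if e = a then 1 else 0)"
  by (rule ext, rule pdI) auto

lemma partial_add:
  assumes "polyfun E f" "polyfun E h"
  shows "partial a (\<lambda>x. f x + h x) = (\<lambda>x. partial a f x + partial a h x)"
  by (rule ext, rule pdI) (auto intro!: derivative_eq_intros partial_DERIV assms)

lemma partial_mult:
  assumes "polyfun E f" "polyfun E h"
  shows "partial a (\<lambda>x. f x * h x) = (\<lambda>x. partial a f x * h x + f x * partial a h x)"
  by (rule ext, rule pdI) (auto intro!: derivative_eq_intros partial_DERIV[of E] assms)

lemma partial_cmult:
  assumes "polyfun E f"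
  shows "partial a (\<lambda>x. c * f x) = (\<lambda>x. c * partial a f x)"
  using partial_mult[OF polyfun.const assms, of a c] by simp

lemma partial_minus:
  assumes "polyfun E f"
  shows "partial a (\<lambda>x. - f x) = (\<lambda>x. - partial a f x)"
  using partial_cmult[OF assms, of a "-1"] by simp

lemma partial_diff:
  assumes "polyfun E f" "polyfun E h"
  shows "partial a (\<lambda>x. f x - h x) = (\<lambda>x. partial a f x - partial a h x)"
  using partial_add[OF assms(1) polyfun_minus[OF assms(2)], of a] partial_minus[OF assms(2), of a] by simp

lemma partial_sum:
  assumes "\<And>i. i \<in> I \<Longrightarrow> polyfun E (f i)"
  shows "partial a (\<lambda>x. \<Sum>i\<in>I. f i x) = (\<lambda>x. \<Sum>i\<in>I. partial a (f i) x)"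
  using assms
proof (induction I rule: infinite_finite_induct)
  case (insert i I)
  have "partial a (\<lambda>x. f i x + (\<Sum>i\<in>I. f i x)) = (\<lambda>x. partial a (f i) x + partial a (\<lambda>x. \<Sum>i\<in>I. f i x) x)"
    by (rule partial_add) (auto intro!: polyI insert.prems)
  with insert show ?case by simp
qed auto

lemma partial_commute:
  assumes "polyfun E f"
  shows "partial a (partial b f) = partial b (partial a f)"
  using assms
proof induction
  case (add f h)
  then show ?case by (simp add: partial_add[of E] polyI)
next
  case (mult f h)
  then show ?case
    by (simp add: partial_add[of E] partial_mult[of E] polyI algebra_simps)
qed (auto simp: partial_var)

lemma partial_scale:
  assumes "polyfun E f"
  shows "partial a (\<lambda>x. f (\<lambda>e. s e * x e)) = (\<lambda>x. s a * partial a f (\<lambda>e. s e * x e))"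
proof (rule ext, rule pdI)
  fix x
  define z where "z = (\<lambda>e. s e * x e)"
  have eq: "(\<lambda>y. f (\<lambda>e. s e * (x(a := y)) e)) = (\<lambda>u. f (z(a := u))) \<circ> (\<lambda>y. s a * y)"
    by (auto simp: z_def fun_eq_iff intro!: arg_cong[where f=f])
  have "((\<lambda>u. f (z(a := u))) has_real_derivative partial a f z) (at (s a * x a))"
    using partial_DERIV[OF assms, of z a] by (simp add: z_def)
  then have "((\<lambda>u. f (z(a := u))) \<circ> (\<lambda>y. s a * y) has_real_derivative partial a f z * (s a * 1)) (at (x a))"
    by (rule DERIV_chain) (auto intro!: derivative_eq_intros)
  then show "((\<lambda>y. f (\<lambda>e. s e * (x(a := y)) e)) has_real_derivative s a * partial a f (\<lambda>e. s e * x e)) (at (x a))"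
    unfolding eq by (simp add: z_def mult.commute[of "s a" "partial a f (\<lambda>e. s e * x e)"] del: fun_upd_apply)
qed

lemma partial_monom:
  assumes "finite E" "a \<in> E"
  shows "partial a (monomial E k) = (\<lambda>x. real (k a) * monomial E (k(a := k a - 1)) x)"
proof (rule ext, rule pdI)
  fix x :: "'a \<Rightarrow> real"
  have eq: "monomial E k (x(a := y)) = y ^ k a * (\<Prod>e\<in>E-{a}. x e ^ k e)" for y
    unfolding monomial_def using assms by (subst prod.remove[of _ a]) auto
  have eq': "monomial E (k(a := k a - 1)) x = x a ^ (k a - 1) * (\<Prod>e\<in>E-{a}. x e ^ k e)"
    unfolding monomial_def using assms by (subst prod.remove[of _ a]) auto
  show "((\<lambda>y. monomial E k (x(a := y))) has_real_derivative
      real (k a) * monomial E (k(a := k a - 1)) x) (at (x a))"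
    unfolding eq eq' by (auto intro!: derivative_eq_intros)
qed

section \<open>Gaussian families and the Poincare inequality\<close>

text \<open>The moments of the standard normal law: \<open>(r - 1)!!\<close> for even \<open>r\<close> and \<open>0\<close> for odd \<open>r\<close>, in the recursive form
  in which integration by parts needs them.\<close>

fun gauss_moment :: "nat \<Rightarrow> real" where
  "gauss_moment 0 = 1"
| "gauss_moment (Suc 0) = 0"
| "gauss_moment (Suc (Suc n)) = real (Suc n) * gauss_moment n"

text \<open>Independent standard Gaussian variables, seen only through their joint moments. Everything below is an
  expectation of a polynomial or a limit of such expectations, so this is all that has to be known about them, and
  passing to a subfamily or relabelling the variables is immediate.\<close>

definition gaussian_family :: "'w measure \<Rightarrow> ('e \<Rightarrow> 'w \<Rightarrow> real) \<Rightarrow> 'e set \<Rightarrow> bool" where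
  "gaussian_family M g E \<longleftrightarrow> prob_space M \<and> finite E \<and>
     (\<forall>k. has_bochner_integral M (\<lambda>\<omega>. monomial E k (\<lambda>e. g e \<omega>)) (\<Prod>e\<in>E. gauss_moment (k e)))"

lemma gaussian_family_inj:
  assumes "gaussian_family M g E" "inj_on \<pi> E'" "\<pi> ` E' \<subseteq> E"
  shows "gaussian_family M (\<lambda>e. g (\<pi> e)) E'"
proof -
  have fin: "finite E" "finite E'"
    using assms finite_imageD[OF finite_subset[of "\<pi> ` E'" E]] by (auto simp: gaussian_family_def)
  have "has_bochner_integral M (\<lambda>\<omega>. monomial E' k (\<lambda>e. g (\<pi> e) \<omega>)) (\<Prod>e\<in>E'. gauss_moment (k e))" for k
  proof -
    define k' where "k' = (\<lambda>e. if e \<in> \<pi> ` E' then k (the_inv_into E' \<pi> e) else 0)"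
    have k': "k' (\<pi> e) = k e" if "e \<in> E'" for e
      using that assms(2) by (simp add: k'_def the_inv_into_f_f)
    have *: "(\<Prod>e\<in>E. F e (k' e)) = (\<Prod>e\<in>E'. F (\<pi> e) (k e))"
      if "\<And>e. F e 0 = (1::real)" for F :: "_ \<Rightarrow> nat \<Rightarrow> real"
    proof -
      have "(\<Prod>e\<in>E. F e (k' e)) = (\<Prod>e\<in>\<pi> ` E'. F e (k' e))"
        by (rule prod.mono_neutral_right) (use fin assms that in \<open>auto simp: k'_def\<close>)
      also have "\<dots> = (\<Prod>e\<in>E'. F (\<pi> e) (k' (\<pi> e)))"
        using assms(2) by (simp add: prod.reindex)
      finally show ?thesis by (simp add: k')
    qed
    have "has_bochner_integral M (\<lambda>\<omega>. monomial E k' (\<lambda>e. g e \<omega>)) (\<Prod>e\<in>E. gauss_moment (k' e))"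
      using assms(1) by (auto simp: gaussian_family_def)
    then show ?thesis
      unfolding monomial_def by (subst (asm) (1 2) *) auto
  qed
  then show ?thesis using assms(1) fin by (auto simp: gaussian_family_def)
qed

text \<open>Equality in law, for polynomials: this is what makes block exchangeability and comparison between
  different probability spaces available.\<close>

lemma gaussian_family_expectation_eq:
  assumes "gaussian_family M g E" "gaussian_family M' g' E" "polyfun E f"
  shows "integrable M (\<lambda>\<omega>. f (\<lambda>e. g e \<omega>))"
    and "integral\<^sup>L M (\<lambda>\<omega>. f (\<lambda>e. g e \<omega>)) = integral\<^sup>L M' (\<lambda>\<omega>. f (\<lambda>e. g' e \<omega>))"
proof -
  have fin: "finite E" using assms(1) by (simp add: gaussian_family_def)
  have "integrable M (\<lambda>\<omega>. f (\<lambda>e. g e \<omega>)) \<and> integrable M' (\<lambda>\<omega>. f (\<lambda>e. g' e \<omega>)) \<and>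
      integral\<^sup>L M (\<lambda>\<omega>. f (\<lambda>e. g e \<omega>)) = integral\<^sup>L M' (\<lambda>\<omega>. f (\<lambda>e. g' e \<omega>))"
    using fin assms(3)
  proof (induction rule: polyfun_monom_induct)
    case (monom k)
    then show ?case using assms(1,2) by (auto simp: gaussian_family_def has_bochner_integral_iff)
  qed auto
  then show "integrable M (\<lambda>\<omega>. f (\<lambda>e. g e \<omega>))"
    and "integral\<^sup>L M (\<lambda>\<omega>. f (\<lambda>e. g e \<omega>)) = integral\<^sup>L M' (\<lambda>\<omega>. f (\<lambda>e. g' e \<omega>))"
    by auto
qed

locale gaussians = prob_space M for M :: "'w measure" +
  fixes g :: "'e \<Rightarrow> 'w \<Rightarrow> real" and E :: "'e set"
  assumes fam: "gaussian_family M g E"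
begin

lemma finE: "finite E" using fam by (simp add: gaussian_family_def)

definition ex :: "(('e \<Rightarrow> real) \<Rightarrow> real) \<Rightarrow> real" where
  "ex f = expectation (\<lambda>\<omega>. f (\<lambda>e. g e \<omega>))"

lemma integrable_poly [simp]: "polyfun E f \<Longrightarrow> integrable M (\<lambda>\<omega>. f (\<lambda>e. g e \<omega>))"
  using gaussian_family_expectation_eq(1)[OF fam fam] .

lemma ex_const [simp]: "ex (\<lambda>_. c) = c"
  by (simp add: ex_def prob_space)

lemma ex_add: "polyfun E f \<Longrightarrow> polyfun E h \<Longrightarrow> ex (\<lambda>x. f x + h x) = ex f + ex h"
  by (simp add: ex_def)

lemma ex_diff: "polyfun E f \<Longrightarrow> polyfun E h \<Longrightarrow> ex (\<lambda>x. f x - h x) = ex f - ex h"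
  by (simp add: ex_def)

lemma ex_cmult: "ex (\<lambda>x. c * f x) = c * ex f"
  by (simp add: ex_def)

lemma ex_sum: "(\<And>i. i \<in> I \<Longrightarrow> polyfun E (f i)) \<Longrightarrow> ex (\<lambda>x. \<Sum>i\<in>I. f i x) = (\<Sum>i\<in>I. ex (f i))"
  by (simp add: ex_def)

lemma ex_mono: "polyfun E f \<Longrightarrow> polyfun E h \<Longrightarrow> (\<And>x. f x \<le> h x) \<Longrightarrow> ex f \<le> ex h"
  unfolding ex_def by (rule integral_mono) auto

lemma ex_nonneg: "(\<And>x. 0 \<le> f x) \<Longrightarrow> 0 \<le> ex f"
  unfolding ex_def by simp

lemma ex_monom: "ex (monomial E k) = (\<Prod>e\<in>E. gauss_moment (k e))"
  using fam by (auto simp: gaussian_family_def has_bochner_integral_iff ex_def)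

lemma ibp:
  assumes "polyfun E f" "a \<in> E"
  shows "ex (\<lambda>x. x a * f x) = ex (partial a f)"
  using finE assms(1)
proof (induction rule: polyfun_monom_induct)
  case (monom k)
  have "(\<lambda>x. x a * monomial E k x) = monomial E (k(a := Suc (k a)))"
  proof
    fix x :: "'e \<Rightarrow> real"
    show "x a * monomial E k x = monomial E (k(a := Suc (k a))) x"
      unfolding monomial_def using finE assms(2) by (subst (1 2) prod.remove[of _ a]) auto
  qed
  then have "ex (\<lambda>x. x a * monomial E k x) = gauss_moment (Suc (k a)) * (\<Prod>e\<in>E-{a}. gauss_moment (k e))"
    using finE assms(2) by (simp add: ex_monom) (subst prod.remove[of _ a], auto)
  also have "\<dots> = real (k a) * (gauss_moment (k a - 1) * (\<Prod>e\<in>E-{a}. gauss_moment (k e)))"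
    by (cases "k a") auto
  also have "\<dots> = ex (partial a (monomial E k))"
    using finE assms(2) by (simp add: partial_monom ex_cmult ex_monom) (subst (2) prod.remove[of _ a], auto)
  finally show ?case .
next
  case (scale c f)
  have "(\<lambda>x. x a * (c * f x)) = (\<lambda>x. c * (x a * f x))" by (auto simp: algebra_simps)
  then show ?case using scale by (simp add: ex_cmult partial_cmult[of E])
next
  case (add f h)
  have "(\<lambda>x. x a * (f x + h x)) = (\<lambda>x. x a * f x + x a * h x)" by (auto simp: algebra_simps)
  then show ?case using add assms(2) by (simp add: ex_add partial_add[of E] polyI)
qed

text \<open>The Ornstein-Uhlenbeck operator (number operator), the divergence form of the Gaussian Dirichlet form.\<close>

definition number_op :: "(('e \<Rightarrow> real) \<Rightarrow> real) \<Rightarrow> ('e \<Rightarrow> real) \<Rightarrow> real" where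
  "number_op f = (\<lambda>x. \<Sum>e\<in>E. x e * partial e f x - partial e (partial e f) x)"

lemma polyfun_number_op [polyI]: "polyfun E f \<Longrightarrow> polyfun E (number_op f)"
  unfolding number_op_def by (intro polyI)

lemma number_op_add: "polyfun E f \<Longrightarrow> polyfun E h \<Longrightarrow> number_op (\<lambda>x. f x + h x) = (\<lambda>x. number_op f x + number_op h x)"
  by (simp add: number_op_def partial_add[of E] polyI sum.distrib[symmetric] algebra_simps)

lemma number_op_cmult: "polyfun E f \<Longrightarrow> number_op (\<lambda>x. c * f x) = (\<lambda>x. c * number_op f x)"
  by (simp add: number_op_def partial_cmult[of E] polyI sum_distrib_left algebra_simps)

lemma number_op_sum: "(\<And>i. i \<in> I \<Longrightarrow> polyfun E (f i)) \<Longrightarrow>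
    number_op (\<lambda>x. \<Sum>i\<in>I. f i x) = (\<lambda>x. \<Sum>i\<in>I. number_op (f i) x)"
proof (induction I rule: infinite_finite_induct)
  case (insert i I)
  then show ?case by (simp add: number_op_add polyI)
qed (auto simp: number_op_def)

text \<open>Integration by parts: the number operator represents the Dirichlet form.\<close>

lemma ex_mult_number_op:
  assumes f: "polyfun E f" and h: "polyfun E h"
  shows "ex (\<lambda>x. f x * number_op h x) = (\<Sum>e\<in>E. ex (\<lambda>x. partial e f x * partial e h x))"
proof -
  have p1: "polyfun E (\<lambda>x. f x * partial e h x)" for e
    by (rule polyfun.mult[OF f polyfun_partial[OF h]])
  have p2: "polyfun E (\<lambda>x. x e * (f x * partial e h x))" if "e \<in> E" for e
    by (rule polyfun.mult[OF polyfun.var[OF that] p1])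
  have p3: "polyfun E (\<lambda>x. f x * partial e (partial e h) x)" for e
    by (rule polyfun.mult[OF f polyfun_partial[OF polyfun_partial[OF h]]])
  have p4: "polyfun E (\<lambda>x. partial e f x * partial e h x)" for e
    by (rule polyfun.mult[OF polyfun_partial[OF f] polyfun_partial[OF h]])
  have "ex (\<lambda>x. f x * number_op h x) = ex (\<lambda>x. \<Sum>e\<in>E. x e * (f x * partial e h x) - f x * partial e (partial e h) x)"
    by (simp add: number_op_def sum_distrib_left right_diff_distrib mult.left_commute)
  also have "\<dots> = (\<Sum>e\<in>E. ex (\<lambda>x. x e * (f x * partial e h x) - f x * partial e (partial e h) x))"
    by (rule ex_sum, rule polyfun_diff[OF p2 p3])
  also have "\<dots> = (\<Sum>e\<in>E. ex (\<lambda>x. partial e f x * partial e h x))"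
  proof (rule sum.cong)
    fix e assume e: "e \<in> E"
    have "ex (\<lambda>x. x e * (f x * partial e h x) - f x * partial e (partial e h) x)
       = ex (\<lambda>x. x e * (f x * partial e h x)) - ex (\<lambda>x. f x * partial e (partial e h) x)"
      by (rule ex_diff[OF p2[OF e] p3])
    also have "ex (\<lambda>x. x e * (f x * partial e h x)) = ex (partial e (\<lambda>x. f x * partial e h x))"
      by (rule ibp[OF p1 e])
    also have "partial e (\<lambda>x. f x * partial e h x) = (\<lambda>x. partial e f x * partial e h x + f x * partial e (partial e h) x)"
      by (rule partial_mult[OF f polyfun_partial[OF h]])
    also have "ex (\<lambda>x. partial e f x * partial e h x + f x * partial e (partial e h) x)
        = ex (\<lambda>x. partial e f x * partial e h x) + ex (\<lambda>x. f x * partial e (partial e h) x)"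
      by (rule ex_add[OF p4 p3])
    finally show "ex (\<lambda>x. x e * (f x * partial e h x) - f x * partial e (partial e h) x)
        = ex (\<lambda>x. partial e f x * partial e h x)" by simp
  qed simp
  finally show ?thesis .
qed

lemma partial_number_op:
  assumes "polyfun E f" "a \<in> E"
  shows "partial a (number_op f) = (\<lambda>x. number_op (partial a f) x + partial a f x)"
proof
  fix x
  have "partial a (number_op f) x = (\<Sum>e\<in>E. partial a (\<lambda>x. x e * partial e f x - partial e (partial e f) x) x)"
    unfolding number_op_def by (subst partial_sum) (auto intro!: polyI assms)
  also have "\<dots> = (\<Sum>e\<in>E. (if e = a then partial e f x else 0) + (x e * partial e (partial a f) x - partial e (partial e (partial a f)) x))"
  proof (rule sum.cong)
    fix e assume e: "e \<in> E"
    have "partial a (\<lambda>x. x e * partial e f x - partial e (partial e f) x) x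
      = (if e = a then 1 else 0) * partial e f x + x e * partial a (partial e f) x - partial a (partial e (partial e f)) x"
      using e by (subst partial_diff[of E]) (auto intro!: polyI assms simp: partial_mult[of E] partial_var polyI assms)
    then show "partial a (\<lambda>x. x e * partial e f x - partial e (partial e f) x) x
      = (if e = a then partial e f x else 0) + (x e * partial e (partial a f) x - partial e (partial e (partial a f)) x)"
      using assms by (simp add: partial_commute[of E f a e] partial_commute[of E "partial e f" a e] polyI)
  qed simp
  also have "\<dots> = number_op (partial a f) x + partial a f x"
    using assms finE by (simp add: sum.distrib number_op_def)
  finally show "partial a (number_op f) x = number_op (partial a f) x + partial a f x" .
qed

text \<open>The Poisson equation has a polynomial solution: the number operator multiplies a monomial by its degree, up to
  monomials of smaller degree.\<close>

lemma number_op_solvable: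
  assumes "polyfun E f"
  shows "\<exists>c h. polyfun E h \<and> f = (\<lambda>x. c + number_op h x)"
  using finE assms
proof (induction rule: polyfun_monom_induct)
  case (monom k)
  show ?case
  proof (induction "sum k E" arbitrary: k rule: less_induct)
    case less
    show ?case
    proof (cases "sum k E = 0")
      case True
      then have "monomial E k = (\<lambda>x. 1)" using finE by (auto simp: monomial_def)
      then show ?thesis
        by (intro exI[of _ 1] exI[of _ "\<lambda>_. 0"]) (auto intro: polyI simp: number_op_def)
    next
      case False
      define d where "d = real (sum k E)"
      define kk where "kk = (\<lambda>e. (k(e := k e - 1))(e := k e - 2))"
      define q where "q = (\<lambda>e. real (k e) * real (k e - 1))"
      have sol: "\<exists>c h. polyfun E h \<and> (\<lambda>x. q e * monomial E (kk e) x) = (\<lambda>x. c + number_op h x)" if "e \<in> E" for e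
      proof (cases "k e \<ge> 2")
        case True
        have "sum (kk e) E < sum k E"
          using that finE True by (intro sum_strict_mono_ex1) (auto simp: kk_def intro!: bexI[of _ e])
        from less[OF this] obtain c h where h: "polyfun E h" "monomial E (kk e) = (\<lambda>x. c + number_op h x)" by blast
        show ?thesis
          by (rule exI[of _ "q e * c"], rule exI[of _ "\<lambda>x. q e * h x"])
             (use h in \<open>auto intro!: polyI simp: number_op_cmult distrib_left\<close>)
      next
        case False
        then have "q e = 0" by (auto simp: q_def)
        then show ?thesis
          by (intro exI[of _ 0] exI[of _ "\<lambda>_. 0"]) (auto intro: polyI simp: number_op_def)
      qed
      then obtain c h where h: "\<And>e. e \<in> E \<Longrightarrow> polyfun E (h e)"
        "\<And>e. e \<in> E \<Longrightarrow> (\<lambda>x. q e * monomial E (kk e) x) = (\<lambda>x. c e + number_op (h e) x)" by metis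
      have N: "number_op (monomial E k) x = d * monomial E k x - (\<Sum>e\<in>E. q e * monomial E (kk e) x)" for x
      proof -
        have "x e * partial e (monomial E k) x - partial e (partial e (monomial E k)) x
            = real (k e) * monomial E k x - q e * monomial E (kk e) x" if "e \<in> E" for e
        proof -
          have "x e * (real (k e) * x e ^ (k e - 1)) = real (k e) * x e ^ k e"
            by (cases "k e") auto
          then have "x e * (real (k e) * x e ^ (k e - 1)) * (\<Prod>e\<in>E-{e}. x e ^ k e)
              = real (k e) * x e ^ k e * (\<Prod>e\<in>E-{e}. x e ^ k e)"
            by simp
          then have 1: "x e * (real (k e) * monomial E (k(e := k e - 1)) x) = real (k e) * monomial E k x"
            unfolding monomial_def prod.remove[OF finE that] by (simp add: mult.assoc)
          have "partial e (partial e (monomial E k)) x = real (k e) * partial e (monomial E (k(e := k e - 1))) x"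
            unfolding partial_monom[OF finE that] partial_cmult[OF polyfun_monom] ..
          also have "\<dots> = q e * monomial E (kk e) x"
            unfolding partial_monom[OF finE that] by (simp add: q_def kk_def numeral_2_eq_2)
          finally have 2: "partial e (partial e (monomial E k)) x = q e * monomial E (kk e) x" .
          show ?thesis unfolding 2 unfolding partial_monom[OF finE that] 1 ..
        qed
        then have "number_op (monomial E k) x = (\<Sum>e\<in>E. real (k e) * monomial E k x - q e * monomial E (kk e) x)"
          unfolding number_op_def by (intro sum.cong) auto
        then show ?thesis by (simp add: sum_subtractf d_def sum_distrib_right)
      qed
      \<comment> \<open>Dividing by the degree inverts the leading part; the functions \<open>h e\<close> solve the equation for the terms of lower degree.\<close>
      define H where "H = (\<lambda>x. (1/d) * (monomial E k x + (\<Sum>e\<in>E. h e x)))"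
      have H: "polyfun E H" unfolding H_def by (intro polyI h)
      have "number_op H = (\<lambda>x. (1/d) * number_op (\<lambda>x. monomial E k x + (\<Sum>e\<in>E. h e x)) x)"
        unfolding H_def by (rule number_op_cmult) (intro polyI h)
      also have "number_op (\<lambda>x. monomial E k x + (\<Sum>e\<in>E. h e x)) = (\<lambda>x. number_op (monomial E k) x + number_op (\<lambda>x. \<Sum>e\<in>E. h e x) x)"
        by (rule number_op_add) (intro polyI h)+
      also have "number_op (\<lambda>x. \<Sum>e\<in>E. h e x) = (\<lambda>x. \<Sum>e\<in>E. number_op (h e) x)"
        by (rule number_op_sum) (rule h)
      also have "(\<lambda>x. \<Sum>e\<in>E. number_op (h e) x) = (\<lambda>x. (\<Sum>e\<in>E. q e * monomial E (kk e) x) - (\<Sum>e\<in>E. c e))"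
      proof
        fix x
        have "q e * monomial E (kk e) x = c e + number_op (h e) x" if "e \<in> E" for e
          using fun_cong[OF h(2)[OF that], of x] .
        then show "(\<Sum>e\<in>E. number_op (h e) x) = (\<Sum>e\<in>E. q e * monomial E (kk e) x) - (\<Sum>e\<in>E. c e)"
          by (simp add: sum.distrib)
      qed
      finally have nH: "number_op H x = (1/d) * (d * monomial E k x - (\<Sum>e\<in>E. c e))" for x
        by (simp add: N)
      have "d \<noteq> 0" using False unfolding d_def of_nat_eq_0_iff .
      then have "monomial E k = (\<lambda>x. (\<Sum>e\<in>E. c e)/d + number_op H x)"
        by (intro ext) (simp add: nH field_simps)
      with H show ?thesis by blast
    qed
  qed
next
  case (scale c f)
  then obtain c' h where "polyfun E h" "f = (\<lambda>x. c' + number_op h x)" by blast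
  then show ?case
    by (intro exI[of _ "c*c'"] exI[of _ "\<lambda>x. c * h x"]) (auto intro!: polyI simp: number_op_cmult distrib_left)
next
  case (add f f')
  then obtain c h c' h' where "polyfun E h" "f = (\<lambda>x. c + number_op h x)" "polyfun E h'" "f' = (\<lambda>x. c' + number_op h' x)" by blast
  then show ?case
    by (intro exI[of _ "c+c'"] exI[of _ "\<lambda>x. h x + h' x"]) (auto intro!: polyI simp: number_op_add algebra_simps)
qed

text \<open>Bochner's argument. Write \<open>f = c + N h\<close>; then the variance of \<open>f\<close> is \<open>E (f * N h)\<close>, the correlation of the gradients of
  \<open>f\<close> and \<open>h\<close>, while the commutation relation between \<open>N\<close> and the partial derivatives bounds the gradient of \<open>h\<close> by the
  variance. This needs no density or semigroup, only moments.\<close>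

lemma poincare:
  assumes "polyfun E f"
  shows "ex (\<lambda>x. (f x - ex f)^2) \<le> (\<Sum>e\<in>E. ex (\<lambda>x. (partial e f x)^2))"
proof -
  from number_op_solvable[OF assms] obtain c h where h: "polyfun E h" and f: "f = (\<lambda>x. c + number_op h x)" by blast
  note p = h assms
  have "ex (number_op h) = 0"
    using ex_mult_number_op[OF polyfun.const[of E 1] h] by simp
  then have c: "ex f = c" unfolding f by (subst ex_add) (auto intro!: polyI h)
  have V1: "ex (\<lambda>x. (f x - ex f)^2) = (\<Sum>e\<in>E. ex (\<lambda>x. partial e (number_op h) x * partial e h x))"
    using ex_mult_number_op[OF polyfun_number_op[OF h] h] by (simp add: f c[unfolded f] power2_eq_square)
  have pf: "partial e f = partial e (number_op h)" for e unfolding f by (subst partial_add[of E]) (auto intro!: polyI h)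
  have S: "(\<Sum>e\<in>E. ex (\<lambda>x. (partial e h x)^2)) \<le> ex (\<lambda>x. (f x - ex f)^2)"
    unfolding V1
  proof (rule sum_mono)
    fix e assume e: "e \<in> E"
    have "ex (\<lambda>x. partial e (number_op h) x * partial e h x) = ex (\<lambda>x. partial e h x * number_op (partial e h) x + (partial e h x)^2)"
      using e h by (simp add: partial_number_op power2_eq_square algebra_simps)
    also have "\<dots> = ex (\<lambda>x. partial e h x * number_op (partial e h) x) + ex (\<lambda>x. (partial e h x)^2)"
      by (rule ex_add) (auto intro!: polyI h)
    also have "ex (\<lambda>x. partial e h x * number_op (partial e h) x) = (\<Sum>a\<in>E. ex (\<lambda>x. partial a (partial e h) x * partial a (partial e h) x))"
      by (rule ex_mult_number_op) (auto intro!: polyI h)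
    finally have "ex (\<lambda>x. partial e (number_op h) x * partial e h x) = (\<Sum>a\<in>E. ex (\<lambda>x. partial a (partial e h) x * partial a (partial e h) x)) + ex (\<lambda>x. (partial e h x)^2)" .
    moreover have "0 \<le> (\<Sum>a\<in>E. ex (\<lambda>x. partial a (partial e h) x * partial a (partial e h) x))" by (intro sum_nonneg ex_nonneg) auto
    ultimately show "ex (\<lambda>x. (partial e h x)^2) \<le> ex (\<lambda>x. partial e (number_op h) x * partial e h x)" by simp
  qed
  have "ex (\<lambda>x. (f x - ex f)^2) \<le> (\<Sum>e\<in>E. (1/2) * ex (\<lambda>x. (partial e f x)^2) + (1/2) * ex (\<lambda>x. (partial e h x)^2))"
    unfolding V1
  proof (rule sum_mono)
    fix e assume e: "e \<in> E"
    have p1: "polyfun E (partial e f)" "polyfun E (partial e h)" "polyfun E (partial e (number_op h))"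
      using p polyfun_number_op by (blast intro: polyfun_partial)+
    have p2: "polyfun E (\<lambda>x. (1/2) * (partial e f x)^2)" "polyfun E (\<lambda>x. (1/2) * (partial e h x)^2)"
      by (rule polyfun_cmult, rule polyfun_power, rule p1)+
    have "ex (\<lambda>x. partial e (number_op h) x * partial e h x) \<le> ex (\<lambda>x. (1/2) * (partial e f x)^2 + (1/2) * (partial e h x)^2)"
    proof (rule ex_mono[OF polyfun.mult[OF p1(3,2)] polyfun.add[OF p2]])
      fix x show "partial e (number_op h) x * partial e h x \<le> (1/2) * (partial e f x)^2 + (1/2) * (partial e h x)^2"
        using sum_squares_bound[of "partial e f x" "partial e h x"] unfolding pf by simp
    qed
    also have "\<dots> = (1/2) * ex (\<lambda>x. (partial e f x)^2) + (1/2) * ex (\<lambda>x. (partial e h x)^2)"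
      by (simp only: ex_add[OF p2] ex_cmult)
    finally show "ex (\<lambda>x. partial e (number_op h) x * partial e h x) \<le> (1/2) * ex (\<lambda>x. (partial e f x)^2) + (1/2) * ex (\<lambda>x. (partial e h x)^2)" .
  qed
  also have "\<dots> = (1/2) * (\<Sum>e\<in>E. ex (\<lambda>x. (partial e f x)^2)) + (1/2) * (\<Sum>e\<in>E. ex (\<lambda>x. (partial e h x)^2))"
    by (simp only: sum.distrib sum_distrib_left)
  finally show ?thesis using S by linarith
qed

end

section \<open>Matrices over a finite index set\<close>

definition mmult :: "'a set \<Rightarrow> ('a \<Rightarrow> 'a \<Rightarrow> real) \<Rightarrow> ('a \<Rightarrow> 'a \<Rightarrow> real) \<Rightarrow> 'a \<Rightarrow> 'a \<Rightarrow> real" where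
  "mmult I X Y i j = (\<Sum>l\<in>I. X i l * Y l j)"

definition kdelta :: "'a \<Rightarrow> 'a \<Rightarrow> real" where
  "kdelta i j = (if i = j then 1 else 0)"

text \<open>Matrices are functions on a finite index set. The dimension can then vary inside statements, a principal submatrix is the
  same function on a smaller set, and Kronecker structure is indexing by pairs.\<close>

primrec mpow :: "'a set \<Rightarrow> ('a \<Rightarrow> 'a \<Rightarrow> real) \<Rightarrow> nat \<Rightarrow> 'a \<Rightarrow> 'a \<Rightarrow> real" where
  "mpow I X 0 = kdelta"
| "mpow I X (Suc r) = mmult I X (mpow I X r)"

definition mtrace :: "'a set \<Rightarrow> ('a \<Rightarrow> 'a \<Rightarrow> real) \<Rightarrow> real" where
  "mtrace I X = (\<Sum>i\<in>I. X i i)"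

text \<open>The square of the Hilbert-Schmidt norm.\<close>

definition hs_sq :: "'a set \<Rightarrow> ('a \<Rightarrow> 'a \<Rightarrow> real) \<Rightarrow> real" where
  "hs_sq I X = (\<Sum>i\<in>I. \<Sum>j\<in>I. (X i j)^2)"

definition symm :: "'a set \<Rightarrow> ('a \<Rightarrow> 'a \<Rightarrow> real) \<Rightarrow> bool" where
  "symm I X \<longleftrightarrow> (\<forall>i\<in>I. \<forall>j\<in>I. X i j = X j i)"

definition qform :: "'a set \<Rightarrow> ('a \<Rightarrow> 'a \<Rightarrow> real) \<Rightarrow> ('a \<Rightarrow> real) \<Rightarrow> real" where
  "qform I X v = (\<Sum>i\<in>I. \<Sum>j\<in>I. v i * X i j * v j)"

definition sqnorm :: "'a set \<Rightarrow> ('a \<Rightarrow> real) \<Rightarrow> real" where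
  "sqnorm I v = (\<Sum>i\<in>I. (v i)^2)"

text \<open>The supremum of the absolute Rayleigh quotients, which for symmetric matrices is the operator norm. Division by zero gives
  vectors vanishing on \<open>I\<close> the quotient \<open>0\<close>.\<close>

definition opnorm :: "'a set \<Rightarrow> ('a \<Rightarrow> 'a \<Rightarrow> real) \<Rightarrow> real" where
  "opnorm I X = (SUP v. \<bar>qform I X v\<bar> / sqnorm I v)"

lemma sqnorm_nonneg [simp]: "0 \<le> sqnorm I v" by (simp add: sqnorm_def sum_nonneg)

lemma mmult_assoc: "mmult I (mmult I X Y) Z i j = mmult I X (mmult I Y Z) i j"
  unfolding mmult_def sum_distrib_left sum_distrib_right
  by (subst sum.swap) (simp add: mult.assoc)

lemma mmult_assoc_fun: "mmult I (mmult I X Y) Z = mmult I X (mmult I Y Z)"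
  by (intro ext mmult_assoc)

lemma sum_delta_l: "finite I \<Longrightarrow> (\<Sum>l\<in>I. kdelta i l * f l) = (if i \<in> I then f i else 0)"
proof -
  have "(\<Sum>l\<in>I. kdelta i l * f l) = (\<Sum>l\<in>I. if l = i then f l else 0)"
    by (rule sum.cong) (auto simp: kdelta_def)
  then show "finite I \<Longrightarrow> ?thesis" by simp
qed

lemma sum_delta_r: "finite I \<Longrightarrow> (\<Sum>l\<in>I. f l * kdelta l i) = (if i \<in> I then f i else 0)"
proof -
  have "(\<Sum>l\<in>I. f l * kdelta l i) = (\<Sum>l\<in>I. if l = i then f l else 0)"
    by (rule sum.cong) (auto simp: kdelta_def)
  then show "finite I \<Longrightarrow> ?thesis" by simp
qed

lemma sum_rotate3: "(\<Sum>i\<in>A. \<Sum>j\<in>B. \<Sum>c\<in>C. f i j c) = (\<Sum>c\<in>C. \<Sum>i\<in>A. \<Sum>j\<in>B. f i j c)"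
proof -
  have "(\<Sum>i\<in>A. \<Sum>j\<in>B. \<Sum>c\<in>C. f i j c) = (\<Sum>i\<in>A. \<Sum>c\<in>C. \<Sum>j\<in>B. f i j c)"
    by (intro sum.cong refl sum.swap)
  also have "\<dots> = (\<Sum>c\<in>C. \<Sum>i\<in>A. \<Sum>j\<in>B. f i j c)" by (rule sum.swap)
  finally show ?thesis .
qed

lemma mmult_cong: "(\<And>l. l \<in> I \<Longrightarrow> X i l = X' i l) \<Longrightarrow> (\<And>l. l \<in> I \<Longrightarrow> Y l j = Y' l j) \<Longrightarrow>
   mmult I X Y i j = mmult I X' Y' i j"
  by (simp add: mmult_def)

lemma mmult_kdelta_left: "finite I \<Longrightarrow> i \<in> I \<Longrightarrow> mmult I kdelta Y i j = Y i j"
  by (simp add: mmult_def sum_delta_l)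

lemma mmult_kdelta_right: "finite I \<Longrightarrow> j \<in> I \<Longrightarrow> mmult I X kdelta i j = X i j"
  by (simp add: mmult_def sum_delta_r)

lemma mpow_cong:
  assumes "\<And>i j. i \<in> I \<Longrightarrow> j \<in> I \<Longrightarrow> X i j = Y i j" "i \<in> I"
  shows "mpow I X r i j = mpow I Y r i j"
  using assms(2) by (induction r arbitrary: i) (auto simp: mmult_def assms(1))

lemma mpow_add:
  assumes "finite I" "i \<in> I"
  shows "mpow I X (a + b) i j = mmult I (mpow I X a) (mpow I X b) i j"
  using assms(2)
proof (induction a arbitrary: i)
  case 0
  then show ?case using assms by (simp add: mmult_kdelta_left)
next
  case (Suc a)
  have "mpow I X (Suc a + b) i j = mmult I X (mmult I (mpow I X a) (mpow I X b)) i j"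
    using Suc by (simp add: mmult_def)
  then show ?case by (simp add: mmult_assoc)
qed

lemma mtrace_mmult_commute: "mtrace I (mmult I X Y) = mtrace I (mmult I Y X)"
  unfolding mtrace_def mmult_def by (subst sum.swap) (simp add: mult.commute)

section \<open>Spectral theorem\<close>

lemma real_eigenvector_mat:
  fixes A :: "real mat"
  assumes A: "A \<in> carrier_mat n n" and n: "n > 0"
    and sym: "\<And>i j. i < n \<Longrightarrow> j < n \<Longrightarrow> A $$ (i,j) = A $$ (j,i)"
  shows "\<exists>e v. (\<exists>i<n. v i \<noteq> 0) \<and> (\<forall>i<n. (\<Sum>j<n. A $$ (i,j) * v j) = e * v i)"
proof -
  define C where "C = map_mat complex_of_real A"
  have C: "C \<in> carrier_mat n n" using A by (simp add: C_def)
  from spectrum_non_empty[OF C] n obtain z where "z \<in> spectrum C" by auto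
  then obtain w where w: "eigenvector C w z" by (auto simp: spectrum_def eigenvalue_def)
  then have wc: "w \<in> carrier_vec n" and w0: "w \<noteq> 0\<^sub>v n" and Cw: "C *\<^sub>v w = z \<cdot>\<^sub>v w"
    using C by (auto simp: eigenvector_def)
  have E: "(\<Sum>j<n. complex_of_real (A $$ (i,j)) * w $ j) = z * w $ i" if "i < n" for i
  proof -
    have "(C *\<^sub>v w) $ i = (\<Sum>j<n. complex_of_real (A $$ (i,j)) * w $ j)"
      using that A wc by (auto simp: C_def scalar_prod_def atLeast0LessThan intro!: sum.cong)
    then show ?thesis using Cw that wc by simp
  qed
  define S where "S = (\<Sum>i<n. \<Sum>j<n. cnj (w $ i) * (complex_of_real (A $$ (i,j)) * w $ j))"
  have S1: "S = z * complex_of_real (\<Sum>i<n. (cmod (w $ i))^2)"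
  proof -
    have "S = (\<Sum>i<n. cnj (w $ i) * (z * w $ i))"
      unfolding S_def by (intro sum.cong refl) (simp only: sum_distrib_left[symmetric] E lessThan_iff)
    also have "\<dots> = (\<Sum>i<n. z * complex_of_real ((cmod (w $ i))^2))"
      by (intro sum.cong refl) (simp add: complex_norm_square mult_ac del: of_real_power)
    finally show ?thesis by (simp only: of_real_sum sum_distrib_left)
  qed
  have "cnj S = (\<Sum>i<n. \<Sum>j<n. cnj (w $ j) * (complex_of_real (A $$ (j,i)) * w $ i))"
    unfolding S_def cnj_sum using sym by (intro sum.cong) auto
  also have "\<dots> = S" unfolding S_def by (rule sum.swap)
  finally have S2: "cnj S = S" .
  obtain i where i: "i < n" "w $ i \<noteq> 0"
    using w0 wc by (metis carrier_vecD eq_vecI index_zero_vec(1) index_zero_vec(2))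
  have pos: "(\<Sum>i<n. (cmod (w $ i))^2) > 0"
    by (rule sum_pos2[of _ i]) (use i in auto)
  have "z \<in> \<real>"
  proof -
    define N where "N = (\<Sum>i<n. (cmod (w $ i))^2)"
    have "z = S / complex_of_real N" using S1 pos unfolding N_def[symmetric] by simp
    moreover have "S \<in> \<real>" using S2 by (simp add: Reals_cnj_iff)
    ultimately show ?thesis by (metis Reals_divide Reals_of_real)
  qed
  then obtain e where e: "z = complex_of_real e" by (auto elim: Reals_cases)
  have R: "(\<Sum>j<n. A $$ (i,j) * Re (w $ j)) = e * Re (w $ i)" if "i < n" for i
    using arg_cong[OF E[OF that], of Re] by (simp add: e)
  have I: "(\<Sum>j<n. A $$ (i,j) * Im (w $ j)) = e * Im (w $ i)" if "i < n" for i
    using arg_cong[OF E[OF that], of Im] by (simp add: e)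
  show ?thesis
  proof (cases "Re (w $ i) = 0")
    case True
    with i have "Im (w $ i) \<noteq> 0" by (auto simp: complex_eq_iff)
    with I i show ?thesis by (intro exI[of _ e] exI[of _ "\<lambda>i. Im (w $ i)"]) auto
  next
    case False
    with R i show ?thesis by (intro exI[of _ e] exI[of _ "\<lambda>i. Re (w $ i)"]) auto
  qed
qed

lemma real_eigenvector:
  assumes I: "finite I" "I \<noteq> {}" and sym: "symm I X"
  shows "\<exists>e v. sqnorm I v = 1 \<and> (\<forall>i\<in>I. (\<Sum>j\<in>I. X i j * v j) = e * v i)"
proof -
  define n where "n = card I"
  from ex_bij_betw_nat_finite[OF I(1)] obtain h where h: "bij_betw h {..<n} I"
    by (auto simp: n_def atLeast0LessThan)
  have hI: "h i \<in> I" if "i < n" for i using h that by (auto simp: bij_betw_def)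
  define A where "A = mat n n (\<lambda>(i,j). X (h i) (h j))"
  have "n > 0" using I by (simp add: n_def card_gt_0_iff)
  have A: "A \<in> carrier_mat n n" by (simp add: A_def)
  have "A $$ (i,j) = A $$ (j,i)" if "i < n" "j < n" for i j
    using that sym hI by (simp add: A_def symm_def)
  from real_eigenvector_mat[OF A \<open>n > 0\<close> this] obtain e v i0 where
    v: "i0 < n" "v i0 \<noteq> 0" "\<And>i. i < n \<Longrightarrow> (\<Sum>j<n. A $$ (i,j) * v j) = e * v i" by blast
  define g where "g = the_inv_into {..<n} h"
  have gh: "g (h i) = i" if "i < n" for i
    using h that by (simp add: g_def bij_betw_def the_inv_into_f_f)
  have hg: "h (g i) = i" "g i < n" if "i \<in> I" for i
    using h that f_the_inv_into_f[of h "{..<n}" i] the_inv_into_into[of h "{..<n}" i "{..<n}"]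
    by (auto simp: g_def bij_betw_def)
  define u where "u = (\<lambda>i. v (g i))"
  have re: "(\<Sum>j\<in>I. f j) = (\<Sum>j<n. f (h j))" for f :: "_ \<Rightarrow> real"
    using sum.reindex_bij_betw[OF h, of f] by simp
  have Eu: "(\<Sum>j\<in>I. X i j * u j) = e * u i" if "i \<in> I" for i
  proof -
    have "(\<Sum>j\<in>I. X i j * u j) = (\<Sum>j<n. A $$ (g i,j) * v j)"
      unfolding re using hg[OF that] by (intro sum.cong) (auto simp: u_def gh A_def)
    then show ?thesis using v(3)[of "g i"] hg[OF that] by (simp add: u_def)
  qed
  have pos: "sqnorm I u > 0"
    unfolding sqnorm_def by (rule sum_pos2[of _ "h i0"]) (use I hI v in \<open>auto simp: u_def gh\<close>)
  define w where "w = (\<lambda>i. u i / sqrt (sqnorm I u))"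
  have "sqnorm I w = 1"
  proof -
    define s where "s = sqnorm I u"
    have "sqnorm I w = (\<Sum>i\<in>I. (u i)^2) / s"
      using pos unfolding w_def s_def[symmetric] by (simp add: sqnorm_def[of I "\<lambda>i. u i / sqrt s"] power_divide sum_divide_distrib)
    then show ?thesis using pos by (simp add: sqnorm_def s_def)
  qed
  moreover have "(\<Sum>j\<in>I. X i j * w j) = e * w i" if "i \<in> I" for i
    using Eu[OF that] by (simp add: w_def sum_divide_distrib[symmetric])
  ultimately show ?thesis by blast
qed

definition eigenbasis :: "'a set \<Rightarrow> ('a \<Rightarrow> 'a \<Rightarrow> real) \<Rightarrow> ('a \<Rightarrow> real) \<Rightarrow> ('a \<Rightarrow> 'a \<Rightarrow> real) \<Rightarrow> bool" where
  "eigenbasis I X lam U \<longleftrightarrow> (\<forall>i\<in>I. \<forall>j\<in>I. X i j = (\<Sum>c\<in>I. lam c * U c i * U c j)) \<and>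
     (\<forall>c\<in>I. \<forall>d\<in>I. (\<Sum>i\<in>I. U c i * U d i) = kdelta c d) \<and>
     (\<forall>i\<in>I. \<forall>j\<in>I. (\<Sum>c\<in>I. U c i * U c j) = kdelta i j)"

text \<open>The reflection exchanging a basis vector and \<open>v\<close>; it serves to split off an eigenvector in the proof of the spectral
  theorem.\<close>

lemma householder:
  assumes I: "finite I" "b0 \<in> I" and v: "sqnorm I v = 1"
  shows "\<exists>Q. (\<forall>i j. Q i j = Q j i) \<and> (\<forall>i\<in>I. \<forall>j\<in>I. mmult I Q Q i j = kdelta i j) \<and> (\<forall>i\<in>I. Q i b0 = v i)"
proof (cases "\<forall>i\<in>I. v i = kdelta i b0")
  case True
  then show ?thesis
    using I by (intro exI[of _ kdelta]) (auto simp: mmult_kdelta_left kdelta_def)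
next
  case False
  define b where "b = 1 - v b0"
  define w where "w = (\<lambda>i. v i - kdelta i b0)"
  have ww: "(\<Sum>i\<in>I. w i * w i) = 2 * b"
  proof -
    have "(\<Sum>i\<in>I. w i * w i) = (\<Sum>i\<in>I. (v i)^2 - 2 * (v i * kdelta i b0) + kdelta i b0 * kdelta i b0)"
      by (rule sum.cong) (auto simp: w_def algebra_simps power2_eq_square)
    also have "\<dots> = sqnorm I v - 2 * (\<Sum>i\<in>I. v i * kdelta i b0) + (\<Sum>i\<in>I. kdelta i b0 * kdelta i b0)"
      by (simp add: sum.distrib sum_subtractf sum_distrib_left sqnorm_def)
    also have "\<dots> = 2 * b"
      using I v by (simp add: sum_delta_r b_def) (simp add: kdelta_def)
    finally show ?thesis .
  qed
  have b: "b \<noteq> 0"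
  proof
    assume "b = 0"
    with ww have "(\<Sum>i\<in>I. w i * w i) = 0" by simp
    then have "\<forall>i\<in>I. w i = 0" using I by (simp add: sum_nonneg_eq_0_iff)
    with False show False by (auto simp: w_def)
  qed
  define Q where "Q = (\<lambda>i j. kdelta i j - w i * w j / b)"
  have "mmult I Q Q i j = kdelta i j" if "i \<in> I" "j \<in> I" for i j
  proof -
    define r1 r2 where "r1 = w i / b" and "r2 = w i * w j / b^2"
    have "mmult I Q Q i j = (\<Sum>l\<in>I. kdelta i l * Q l j - r1 * (w l * kdelta l j) + r2 * (w l * w l))"
      unfolding mmult_def Q_def r1_def r2_def using b by (intro sum.cong) (auto simp: field_simps power2_eq_square)
    also have "\<dots> = Q i j - r1 * w j + r2 * (2 * b)"
      using that I by (simp add: sum.distrib sum_subtractf sum_distrib_left[symmetric] sum_delta_l sum_delta_r ww)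
    also have "\<dots> = kdelta i j" using b by (simp add: Q_def r1_def r2_def field_simps power2_eq_square)
    finally show ?thesis .
  qed
  moreover have "Q i b0 = v i" if "i \<in> I" for i
  proof -
    have "w b0 = - b" using I by (simp add: w_def b_def kdelta_def)
    then show ?thesis using b by (simp add: Q_def w_def)
  qed
  moreover have "Q i j = Q j i" for i j by (simp add: Q_def kdelta_def mult.commute)
  ultimately show ?thesis by blast
qed

text \<open>Induction on the size: one real eigenvector exists because the complex spectrum of a symmetric matrix is nonempty
  and real, and conjugating with a reflection that moves a basis vector to it leaves a smaller symmetric matrix.\<close>

theorem eigenbasis_exists:
  assumes "finite I" "symm I X"
  shows "\<exists>lam U. eigenbasis I X lam U"
  using assms
proof (induction I arbitrary: X rule: finite_induct)
  case empty
  then show ?case by (simp add: eigenbasis_def)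
next
  case (insert b0 I)
  let ?J = "insert b0 I"
  have J: "finite ?J" "?J \<noteq> {}" "b0 \<in> ?J" using insert by auto
  from real_eigenvector[OF J(1,2) insert.prems] obtain e v where
    v: "sqnorm ?J v = 1" "\<And>i. i \<in> ?J \<Longrightarrow> (\<Sum>j\<in>?J. X i j * v j) = e * v i" by blast
  from householder[OF J(1,3) v(1)] obtain Q where
    Q: "\<And>i j. Q i j = Q j i" "\<And>i j. i \<in> ?J \<Longrightarrow> j \<in> ?J \<Longrightarrow> mmult ?J Q Q i j = kdelta i j"
       "\<And>i. i \<in> ?J \<Longrightarrow> Q i b0 = v i" by blast
  define Y where "Y = mmult ?J Q (mmult ?J X Q)"
  have XQo: "mmult ?J X Q i b0 = e * v i" if "i \<in> ?J" for i
    unfolding mmult_def using v(2)[OF that] Q(3) by simp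
  have Yo: "Y i b0 = e * kdelta i b0" if "i \<in> ?J" for i
  proof -
    have "Y i b0 = (\<Sum>l\<in>?J. e * (Q i l * Q l b0))"
      unfolding Y_def mmult_def[of ?J Q] using XQo Q(3) by (intro sum.cong) auto
    also have "\<dots> = e * mmult ?J Q Q i b0" by (simp only: mmult_def sum_distrib_left)
    finally show ?thesis using Q(2) that by simp
  qed
  have Ysym: "Y i j = Y j i" if "i \<in> ?J" "j \<in> ?J" for i j
  proof -
    have "Y i j = (\<Sum>l\<in>?J. \<Sum>m\<in>?J. Q i l * (X l m * Q m j))"
      by (simp only: Y_def mmult_def sum_distrib_left)
    also have "\<dots> = (\<Sum>l\<in>?J. \<Sum>m\<in>?J. Q j m * (X m l * Q l i))"
    proof (intro sum.cong refl)
      fix l m assume "l \<in> ?J" "m \<in> ?J"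
      then have "X l m = X m l" using insert.prems by (auto simp only: symm_def)
      then show "Q i l * (X l m * Q m j) = Q j m * (X m l * Q l i)"
        using Q(1)[of i l] Q(1)[of m j] by (simp add: mult_ac)
    qed
    also have "\<dots> = Y j i" by (simp only: Y_def mmult_def sum_distrib_left) (rule sum.swap)
    finally show ?thesis .
  qed
  have "symm I Y" using Ysym by (auto simp: symm_def)
  from insert.IH[OF this] obtain lam U where IH: "eigenbasis I Y lam U" by blast
  define lam' where "lam' = lam(b0 := e)"
  define V where "V = (\<lambda>c i. if c = b0 then kdelta i b0 else if i = b0 then 0 else U c i)"
  have oI: "b0 \<notin> I" by fact
  have Vn: "V c i = U c i" if "c \<in> I" "i \<in> I" for c i using that oI by (auto simp: V_def)
  have Vo: "V b0 i = kdelta i b0" "c \<noteq> b0 \<Longrightarrow> V c b0 = 0" for i c by (auto simp: V_def)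
  have ne: "c \<in> I \<Longrightarrow> c \<noteq> b0" for c using oI by auto
  have V1: "Y i j = (\<Sum>c\<in>?J. lam' c * V c i * V c j)" if "i \<in> ?J" "j \<in> ?J" for i j
  proof -
    have "(\<Sum>c\<in>?J. lam' c * V c i * V c j) = e * kdelta i b0 * kdelta j b0 + (\<Sum>c\<in>I. lam c * V c i * V c j)"
      using insert.hyps ne by (simp add: lam'_def Vo)
    also have "\<dots> = Y i j"
    proof (cases "i = b0 \<or> j = b0")
      case True
      then have "(\<Sum>c\<in>I. lam c * V c i * V c j) = 0" using ne by (intro sum.neutral) (auto simp: Vo)
      moreover have "Y i j = e * kdelta i b0 * kdelta j b0"
        using True Yo[OF that(1)] Yo[OF that(2)] Ysym[OF that] by (auto simp: kdelta_def)
      ultimately show ?thesis by simp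
    next
      case False
      then have "i \<in> I" "j \<in> I" using that by auto
      then show ?thesis using IH False by (simp add: eigenbasis_def Vn kdelta_def)
    qed
    finally show ?thesis by simp
  qed
  have V2: "(\<Sum>i\<in>?J. V c i * V d i) = kdelta c d" if "c \<in> ?J" "d \<in> ?J" for c d
  proof (cases "c = b0 \<or> d = b0")
    case True
    then show ?thesis using insert.hyps ne that by (auto simp: Vo kdelta_def intro!: sum.neutral)
  next
    case False
    then have "c \<in> I" "d \<in> I" using that by auto
    then show ?thesis using IH insert.hyps False by (simp add: eigenbasis_def Vn Vo)
  qed
  have V3: "(\<Sum>c\<in>?J. V c i * V c j) = kdelta i j" if "i \<in> ?J" "j \<in> ?J" for i j
  proof (cases "i = b0 \<or> j = b0")
    case True
    then show ?thesis using insert.hyps ne that by (auto simp: Vo kdelta_def intro!: sum.neutral)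
  next
    case False
    then have "i \<in> I" "j \<in> I" using that by auto
    then show ?thesis using IH insert.hyps False by (simp add: eigenbasis_def Vn Vo kdelta_def)
  qed
  define W where "W = mmult ?J V Q"
  have QX: "X i j = mmult ?J Q (mmult ?J Y Q) i j" if "i \<in> ?J" "j \<in> ?J" for i j
  proof -
    have "mmult ?J Q (mmult ?J Y Q) i j = mmult ?J Q (mmult ?J Q (mmult ?J X (mmult ?J Q Q))) i j"
      by (simp only: Y_def mmult_assoc_fun)
    also have "\<dots> = mmult ?J (mmult ?J Q Q) (mmult ?J X (mmult ?J Q Q)) i j" by (simp only: mmult_assoc_fun)
    also have "\<dots> = mmult ?J kdelta (mmult ?J X kdelta) i j" using Q(2) that by (intro mmult_cong) simp_all
    also have "\<dots> = X i j" using that J by (simp only: mmult_kdelta_left mmult_kdelta_right)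
    finally show ?thesis by simp
  qed
  have "eigenbasis ?J X lam' W"
    unfolding eigenbasis_def
  proof (intro conjI ballI)
    fix i j assume ij: "i \<in> ?J" "j \<in> ?J"
    have "X i j = (\<Sum>l\<in>?J. \<Sum>m\<in>?J. Q i l * (Y l m * Q m j))"
      by (subst QX[OF ij]) (simp only: mmult_def sum_distrib_left)
    also have "\<dots> = (\<Sum>l\<in>?J. \<Sum>m\<in>?J. \<Sum>c\<in>?J. lam' c * (V c l * Q l i) * (V c m * Q m j))"
      by (intro sum.cong refl) (simp only: V1 sum_distrib_left sum_distrib_right Q(1)[of i] mult_ac)
    also have "\<dots> = (\<Sum>c\<in>?J. \<Sum>l\<in>?J. \<Sum>m\<in>?J. lam' c * (V c l * Q l i) * (V c m * Q m j))"
      by (rule sum_rotate3)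
    also have "\<dots> = (\<Sum>c\<in>?J. lam' c * W c i * W c j)"
      by (simp only: W_def mmult_def mult.assoc sum_product) (simp only: sum_distrib_left mult.assoc)
    finally show "X i j = (\<Sum>c\<in>?J. lam' c * W c i * W c j)" .
  next
    fix c d assume cd: "c \<in> ?J" "d \<in> ?J"
    have "(\<Sum>i\<in>?J. W c i * W d i) = (\<Sum>i\<in>?J. \<Sum>l\<in>?J. \<Sum>m\<in>?J. (V c l * V d m) * (Q l i * Q i m))"
      unfolding W_def mmult_def sum_product by (intro sum.cong refl) (simp only: Q(1)[of _ ] mult_ac)
    also have "\<dots> = (\<Sum>l\<in>?J. \<Sum>m\<in>?J. \<Sum>i\<in>?J. (V c l * V d m) * (Q l i * Q i m))"
      by (rule sum_rotate3[symmetric])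
    also have "\<dots> = (\<Sum>l\<in>?J. \<Sum>m\<in>?J. (V c l * V d m) * kdelta l m)"
      using Q(2) by (intro sum.cong refl) (simp only: sum_distrib_left[symmetric] mmult_def)
    also have "\<dots> = (\<Sum>l\<in>?J. V c l * V d l)"
      using J by (intro sum.cong refl) (simp only: mult.assoc sum_distrib_left[symmetric], simp add: kdelta_def if_distrib cong: if_cong)
    finally show "(\<Sum>i\<in>?J. W c i * W d i) = kdelta c d" using V2[OF cd] by simp
  next
    fix i j assume ij: "i \<in> ?J" "j \<in> ?J"
    have "(\<Sum>c\<in>?J. W c i * W c j) = (\<Sum>c\<in>?J. \<Sum>l\<in>?J. \<Sum>m\<in>?J. (V c l * V c m) * (Q i l * Q m j))"
      unfolding W_def mmult_def sum_product by (intro sum.cong refl) (simp only: Q(1)[of _ ] mult_ac)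
    also have "\<dots> = (\<Sum>l\<in>?J. \<Sum>m\<in>?J. \<Sum>c\<in>?J. (V c l * V c m) * (Q i l * Q m j))"
      by (rule sum_rotate3[symmetric])
    also have "\<dots> = (\<Sum>l\<in>?J. \<Sum>m\<in>?J. kdelta l m * (Q i l * Q m j))"
      using V3 by (intro sum.cong refl) (simp only: sum_distrib_right[symmetric])
    also have "\<dots> = mmult ?J Q Q i j"
      unfolding mmult_def using J by (intro sum.cong refl) (simp add: sum_delta_l)
    finally show "(\<Sum>c\<in>?J. W c i * W c j) = kdelta i j" using Q(2)[OF ij] by simp
  qed
  then show ?case by blast
qed

section \<open>Consequences of the spectral theorem\<close>

lemma eigenbasis_mpow:
  assumes I: "finite I" and B: "eigenbasis I X lam U" and ij: "i \<in> I" "j \<in> I"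
  shows "mpow I X r i j = (\<Sum>c\<in>I. lam c ^ r * U c i * U c j)"
  using ij(1)
proof (induction r arbitrary: i)
  case 0
  then show ?case using B ij by (simp add: eigenbasis_def)
next
  case (Suc r)
  have "mpow I X (Suc r) i j = (\<Sum>l\<in>I. (\<Sum>c\<in>I. lam c * U c i * U c l) * (\<Sum>d\<in>I. lam d ^ r * U d l * U d j))"
    using Suc B by (simp add: mmult_def eigenbasis_def)
  also have "\<dots> = (\<Sum>l\<in>I. \<Sum>c\<in>I. \<Sum>d\<in>I. (lam c * U c i * lam d ^ r * U d j) * (U c l * U d l))"
    unfolding sum_product by (intro sum.cong refl) (simp add: mult_ac)
  also have "\<dots> = (\<Sum>c\<in>I. \<Sum>d\<in>I. \<Sum>l\<in>I. (lam c * U c i * lam d ^ r * U d j) * (U c l * U d l))"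
    by (rule sum_rotate3[symmetric])
  also have "\<dots> = (\<Sum>c\<in>I. \<Sum>d\<in>I. (lam c * U c i * lam d ^ r * U d j) * kdelta c d)"
    using B by (simp only: eigenbasis_def sum_distrib_left[symmetric] cong: sum.cong)
  also have "\<dots> = (\<Sum>c\<in>I. lam c * U c i * (\<Sum>d\<in>I. kdelta c d * (lam d ^ r * U d j)))"
    by (simp only: sum_distrib_left mult_ac)
  also have "\<dots> = (\<Sum>c\<in>I. lam c ^ Suc r * U c i * U c j)"
    using I by (intro sum.cong refl) (simp add: sum_delta_l)
  finally show ?case .
qed

lemma eigenbasis_mtrace:
  assumes I: "finite I" and B: "eigenbasis I X lam U"
  shows "mtrace I (mpow I X r) = (\<Sum>c\<in>I. lam c ^ r)"
proof -
  have "mtrace I (mpow I X r) = (\<Sum>i\<in>I. \<Sum>c\<in>I. lam c ^ r * U c i * U c i)"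
    unfolding mtrace_def using eigenbasis_mpow[OF I B] by (intro sum.cong) auto
  also have "\<dots> = (\<Sum>c\<in>I. lam c ^ r * (\<Sum>i\<in>I. U c i * U c i))"
    by (subst sum.swap) (simp only: sum_distrib_left mult.assoc)
  also have "\<dots> = (\<Sum>c\<in>I. lam c ^ r)"
    using B by (intro sum.cong refl) (simp add: eigenbasis_def kdelta_def)
  finally show ?thesis .
qed

lemma eigenbasis_qform:
  assumes I: "finite I" and B: "eigenbasis I X lam U"
  shows "qform I (mpow I X r) v = (\<Sum>c\<in>I. lam c ^ r * (\<Sum>i\<in>I. U c i * v i)^2)"
proof -
  have "qform I (mpow I X r) v = (\<Sum>i\<in>I. \<Sum>j\<in>I. \<Sum>c\<in>I. lam c ^ r * ((U c i * v i) * (U c j * v j)))"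
    unfolding qform_def using eigenbasis_mpow[OF I B]
    by (intro sum.cong refl) (simp add: sum_distrib_left sum_distrib_right mult_ac)
  also have "\<dots> = (\<Sum>c\<in>I. \<Sum>i\<in>I. \<Sum>j\<in>I. lam c ^ r * ((U c i * v i) * (U c j * v j)))"
    by (rule sum_rotate3)
  also have "\<dots> = (\<Sum>c\<in>I. lam c ^ r * (\<Sum>i\<in>I. U c i * v i)^2)"
    by (simp only: power2_eq_square sum_product) (simp only: sum_distrib_left)
  finally show ?thesis .
qed

lemma qform_kdelta: "finite I \<Longrightarrow> qform I kdelta v = sqnorm I v"
  unfolding qform_def sqnorm_def by (intro sum.cong refl)
    (simp only: mult.assoc sum_distrib_left[symmetric] sum_delta_l, simp add: power2_eq_square)

lemma eigenbasis_sqnorm: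
  assumes I: "finite I" and B: "eigenbasis I X lam U"
  shows "sqnorm I v = (\<Sum>c\<in>I. (\<Sum>i\<in>I. U c i * v i)^2)"
  using eigenbasis_qform[OF I B, of 0 v] qform_kdelta[OF I, of v] by simp

lemma qform_cong: "(\<And>i j. i \<in> I \<Longrightarrow> j \<in> I \<Longrightarrow> X i j = Y i j) \<Longrightarrow> qform I X v = qform I Y v"
  by (simp add: qform_def)

lemma eigenbasis_quad1:
  assumes I: "finite I" and B: "eigenbasis I X lam U"
  shows "qform I X v = (\<Sum>c\<in>I. lam c * (\<Sum>i\<in>I. U c i * v i)^2)"
  using eigenbasis_qform[OF I B, of "Suc 0" v] I by (simp add: mmult_kdelta_right cong: qform_cong)

lemma eigenbasis_eigvec:
  assumes I: "finite I" and B: "eigenbasis I X lam U" and c: "c \<in> I"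
  shows "sqnorm I (U c) = 1" "qform I X (U c) = lam c"
proof -
  have *: "(\<Sum>i\<in>I. U d i * U c i) = kdelta d c" if "d \<in> I" for d
    using B c that by (simp add: eigenbasis_def)
  have idm2: "(kdelta d c)^2 = kdelta d c" for d :: 'a by (simp add: kdelta_def)
  show "sqnorm I (U c) = 1" "qform I X (U c) = lam c"
    using I c by (simp_all add: eigenbasis_sqnorm[OF I B] eigenbasis_quad1[OF I B] * idm2 sum_delta_r)
      (simp_all add: kdelta_def)
qed

lemma abs_qform_le_aux:
  assumes I: "finite I" and B: "eigenbasis I X lam U" and m: "\<And>c. c \<in> I \<Longrightarrow> \<bar>lam c\<bar> \<le> m"
  shows "\<bar>qform I X v\<bar> \<le> m * sqnorm I v"
proof -
  have "\<bar>qform I X v\<bar> \<le> (\<Sum>c\<in>I. \<bar>lam c * (\<Sum>i\<in>I. U c i * v i)^2\<bar>)"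
    unfolding eigenbasis_quad1[OF I B] by (rule sum_abs)
  also have "\<dots> \<le> (\<Sum>c\<in>I. m * (\<Sum>i\<in>I. U c i * v i)^2)"
    using m by (intro sum_mono) (auto simp: abs_mult intro!: mult_right_mono)
  finally show ?thesis by (simp only: eigenbasis_sqnorm[OF I B] sum_distrib_left)
qed

lemma opnorm_eigen:
  assumes I: "finite I" "I \<noteq> {}" and B: "eigenbasis I X lam U"
  shows "\<And>c. c \<in> I \<Longrightarrow> \<bar>lam c\<bar> \<le> opnorm I X" "\<exists>c\<in>I. opnorm I X = \<bar>lam c\<bar>"
    "\<bar>qform I X v\<bar> \<le> opnorm I X * sqnorm I v"
proof -
  define m where "m = Max ((\<lambda>c. \<bar>lam c\<bar>) ` I)"
  have m: "\<bar>lam c\<bar> \<le> m" if "c \<in> I" for c using that I by (simp add: m_def)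
  have "m \<in> (\<lambda>c. \<bar>lam c\<bar>) ` I" unfolding m_def using I by (intro Max_in) auto
  then obtain c where c: "c \<in> I" "m = \<bar>lam c\<bar>" by auto
  have q: "\<bar>qform I X v\<bar> \<le> m * sqnorm I v" for v by (rule abs_qform_le_aux[OF I(1) B m])
  have "opnorm I X = m"
    unfolding opnorm_def
  proof (rule cSup_eq_maximum)
    show "m \<in> range (\<lambda>v. \<bar>qform I X v\<bar> / sqnorm I v)"
      using eigenbasis_eigvec[OF I(1) B c(1)] c by (intro image_eqI[of _ _ "U c"]) auto
  next
    fix x assume "x \<in> range (\<lambda>v. \<bar>qform I X v\<bar> / sqnorm I v)"
    then obtain v where x: "x = \<bar>qform I X v\<bar> / sqnorm I v" by auto
    show "x \<le> m"
    proof (cases "sqnorm I v = 0")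
      case True
      then show ?thesis using c x by simp
    next
      case False
      then have "sqnorm I v > 0" using sqnorm_nonneg[of I v] by linarith
      then show ?thesis using q[of v] x by (simp add: divide_le_eq)
    qed
  qed
  with m c q show "\<And>c. c \<in> I \<Longrightarrow> \<bar>lam c\<bar> \<le> opnorm I X" "\<exists>c\<in>I. opnorm I X = \<bar>lam c\<bar>"
    "\<bar>qform I X v\<bar> \<le> opnorm I X * sqnorm I v" by auto
qed

lemma abs_qform_le:
  assumes "finite I" "I \<noteq> {}" "symm I X"
  shows "\<bar>qform I X v\<bar> \<le> opnorm I X * sqnorm I v"
  using eigenbasis_exists[OF assms(1,3)] opnorm_eigen(3)[OF assms(1,2)] by blast

lemma opnorm_attained:
  assumes "finite I" "I \<noteq> {}" "symm I X"
  shows "\<exists>v. sqnorm I v = 1 \<and> opnorm I X = \<bar>qform I X v\<bar>"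
  using eigenbasis_exists[OF assms(1,3)] opnorm_eigen(2)[OF assms(1,2)] eigenbasis_eigvec[OF assms(1)] by metis

lemma opnorm_nonneg:
  assumes "finite I" "I \<noteq> {}" "symm I X" shows "0 \<le> opnorm I X"
  using opnorm_attained[OF assms] by auto

lemma opnorm_le:
  assumes "finite I" "I \<noteq> {}" "symm I X" "\<And>v. sqnorm I v = 1 \<Longrightarrow> \<bar>qform I X v\<bar> \<le> m"
  shows "opnorm I X \<le> m"
  using opnorm_attained[OF assms(1-3)] assms(4) by metis

lemma power_le_opnorm:
  assumes "finite I" "I \<noteq> {}" "eigenbasis I X lam U" "c \<in> I"
  shows "\<bar>lam c ^ r\<bar> \<le> opnorm I X ^ r"
  using opnorm_eigen(1)[OF assms] by (simp add: power_abs power_mono)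

text \<open>Each item reduces to an inequality between eigenvalues. The third is Bernoulli's inequality
  \<open>1 + 2 * p * (y - 1) \<le> y ^ (2 * p)\<close> (convexity at \<open>1\<close>), which turns a lower bound on the mean trace into a lower bound on
  the trace moments; the last one is the Cauchy-Schwarz step for the crossed terms of the interpolation.\<close>

lemma mtrace_even_bounds:
  assumes I: "finite I" "I \<noteq> {}" and X: "symm I X" and "p \<ge> 2"
  shows "opnorm I X ^ (2*p) \<le> mtrace I (mpow I X (2*p))"
    "mtrace I (mpow I X (2*p)) \<le> real (card I) * opnorm I X ^ (2*p)"
    "real (card I) + 2 * real p * (mtrace I X - real (card I)) \<le> mtrace I (mpow I X (2*p))"
    "mtrace I (mpow I X (4*p-2)) \<le> mtrace I (mpow I X (2*p)) * opnorm I X ^ (2*p-2)"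
    "a + b = 2*p-2 \<Longrightarrow> mtrace I (mpow I X (2*a)) * mtrace I (mpow I X (2*b)) \<le> real (card I) * (mtrace I (mpow I X (2*p)) * opnorm I X ^ (2*p-4))"
proof -
  from eigenbasis_exists[OF I(1) X] obtain lam U where B: "eigenbasis I X lam U" by blast
  note T = eigenbasis_mtrace[OF I(1) B]
  note L = opnorm_eigen(1)[OF I B]
  have P: "lam c ^ (2*r) \<le> opnorm I X ^ (2*r)" if "c \<in> I" for c r
    using power_le_opnorm[OF I B that, of "2*r"] by simp
  have even: "0 \<le> lam c ^ (2*r)" for c r by simp
  obtain c where c: "c \<in> I" "opnorm I X = \<bar>lam c\<bar>" using opnorm_eigen(2)[OF I B] by blast
  have "opnorm I X ^ (2*p) = lam c ^ (2*p)" using c(2) by (simp add: power_mult)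
  also have "\<dots> \<le> (\<Sum>c\<in>I. lam c ^ (2*p))" using I c(1) even by (intro member_le_sum) auto
  finally show "opnorm I X ^ (2*p) \<le> mtrace I (mpow I X (2*p))" by (simp add: T)
  have "(\<Sum>c\<in>I. lam c ^ (2*p)) \<le> (\<Sum>c\<in>I. opnorm I X ^ (2*p))" by (intro sum_mono P)
  then show "mtrace I (mpow I X (2*p)) \<le> real (card I) * opnorm I X ^ (2*p)" by (simp add: T)
  have "1 + 2 * real p * (lam c - 1) \<le> lam c ^ (2*p)" for c
  proof -
    have "1 + real p * ((lam c)^2 - 1) \<le> (1 + ((lam c)^2 - 1)) ^ p"
      by (rule Bernoulli_inequality) simp
    moreover have "real p * (2 * (lam c - 1)) \<le> real p * ((lam c)^2 - 1)"
    proof (rule mult_left_mono)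
      have "0 \<le> (lam c - 1)^2" by simp
      then show "2 * (lam c - 1) \<le> (lam c)^2 - 1" by (simp add: power2_eq_square algebra_simps)
    qed simp
    ultimately show ?thesis unfolding power_mult by (simp add: algebra_simps del: power_even_eq)
  qed
  then have "(\<Sum>c\<in>I. 1 + 2 * real p * (lam c - 1)) \<le> (\<Sum>c\<in>I. lam c ^ (2*p))" by (intro sum_mono)
  moreover have "mtrace I X = (\<Sum>c\<in>I. lam c)"
    using T[of 1] I by (simp add: mtrace_def mmult_kdelta_right)
  ultimately show "real (card I) + 2 * real p * (mtrace I X - real (card I)) \<le> mtrace I (mpow I X (2*p))"
    by (simp add: T sum.distrib sum_subtractf sum_distrib_left[symmetric])
  have "lam c ^ (4*p-2) \<le> lam c ^ (2*p) * opnorm I X ^ (2*p-2)" if "c \<in> I" for c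
  proof -
    have "lam c ^ (4*p-2) = lam c ^ (2*p) * lam c ^ (2*p-2)"
      using \<open>p \<ge> 2\<close> by (simp add: power_add[symmetric])
    moreover have "lam c ^ (2*p-2) \<le> opnorm I X ^ (2*p-2)"
      using P[OF that, of "p-1"] by (simp add: diff_mult_distrib2)
    ultimately show ?thesis using even by (simp add: mult_left_mono)
  qed
  then show "mtrace I (mpow I X (4*p-2)) \<le> mtrace I (mpow I X (2*p)) * opnorm I X ^ (2*p-2)"
    unfolding T sum_distrib_right by (intro sum_mono)
  show "mtrace I (mpow I X (2*a)) * mtrace I (mpow I X (2*b)) \<le> real (card I) * (mtrace I (mpow I X (2*p)) * opnorm I X ^ (2*p-4))"
    if ab: "a + b = 2*p-2"
  proof -
    have cheb: "x^a * y^b + x^b * y^a \<le> x^(a+b) + y^(a+b)" if "0 \<le> x" "0 \<le> y" for x y :: real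
    proof -
      have "0 \<le> (x^a - y^a) * (x^b - y^b)"
      proof (cases "x \<le> y")
        case True
        then show ?thesis using that by (intro mult_nonpos_nonpos) (auto intro: power_mono)
      next
        case False
        then show ?thesis using that by (intro mult_nonneg_nonneg) (auto intro: power_mono)
      qed
      then show ?thesis by (simp add: power_add algebra_simps)
    qed
    have "2 * (mtrace I (mpow I X (2*a)) * mtrace I (mpow I X (2*b))) =
        (\<Sum>c\<in>I. \<Sum>d\<in>I. (lam c^2)^a * (lam d^2)^b) + (\<Sum>c\<in>I. \<Sum>d\<in>I. (lam c^2)^b * (lam d^2)^a)"
      unfolding T power_mult by (simp add: sum_product[symmetric])
    also have "\<dots> = (\<Sum>c\<in>I. \<Sum>d\<in>I. (lam c^2)^a * (lam d^2)^b + (lam c^2)^b * (lam d^2)^a)"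
      by (simp only: sum.distrib)
    also have "\<dots> \<le> (\<Sum>c\<in>I. \<Sum>d\<in>I. (lam c^2)^(a+b) + (lam d^2)^(a+b))"
      by (intro sum_mono cheb) auto
    also have "\<dots> = 2 * (real (card I) * (\<Sum>c\<in>I. lam c ^ (2*(a+b))))"
      unfolding power_mult by (simp add: sum.distrib sum_distrib_left[symmetric] del: power_even_eq)
    also have "(\<Sum>c\<in>I. lam c ^ (2*(a+b))) \<le> (\<Sum>c\<in>I. lam c ^ (2*p) * opnorm I X ^ (2*p-4))"
    proof (rule sum_mono)
      fix c assume c: "c \<in> I"
      have "lam c ^ (2*(a+b)) = lam c ^ (2*p) * lam c ^ (2*p-4)"
        using \<open>p \<ge> 2\<close> by (simp add: ab power_add[symmetric] diff_mult_distrib2)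
      moreover have "lam c ^ (2*p-4) \<le> opnorm I X ^ (2*p-4)"
        using P[OF c, of "p-2"] by (simp add: diff_mult_distrib2)
      ultimately show "lam c ^ (2*(a+b)) \<le> lam c ^ (2*p) * opnorm I X ^ (2*p-4)"
        using even by (simp add: mult_left_mono)
    qed
    finally show ?thesis by (simp add: T sum_distrib_right mult_left_mono)
  qed
qed

lemma sqnorm_mvm_le:
  assumes I: "finite I" "I \<noteq> {}" and X: "symm I X"
  shows "sqnorm I (\<lambda>i. \<Sum>j\<in>I. X i j * v j) \<le> (opnorm I X)^2 * sqnorm I v"
proof -
  from eigenbasis_exists[OF I(1) X] obtain lam U where B: "eigenbasis I X lam U" by blast
  have "sqnorm I (\<lambda>i. \<Sum>j\<in>I. X i j * v j) = qform I (mpow I X 2) v"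
  proof -
    have "qform I (mpow I X 2) v = (\<Sum>i\<in>I. \<Sum>j\<in>I. \<Sum>l\<in>I. (X l i * v i) * (X l j * v j))"
      unfolding qform_def
    proof (intro sum.cong refl)
      fix i j assume ij: "i \<in> I" "j \<in> I"
      have "mpow I X 2 i j = mmult I X X i j"
        unfolding numeral_2_eq_2 mpow.simps using I ij by (intro mmult_cong) (simp_all add: mmult_kdelta_right)
      also have "\<dots> = (\<Sum>l\<in>I. X l i * X l j)"
        unfolding mmult_def using X ij by (intro sum.cong) (auto simp: symm_def)
      finally show "v i * mpow I X 2 i j * v j = (\<Sum>l\<in>I. (X l i * v i) * (X l j * v j))"
        by (simp add: sum_distrib_left sum_distrib_right mult_ac)
    qed
    also have "\<dots> = (\<Sum>l\<in>I. \<Sum>i\<in>I. \<Sum>j\<in>I. (X l i * v i) * (X l j * v j))"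
      by (rule sum_rotate3)
    also have "\<dots> = sqnorm I (\<lambda>i. \<Sum>j\<in>I. X i j * v j)"
      by (simp only: sqnorm_def power2_eq_square sum_product)
    finally show ?thesis by simp
  qed
  also have "\<dots> \<le> (\<Sum>c\<in>I. (opnorm I X)^2 * (\<Sum>i\<in>I. U c i * v i)^2)"
    unfolding eigenbasis_qform[OF I(1) B]
    using power_le_opnorm[OF I B, of _ 2] by (intro sum_mono mult_right_mono) auto
  also have "\<dots> = (opnorm I X)^2 * sqnorm I v" by (simp only: eigenbasis_sqnorm[OF I(1) B] sum_distrib_left)
  finally show ?thesis .
qed

lemma hs_mmult_left:
  assumes I: "finite I" "I \<noteq> {}" and X: "symm I X"
  shows "hs_sq I (mmult I X M) \<le> (opnorm I X)^2 * hs_sq I M"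
proof -
  have hs_sq: "hs_sq I Y = (\<Sum>j\<in>I. sqnorm I (\<lambda>i. Y i j))" for Y
    unfolding hs_sq_def sqnorm_def by (rule sum.swap)
  show ?thesis unfolding hs_sq sum_distrib_left mmult_def
    by (intro sum_mono sqnorm_mvm_le[OF I X])
qed

lemma hs_mmult_right:
  assumes I: "finite I" "I \<noteq> {}" and X: "symm I X"
  shows "hs_sq I (mmult I M X) \<le> (opnorm I X)^2 * hs_sq I M"
proof -
  have "hs_sq I (mmult I M X) = hs_sq I (mmult I X (\<lambda>i j. M j i))"
    unfolding hs_sq_def using X
    by (subst sum.swap) (intro sum.cong refl, auto simp: mmult_def symm_def mult.commute intro!: arg_cong[where f="\<lambda>x. x^2"] sum.cong)
  also have "\<dots> \<le> (opnorm I X)^2 * hs_sq I (\<lambda>i j. M j i)" by (rule hs_mmult_left[OF I X])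
  also have "hs_sq I (\<lambda>i j. M j i) = hs_sq I M" unfolding hs_sq_def by (rule sum.swap)
  finally show ?thesis .
qed

lemma hs_sandwich:
  assumes I: "finite I" "I \<noteq> {}" and X: "symm I X"
  shows "hs_sq I (mmult I (mpow I X c) (mmult I C (mpow I X d))) \<le> opnorm I X ^ (2*(c+d)) * hs_sq I C"
proof -
  have L: "hs_sq I (mmult I (mpow I X c) M) \<le> opnorm I X ^ (2*c) * hs_sq I M" for M c
  proof (induction c)
    case 0
    show ?case using I by (simp add: hs_sq_def mmult_kdelta_left)
  next
    case (Suc c)
    have "hs_sq I (mmult I (mpow I X (Suc c)) M) = hs_sq I (mmult I X (mmult I (mpow I X c) M))" by (simp add: mmult_assoc_fun)
    also have "\<dots> \<le> (opnorm I X)^2 * hs_sq I (mmult I (mpow I X c) M)" by (rule hs_mmult_left[OF I X])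
    also have "\<dots> \<le> (opnorm I X)^2 * (opnorm I X ^ (2*c) * hs_sq I M)" using Suc by (intro mult_left_mono) auto
    finally show ?case by (simp add: power2_eq_square mult_ac)
  qed
  have R: "hs_sq I (mmult I M (mpow I X d)) \<le> opnorm I X ^ (2*d) * hs_sq I M" for M d
  proof (induction d arbitrary: M)
    case 0
    show ?case using I by (simp add: hs_sq_def mmult_kdelta_right)
  next
    case (Suc d)
    have "hs_sq I (mmult I M (mpow I X (Suc d))) = hs_sq I (mmult I (mmult I M X) (mpow I X d))" by (simp add: mmult_assoc_fun)
    also have "\<dots> \<le> opnorm I X ^ (2*d) * hs_sq I (mmult I M X)" by (rule Suc)
    also have "\<dots> \<le> opnorm I X ^ (2*d) * ((opnorm I X)^2 * hs_sq I M)" using hs_mmult_right[OF I X] by (intro mult_left_mono) auto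
    finally show ?case by (simp add: power2_eq_square mult_ac)
  qed
  have "hs_sq I (mmult I (mpow I X c) (mmult I C (mpow I X d))) \<le> opnorm I X ^ (2*c) * (opnorm I X ^ (2*d) * hs_sq I C)"
    using L[of c "mmult I C (mpow I X d)"] R[of C d] by (meson mult_left_mono order_trans zero_le_even_power even_mult_iff even_numeral)
  then show ?thesis by (simp add: power_add distrib_left mult_ac)
qed

lemma mpow_sym: "finite I \<Longrightarrow> symm I X \<Longrightarrow> symm I (mpow I X r)"
  unfolding symm_def[of I "mpow I X r"]
  using eigenbasis_exists[of I X] eigenbasis_mpow[of I X] by (auto simp: mult_ac)

lemma hs_mpow:
  assumes "finite I" "symm I X"
  shows "hs_sq I (mpow I X a) = mtrace I (mpow I X (2*a))"
  unfolding hs_sq_def mtrace_def mult_2 using mpow_sym[OF assms, of a] assms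
  by (intro sum.cong refl) (simp add: mpow_add mmult_def symm_def power2_eq_square)

text \<open>In the second item \<open>\<lambda> ^ (2 * r + 1) \<ge> - opnorm * \<lambda> ^ (2 * r)\<close> for each eigenvalue: this is what will make
  the solution of the Dyson equation positive definite.\<close>

lemma qform_mpow_bounds:
  assumes I: "finite I" "I \<noteq> {}" and X: "symm I X"
  shows "0 \<le> qform I (mpow I X (2*r)) v"
    "- opnorm I X * qform I (mpow I X (2*r)) v \<le> qform I (mpow I X (2*r+1)) v"
    "\<bar>qform I (mpow I X r) v\<bar> \<le> opnorm I X ^ r * sqnorm I v"
proof -
  from eigenbasis_exists[OF I(1) X] obtain lam U where B: "eigenbasis I X lam U" by blast
  note Q = eigenbasis_qform[OF I(1) B]
  show "0 \<le> qform I (mpow I X (2*r)) v" unfolding Q by (intro sum_nonneg) auto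
  show "- opnorm I X * qform I (mpow I X (2*r)) v \<le> qform I (mpow I X (2*r+1)) v"
    unfolding Q sum_distrib_left
  proof (rule sum_mono)
    fix c assume "c \<in> I"
    from opnorm_eigen(1)[OF I B this] have "- opnorm I X \<le> lam c" by linarith
    then have "- opnorm I X * (lam c ^ (2*r) * (\<Sum>i\<in>I. U c i * v i)^2) \<le> lam c * (lam c ^ (2*r) * (\<Sum>i\<in>I. U c i * v i)^2)"
      by (intro mult_right_mono) auto
    then show "- opnorm I X * (lam c ^ (2*r) * (\<Sum>i\<in>I. U c i * v i)^2) \<le> lam c ^ (2*r+1) * (\<Sum>i\<in>I. U c i * v i)^2"
      by (simp add: mult_ac)
  qed
  have "\<bar>qform I (mpow I X r) v\<bar> \<le> (\<Sum>c\<in>I. \<bar>lam c ^ r * (\<Sum>i\<in>I. U c i * v i)^2\<bar>)"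
    unfolding Q by (rule sum_abs)
  also have "\<dots> \<le> (\<Sum>c\<in>I. opnorm I X ^ r * (\<Sum>i\<in>I. U c i * v i)^2)"
    using power_le_opnorm[OF I B] by (intro sum_mono) (auto simp: abs_mult intro!: mult_right_mono)
  finally show "\<bar>qform I (mpow I X r) v\<bar> \<le> opnorm I X ^ r * sqnorm I v"
    by (simp only: eigenbasis_sqnorm[OF I(1) B] sum_distrib_left)
qed

lemma qform_add: "qform I (\<lambda>i j. X i j + Y i j) v = qform I X v + qform I Y v"
  by (simp add: qform_def algebra_simps sum.distrib)

lemma qform_scale: "qform I (\<lambda>i j. c * X i j) v = c * qform I X v"
  by (simp add: qform_def sum_distrib_left mult_ac)

lemma opnorm_subset:
  assumes I: "finite I" "J \<subseteq> I" "J \<noteq> {}" and X: "symm I X"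
  shows "opnorm J X \<le> opnorm I X"
proof (rule opnorm_le)
  show "finite J" "J \<noteq> {}" using I finite_subset by auto
  show "symm J X" using X I by (auto simp: symm_def)
  fix v assume v: "sqnorm J v = 1"
  define w where "w = (\<lambda>i. if i \<in> J then v i else 0)"
  have 1: "sqnorm I w = sqnorm J v"
    unfolding sqnorm_def by (rule sum.mono_neutral_cong_right) (use I in \<open>auto simp: w_def\<close>)
  have "qform J X v = (\<Sum>i\<in>J. \<Sum>j\<in>J. w i * X i j * w j)"
    by (simp add: qform_def w_def)
  also have "\<dots> = (\<Sum>i\<in>J. \<Sum>j\<in>I. w i * X i j * w j)"
    by (intro sum.cong refl sum.mono_neutral_left) (use I in \<open>auto simp: w_def\<close>)
  also have "\<dots> = qform I X w" unfolding qform_def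
    by (intro sum.mono_neutral_left) (use I in \<open>auto simp: w_def\<close>)
  finally show "\<bar>qform J X v\<bar> \<le> opnorm I X"
    using abs_qform_le[OF I(1) _ X, of w] 1 v I by auto
qed

lemma hs_nonneg: "0 \<le> hs_sq I X"
  by (simp add: hs_sq_def sum_nonneg)

lemma hs_sum_le: "hs_sq I (\<lambda>i j. \<Sum>c<a. Y c i j) \<le> real a * (\<Sum>c<a. hs_sq I (Y c))"
proof -
  have "hs_sq I (\<lambda>i j. \<Sum>c<a. Y c i j) \<le> (\<Sum>i\<in>I. \<Sum>j\<in>I. real a * (\<Sum>c<a. (Y c i j)^2))"
    unfolding hs_sq_def
  proof (intro sum_mono)
    fix i j
    show "(\<Sum>c<a. Y c i j)^2 \<le> real a * (\<Sum>c<a. (Y c i j)^2)"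
      using sum_squared_le_sum_of_squares[of "\<lambda>c. Y c i j" "{..<a}"] by (simp add: mult.commute)
  qed
  also have "\<dots> = real a * (\<Sum>i\<in>I. \<Sum>j\<in>I. \<Sum>c<a. (Y c i j)^2)"
    by (simp only: sum_distrib_left)
  also have "(\<Sum>i\<in>I. \<Sum>j\<in>I. \<Sum>c<a. (Y c i j)^2) = (\<Sum>c<a. hs_sq I (Y c))"
    unfolding hs_sq_def by (rule sum_rotate3)
  finally show ?thesis .
qed

lemma mtrace_sum: "mtrace I (\<lambda>i j. \<Sum>c\<in>A. Y c i j) = (\<Sum>c\<in>A. mtrace I (Y c))"
  unfolding mtrace_def by (rule sum.swap)

lemma mmult_sum_right: "mmult I X (\<lambda>i j. \<Sum>c\<in>A. Y c i j) = (\<lambda>i j. \<Sum>c\<in>A. mmult I X (Y c) i j)"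
  unfolding mmult_def sum_distrib_left by (intro ext sum.swap)

lemma mtrace_cong: "(\<And>i. i \<in> I \<Longrightarrow> X i i = Y i i) \<Longrightarrow> mtrace I X = mtrace I Y"
  by (simp add: mtrace_def)

section \<open>Affine matrix functions of Gaussian variables\<close>

text \<open>A symmetric matrix depending affinely on the variables, with coefficient matrix \<open>D e\<close> for the variable \<open>e\<close>.\<close>

locale affmat =
  fixes E :: "'e set" and I :: "'a set" and X :: "('e \<Rightarrow> real) \<Rightarrow> 'a \<Rightarrow> 'a \<Rightarrow> real"
    and D :: "'e \<Rightarrow> 'a \<Rightarrow> 'a \<Rightarrow> real"
  assumes finI: "finite I" and neI: "I \<noteq> {}"
    and polyX: "polyfun E (\<lambda>x. X x i j)"
    and pdX: "e \<in> E \<Longrightarrow> partial e (\<lambda>x. X x i j) = (\<lambda>_. D e i j)"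
    and symX: "symm I (X x)"
begin

lemma poly_mpow: "polyfun E (\<lambda>x. mpow I (X x) r i j)"
  by (induction r arbitrary: i) (auto simp: mmult_def intro!: polyfun_sum polyfun.mult polyX polyfun.const)

lemma poly_mmult: "(\<And>i j. polyfun E (\<lambda>x. F x i j)) \<Longrightarrow> (\<And>i j. polyfun E (\<lambda>x. H x i j)) \<Longrightarrow> polyfun E (\<lambda>x. mmult I (F x) (H x) i j)"
  unfolding mmult_def by (intro polyfun_sum polyfun.mult)

lemma poly_mtrace: "(\<And>i j. polyfun E (\<lambda>x. F x i j)) \<Longrightarrow> polyfun E (\<lambda>x. mtrace I (F x))"
  unfolding mtrace_def by (intro polyfun_sum)

lemma poly_const_mat: "polyfun E (\<lambda>x. C i j)" by (rule polyfun.const)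

lemmas poly_mat = poly_mmult poly_mpow poly_mtrace poly_const_mat polyX

lemma partial_mpow:
  assumes "e \<in> E" "i \<in> I"
  shows "partial e (\<lambda>x. mpow I (X x) r i j) x
    = (\<Sum>c<r. mmult I (mpow I (X x) c) (mmult I (D e) (mpow I (X x) (r - 1 - c))) i j)"
  using assms(2)
proof (induction r arbitrary: i)
  case 0
  then show ?case by simp
next
  case (Suc r)
  have "partial e (\<lambda>x. mpow I (X x) (Suc r) i j) x
    = (\<Sum>l\<in>I. partial e (\<lambda>x. X x i l * mpow I (X x) r l j) x)"
    by (simp add: mmult_def partial_sum[where E=E] polyfun.mult polyX poly_mpow)
  also have "\<dots> = (\<Sum>l\<in>I. D e i l * mpow I (X x) r l j + X x i l * partial e (\<lambda>x. mpow I (X x) r l j) x)"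
    by (simp add: partial_mult[OF polyX poly_mpow] pdX[OF assms(1)])
  also have "\<dots> = mmult I (D e) (mpow I (X x) r) i j
      + (\<Sum>l\<in>I. X x i l * (\<Sum>c<r. mmult I (mpow I (X x) c) (mmult I (D e) (mpow I (X x) (r - 1 - c))) l j))"
    by (simp add: sum.distrib Suc.IH) (simp add: mmult_def)
  also have "(\<Sum>l\<in>I. X x i l * (\<Sum>c<r. mmult I (mpow I (X x) c) (mmult I (D e) (mpow I (X x) (r - 1 - c))) l j))
     = (\<Sum>c<r. mmult I (mpow I (X x) (Suc c)) (mmult I (D e) (mpow I (X x) (r - 1 - c))) i j)"
    unfolding sum_distrib_left by (subst sum.swap) (simp add: mmult_assoc_fun mmult_def[of I "X x"])
  also have "mmult I (D e) (mpow I (X x) r) i j = mmult I (mpow I (X x) 0) (mmult I (D e) (mpow I (X x) r)) i j"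
    using finI Suc.prems by (simp add: mmult_kdelta_left)
  finally show ?case by (simp only: sum.lessThan_Suc_shift) simp
qed

text \<open>The matrix \<open>\<Sum>c<a. X\<^sup>a\<^sup>-\<^sup>1\<^sup>-\<^sup>c C X\<^sup>c\<close>, the gradient of \<open>Tr (C X\<^sup>a)\<close> before it is paired with the coefficients.\<close>

definition grad_mat :: "('a \<Rightarrow> 'a \<Rightarrow> real) \<Rightarrow> nat \<Rightarrow> ('e \<Rightarrow> real) \<Rightarrow> 'a \<Rightarrow> 'a \<Rightarrow> real" where
  "grad_mat C a x = (\<lambda>i j. \<Sum>c<a. mmult I (mpow I (X x) (a - 1 - c)) (mmult I C (mpow I (X x) c)) i j)"

lemma mtrace_cycle3: "mtrace I (mmult I C (mmult I P (mmult I Q R))) = mtrace I (mmult I Q (mmult I R (mmult I C P)))"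
proof -
  have "mtrace I (mmult I C (mmult I P (mmult I Q R))) = mtrace I (mmult I (mmult I C P) (mmult I Q R))" by (simp add: mmult_assoc_fun)
  also have "\<dots> = mtrace I (mmult I (mmult I Q R) (mmult I C P))" by (rule mtrace_mmult_commute)
  finally show ?thesis by (simp add: mmult_assoc_fun)
qed

lemma partial_mtrace_mpow:
  assumes "e \<in> E"
  shows "partial e (\<lambda>x. mtrace I (mmult I C (mpow I (X x) a))) x = mtrace I (mmult I (D e) (grad_mat C a x))"
proof -
  have p: "polyfun E (\<lambda>x. mpow I (X x) a l i)" for l i by (rule poly_mpow)
  have "partial e (\<lambda>x. mtrace I (mmult I C (mpow I (X x) a))) x
    = (\<Sum>i\<in>I. \<Sum>l\<in>I. C i l * partial e (\<lambda>x. mpow I (X x) a l i) x)"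
    unfolding mtrace_def mmult_def by (simp add: partial_sum[where E=E] polyfun_sum polyfun_cmult p partial_cmult[OF p])
  also have "\<dots> = (\<Sum>i\<in>I. \<Sum>l\<in>I. C i l * (\<Sum>c<a. mmult I (mpow I (X x) c) (mmult I (D e) (mpow I (X x) (a - 1 - c))) l i))"
    using assms by (intro sum.cong refl) (simp add: partial_mpow)
  also have "\<dots> = mtrace I (mmult I C (\<lambda>i j. \<Sum>c<a. mmult I (mpow I (X x) c) (mmult I (D e) (mpow I (X x) (a - 1 - c))) i j))"
    by (simp add: mtrace_def mmult_def[of I C])
  also have "\<dots> = (\<Sum>c<a. mtrace I (mmult I C (mmult I (mpow I (X x) c) (mmult I (D e) (mpow I (X x) (a - 1 - c))))))"
    by (simp only: mmult_sum_right mtrace_sum)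
  also have "\<dots> = (\<Sum>c<a. mtrace I (mmult I (D e) (mmult I (mpow I (X x) (a - 1 - c)) (mmult I C (mpow I (X x) c)))))"
    by (simp only: mtrace_cycle3)
  also have "\<dots> = mtrace I (mmult I (D e) (grad_mat C a x))"
    by (simp only: grad_mat_def mmult_sum_right mtrace_sum)
  finally show ?thesis .
qed

lemma hs_grad_mat: "hs_sq I (grad_mat C a x) \<le> (real a)^2 * (opnorm I (X x) ^ (2*a-2) * hs_sq I C)"
proof -
  have "hs_sq I (grad_mat C a x) \<le> real a * (\<Sum>c<a. hs_sq I (mmult I (mpow I (X x) (a - 1 - c)) (mmult I C (mpow I (X x) c))))"
    unfolding grad_mat_def by (rule hs_sum_le)
  also have "\<dots> \<le> real a * (\<Sum>c<a. opnorm I (X x) ^ (2*a-2) * hs_sq I C)"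
  proof (intro mult_left_mono sum_mono)
    fix c assume "c \<in> {..<a}"
    then have "2 * (a - 1 - c + c) = 2*a-2" by auto
    then show "hs_sq I (mmult I (mpow I (X x) (a - 1 - c)) (mmult I C (mpow I (X x) c))) \<le> opnorm I (X x) ^ (2*a-2) * hs_sq I C"
      using hs_sandwich[OF finI neI symX, of x "a - 1 - c" C c] by simp
  qed simp
  finally show ?thesis by (simp add: power2_eq_square)
qed

definition V :: "nat \<Rightarrow> ('e \<Rightarrow> real) \<Rightarrow> real" where
  "V p x = mtrace I (mpow I (X x) (2*p))"

lemma poly_V: "polyfun E (V p)"
  unfolding V_def[abs_def] by (intro poly_mtrace poly_mpow)

lemma partial_mtrace_pow:
  assumes "e \<in> E"
  shows "partial e (\<lambda>x. mtrace I (mpow I (X x) r)) x = real r * mtrace I (mmult I (D e) (mpow I (X x) (r - 1)))"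
proof -
  have eq: "(\<lambda>x. mtrace I (mpow I (X x) r)) = (\<lambda>x. mtrace I (mmult I kdelta (mpow I (X x) r)))"
    using finI by (intro ext mtrace_cong) (simp add: mmult_kdelta_left)
  have "partial e (\<lambda>x. mtrace I (mpow I (X x) r)) x = (\<Sum>c<r. mtrace I (mmult I (D e) (mmult I (mpow I (X x) (r - 1 - c)) (mmult I kdelta (mpow I (X x) c)))))"
    unfolding eq partial_mtrace_mpow[OF assms] by (simp only: grad_mat_def mmult_sum_right mtrace_sum)
  also have "\<dots> = (\<Sum>c<r. mtrace I (mmult I (D e) (mpow I (X x) (r - 1))))"
  proof (intro sum.cong refl mtrace_cong mmult_cong)
    fix c l i assume c: "c \<in> {..<r}" and l: "l \<in> I"
    have "mmult I (mpow I (X x) (r - 1 - c)) (mmult I kdelta (mpow I (X x) c)) l i = mmult I (mpow I (X x) (r - 1 - c)) (mpow I (X x) c) l i"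
      using finI by (intro mmult_cong) (simp_all add: mmult_kdelta_left)
    also have "\<dots> = mpow I (X x) (r - 1 - c + c) l i" using finI l by (simp add: mpow_add)
    also have "r - 1 - c + c = r - 1" using c by auto
    finally show "mmult I (mpow I (X x) (r - 1 - c)) (mmult I kdelta (mpow I (X x) c)) l i = mpow I (X x) (r - 1) l i" .
  qed
  finally show ?thesis by simp
qed

lemma partial_partial_mtrace_pow:
  assumes "e \<in> E"
  shows "partial e (partial e (\<lambda>x. mtrace I (mpow I (X x) r))) x
    = real r * (\<Sum>c<r-1. mtrace I (mmult I (D e) (mmult I (mpow I (X x) c) (mmult I (D e) (mpow I (X x) (r - 2 - c))))))"
proof -
  have inv: "r - Suc (Suc (r - Suc (Suc c))) = c" if "c < r - Suc 0" for c
    using that by arith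
  have eq: "partial e (\<lambda>x. mtrace I (mpow I (X x) r)) = (\<lambda>x. real r * mtrace I (mmult I (D e) (mpow I (X x) (r - 1))))"
    by (intro ext partial_mtrace_pow assms)
  have "partial e (partial e (\<lambda>x. mtrace I (mpow I (X x) r))) x = real r * partial e (\<lambda>x. mtrace I (mmult I (D e) (mpow I (X x) (r - 1)))) x"
    unfolding eq by (subst partial_cmult[of E]) (auto intro!: poly_mat)
  also have "partial e (\<lambda>x. mtrace I (mmult I (D e) (mpow I (X x) (r - 1)))) x
      = (\<Sum>c<r-1. mtrace I (mmult I (D e) (mmult I (mpow I (X x) (r - 1 - 1 - c)) (mmult I (D e) (mpow I (X x) c)))))"
    unfolding partial_mtrace_mpow[OF assms] by (simp only: grad_mat_def mmult_sum_right mtrace_sum)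
  also have "\<dots> = (\<Sum>c<r-1. mtrace I (mmult I (D e) (mmult I (mpow I (X x) c) (mmult I (D e) (mpow I (X x) (r - 2 - c))))))"
    by (rule sum.reindex_bij_witness[of _ "\<lambda>c. r - 2 - c" "\<lambda>c. r - 2 - c"]) (auto simp: inv)
  finally show ?thesis .
qed

end

text \<open>The variables \<open>s e * g e\<close> have variances \<open>(s e)\<^sup>2\<close>. The assumption \<open>bessel\<close> bounds the covariance operator of the random part
  by \<open>\<kappa>\<close>; for the model it is of order \<open>1 / n\<close>, and this is the only source of concentration.\<close>

locale gmat = gaussians M g E + affmat E I X D
  for M :: "'w measure" and g :: "'e \<Rightarrow> 'w \<Rightarrow> real" and E :: "'e set" and I :: "'a set"
    and X :: "('e \<Rightarrow> real) \<Rightarrow> 'a \<Rightarrow> 'a \<Rightarrow> real" and D :: "'e \<Rightarrow> 'a \<Rightarrow> 'a \<Rightarrow> real" +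
  fixes s :: "'e \<Rightarrow> real" and \<kappa> :: real
  assumes bessel: "(\<Sum>e\<in>E. (s e)^2 * (mtrace I (mmult I (D e) Y))^2) \<le> \<kappa> * hs_sq I Y"
begin

definition scaled :: "'w \<Rightarrow> 'e \<Rightarrow> real" where "scaled \<omega> = (\<lambda>e. s e * g e \<omega>)"

definition avg :: "(('e \<Rightarrow> real) \<Rightarrow> real) \<Rightarrow> real" where
  "avg f = expectation (\<lambda>\<omega>. f (scaled \<omega>))"

lemma avg_ex: "avg f = ex (\<lambda>x. f (\<lambda>e. s e * x e))"
  by (simp add: avg_def ex_def scaled_def)

lemma poly_scale: "polyfun E f \<Longrightarrow> polyfun E (\<lambda>x. f (\<lambda>e. s e * x e))"
  by (rule polyfun_subst) (auto intro: polyI)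

lemma integrable_scaled [simp]: "polyfun E f \<Longrightarrow> integrable M (\<lambda>\<omega>. f (scaled \<omega>))"
  using integrable_poly[OF poly_scale, of f] by (simp add: scaled_def)

lemma avg_const [simp]: "avg (\<lambda>_. c) = c" by (simp add: avg_ex)
lemma avg_add: "polyfun E f \<Longrightarrow> polyfun E h \<Longrightarrow> avg (\<lambda>x. f x + h x) = avg f + avg h"
  by (simp add: avg_def)
lemma avg_diff: "polyfun E f \<Longrightarrow> polyfun E h \<Longrightarrow> avg (\<lambda>x. f x - h x) = avg f - avg h"
  by (simp add: avg_def)
lemma avg_cmult: "avg (\<lambda>x. c * f x) = c * avg f"
  by (simp add: avg_def)
lemma avg_sum: "(\<And>i. i \<in> J \<Longrightarrow> polyfun E (f i)) \<Longrightarrow> avg (\<lambda>x. \<Sum>i\<in>J. f i x) = (\<Sum>i\<in>J. avg (f i))"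
  by (simp add: avg_def)
lemma avg_mono: "polyfun E f \<Longrightarrow> polyfun E h \<Longrightarrow> (\<And>x. f x \<le> h x) \<Longrightarrow> avg f \<le> avg h"
  unfolding avg_def by (rule integral_mono) auto
lemma avg_nonneg: "(\<And>x. 0 \<le> f x) \<Longrightarrow> 0 \<le> avg f"
  unfolding avg_def by simp

definition var :: "(('e \<Rightarrow> real) \<Rightarrow> real) \<Rightarrow> real" where
  "var f = avg (\<lambda>x. (f x - avg f)^2)"

lemma poly_centered: "polyfun E f \<Longrightarrow> polyfun E (\<lambda>x. f x - c)"
  by (intro polyfun_diff polyfun.const)

lemma var_eq: assumes "polyfun E f" shows "var f = avg (\<lambda>x. (f x)^2) - (avg f)^2"
proof -
  have "var f = avg (\<lambda>x. (f x)^2 - (2 * avg f) * f x + (avg f)^2)"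
    by (simp add: var_def power2_diff algebra_simps)
  also have "\<dots> = avg (\<lambda>x. (f x)^2) - (2 * avg f) * avg f + (avg f)^2"
    using assms by (simp add: avg_add avg_diff avg_cmult polyfun_power polyfun_cmult polyfun.const polyfun_diff)
  finally show ?thesis by (simp add: power2_eq_square)
qed

lemma cov_le:
  assumes "polyfun E f" "polyfun E h" and t: "t > 0"
  shows "\<bar>avg (\<lambda>x. f x * h x) - avg f * avg h\<bar> \<le> (t * var f + var h / t) / 2"
proof -
  let ?F = "\<lambda>x. f x - avg f" and ?H = "\<lambda>x. h x - avg h"
  have p: "polyfun E ?F" "polyfun E ?H" using assms(1,2) by (simp_all add: poly_centered)
  have "avg (\<lambda>x. ?F x * ?H x) = avg (\<lambda>x. (f x * h x - avg h * f x) - (avg f * h x - avg f * avg h))"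
    by (simp add: algebra_simps)
  also have "\<dots> = avg (\<lambda>x. f x * h x) - avg f * avg h"
    using assms by (simp add: avg_diff avg_cmult polyfun.mult polyfun_cmult polyfun_diff polyfun.const)
  finally have c: "avg (\<lambda>x. ?F x * ?H x) = avg (\<lambda>x. f x * h x) - avg f * avg h" .
  have q: "polyfun E (\<lambda>x. (t/2) * (?F x)^2 + (1/(2*t)) * (?H x)^2)"
    using p by (intro polyfun.add polyfun_cmult polyfun_power)
  have pw: "\<bar>u * v\<bar> \<le> (t/2) * u^2 + (1/(2*t)) * v^2" for u v :: real
  proof -
    have "0 \<le> (t * \<bar>u\<bar> - \<bar>v\<bar>)^2 / (2*t)" using t by simp
    also have "\<dots> = (t/2) * u^2 + (1/(2*t)) * v^2 - \<bar>u * v\<bar>"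
      using t by (simp add: power2_eq_square field_simps abs_mult)
    finally show ?thesis by simp
  qed
  have e: "avg (\<lambda>x. (t/2) * (?F x)^2 + (1/(2*t)) * (?H x)^2) = (t * var f + var h / t) / 2"
    using p by (simp add: avg_add avg_cmult polyfun_cmult polyfun_power var_def del: times_divide_eq_left) (simp add: field_simps)
  have "avg (\<lambda>x. ?F x * ?H x) \<le> (t * var f + var h / t) / 2"
    unfolding e[symmetric] by (rule avg_mono[OF polyfun.mult[OF p] q]) (use pw in \<open>metis abs_le_D1\<close>)
  moreover have "- avg (\<lambda>x. ?F x * ?H x) \<le> (t * var f + var h / t) / 2"
  proof -
    have "- avg (\<lambda>x. ?F x * ?H x) = avg (\<lambda>x. -1 * (?F x * ?H x))" by (subst avg_cmult) simp
    also have "\<dots> \<le> (t * var f + var h / t) / 2"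
      unfolding e[symmetric] by (rule avg_mono[OF polyfun_cmult[OF polyfun.mult[OF p]] q])
        (use pw in \<open>metis abs_le_D2 mult_minus1\<close>)
    finally show ?thesis .
  qed
  ultimately show ?thesis unfolding c by linarith
qed

lemma poincare_scaled:
  assumes "polyfun E f"
  shows "var f \<le> avg (\<lambda>x. \<Sum>e\<in>E. (s e)^2 * (partial e f x)^2)"
proof -
  let ?F = "\<lambda>x. f (\<lambda>e. s e * x e)"
  have p: "polyfun E (\<lambda>x. (s e)^2 * (partial e f (\<lambda>e. s e * x e))^2)" for e
    using poly_scale[OF polyfun_partial[OF assms]] by (intro polyfun_cmult polyfun_power)
  have "var f = ex (\<lambda>x. (?F x - ex ?F)^2)" by (simp add: var_def avg_ex)
  also have "\<dots> \<le> (\<Sum>e\<in>E. ex (\<lambda>x. (partial e ?F x)^2))" by (rule poincare[OF poly_scale[OF assms]])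
  also have "\<dots> = (\<Sum>e\<in>E. ex (\<lambda>x. (s e)^2 * (partial e f (\<lambda>e. s e * x e))^2))"
    by (simp only: partial_scale[OF assms] power_mult_distrib)
  also have "\<dots> = avg (\<lambda>x. \<Sum>e\<in>E. (s e)^2 * (partial e f x)^2)"
    unfolding avg_ex by (rule ex_sum[symmetric]) (rule p)
  finally show ?thesis .
qed

lemma kappa_nonneg: "0 \<le> \<kappa>"
proof -
  have "0 \<le> (\<Sum>e\<in>E. (s e)^2 * (mtrace I (mmult I (D e) kdelta))^2)" by (intro sum_nonneg) auto
  also have "\<dots> \<le> \<kappa> * hs_sq I kdelta" by (rule bessel)
  finally have "0 \<le> \<kappa> * hs_sq I kdelta" .
  moreover obtain i where "i \<in> I" using neI by blast
  then have "hs_sq I kdelta > 0"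
    unfolding hs_sq_def using finI by (intro sum_pos2[of _ i] sum_nonneg) (auto simp: kdelta_def)
  ultimately show ?thesis by (simp add: zero_le_mult_iff)
qed

lemma poly_grad: "polyfun E f \<Longrightarrow> polyfun E (\<lambda>x. \<Sum>e\<in>E. (s e)^2 * (partial e f x)^2)"
  by (intro polyfun_sum polyfun_cmult polyfun_power polyfun_partial)

text \<open>Poincare inequality for a trace polynomial: the gradient is \<open>D e \<mapsto> Tr (D e * grad_mat)\<close>, to which the Bessel bound
  applies.\<close>

lemma var_mtrace_le:
  assumes w: "polyfun E w" "\<And>x. opnorm I (X x) ^ (2*a-2) \<le> w x"
  shows "var (\<lambda>x. mtrace I (mmult I C (mpow I (X x) a))) \<le> \<kappa> * (real a)^2 * hs_sq I C * avg w"
proof -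
  let ?f = "\<lambda>x. mtrace I (mmult I C (mpow I (X x) a))"
  have p: "polyfun E ?f" by (intro poly_mat)
  have "var ?f \<le> avg (\<lambda>x. \<Sum>e\<in>E. (s e)^2 * (partial e ?f x)^2)" by (rule poincare_scaled[OF p])
  also have "\<dots> \<le> avg (\<lambda>x. (\<kappa> * (real a)^2 * hs_sq I C) * w x)"
  proof (rule avg_mono[OF poly_grad[OF p] polyfun_cmult[OF w(1)]])
    fix x
    have "(\<Sum>e\<in>E. (s e)^2 * (partial e ?f x)^2) = (\<Sum>e\<in>E. (s e)^2 * (mtrace I (mmult I (D e) (grad_mat C a x)))^2)"
      by (intro sum.cong refl) (simp add: partial_mtrace_mpow)
    also have "\<dots> \<le> \<kappa> * hs_sq I (grad_mat C a x)" by (rule bessel)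
    also have "\<dots> \<le> \<kappa> * ((real a)^2 * (opnorm I (X x) ^ (2*a-2) * hs_sq I C))"
      by (intro mult_left_mono hs_grad_mat kappa_nonneg)
    also have "\<dots> \<le> \<kappa> * ((real a)^2 * (w x * hs_sq I C))"
      by (intro mult_left_mono mult_right_mono w hs_nonneg kappa_nonneg) auto
    finally show "(\<Sum>e\<in>E. (s e)^2 * (partial e ?f x)^2) \<le> (\<kappa> * (real a)^2 * hs_sq I C) * w x"
      by (simp add: mult_ac)
  qed
  finally show ?thesis by (simp only: avg_cmult)
qed

text \<open>The exponents give \<open>opnorm ^ (2p-2) * Tr X\<^sup>2\<^sup>p\<close>, which is at most \<open>V + V\<^sup>2\<close>; so the relative variance of \<open>V\<close> is
  of order \<open>\<kappa> p\<^sup>2\<close> and \<open>V\<close> concentrates as long as \<open>p\<^sup>2\<close> is small compared to \<open>n\<close>.\<close>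

lemma var_V:
  assumes p: "p \<ge> 2"
  shows "var (V p) \<le> 4 * \<kappa> * (real p)^2 * (avg (V p) + avg (\<lambda>x. (V p x)^2))"
proof -
  have "var (V p) \<le> avg (\<lambda>x. \<Sum>e\<in>E. (s e)^2 * (partial e (V p) x)^2)" by (rule poincare_scaled[OF poly_V])
  also have "\<dots> \<le> avg (\<lambda>x. (4 * \<kappa> * (real p)^2) * (V p x + (V p x)^2))"
  proof (rule avg_mono[OF poly_grad[OF poly_V]])
    show "polyfun E (\<lambda>x. (4 * \<kappa> * (real p)^2) * (V p x + (V p x)^2))"
      by (intro polyfun_cmult polyfun.add polyfun_power poly_V)
    fix x
    note T = mtrace_even_bounds[OF finI neI symX[of x] p]
    have V0: "0 \<le> V p x" using T(1) opnorm_nonneg[OF finI neI symX, of x] unfolding V_def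
      by (meson order_trans zero_le_power)
    have pdV: "partial e (V p) x = real (2*p) * mtrace I (mmult I (D e) (mpow I (X x) (2*p - 1)))" if "e \<in> E" for e
      unfolding V_def[abs_def] by (rule partial_mtrace_pow[OF that])
    have "(\<Sum>e\<in>E. (s e)^2 * (partial e (V p) x)^2) = (real (2*p))^2 * (\<Sum>e\<in>E. (s e)^2 * (mtrace I (mmult I (D e) (mpow I (X x) (2*p-1))))^2)"
      unfolding sum_distrib_left by (intro sum.cong refl) (simp add: pdV power_mult_distrib)
    also have "\<dots> \<le> (real (2*p))^2 * (\<kappa> * hs_sq I (mpow I (X x) (2*p-1)))"
      by (intro mult_left_mono bessel) auto
    also have "hs_sq I (mpow I (X x) (2*p-1)) = mtrace I (mpow I (X x) (4*p-2))"
      by (simp add: hs_mpow[OF finI symX] diff_mult_distrib2)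
    also have "(real (2*p))^2 * (\<kappa> * mtrace I (mpow I (X x) (4*p-2))) \<le> (real (2*p))^2 * (\<kappa> * (V p x + (V p x)^2))"
    proof (intro mult_left_mono kappa_nonneg)
      have "opnorm I (X x) ^ (2*p-2) \<le> 1 + opnorm I (X x) ^ (2*p)"
      proof (cases "opnorm I (X x) \<le> 1")
        case True
        then have "opnorm I (X x) ^ (2*p-2) \<le> 1" using opnorm_nonneg[OF finI neI symX, of x] by (simp add: power_le_one)
        then show ?thesis using opnorm_nonneg[OF finI neI symX, of x] by (smt (verit) zero_le_power)
      next
        case False
        then have "opnorm I (X x) ^ (2*p-2) \<le> opnorm I (X x) ^ (2*p)" by (intro power_increasing) auto
        then show ?thesis by simp
      qed
      also have "\<dots> \<le> 1 + V p x" using T(1) by (simp add: V_def)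
      finally have "V p x * opnorm I (X x) ^ (2*p-2) \<le> V p x * (1 + V p x)" by (rule mult_left_mono[OF _ V0])
      then show "mtrace I (mpow I (X x) (4*p-2)) \<le> V p x + (V p x)^2"
        using T(4) by (simp add: V_def power2_eq_square algebra_simps)
    qed simp
    finally show "(\<Sum>e\<in>E. (s e)^2 * (partial e (V p) x)^2) \<le> (4 * \<kappa> * (real p)^2) * (V p x + (V p x)^2)"
      by (simp add: power_mult_distrib mult_ac)
  qed
  finally show ?thesis by (simp only: avg_cmult avg_add[OF poly_V polyfun_power[OF poly_V]])
qed

lemma V_nonneg: "p \<ge> 2 \<Longrightarrow> 0 \<le> V p x"
  using mtrace_even_bounds(1)[OF finI neI symX, of p x] opnorm_nonneg[OF finI neI symX, of x]
  unfolding V_def by (meson order_trans zero_le_power)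

lemma opnorm_pow_le_V: "p \<ge> 2 \<Longrightarrow> opnorm I (X x) ^ (2*p) \<le> V p x"
  using mtrace_even_bounds(1)[OF finI neI symX, of p x] unfolding V_def by simp

lemma nrmX_nonneg [simp]: "0 \<le> opnorm I (X x)"
  by (rule opnorm_nonneg[OF finI neI symX])

text \<open>The operator norm is the limit of \<open>(Tr X\<^sup>2\<^sup>p)\<^sup>1\<^sup>/\<^sup>2\<^sup>p\<close>, and each of these is a root of a polynomial in the
  variables.\<close>

lemma measurable_opnorm [measurable]: "(\<lambda>\<omega>. opnorm I (X (scaled \<omega>))) \<in> borel_measurable M"
proof (rule borel_measurable_LIMSEQ_real)
  show "(\<lambda>\<omega>. root (2*(p+2)) (V (p+2) (scaled \<omega>))) \<in> borel_measurable M" for p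
    using borel_measurable_integrable[OF integrable_scaled[OF poly_V]] by measurable
  fix \<omega>
  define y where "y = opnorm I (X (scaled \<omega>))"
  have c: "0 < real (card I)" using finI neI by (simp add: card_gt_0_iff)
  have lo: "y \<le> root (2*(p+2)) (V (p+2) (scaled \<omega>))" for p
    using opnorm_pow_le_V[of "p+2" "scaled \<omega>"] real_root_le_mono[of "2*(p+2)" "y ^ (2*(p+2))"]
    by (simp add: y_def real_root_power_cancel del: power_Suc mult_Suc_right)
  have up: "root (2*(p+2)) (V (p+2) (scaled \<omega>)) \<le> root (2*(p+2)) (real (card I)) * y" for p
  proof -
    have "V (p+2) (scaled \<omega>) \<le> real (card I) * y ^ (2*(p+2))"
      using mtrace_even_bounds(2)[OF finI neI symX, of "p+2" "scaled \<omega>"] by (simp add: V_def y_def)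
    then have "root (2*(p+2)) (V (p+2) (scaled \<omega>)) \<le> root (2*(p+2)) (real (card I) * y ^ (2*(p+2)))"
      by (intro real_root_le_mono) auto
    then show ?thesis by (simp add: real_root_mult real_root_power_cancel y_def del: power_Suc mult_Suc_right)
  qed
  have "(\<lambda>n. root n (real (card I))) \<longlonglongrightarrow> 1" by (rule LIMSEQ_root_const[OF c])
  moreover have "filterlim (\<lambda>p. 2*(p+2)) at_top sequentially"
    by (rule filterlim_at_top_mono[OF filterlim_ident]) auto
  ultimately have "(\<lambda>p. root (2*(p+2)) (real (card I))) \<longlonglongrightarrow> 1"
    by (rule filterlim_compose)
  then have "(\<lambda>p. root (2*(p+2)) (real (card I)) * y) \<longlonglongrightarrow> 1 * y" by (intro tendsto_intros)
  then have L: "(\<lambda>p. root (2*(p+2)) (real (card I)) * y) \<longlonglongrightarrow> y" by simp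
  show "(\<lambda>p. root (2*(p+2)) (V (p+2) (scaled \<omega>))) \<longlonglongrightarrow> opnorm I (X (scaled \<omega>))"
    unfolding y_def[symmetric]
    by (rule tendsto_sandwich[OF _ _ tendsto_const L]) (use lo up in \<open>auto intro!: always_eventually\<close>)
qed

lemma opnorm_pow_bound: "opnorm I (X x) ^ r \<le> 1 + V (r+2) x"
proof (cases "opnorm I (X x) \<le> 1")
  case True
  then have "opnorm I (X x) ^ r \<le> 1" by (simp add: power_le_one)
  then show ?thesis using V_nonneg[of "r+2" x] by simp
next
  case False
  then have "opnorm I (X x) ^ r \<le> opnorm I (X x) ^ (2*(r+2))" by (intro power_increasing) auto
  then show ?thesis using opnorm_pow_le_V[of "r+2" x] by simp
qed

lemma integrable_opnorm_pow: "integrable M (\<lambda>\<omega>. opnorm I (X (scaled \<omega>)) ^ r)"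
proof (rule Bochner_Integration.integrable_bound)
  show "integrable M (\<lambda>\<omega>. 1 + V (r+2) (scaled \<omega>))" by (intro integrable_scaled polyfun.add polyfun.const poly_V)
  show "AE \<omega> in M. norm (opnorm I (X (scaled \<omega>)) ^ r) \<le> norm (1 + V (r+2) (scaled \<omega>))"
  proof (rule AE_I2)
    fix \<omega>
    show "norm (opnorm I (X (scaled \<omega>)) ^ r) \<le> norm (1 + V (r+2) (scaled \<omega>))"
      using opnorm_pow_bound[of "scaled \<omega>" r] by simp
  qed
qed measurable

lemma integrable_opnorm: "integrable M (\<lambda>\<omega>. opnorm I (X (scaled \<omega>)))"
  using integrable_opnorm_pow[of 1] by simp

lemma var_nonneg: "0 \<le> var f"
  unfolding var_def by (rule avg_nonneg) simp

end

lemma young_power: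
  fixes y :: real
  assumes "0 \<le> y" "1 \<le> r" "r < p"
  shows "y ^ r \<le> 1 + (real r / real p) * (y ^ p - 1)"
proof (cases "y = 0")
  case True
  then show ?thesis using assms by (simp add: zero_power field_simps)
next
  case False
  define a where "a = real p / real r"
  define b where "b = real p / (real p - real r)"
  have "y ^ r * 1 \<le> (y ^ r) powr a / a + 1 powr b / b"
    by (rule Youngs_inequality) (use assms in \<open>auto simp: a_def b_def field_simps\<close>)
  moreover have "(y ^ r) powr a = y ^ p"
    using False assms by (simp add: a_def powr_realpow[symmetric] powr_powr)
  moreover have "y ^ p / a + 1 / b = 1 + (real r / real p) * (y ^ p - 1)"
    using assms by (simp add: a_def b_def field_simps)
  ultimately show ?thesis by simp
qed

text \<open>Normalized mean trace at least \<open>1\<close>. It is achieved by adding a multiple of the identity and keeps all trace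
  moments away from \<open>0\<close>, so that logarithms can be compared.\<close>

locale gmatm = gmat +
  assumes mean: "real (card I) \<le> avg (\<lambda>x. mtrace I (X x))"
begin

lemma card_pos: "0 < real (card I)" "1 \<le> real (card I)"
proof -
  have "0 < card I" using finI neI by (simp add: card_gt_0_iff)
  then show "0 < real (card I)" "1 \<le> real (card I)" by auto
qed

lemma trace_moment_ge:
  assumes "p \<ge> 2"
  shows "real (card I) \<le> avg (V p)" "1 \<le> avg (V p)"
proof -
  have pt: "polyfun E (\<lambda>x. mtrace I (X x))" by (intro poly_mtrace polyX)
  have "real (card I) \<le> real (card I) + 2 * real p * (avg (\<lambda>x. mtrace I (X x)) - real (card I))"
    using mean by simp
  also have "\<dots> = avg (\<lambda>x. real (card I) + 2 * real p * (mtrace I (X x) - real (card I)))"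
    using pt by (simp add: avg_add avg_cmult avg_diff polyfun.const polyfun_cmult polyfun_diff)
  also have "\<dots> \<le> avg (V p)"
  proof (rule avg_mono)
    show "polyfun E (\<lambda>x. real (card I) + 2 * real p * (mtrace I (X x) - real (card I)))"
      by (intro polyfun.add polyfun.const polyfun_cmult polyfun_diff pt)
    show "real (card I) + 2 * real p * (mtrace I (X x) - real (card I)) \<le> V p x" for x
      using mtrace_even_bounds(3)[OF finI neI symX assms, of x] by (simp add: V_def)
  qed (rule poly_V)
  finally show "real (card I) \<le> avg (V p)" .
  then show "1 \<le> avg (V p)" using card_pos by linarith
qed

definition trace_moment_sq :: "nat \<Rightarrow> real" where "trace_moment_sq p = avg (\<lambda>x. (V p x)^2)"

lemma EVV_bounds:
  assumes p: "p \<ge> 2" and small: "16 * \<kappa> * (real p)^2 \<le> 1"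
  shows "(avg (V p))^2 \<le> trace_moment_sq p" "trace_moment_sq p \<le> 2 * (avg (V p))^2" "var (V p) \<le> 16 * \<kappa> * (real p)^2 * (avg (V p))^2"
proof -
  have v: "var (V p) = trace_moment_sq p - (avg (V p))^2" unfolding trace_moment_sq_def by (rule var_eq[OF poly_V])
  show 1: "(avg (V p))^2 \<le> trace_moment_sq p" using v var_nonneg[of "V p"] by linarith
  have "avg (V p) \<le> (avg (V p))^2" using trace_moment_ge(2)[OF p] by (simp add: power2_eq_square)
  then have s2: "avg (V p) + trace_moment_sq p \<le> 2 * trace_moment_sq p" using 1 by linarith
  have kp: "0 \<le> 4 * \<kappa> * (real p)^2" using kappa_nonneg by simp
  have "var (V p) \<le> 4 * \<kappa> * (real p)^2 * (avg (V p) + trace_moment_sq p)"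
    using var_V[OF p] by (simp only: trace_moment_sq_def)
  also have "\<dots> \<le> 4 * \<kappa> * (real p)^2 * (2 * trace_moment_sq p)" by (rule mult_left_mono[OF s2 kp])
  finally have 2: "var (V p) \<le> 4 * \<kappa> * (real p)^2 * (2 * trace_moment_sq p)" .
  have E0: "0 \<le> trace_moment_sq p" using 1 zero_le_power2[of "avg (V p)"] by linarith
  note 2
  also have "4 * \<kappa> * (real p)^2 * (2 * trace_moment_sq p) = (16 * \<kappa> * (real p)^2) * (trace_moment_sq p / 2)" by simp
  also have "\<dots> \<le> 1 * (trace_moment_sq p / 2)" using E0 by (intro mult_right_mono[OF small]) simp
  finally show 3: "trace_moment_sq p \<le> 2 * (avg (V p))^2" using v by linarith
  have "4 * \<kappa> * (real p)^2 * (2 * trace_moment_sq p) \<le> 4 * \<kappa> * (real p)^2 * (2 * (2 * (avg (V p))^2))"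
    using 3 kappa_nonneg by (intro mult_left_mono) auto
  with 2 show "var (V p) \<le> 16 * \<kappa> * (real p)^2 * (avg (V p))^2" by (simp add: mult_ac)
qed

definition norm_scale :: "nat \<Rightarrow> real" where "norm_scale p = root (4*p) (trace_moment_sq p)"

text \<open>The powers of the operator norm are not polynomials. This polynomial dominates the power \<open>c \<le> 4 * p\<close> by Young's inequality, and its
  mean is only twice the natural scale.\<close>

definition majorant :: "nat \<Rightarrow> nat \<Rightarrow> ('b \<Rightarrow> real) \<Rightarrow> real" where
  "majorant p c x = norm_scale p ^ c * (1 + (1 / trace_moment_sq p) * (V p x)^2)"

lemma majorant_props:
  assumes p: "p \<ge> 2" and small: "16 * \<kappa> * (real p)^2 \<le> 1"
  shows "1 \<le> norm_scale p" "norm_scale p ^ (4*p) = trace_moment_sq p" "polyfun E (majorant p c)" "avg (majorant p c) = 2 * norm_scale p ^ c"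
    "c \<le> 4*p \<Longrightarrow> opnorm I (X x) ^ c \<le> majorant p c x"
proof -
  have "1 \<le> (avg (V p))^2" using trace_moment_ge(2)[OF p] by simp
  then have E1: "1 \<le> trace_moment_sq p" using EVV_bounds(1)[OF p small] by linarith
  show L: "1 \<le> norm_scale p" using E1 p by (simp add: norm_scale_def)
  show L4: "norm_scale p ^ (4*p) = trace_moment_sq p" using E1 p by (simp add: norm_scale_def real_root_pow_pos2)
  have pv: "polyfun E (\<lambda>x. (1 / trace_moment_sq p) * (V p x)^2)" by (intro polyfun_cmult polyfun_power poly_V)
  show "polyfun E (majorant p c)" unfolding majorant_def[abs_def] by (intro polyfun_cmult polyfun.add polyfun.const pv)
  have "avg (majorant p c) = norm_scale p ^ c * (1 + (1 / trace_moment_sq p) * trace_moment_sq p)"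
    unfolding majorant_def[abs_def] trace_moment_sq_def[symmetric]
    by (simp only: avg_cmult avg_add[OF polyfun.const pv] avg_const) (simp only: trace_moment_sq_def)
  then show "avg (majorant p c) = 2 * norm_scale p ^ c" using E1 by simp
  show "opnorm I (X x) ^ c \<le> majorant p c x" if c: "c \<le> 4*p"
  proof -
    define z where "z = opnorm I (X x) / norm_scale p"
    have z0: "0 \<le> z" using L by (simp add: z_def)
    have "z ^ c \<le> 1 + z ^ (4*p)"
    proof (cases "z \<le> 1")
      case True
      then have "z ^ c \<le> 1" using z0 by (simp add: power_le_one)
      then show ?thesis using z0 by (smt (verit) zero_le_power)
    next
      case False
      then have "z ^ c \<le> z ^ (4*p)" using c by (intro power_increasing) auto
      then show ?thesis by simp
    qed
    also have "z ^ (4*p) = opnorm I (X x) ^ (4*p) / trace_moment_sq p"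
      by (simp only: z_def power_divide L4)
    also have "4*p = (2*p)*2" by simp
    also have "opnorm I (X x) ^ ((2*p)*2) = (opnorm I (X x) ^ (2*p))^2" by (rule power_mult)
    also have "(opnorm I (X x) ^ (2*p))^2 / trace_moment_sq p \<le> (V p x)^2 / trace_moment_sq p"
      using E1 opnorm_pow_le_V[OF p, of x] by (intro divide_right_mono power_mono) auto
    finally have "z ^ c \<le> 1 + (1 / trace_moment_sq p) * (V p x)^2" by simp
    then have "norm_scale p ^ c * z ^ c \<le> majorant p c x" unfolding majorant_def using L by (intro mult_left_mono) auto
    moreover have "norm_scale p ^ c * z ^ c = opnorm I (X x) ^ c" using L by (simp add: z_def power_divide)
    ultimately show ?thesis by simp
  qed
qed

definition mean_opnorm :: real where "mean_opnorm = expectation (\<lambda>\<omega>. opnorm I (X (scaled \<omega>)))"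

text \<open>Young's inequality linearizes \<open>opnorm ^ (2 * r)\<close> around the scale \<open>root p (avg (V p))\<close>, so a single large trace moment controls
  all lower moments of the norm.\<close>

lemma moment_le:
  assumes p: "p \<ge> 2" and r: "1 \<le> r" "r < p"
  shows "expectation (\<lambda>\<omega>. opnorm I (X (scaled \<omega>)) ^ (2*r)) \<le> root p (avg (V p)) ^ r"
proof -
  define t where "t = root p (avg (V p))"
  have V1: "1 \<le> avg (V p)" by (rule trace_moment_ge(2)[OF p])
  have t: "t > 0" "t ^ p = avg (V p)" using V1 p by (simp_all add: t_def real_root_pow_pos2)
  have pw: "opnorm I (X x) ^ (2*r) \<le> t ^ r * (1 + (real r / real p) * (V p x / avg (V p) - 1))" for x
  proof -
    define y where "y = (opnorm I (X x))^2 / t"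
    have "y ^ r \<le> 1 + (real r / real p) * (y ^ p - 1)"
      by (rule young_power) (use t r in \<open>auto simp: y_def\<close>)
    also have "y ^ p = opnorm I (X x) ^ (2*p) / avg (V p)" by (simp add: y_def power_divide t power_mult)
    also have "1 + (real r / real p) * (opnorm I (X x) ^ (2*p) / avg (V p) - 1) \<le> 1 + (real r / real p) * (V p x / avg (V p) - 1)"
      using V1 opnorm_pow_le_V[OF p, of x] by (intro add_left_mono mult_left_mono diff_right_mono divide_right_mono) auto
    finally have "t ^ r * y ^ r \<le> t ^ r * (1 + (real r / real p) * (V p x / avg (V p) - 1))"
      using t by (intro mult_left_mono) auto
    moreover have "t ^ r * y ^ r = opnorm I (X x) ^ (2*r)" using t by (simp add: y_def power_divide power_mult)
    ultimately show ?thesis by simp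
  qed
  have pf: "polyfun E (\<lambda>x. t ^ r * (1 + (real r / real p) * (V p x / avg (V p) - 1)))"
    by (intro polyfun_cmult polyfun.add polyfun.const polyfun_diff polyfun_divide poly_V)
  have "expectation (\<lambda>\<omega>. opnorm I (X (scaled \<omega>)) ^ (2*r)) \<le> avg (\<lambda>x. t ^ r * (1 + (real r / real p) * (V p x / avg (V p) - 1)))"
    unfolding avg_def[of "\<lambda>x. t ^ r * (1 + (real r / real p) * (V p x / avg (V p) - 1))"]
    by (rule integral_mono[OF integrable_opnorm_pow integrable_scaled[OF pf]]) (rule pw)
  also have "\<dots> = t ^ r * (1 + (real r / real p) * ((1 / avg (V p)) * avg (V p) - 1))"
  proof -
    have "avg (\<lambda>x. t ^ r * (1 + (real r / real p) * (V p x / avg (V p) - 1)))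
      = avg (\<lambda>x. t ^ r * (1 + (real r / real p) * ((1 / avg (V p)) * V p x - 1)))" by simp
    also have "\<dots> = t ^ r * (1 + (real r / real p) * ((1 / avg (V p)) * avg (V p) - 1))"
      by (simp only: avg_cmult avg_const avg_add[OF polyfun.const polyfun_cmult[OF polyfun_diff[OF polyfun_cmult[OF poly_V] polyfun.const]]]
         avg_diff[OF polyfun_cmult[OF poly_V] polyfun.const])
    finally show ?thesis .
  qed
  also have "\<dots> = t ^ r" using V1 by simp
  finally show ?thesis by (simp add: t_def)
qed

lemma mean_opnorm_sq_le: "mean_opnorm^2 \<le> expectation (\<lambda>\<omega>. opnorm I (X (scaled \<omega>)) ^ 2)"
proof -
  have "0 \<le> expectation (\<lambda>\<omega>. (opnorm I (X (scaled \<omega>)) - mean_opnorm)^2)" by simp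
  also have "\<dots> = expectation (\<lambda>\<omega>. opnorm I (X (scaled \<omega>)) ^ 2 - 2 * mean_opnorm * opnorm I (X (scaled \<omega>)) + mean_opnorm^2)"
    by (simp add: power2_diff algebra_simps)
  also have "\<dots> = expectation (\<lambda>\<omega>. opnorm I (X (scaled \<omega>)) ^ 2) - 2 * mean_opnorm * mean_opnorm + mean_opnorm^2"
    using integrable_opnorm integrable_opnorm_pow[of 2] by (simp add: mean_opnorm_def prob_space)
  finally show ?thesis by (simp add: power2_eq_square)
qed

lemma mean_opnorm_nonneg: "0 \<le> mean_opnorm" unfolding mean_opnorm_def by simp

lemma mean_opnorm_upper:
  assumes p: "p \<ge> 2"
  shows "mean_opnorm \<le> root (2*p) (avg (V p))"
proof -
  have "mean_opnorm^2 \<le> expectation (\<lambda>\<omega>. opnorm I (X (scaled \<omega>)) ^ (2*1))" using mean_opnorm_sq_le by simp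
  also have "\<dots> \<le> root p (avg (V p)) ^ 1" by (rule moment_le) (use p in auto)
  finally have "mean_opnorm^2 \<le> root p (avg (V p))" by simp
  then have "sqrt (mean_opnorm^2) \<le> sqrt (root p (avg (V p)))" by (rule real_sqrt_le_mono)
  also have "sqrt (root p (avg (V p))) = root (2*p) (avg (V p))" by (simp only: sqrt_def real_root_mult_exp)
  finally show ?thesis using mean_opnorm_nonneg by simp
qed

text \<open>Chebyshev's inequality for \<open>V p\<close>: where \<open>V p \<ge> q / 2\<close>, the norm is at least \<open>root (2 * p) (q / (2 * card I))\<close>. The event is
  replaced by a quadratic polynomial in \<open>V p\<close>.\<close>

lemma mean_opnorm_lower:
  assumes p: "p \<ge> 2" and small: "16 * \<kappa> * (real p)^2 \<le> 1"
  shows "(1 - 64 * \<kappa> * (real p)^2) * root (2*p) (avg (V p) / (2 * real (card I))) \<le> mean_opnorm"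
proof -
  define q where "q = avg (V p)"
  define t where "t = root (2*p) (q / (2 * real (card I)))"
  have q1: "1 \<le> q" using trace_moment_ge(2)[OF p] by (simp add: q_def)
  have t0: "0 \<le> t" unfolding t_def using q1 by (intro real_root_ge_zero divide_nonneg_nonneg) auto
  have t2p: "t ^ (2*p) = q / (2 * real (card I))" using q1 p by (simp add: t_def real_root_pow_pos2)
  have pw: "t * (1 - (4 / q^2) * (V p x - q)^2) \<le> opnorm I (X x)" for x
  proof (cases "V p x \<ge> q / 2")
    case True
    have "q / 2 \<le> real (card I) * opnorm I (X x) ^ (2*p)"
      using True mtrace_even_bounds(2)[OF finI neI symX p, of x] by (simp add: V_def)
    then have "t ^ (2*p) \<le> opnorm I (X x) ^ (2*p)" unfolding t2p using card_pos by (simp add: divide_le_eq mult_ac)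
    then have "t \<le> opnorm I (X x)" using p by (simp add: power_mono_iff t0)
    moreover have "t * (1 - (4 / q^2) * (V p x - q)^2) \<le> t * 1" using t0 by (intro mult_left_mono) auto
    ultimately show ?thesis by simp
  next
    case False
    then have "(q/2)^2 \<le> (q - V p x)^2" using q1 by (intro power_mono) auto
    then have "1 \<le> (4 / q^2) * (V p x - q)^2" using q1 by (simp add: power2_commute field_simps power_divide)
    then have "t * (1 - (4 / q^2) * (V p x - q)^2) \<le> 0" using t0 by (intro mult_nonneg_nonpos) auto
    then show ?thesis using nrmX_nonneg[of x] by linarith
  qed
  have pv: "polyfun E (\<lambda>x. (4 / q^2) * (V p x - q)^2)" by (intro polyfun_cmult polyfun_power polyfun_diff poly_V polyfun.const)
  have pf: "polyfun E (\<lambda>x. t * (1 - (4 / q^2) * (V p x - q)^2))" by (intro polyfun_cmult polyfun_diff polyfun.const pv)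
  have "avg (\<lambda>x. t * (1 - (4 / q^2) * (V p x - q)^2)) \<le> mean_opnorm"
    unfolding avg_def mean_opnorm_def by (rule integral_mono[OF integrable_scaled[OF pf] integrable_opnorm]) (rule pw)
  moreover have "avg (\<lambda>x. t * (1 - (4 / q^2) * (V p x - q)^2)) = t * (1 - (4 / q^2) * var (V p))"
    unfolding var_def q_def[symmetric]
    by (simp only: avg_cmult avg_diff[OF polyfun.const pv] avg_const)
  moreover have "t * (1 - 64 * \<kappa> * (real p)^2) \<le> t * (1 - (4 / q^2) * var (V p))"
  proof -
    have "(4 / q^2) * var (V p) \<le> (4 / q^2) * (16 * \<kappa> * (real p)^2 * q^2)"
      using EVV_bounds(3)[OF p small] by (intro mult_left_mono) (auto simp: q_def)
    also have "\<dots> = 64 * \<kappa> * (real p)^2" using q1 by simp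
    finally show ?thesis using t0 by (intro mult_left_mono) auto
  qed
  ultimately show ?thesis by (simp add: t_def q_def mult.commute)
qed

end

section \<open>Block matrices with Gaussian blocks\<close>

definition block_index :: "nat \<Rightarrow> 'p set \<Rightarrow> (nat \<times> 'p) set" where "block_index k P = {..<k} \<times> P"
text \<open>One variable for each coefficient matrix and each entry, both triangles included, as in the symmetrization \<open>(G + G\<^sup>T) / sqrt 2\<close>.\<close>

definition noise_index :: "nat \<Rightarrow> 'p set \<Rightarrow> (nat \<times> 'p \<times> 'p) set" where "noise_index l P = {1..l} \<times> P \<times> P"

definition noise_coeff :: "(nat \<Rightarrow> nat \<Rightarrow> nat \<Rightarrow> real) \<Rightarrow> nat \<times> 'p \<times> 'p \<Rightarrow> nat \<times> 'p \<Rightarrow> nat \<times> 'p \<Rightarrow> real" where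
  "noise_coeff A = (\<lambda>(i,p,q) (a,u) (b,v). A i a b * (kdelta u p * kdelta v q + kdelta u q * kdelta v p) / sqrt 2)"

text \<open>The matrix \<open>B \<otimes> 1 + \<Sum>i. A i \<otimes> (x i + (x i)\<^sup>T) / sqrt 2\<close>, whose rows are pairs (block index, position).\<close>

definition gauss_mat :: "nat \<Rightarrow> (nat \<Rightarrow> nat \<Rightarrow> nat \<Rightarrow> real) \<Rightarrow> (nat \<Rightarrow> nat \<Rightarrow> real) \<Rightarrow> 'p set \<Rightarrow>
    (nat \<times> 'p \<times> 'p \<Rightarrow> real) \<Rightarrow> nat \<times> 'p \<Rightarrow> nat \<times> 'p \<Rightarrow> real" where
  "gauss_mat l A B P x = (\<lambda>(a,u) (b,v). if u \<in> P \<and> v \<in> P then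
     B a b * kdelta u v + (\<Sum>i\<in>{1..l}. A i a b * ((x (i,u,v) + x (i,v,u)) / sqrt 2)) else 0)"

lemma gauss_mat_simp: "gauss_mat l A B P x (a,u) (b,v) = (if u \<in> P \<and> v \<in> P then
     B a b * kdelta u v + (\<Sum>i\<in>{1..l}. A i a b * ((x (i,u,v) + x (i,v,u)) / sqrt 2)) else 0)"
  by (simp add: gauss_mat_def)

lemma noise_coeff_simp: "noise_coeff A (i,p,q) (a,u) (b,v) = A i a b * (kdelta u p * kdelta v q + kdelta u q * kdelta v p) / sqrt 2"
  by (simp add: noise_coeff_def)

lemma sum_block_index: "(\<Sum>j\<in>block_index k P. f j) = (\<Sum>a<k. \<Sum>u\<in>P. f (a,u))"
  by (simp add: block_index_def sum.cartesian_product)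

lemma sum_noise_index: "(\<Sum>e\<in>noise_index l P. f e) = (\<Sum>i\<in>{1..l}. \<Sum>p\<in>P. \<Sum>q\<in>P. f (i,p,q))"
  by (simp add: noise_index_def sum.cartesian_product)

lemma finite_block_index: "finite P \<Longrightarrow> finite (block_index k P)" by (simp add: block_index_def)
lemma card_block_index: "card (block_index k P) = k * card P" by (simp add: block_index_def card_cartesian_product)

lemma kdelta_commute: "kdelta u p = kdelta p u"
  by (simp add: kdelta_def)

lemma mmult_noise_coeff:
  assumes "finite P" "p \<in> P" "q \<in> P"
  shows "mmult (block_index k P) (noise_coeff A (i,p,q)) N (a,u) j
     = (\<Sum>b<k. A i a b * (kdelta p u * N (b,q) j + kdelta q u * N (b,p) j)) / sqrt 2"
proof -
  have "mmult (block_index k P) (noise_coeff A (i,p,q)) N (a,u) j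
     = (\<Sum>b<k. \<Sum>v\<in>P. (A i a b * kdelta u p / sqrt 2) * (N (b,v) j * kdelta v q) + (A i a b * kdelta u q / sqrt 2) * (N (b,v) j * kdelta v p))"
    unfolding mmult_def sum_block_index by (intro sum.cong refl) (simp add: noise_coeff_simp algebra_simps add_divide_distrib)
  also have "\<dots> = (\<Sum>b<k. (A i a b * kdelta u p / sqrt 2) * N (b,q) j + (A i a b * kdelta u q / sqrt 2) * N (b,p) j)"
    using assms by (simp only: sum.distrib sum_distrib_left[symmetric] sum_delta_r if_True)
  also have "\<dots> = (\<Sum>b<k. A i a b * (kdelta p u * N (b,q) j + kdelta q u * N (b,p) j)) / sqrt 2"
    by (simp add: sum_divide_distrib algebra_simps add_divide_distrib kdelta_commute[of u p] kdelta_commute[of u q])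
  finally show ?thesis .
qed

lemma mtrace_noise_coeff:
  assumes P: "finite P" "p \<in> P" "q \<in> P"
  shows "mtrace (block_index k P) (mmult (block_index k P) (noise_coeff A (i,p,q)) Y)
     = (\<Sum>a<k. \<Sum>b<k. A i a b * (Y (b,q) (a,p) + Y (b,p) (a,q))) / sqrt 2"
proof -
  have "mtrace (block_index k P) (mmult (block_index k P) (noise_coeff A (i,p,q)) Y)
     = (\<Sum>a<k. \<Sum>u\<in>P. \<Sum>b<k. (A i a b / sqrt 2) * (kdelta p u * Y (b,q) (a,u) + kdelta q u * Y (b,p) (a,u)))"
    unfolding mtrace_def sum_block_index mmult_noise_coeff[OF P]
    by (intro sum.cong refl) (simp add: sum_divide_distrib)
  also have "\<dots> = (\<Sum>a<k. \<Sum>b<k. \<Sum>u\<in>P. (A i a b / sqrt 2) * (kdelta p u * Y (b,q) (a,u) + kdelta q u * Y (b,p) (a,u)))"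
    by (intro sum.cong refl sum.swap)
  also have "\<dots> = (\<Sum>a<k. \<Sum>b<k. (A i a b / sqrt 2) * (Y (b,q) (a,p) + Y (b,p) (a,q)))"
    using P by (simp only: sum_distrib_left[symmetric] sum.distrib sum_delta_l if_True)
  finally show ?thesis by (simp add: sum_divide_distrib)
qed

text \<open>The contraction of a four-index array with \<open>\<Sum>i. A i \<otimes> A i\<close>.\<close>

definition quart :: "(nat \<Rightarrow> nat \<Rightarrow> nat \<Rightarrow> real) \<Rightarrow> nat \<Rightarrow> nat \<Rightarrow> (nat \<Rightarrow> nat \<Rightarrow> nat \<Rightarrow> nat \<Rightarrow> real) \<Rightarrow> real" where
  "quart A l k F = (\<Sum>i\<in>{1..l}. \<Sum>a<k. \<Sum>b<k. \<Sum>c<k. \<Sum>d<k. A i a b * A i c d * F a b c d)"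

lemma mtrace_noise_coeff_noise_coeff:
  assumes P: "finite P" "p \<in> P" "q \<in> P"
  shows "mtrace (block_index k P) (mmult (block_index k P) (noise_coeff A (i,p,q)) (mmult (block_index k P) M (mmult (block_index k P) (noise_coeff A (i,p,q)) N)))
     = (\<Sum>a<k. \<Sum>b<k. \<Sum>c<k. \<Sum>d<k. A i a b * A i c d *
         ((M (b,q) (c,p) * N (d,q) (a,p) + M (b,q) (c,q) * N (d,p) (a,p)) +
          (M (b,p) (c,q) * N (d,p) (a,q) + M (b,p) (c,p) * N (d,q) (a,q)))) / 2"
proof -
  have MDN: "mmult (block_index k P) M (mmult (block_index k P) (noise_coeff A (i,p,q)) N) j h
     = (\<Sum>c<k. \<Sum>d<k. A i c d * (M j (c,p) * N (d,q) h + M j (c,q) * N (d,p) h)) / sqrt 2" for j h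
  proof -
    have "mmult (block_index k P) M (mmult (block_index k P) (noise_coeff A (i,p,q)) N) j h
     = (\<Sum>c<k. \<Sum>u\<in>P. \<Sum>d<k. (A i c d / sqrt 2) * (kdelta p u * (M j (c,u) * N (d,q) h) + kdelta q u * (M j (c,u) * N (d,p) h)))"
      unfolding mmult_def[of "block_index k P" M] sum_block_index mmult_noise_coeff[OF P]
      by (intro sum.cong refl) (simp add: sum_divide_distrib sum_distrib_left sum.distrib add_divide_distrib algebra_simps)
    also have "\<dots> = (\<Sum>c<k. \<Sum>d<k. \<Sum>u\<in>P. (A i c d / sqrt 2) * (kdelta p u * (M j (c,u) * N (d,q) h) + kdelta q u * (M j (c,u) * N (d,p) h)))"
      by (intro sum.cong refl sum.swap)
    also have "\<dots> = (\<Sum>c<k. \<Sum>d<k. (A i c d / sqrt 2) * (M j (c,p) * N (d,q) h + M j (c,q) * N (d,p) h))"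
      using P by (simp only: sum_distrib_left[symmetric] sum.distrib sum_delta_l if_True)
    finally show ?thesis by (simp add: sum_divide_distrib)
  qed
  define Z where "Z = (\<lambda>j h. \<Sum>c<k. \<Sum>d<k. A i c d * (M j (c,p) * N (d,q) h + M j (c,q) * N (d,p) h))"
  define W where "W = (\<lambda>a b c d. (M (b,q) (c,p) * N (d,q) (a,p) + M (b,q) (c,q) * N (d,p) (a,p)) +
          (M (b,p) (c,q) * N (d,p) (a,q) + M (b,p) (c,p) * N (d,q) (a,q)))"
  have ZW: "Z (b,q) (a,p) + Z (b,p) (a,q) = (\<Sum>c<k. \<Sum>d<k. A i c d * W a b c d)" for a b
    unfolding Z_def W_def sum.distrib[symmetric] distrib_left[symmetric] by (intro sum.cong refl) (simp only: add_ac)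
  have "(\<Sum>a<k. \<Sum>b<k. A i a b * (Z (b,q) (a,p) / sqrt 2 + Z (b,p) (a,q) / sqrt 2)) / sqrt 2
     = (\<Sum>a<k. \<Sum>b<k. A i a b * (Z (b,q) (a,p) + Z (b,p) (a,q))) / sqrt 2 / sqrt 2"
    by (simp only: add_divide_distrib[symmetric] times_divide_eq_right sum_divide_distrib[symmetric])
  also have "\<dots> = (\<Sum>a<k. \<Sum>b<k. A i a b * (Z (b,q) (a,p) + Z (b,p) (a,q))) / 2" by simp
  also have "\<dots> = (\<Sum>a<k. \<Sum>b<k. \<Sum>c<k. \<Sum>d<k. A i a b * A i c d * W a b c d) / 2"
    by (simp only: ZW sum_distrib_left mult.assoc)
  finally show ?thesis
    unfolding mtrace_noise_coeff[OF P] MDN W_def Z_def .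
qed

text \<open>Wick contraction: summing over a pair of equal noise variables produces a term in which the two partial traces
  factorize, and, because of the symmetrization, a crossed term in which they do not. Only the first one is of leading order.\<close>

lemma sum_noise_coeff_noise_coeff:
  assumes P: "finite P" and w: "\<And>p q. w p q = w q p"
  shows "(\<Sum>i\<in>{1..l}. \<Sum>p\<in>P. \<Sum>q\<in>P. w p q * mtrace (block_index k P) (mmult (block_index k P) (noise_coeff A (i,p,q)) (mmult (block_index k P) M (mmult (block_index k P) (noise_coeff A (i,p,q)) N))))
    = quart A l k (\<lambda>a b c d. \<Sum>p\<in>P. \<Sum>q\<in>P. w p q * (M (b,q) (c,q) * N (d,p) (a,p)))
    + quart A l k (\<lambda>a b c d. \<Sum>p\<in>P. \<Sum>q\<in>P. w p q * (M (b,q) (c,p) * N (d,q) (a,p)))"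
proof -
  define F where "F = (\<lambda>p q a b c d. M (b,q) (c,p) * N (d,q) (a,p) + M (b,q) (c,q) * N (d,p) (a,p))"
  have "(\<Sum>p\<in>P. \<Sum>q\<in>P. w p q * mtrace (block_index k P) (mmult (block_index k P) (noise_coeff A (i,p,q)) (mmult (block_index k P) M (mmult (block_index k P) (noise_coeff A (i,p,q)) N))))
    = (\<Sum>a<k. \<Sum>b<k. \<Sum>c<k. \<Sum>d<k. A i a b * A i c d * (\<Sum>p\<in>P. \<Sum>q\<in>P. w p q * F p q a b c d))" (is "?L = ?R") for i
  proof -
    define G where "G = (\<lambda>p q. \<Sum>a<k. \<Sum>b<k. \<Sum>c<k. \<Sum>d<k. A i a b * A i c d * F p q a b c d)"
    have "?L = (\<Sum>p\<in>P. \<Sum>q\<in>P. w p q * ((G p q + G q p) / 2))"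
    proof (intro sum.cong refl)
      fix p q assume pq: "p \<in> P" "q \<in> P"
      have "G p q + G q p = (\<Sum>a<k. \<Sum>b<k. \<Sum>c<k. \<Sum>d<k. A i a b * A i c d * (F p q a b c d + F q p a b c d))"
        by (simp only: G_def sum.distrib[symmetric] distrib_left[symmetric])
      then have "mtrace (block_index k P) (mmult (block_index k P) (noise_coeff A (i,p,q)) (mmult (block_index k P) M (mmult (block_index k P) (noise_coeff A (i,p,q)) N))) = (G p q + G q p) / 2"
        unfolding mtrace_noise_coeff_noise_coeff[OF P pq] by (simp only: F_def)
      then show "w p q * mtrace (block_index k P) (mmult (block_index k P) (noise_coeff A (i,p,q)) (mmult (block_index k P) M (mmult (block_index k P) (noise_coeff A (i,p,q)) N))) = w p q * ((G p q + G q p) / 2)"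
        by (simp only:)
    qed
    also have "\<dots> = ((\<Sum>p\<in>P. \<Sum>q\<in>P. w p q * G p q) + (\<Sum>p\<in>P. \<Sum>q\<in>P. w p q * G q p)) / 2"
      by (simp only: sum.distrib[symmetric] distrib_left[symmetric] times_divide_eq_right sum_divide_distrib[symmetric])
    also have "(\<Sum>p\<in>P. \<Sum>q\<in>P. w p q * G q p) = (\<Sum>p\<in>P. \<Sum>q\<in>P. w p q * G p q)"
      by (subst sum.swap) (simp add: w)
    also have "((\<Sum>p\<in>P. \<Sum>q\<in>P. w p q * G p q) + (\<Sum>p\<in>P. \<Sum>q\<in>P. w p q * G p q)) / 2 = (\<Sum>p\<in>P. \<Sum>q\<in>P. w p q * G p q)"
      by simp
    also have "\<dots> = (\<Sum>p\<in>P. \<Sum>q\<in>P. \<Sum>a<k. \<Sum>b<k. \<Sum>c<k. \<Sum>d<k. A i a b * A i c d * (w p q * F p q a b c d))"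
      unfolding G_def sum_distrib_left by (intro sum.cong refl) (simp only: mult_ac)
    also have "\<dots> = (\<Sum>a<k. \<Sum>b<k. \<Sum>c<k. \<Sum>d<k. \<Sum>p\<in>P. \<Sum>q\<in>P. A i a b * A i c d * (w p q * F p q a b c d))"
      by (subst sum_rotate3, rule sum.cong[OF refl], subst sum_rotate3, rule sum.cong[OF refl],
          subst sum_rotate3, rule sum.cong[OF refl], subst sum_rotate3, rule refl)
    also have "\<dots> = ?R" by (simp only: sum_distrib_left)
    finally show ?thesis .
  qed
  then have "(\<Sum>i\<in>{1..l}. \<Sum>p\<in>P. \<Sum>q\<in>P. w p q * mtrace (block_index k P) (mmult (block_index k P) (noise_coeff A (i,p,q)) (mmult (block_index k P) M (mmult (block_index k P) (noise_coeff A (i,p,q)) N))))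
    = quart A l k (\<lambda>a b c d. \<Sum>p\<in>P. \<Sum>q\<in>P. w p q * F p q a b c d)"
    by (simp only: quart_def)
  also have "\<dots> = quart A l k (\<lambda>a b c d. \<Sum>p\<in>P. \<Sum>q\<in>P. w p q * (M (b,q) (c,p) * N (d,q) (a,p)))
     + quart A l k (\<lambda>a b c d. \<Sum>p\<in>P. \<Sum>q\<in>P. w p q * (M (b,q) (c,q) * N (d,p) (a,p)))"
    by (simp only: quart_def F_def distrib_left sum.distrib)
  finally show ?thesis by (simp only: add.commute)
qed

definition hsA :: "nat \<Rightarrow> nat \<Rightarrow> (nat \<Rightarrow> nat \<Rightarrow> nat \<Rightarrow> real) \<Rightarrow> real" where
  "hsA k l A = (\<Sum>i\<in>{1..l}. \<Sum>a<k. \<Sum>b<k. (A i a b)^2)"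

lemma hsA_nonneg: "0 \<le> hsA k l A" by (simp add: hsA_def sum_nonneg)

lemma quart_bound:
  assumes F: "\<And>a b c d. a < k \<Longrightarrow> b < k \<Longrightarrow> c < k \<Longrightarrow> d < k \<Longrightarrow> \<bar>F a b c d\<bar> \<le> m"
    and m: "0 \<le> m"
  shows "\<bar>quart A l k F\<bar> \<le> (real k)^2 * hsA k l A * m"
proof -
  have 1: "(\<Sum>a<k. \<Sum>b<k. \<bar>A i a b\<bar>)^2 \<le> (real k)^2 * (\<Sum>a<k. \<Sum>b<k. (A i a b)^2)" for i
    using sum_squared_le_sum_of_squares[of "\<lambda>(a,b). \<bar>A i a b\<bar>" "{..<k} \<times> {..<k}"]
    by (simp add: sum.cartesian_product[symmetric] split_def power2_eq_square mult_ac)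
      (simp add: sum.cartesian_product split_def power2_eq_square)
  have "\<bar>quart A l k F\<bar> \<le> (\<Sum>i\<in>{1..l}. \<Sum>a<k. \<Sum>b<k. \<Sum>c<k. \<Sum>d<k. \<bar>A i a b\<bar> * \<bar>A i c d\<bar> * m)"
    unfolding quart_def
    by (intro order_trans[OF sum_abs] sum_mono) (auto simp: abs_mult intro!: mult_left_mono F)
  also have "\<dots> = (\<Sum>i\<in>{1..l}. (\<Sum>a<k. \<Sum>b<k. \<bar>A i a b\<bar>)^2 * m)"
  proof (rule sum.cong[OF refl])
    fix i
    define S where "S = (\<Sum>c<k. \<Sum>d<k. \<bar>A i c d\<bar>)"
    have "(\<Sum>a<k. \<Sum>b<k. \<Sum>c<k. \<Sum>d<k. \<bar>A i a b\<bar> * \<bar>A i c d\<bar> * m) = (\<Sum>a<k. \<Sum>b<k. \<bar>A i a b\<bar> * (S * m))"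
      unfolding S_def by (simp only: sum_distrib_left sum_distrib_right mult.assoc)
    also have "\<dots> = S * (S * m)" by (simp only: sum_distrib_right[symmetric] S_def[symmetric])
    finally show "(\<Sum>a<k. \<Sum>b<k. \<Sum>c<k. \<Sum>d<k. \<bar>A i a b\<bar> * \<bar>A i c d\<bar> * m) = (\<Sum>a<k. \<Sum>b<k. \<bar>A i a b\<bar>)^2 * m"
      by (simp add: S_def power2_eq_square)
  qed
  also have "\<dots> \<le> (\<Sum>i\<in>{1..l}. (real k)^2 * (\<Sum>a<k. \<Sum>b<k. (A i a b)^2) * m)"
    by (intro sum_mono mult_right_mono 1 m)
  also have "\<dots> = (real k)^2 * hsA k l A * m"
    by (simp add: hsA_def sum_distrib_left sum_distrib_right mult_ac)
  finally show ?thesis .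
qed

lemma bessel_noise_coeff:
  assumes P: "finite P" and s: "\<And>p q. p \<in> P \<Longrightarrow> q \<in> P \<Longrightarrow> (s p q)^2 \<le> b"
  shows "(\<Sum>e\<in>noise_index l P. (case e of (i,p,q) \<Rightarrow> s p q)^2 * (mtrace (block_index k P) (mmult (block_index k P) (noise_coeff A e) Y))^2)
     \<le> 2 * hsA k l A * b * hs_sq (block_index k P) Y"
proof -
  define T where "T = (\<lambda>i p q. \<Sum>a<k. \<Sum>c<k. A i a c * Y (c,q) (a,p))"
  define h where "h = (\<lambda>p q. \<Sum>a<k. \<Sum>c<k. (Y (c,q) (a,p))^2)"
  define n where "n = (\<lambda>i. \<Sum>a<k. \<Sum>c<k. (A i a c)^2)"
  have Th: "(T i p q)^2 \<le> n i * h p q" for i p q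
  proof -
    have "(\<Sum>x\<in>{..<k}\<times>{..<k}. (case x of (a,c) \<Rightarrow> A i a c) * (case x of (a,c) \<Rightarrow> Y (c,q) (a,p)))^2
      \<le> (\<Sum>x\<in>{..<k}\<times>{..<k}. (case x of (a,c) \<Rightarrow> A i a c)^2) * (\<Sum>x\<in>{..<k}\<times>{..<k}. (case x of (a,c) \<Rightarrow> Y (c,q) (a,p))^2)"
      by (rule Cauchy_Schwarz_ineq_sum)
    then show ?thesis
      by (simp add: T_def n_def h_def sum.cartesian_product split_def)
  qed
  have sh: "(\<Sum>p\<in>P. \<Sum>q\<in>P. h p q) = hs_sq (block_index k P) Y"
  proof -
    have "(\<Sum>p\<in>P. \<Sum>q\<in>P. h p q) = (\<Sum>a<k. \<Sum>p\<in>P. \<Sum>q\<in>P. \<Sum>c<k. (Y (c,q) (a,p))^2)"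
      unfolding h_def by (rule sum_rotate3)
    also have "\<dots> = (\<Sum>a<k. \<Sum>p\<in>P. \<Sum>c<k. \<Sum>q\<in>P. (Y (c,q) (a,p))^2)"
      by (intro sum.cong refl sum.swap)
    also have "\<dots> = hs_sq (block_index k P) Y" unfolding hs_sq_def by (subst (3) sum.swap) (simp only: sum_block_index)
    finally show ?thesis .
  qed
  have hn: "0 \<le> h p q" for p q by (simp add: h_def sum_nonneg)
  have nn: "0 \<le> n i" for i by (simp add: n_def sum_nonneg)
  have one: "(s p q)^2 * (mtrace (block_index k P) (mmult (block_index k P) (noise_coeff A (i,p,q)) Y))^2 \<le> b * (n i * (h p q + h q p))"
    if "p \<in> P" "q \<in> P" for i p q
  proof (rule mult_mono[OF s[OF that]])
    have "(mtrace (block_index k P) (mmult (block_index k P) (noise_coeff A (i,p,q)) Y))^2 = (T i p q + T i q p)^2 / 2"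
      by (simp add: mtrace_noise_coeff[OF P that] T_def power_divide distrib_left sum.distrib)
    also have "\<dots> \<le> (T i p q)^2 + (T i q p)^2"
      using sum_squares_bound[of "T i p q" "T i q p"] by (simp add: power2_sum)
    also have "\<dots> \<le> n i * (h p q + h q p)" using Th[of i p q] Th[of i q p] by (simp add: distrib_left)
    finally show "(mtrace (block_index k P) (mmult (block_index k P) (noise_coeff A (i,p,q)) Y))^2 \<le> n i * (h p q + h q p)" .
    show "0 \<le> b" using s[OF that] zero_le_power2[of "s p q"] by linarith
  qed simp
  have "(\<Sum>e\<in>noise_index l P. (case e of (i,p,q) \<Rightarrow> s p q)^2 * (mtrace (block_index k P) (mmult (block_index k P) (noise_coeff A e) Y))^2)
     \<le> (\<Sum>i\<in>{1..l}. \<Sum>p\<in>P. \<Sum>q\<in>P. b * (n i * (h p q + h q p)))"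
    unfolding sum_noise_index by (intro sum_mono) (use one in auto)
  also have "\<dots> = (\<Sum>i\<in>{1..l}. b * n i * ((\<Sum>p\<in>P. \<Sum>q\<in>P. h p q) + (\<Sum>p\<in>P. \<Sum>q\<in>P. h q p)))"
    by (simp add: sum_distrib_left sum.distrib distrib_left mult_ac)
  also have "(\<Sum>p\<in>P. \<Sum>q\<in>P. h q p) = (\<Sum>p\<in>P. \<Sum>q\<in>P. h p q)" by (rule sum.swap)
  also have "(\<Sum>i\<in>{1..l}. b * n i * ((\<Sum>p\<in>P. \<Sum>q\<in>P. h p q) + (\<Sum>p\<in>P. \<Sum>q\<in>P. h p q))) = 2 * hsA k l A * b * hs_sq (block_index k P) Y"
  proof -
    have "hsA k l A = (\<Sum>i\<in>{1..l}. n i)" by (simp add: hsA_def n_def)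
    then show ?thesis by (simp only: sh sum_distrib_left sum_distrib_right) (simp add: mult_ac)
  qed
  finally show ?thesis .
qed

section \<open>Changing the variances, and covariances of traces\<close>

context gaussians begin

lemma ex_scale_monomial: "ex (\<lambda>x. monomial E k (\<lambda>e. s e * x e)) = (\<Prod>e\<in>E. s e ^ k e * gauss_moment (k e))"
proof -
  have "(\<lambda>x. monomial E k (\<lambda>e. s e * x e)) = (\<lambda>x. (\<Prod>e\<in>E. s e ^ k e) * monomial E k x)"
    by (simp add: monomial_def power_mult_distrib prod.distrib)
  then show ?thesis by (simp add: ex_cmult ex_monom prod.distrib)
qed

lemma poly_scaleE: "polyfun E f \<Longrightarrow> polyfun E (\<lambda>x. f (\<lambda>e. s e * x e))"
  by (rule polyfun_subst) (auto intro: polyI)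

lemma ex_scale_continuous:
  assumes "polyfun E f" "\<And>e. e \<in> E \<Longrightarrow> continuous_on T (\<lambda>t. s t e)"
  shows "continuous_on T (\<lambda>t. ex (\<lambda>x. f (\<lambda>e. s t e * x e)))"
  using finE assms(1)
proof (induction rule: polyfun_monom_induct)
  case (monom k)
  then show ?case unfolding ex_scale_monomial using assms(2) by (intro continuous_intros)
next
  case (scale c f)
  then show ?case by (simp add: ex_cmult continuous_intros)
next
  case (add f h)
  then show ?case by (simp add: ex_add poly_scaleE continuous_intros)
qed

text \<open>The heat equation for Gaussian expectations: changing the variances \<open>(s e)\<^sup>2\<close> differentiates twice in the variables.\<close>

lemma ex_scale_DERIV:
  assumes "polyfun E f" and s: "\<And>e. e \<in> E \<Longrightarrow> ((\<lambda>t. s t e) has_real_derivative s' e) (at t)"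
  shows "((\<lambda>t. ex (\<lambda>x. f (\<lambda>e. s t e * x e))) has_real_derivative
    (\<Sum>e\<in>E. s' e * s t e * ex (\<lambda>x. partial e (partial e f) (\<lambda>e. s t e * x e)))) (at t)"
  using finE assms(1)
proof (induction rule: polyfun_monom_induct)
  case (monom k)
  have D: "((\<lambda>t. \<Prod>e\<in>E. s t e ^ k e * gauss_moment (k e)) has_real_derivative
      (\<Sum>e\<in>E. (real (k e) * s t e ^ (k e - 1) * s' e * gauss_moment (k e)) * (\<Prod>b\<in>E-{e}. s t b ^ k b * gauss_moment (k b)))) (at t)"
  proof (rule has_field_derivative_prod)
    fix e assume "e \<in> E"
    show "((\<lambda>t. s t e ^ k e * gauss_moment (k e)) has_real_derivative real (k e) * s t e ^ (k e - 1) * s' e * gauss_moment (k e)) (at t)"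
      by (auto intro!: derivative_eq_intros s[OF \<open>e \<in> E\<close>])
  qed
  have eq: "(real (k e) * s t e ^ (k e - 1) * s' e * gauss_moment (k e)) * (\<Prod>b\<in>E-{e}. s t b ^ k b * gauss_moment (k b))
      = s' e * s t e * ex (\<lambda>x. partial e (partial e (monomial E k)) (\<lambda>e. s t e * x e))" if e: "e \<in> E" for e
  proof -
    have pp: "partial e (partial e (monomial E k)) = (\<lambda>x. real (k e) * (real (k e - 1) * monomial E (k(e := k e - 2)) x))"
    proof -
      have "partial e (partial e (monomial E k)) = (\<lambda>x. real (k e) * partial e (monomial E (k(e := k e - 1))) x)"
        unfolding partial_monom[OF finE e] partial_cmult[OF polyfun_monom] ..
      then show ?thesis unfolding partial_monom[OF finE e] by (simp add: numeral_2_eq_2)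
    qed
    have "ex (\<lambda>x. monomial E (k(e := k e - 2)) (\<lambda>e. s t e * x e))
       = s t e ^ (k e - 2) * gauss_moment (k e - 2) * (\<Prod>b\<in>E-{e}. s t b ^ k b * gauss_moment (k b))"
      unfolding ex_scale_monomial prod.remove[OF finE e] by simp
    then have m1: "s' e * s t e * ex (\<lambda>x. partial e (partial e (monomial E k)) (\<lambda>e. s t e * x e))
       = s' e * s t e * (real (k e) * (real (k e - 1) * (s t e ^ (k e - 2) * gauss_moment (k e - 2) * (\<Prod>b\<in>E-{e}. s t b ^ k b * gauss_moment (k b)))))"
      by (simp only: pp ex_cmult)
    have m2: "real (k e) * s t e ^ (k e - 1) * gauss_moment (k e) = s t e * (real (k e) * (real (k e - 1) * (s t e ^ (k e - 2) * gauss_moment (k e - 2))))"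
    proof (cases "k e")
      case (Suc m)
      show ?thesis unfolding Suc by (cases m) auto
    qed simp
    have "(real (k e) * s t e ^ (k e - 1) * s' e * gauss_moment (k e)) * (\<Prod>b\<in>E-{e}. s t b ^ k b * gauss_moment (k b))
       = s' e * (real (k e) * s t e ^ (k e - 1) * gauss_moment (k e)) * (\<Prod>b\<in>E-{e}. s t b ^ k b * gauss_moment (k b))"
      by (simp only: mult_ac)
    also have "\<dots> = s' e * s t e * (real (k e) * (real (k e - 1) * (s t e ^ (k e - 2) * gauss_moment (k e - 2) * (\<Prod>b\<in>E-{e}. s t b ^ k b * gauss_moment (k b)))))"
      unfolding m2 by (simp only: mult_ac)
    finally show ?thesis unfolding m1 .
  qed
  have S: "(\<Sum>e\<in>E. (real (k e) * s t e ^ (k e - 1) * s' e * gauss_moment (k e)) * (\<Prod>b\<in>E-{e}. s t b ^ k b * gauss_moment (k b)))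
     = (\<Sum>e\<in>E. s' e * s t e * ex (\<lambda>x. partial e (partial e (monomial E k)) (\<lambda>e. s t e * x e)))"
    by (intro sum.cong refl eq)
  show ?case unfolding ex_scale_monomial S[symmetric] by (rule D)
next
  case (scale c f)
  have "partial e (partial e (\<lambda>x. c * f x)) = (\<lambda>x. c * partial e (partial e f) x)" for e
    unfolding partial_cmult[OF scale.hyps(1)] partial_cmult[OF polyfun_partial[OF scale.hyps(1)]] ..
  then show ?case using DERIV_cmult[OF scale.IH, of c] by (simp add: ex_cmult sum_distrib_left mult_ac)
next
  case (add f h)
  have "partial e (partial e (\<lambda>x. f x + h x)) = (\<lambda>x. partial e (partial e f) x + partial e (partial e h) x)" for e
    unfolding partial_add[OF add.hyps] partial_add[OF polyfun_partial[OF add.hyps(1)] polyfun_partial[OF add.hyps(2)]] ..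
  then show ?case using DERIV_add[OF add.IH] add.hyps
    by (simp add: ex_add poly_scaleE polyfun_partial sum.distrib distrib_left)
qed

end

context gmatm begin

lemma var_mtrace_norm_scale:
  assumes p: "p \<ge> 2" and small: "16 * \<kappa> * (real p)^2 \<le> 1" and a: "a \<le> 2*p"
  shows "var (\<lambda>x. mtrace I (mmult I C (mpow I (X x) a))) \<le> \<kappa> * (real a)^2 * hs_sq I C * (2 * norm_scale p ^ (2*a-2))"
  using var_mtrace_le[OF majorant_props(3)[OF p small], of a "2*a-2" C] majorant_props(5)[OF p small, of "2*a-2"] a
  by (simp add: majorant_props(4)[OF p small])

text \<open>The covariance is bounded by the two variances, weighted so that the scales of the different powers balance to that of
  \<open>V p\<close>.\<close>

lemma cov_mtrace_le:
  assumes p: "p \<ge> 2" and small: "16 * \<kappa> * (real p)^2 \<le> 1" and ab: "a + b = 2*p-2"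
    and C: "hs_sq I C \<le> J" "hs_sq I C' \<le> J"
  shows "\<bar>avg (\<lambda>x. mtrace I (mmult I C (mpow I (X x) a)) * mtrace I (mmult I C' (mpow I (X x) b)))
     - avg (\<lambda>x. mtrace I (mmult I C (mpow I (X x) a))) * avg (\<lambda>x. mtrace I (mmult I C' (mpow I (X x) b)))\<bar>
     \<le> 8 * \<kappa> * (real p)^2 * J * avg (V p)"
proof -
  define L where "L = norm_scale p"
  have L1: "1 \<le> L" using majorant_props(1)[OF p small] by (simp add: L_def)
  have J0: "0 \<le> J" using C(1) hs_nonneg[of I C] by linarith
  define t where "t = L ^ b / L ^ a"
  have t0: "t > 0" using L1 by (simp add: t_def)
  let ?f = "\<lambda>x. mtrace I (mmult I C (mpow I (X x) a))" and ?h = "\<lambda>x. mtrace I (mmult I C' (mpow I (X x) b))"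
  have pf: "polyfun E ?f" "polyfun E ?h" by (intro poly_mat)+
  have key: "u * (2 * L ^ (2*c-2)) * (L ^ d / L ^ c) \<le> u * (2 * L ^ (2*p))"
    if "c + d = 2*p-2" "u \<ge> 0" "c = 0 \<Longrightarrow> u = 0" for u c d
  proof (cases "c = 0")
    case False
    have "L ^ (2*c-2) * (L ^ d / L ^ c) = L ^ (2*c-2+d) / L ^ c" by (simp add: power_add)
    also have "2*c-2+d = c + (2*p-4)" using that(1) False p by linarith
    also have "L ^ (c + (2*p-4)) / L ^ c = L ^ (2*p-4)" using L1 by (simp add: power_add)
    also have "\<dots> \<le> L ^ (2*p)" using L1 by (intro power_increasing) auto
    finally have "L ^ (2*c-2) * (L ^ d / L ^ c) \<le> L ^ (2*p)" .
    then have "(2 * u) * (L ^ (2*c-2) * (L ^ d / L ^ c)) \<le> (2 * u) * L ^ (2*p)"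
      using that(2) by (intro mult_left_mono) auto
    then show ?thesis by (simp add: mult_ac)
  qed (use that in simp)
  have v1: "var ?f \<le> (\<kappa> * (real a)^2 * J) * (2 * L ^ (2*a-2))"
    by (rule order_trans[OF var_mtrace_norm_scale[OF p small, folded L_def]])
      (use ab in simp, intro mult_right_mono mult_left_mono, use ab C(1) kappa_nonneg L1 in auto)
  have v2: "var ?h \<le> (\<kappa> * (real b)^2 * J) * (2 * L ^ (2*b-2))"
    by (rule order_trans[OF var_mtrace_norm_scale[OF p small, folded L_def]])
      (use ab in simp, intro mult_right_mono mult_left_mono, use ab C(2) kappa_nonneg L1 in auto)
  have "t * var ?f \<le> t * ((\<kappa> * (real a)^2 * J) * (2 * L ^ (2*a-2)))"
    using v1 t0 by (intro mult_left_mono) auto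
  also have "\<dots> \<le> (\<kappa> * (real a)^2 * J) * (2 * L ^ (2*p))"
    using key[of a b "\<kappa> * (real a)^2 * J"] ab kappa_nonneg J0 by (simp add: t_def mult_ac)
  finally have w1: "t * var ?f \<le> (\<kappa> * (real a)^2 * J) * (2 * L ^ (2*p))" .
  have "var ?h / t \<le> (\<kappa> * (real b)^2 * J) * (2 * L ^ (2*b-2)) / t"
    using v2 t0 by (intro divide_right_mono) auto
  also have "\<dots> = (\<kappa> * (real b)^2 * J) * (2 * L ^ (2*b-2)) * (L ^ a / L ^ b)" by (simp add: t_def)
  also have "\<dots> \<le> (\<kappa> * (real b)^2 * J) * (2 * L ^ (2*p))"
    using key[of b a "\<kappa> * (real b)^2 * J"] ab kappa_nonneg J0 by (simp add: add.commute)
  finally have w2: "var ?h / t \<le> (\<kappa> * (real b)^2 * J) * (2 * L ^ (2*p))" .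
  have L2p: "L ^ (2*p) \<le> 2 * avg (V p)"
  proof (rule power2_le_imp_le)
    have "(L ^ (2*p))^2 = L ^ (4*p)" by (simp add: power_mult[symmetric])
    also have "\<dots> \<le> 2 * (avg (V p))^2" using majorant_props(2)[OF p small] EVV_bounds(2)[OF p small] by (simp add: L_def)
    also have "\<dots> \<le> (2 * avg (V p))^2" by (simp add: power_mult_distrib)
    finally show "(L ^ (2*p))^2 \<le> (2 * avg (V p))^2" .
    show "0 \<le> 2 * avg (V p)" using trace_moment_ge(2)[OF p] by simp
  qed
  have "(real a)^2 + (real b)^2 \<le> (real a + real b)^2" by (simp add: power2_sum)
  also have "\<dots> \<le> (2 * real p)^2" using ab by (intro power_mono) auto
  finally have ab2: "(real a)^2 + (real b)^2 \<le> 4 * (real p)^2" by (simp add: power_mult_distrib)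
  have "\<bar>avg (\<lambda>x. ?f x * ?h x) - avg ?f * avg ?h\<bar> \<le> (t * var ?f + var ?h / t) / 2"
    by (rule cov_le[OF pf t0])
  also have "\<dots> \<le> ((\<kappa> * (real a)^2 * J) * (2 * L ^ (2*p)) + (\<kappa> * (real b)^2 * J) * (2 * L ^ (2*p))) / 2"
    using w1 w2 by (intro divide_right_mono add_mono) auto
  also have "\<dots> = (\<kappa> * J * L ^ (2*p)) * ((real a)^2 + (real b)^2)" by (simp add: algebra_simps)
  also have "\<dots> \<le> (\<kappa> * J * L ^ (2*p)) * (4 * (real p)^2)"
    using ab2 kappa_nonneg J0 L1 by (intro mult_left_mono) auto
  also have "\<dots> = (4 * \<kappa> * J * (real p)^2) * L ^ (2*p)" by (simp add: mult_ac)
  also have "\<dots> \<le> (4 * \<kappa> * J * (real p)^2) * (2 * avg (V p))"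
    using L2p kappa_nonneg J0 by (intro mult_left_mono) auto
  finally show ?thesis by (simp add: mult_ac)
qed

end

lemma bij_mmult_reindex:
  assumes h: "bij_betw h I I'" and e: "\<And>l. l \<in> I \<Longrightarrow> X' (h i) (h l) = X i l" "\<And>l. l \<in> I \<Longrightarrow> Y' (h l) (h j) = Y l j"
  shows "mmult I' X' Y' (h i) (h j) = mmult I X Y i j"
  unfolding mmult_def using sum.reindex_bij_betw[OF h, of "\<lambda>l. X' (h i) l * Y' l (h j)"] e by simp

lemma mpow_reindex:
  assumes h: "bij_betw h I I'" and e: "\<And>i j. i \<in> I \<Longrightarrow> j \<in> I \<Longrightarrow> X' (h i) (h j) = X i j"
    and ij: "i \<in> I" "j \<in> I"
  shows "mpow I' X' r (h i) (h j) = mpow I X r i j"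
  using ij(1)
proof (induction r arbitrary: i)
  case 0
  then show ?case using h ij by (auto simp: kdelta_def bij_betw_def inj_on_def)
next
  case (Suc r)
  then show ?case using e ij unfolding mpow.simps by (intro bij_mmult_reindex[OF h]) auto
qed

section \<open>The model and its invariance under relabelling\<close>

text \<open>The matrices \<open>A 1, ..., A l\<close> and the deterministic part \<open>B\<close>, of fixed size \<open>k\<close>.\<close>

locale model =
  fixes k l :: nat and A :: "nat \<Rightarrow> nat \<Rightarrow> nat \<Rightarrow> real" and B :: "nat \<Rightarrow> nat \<Rightarrow> real"
  assumes k1: "k \<ge> 1"
    and symA: "\<And>i a b. i \<in> {1..l} \<Longrightarrow> a < k \<Longrightarrow> b < k \<Longrightarrow> A i a b = A i b a"
    and symB: "\<And>a b. a < k \<Longrightarrow> b < k \<Longrightarrow> B a b = B b a"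
begin

abbreviation "XX P \<equiv> gauss_mat l A B P"

definition entry_scale :: "('p \<Rightarrow> 'p \<Rightarrow> real) \<Rightarrow> nat \<times> 'p \<times> 'p \<Rightarrow> real" where
  "entry_scale s = (\<lambda>(i,p,q). s p q)"

lemma polyXm: "polyfun (noise_index l P) (\<lambda>x. XX P x i j)"
proof -
  obtain a u b v where ij: "i = (a,u)" "j = (b,v)" by (cases i, cases j) auto
  show ?thesis
  proof (cases "u \<in> P \<and> v \<in> P")
    case True
    then show ?thesis unfolding ij gauss_mat_simp
      by (auto intro!: polyfun.add polyfun.const polyfun_sum polyfun_cmult polyfun_divide polyfun.var simp: noise_index_def)
  next
    case False
    then show ?thesis unfolding ij gauss_mat_simp by (auto intro: polyfun.const)
  qed
qed

lemma pdXm: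
  assumes e: "e \<in> noise_index l P"
  shows "partial e (\<lambda>x. XX P x i j) = (\<lambda>_. noise_coeff A e i j)"
proof -
  obtain a u b v where ij: "i = (a,u)" "j = (b,v)" by (cases i, cases j) auto
  obtain m p q where e': "e = (m,p,q)" by (cases e) auto
  with e have m: "m \<in> {1..l}" and pq: "p \<in> P" "q \<in> P" by (auto simp: noise_index_def)
  show ?thesis
  proof (cases "u \<in> P \<and> v \<in> P")
    case True
    have D: "((\<lambda>y. (\<Sum>i\<in>{1..l}. A i a b * (((x(e := y)) (i,u,v) + (x(e := y)) (i,v,u)) / sqrt 2))) has_real_derivative
       (\<Sum>i\<in>{1..l}. A i a b * (((if (i,u,v) = e then 1 else 0) + (if (i,v,u) = e then 1 else 0)) / sqrt 2))) (at (x e))" for x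
    proof (intro DERIV_sum DERIV_cmult DERIV_cdivide DERIV_add)
      show "((\<lambda>y. (x(e := y)) c) has_real_derivative (if c = e then 1 else 0)) (at (x e))" for c
        by (cases "c = e") auto
      then show "((\<lambda>y. (x(e := y)) c) has_real_derivative (if c = e then 1 else 0)) (at (x e))" for c .
    qed
    have S: "(\<Sum>i\<in>{1..l}. A i a b * (((if (i,u,v) = e then 1 else 0) + (if (i,v,u) = e then 1 else 0)) / sqrt 2))
       = noise_coeff A e i j"
    proof -
      have "(\<Sum>i\<in>{1..l}. A i a b * (((if (i,u,v) = e then 1 else 0) + (if (i,v,u) = e then 1 else 0)) / sqrt 2))
        = (\<Sum>i\<in>{1..l}. if i = m then A m a b * (kdelta u p * kdelta v q + kdelta u q * kdelta v p) / sqrt 2 else 0)"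
      proof (rule sum.cong[OF refl])
        fix i
        have c1: "(if (i,u,v) = e then 1 else 0) = (if i = m then kdelta u p * kdelta v q else (0::real))"
          by (simp add: e' kdelta_def)
        have c2: "(if (i,v,u) = e then 1 else 0) = (if i = m then kdelta u q * kdelta v p else (0::real))"
          by (simp add: e' kdelta_def)
        show "A i a b * (((if (i,u,v) = e then 1 else 0) + (if (i,v,u) = e then 1 else 0)) / sqrt 2)
          = (if i = m then A m a b * (kdelta u p * kdelta v q + kdelta u q * kdelta v p) / sqrt 2 else 0)"
          unfolding c1 c2 by simp
      qed
      also have "\<dots> = noise_coeff A e i j" using m by (simp add: e' ij noise_coeff_simp)
      finally show ?thesis .
    qed
    show ?thesis
    proof (rule ext, rule pdI)
      fix x
      have "((\<lambda>y. B a b * kdelta u v + (\<Sum>i\<in>{1..l}. A i a b * (((x(e := y)) (i,u,v) + (x(e := y)) (i,v,u)) / sqrt 2))) has_real_derivative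
         0 + noise_coeff A e i j) (at (x e))"
        using D[of x] unfolding S by (intro DERIV_add DERIV_const)
      then show "((\<lambda>y. XX P (x(e := y)) i j) has_real_derivative noise_coeff A e i j) (at (x e))"
        using True by (simp only: ij gauss_mat_simp if_True simp_thms add_0)
    qed
  next
    case False
    then have "(\<lambda>x. XX P x i j) = (\<lambda>_. 0)" by (auto simp: ij gauss_mat_simp)
    moreover have "noise_coeff A e i j = 0" using False pq by (auto simp: ij e' noise_coeff_simp kdelta_def)
    ultimately show ?thesis by simp
  qed
qed

lemma symXm: "symm (block_index k P) (XX P x)"
  unfolding symm_def block_index_def using symA symB by (auto simp: gauss_mat_simp kdelta_def add.commute intro!: sum.cong)

lemma affmat_model:
  assumes "finite P" "P \<noteq> {}"
  shows "affmat (noise_index l P) (block_index k P) (XX P) (noise_coeff A)"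
  by unfold_locales (use assms k1 in \<open>auto simp: finite_block_index symXm polyXm pdXm\<close>, auto simp: block_index_def lessThan_empty_iff)

definition bessel_const :: "real \<Rightarrow> real" where "bessel_const b = 2 * hsA k l A * b"

lemma gmat_model:
  assumes g: "gaussian_family M g (noise_index l P)" and P: "finite P" "P \<noteq> {}"
    and s: "\<And>p q. p \<in> P \<Longrightarrow> q \<in> P \<Longrightarrow> (s p q)^2 \<le> b"
  shows "gmat M g (noise_index l P) (block_index k P) (XX P) (noise_coeff A) (entry_scale s) (bessel_const b)"
proof -
  interpret affmat "noise_index l P" "block_index k P" "XX P" "noise_coeff A" by (rule affmat_model[OF P])
  interpret prob_space M using g by (simp add: gaussian_family_def)
  show ?thesis
  proof unfold_locales
    show "gaussian_family M g (noise_index l P)" by fact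
    show "(\<Sum>e\<in>noise_index l P. (entry_scale s e)^2 * (mtrace (block_index k P) (mmult (block_index k P) (noise_coeff A e) Y))^2) \<le> bessel_const b * hs_sq (block_index k P) Y" for Y
      using bessel_noise_coeff[OF P(1) s, where l=l and k=k and A=A and Y=Y] by (simp add: entry_scale_def bessel_const_def split_def)
  qed
qed

lemma gmatm_model:
  assumes trB: "real k \<le> (\<Sum>a<k. B a a)"
    and g: "gaussian_family M g (noise_index l P)" and P: "finite P" "P \<noteq> {}"
    and s: "\<And>p q. p \<in> P \<Longrightarrow> q \<in> P \<Longrightarrow> (s p q)^2 \<le> b"
  shows "gmatm M g (noise_index l P) (block_index k P) (XX P) (noise_coeff A) (entry_scale s) (bessel_const b)"
proof -
  interpret gmat M g "noise_index l P" "block_index k P" "XX P" "noise_coeff A" "entry_scale s" "bessel_const b" by (rule gmat_model[OF g P s])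
  show ?thesis
  proof
    have e0: "avg (\<lambda>x. x e) = 0" if "e \<in> noise_index l P" for e
      using ibp[OF polyfun.const[of "noise_index l P" 1] that] by (simp add: avg_ex ex_cmult)
    have "avg (\<lambda>x. XX P x (a,u) (a,u)) = B a a" if "u \<in> P" for a u
    proof -
      have p: "polyfun (noise_index l P) (\<lambda>x. A i a a * ((x (i,u,u) + x (i,u,u)) / sqrt 2))" if "i \<in> {1..l}" for i
        using that \<open>u \<in> P\<close> by (intro polyfun_cmult polyfun_divide polyfun.add polyfun.var) (auto simp: noise_index_def)
      have z: "avg (\<lambda>x. A i a a * ((x (i,u,u) + x (i,u,u)) / sqrt 2)) = 0" if "i \<in> {1..l}" for i
      proof -
        have "avg (\<lambda>x. A i a a * ((x (i,u,u) + x (i,u,u)) / sqrt 2)) = avg (\<lambda>x. (A i a a * (2 / sqrt 2)) * x (i,u,u))" by (simp add: mult.assoc)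
        also have "\<dots> = 0" using e0[of "(i,u,u)"] that \<open>u \<in> P\<close> unfolding avg_cmult by (simp add: noise_index_def)
        finally show ?thesis .
      qed
      have "avg (\<lambda>x. XX P x (a,u) (a,u)) = avg (\<lambda>x. B a a + (\<Sum>i\<in>{1..l}. A i a a * ((x (i,u,u) + x (i,u,u)) / sqrt 2)))"
        using that by (simp add: gauss_mat_simp kdelta_def)
      also have "\<dots> = B a a + (\<Sum>i\<in>{1..l}. avg (\<lambda>x. A i a a * ((x (i,u,u) + x (i,u,u)) / sqrt 2)))"
        using p by (simp only: avg_add[OF polyfun.const polyfun_sum] avg_const avg_sum)
      finally show ?thesis using z by simp
    qed
    then have "avg (\<lambda>x. mtrace (block_index k P) (XX P x)) = (\<Sum>a<k. \<Sum>u\<in>P. B a a)"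
      unfolding mtrace_def sum_block_index by (subst avg_sum, intro polyfun_sum polyXm, subst avg_sum) (auto intro: polyXm)
    also have "\<dots> = real (card P) * (\<Sum>a<k. B a a)" by (simp add: sum_distrib_left)
    also have "\<dots> \<ge> real (card P) * real k" by (intro mult_left_mono trB) auto
    finally show "real (card (block_index k P)) \<le> avg (\<lambda>x. mtrace (block_index k P) (XX P x))"
      by (simp add: card_block_index mult.commute)
  qed
qed

definition relabel :: "('p \<Rightarrow> 'q) \<Rightarrow> nat \<times> 'p \<times> 'p \<Rightarrow> nat \<times> 'q \<times> 'q" where
  "relabel \<pi> = (\<lambda>(i,p,q). (i, \<pi> p, \<pi> q))"

definition moment_entry :: "'w measure \<Rightarrow> (nat \<times> 'p \<times> 'p \<Rightarrow> 'w \<Rightarrow> real) \<Rightarrow> 'p set \<Rightarrow> ('p \<Rightarrow> 'p \<Rightarrow> real) \<Rightarrow> nat \<Rightarrow> nat \<times> 'p \<Rightarrow> nat \<times> 'p \<Rightarrow> real" where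
  "moment_entry M g P s r i j = integral\<^sup>L M (\<lambda>\<omega>. mpow (block_index k P) (XX P (\<lambda>e. entry_scale s e * g e \<omega>)) r i j)"

lemma gauss_mat_relabel:
  assumes "\<pi> ` P \<subseteq> P'" "inj_on \<pi> P" "u \<in> P" "v \<in> P"
  shows "XX P' x (a, \<pi> u) (b, \<pi> v) = XX P (\<lambda>e. x (relabel \<pi> e)) (a,u) (b,v)"
proof -
  have "kdelta (\<pi> u) (\<pi> v) = kdelta u v" using assms by (auto simp: kdelta_def inj_on_def)
  then show ?thesis using assms by (auto simp: gauss_mat_simp relabel_def)
qed

lemma gaussian_family_relabel:
  assumes "gaussian_family M g (noise_index l P')" "inj_on \<pi> P" "\<pi> ` P \<subseteq> P'"
  shows "gaussian_family M (\<lambda>e. g (relabel \<pi> e)) (noise_index l P)"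
  by (rule gaussian_family_inj[OF assms(1)])
    (use assms(2,3) in \<open>auto simp: inj_on_def relabel_def noise_index_def\<close>)

lemma poly_moment_entry: "finite P \<Longrightarrow> P \<noteq> {} \<Longrightarrow> polyfun (noise_index l P) (\<lambda>x. mpow (block_index k P) (XX P (\<lambda>e. entry_scale s e * x e)) r i j)"
  by (rule polyfun_subst[OF affmat.poly_mpow[OF affmat_model]]) (auto intro: polyI)

text \<open>Invariance under relabelling of the positions that preserves the variance profile.\<close>

lemma moment_entry_law:
  assumes g: "gaussian_family M g (noise_index l P)" "gaussian_family M' g' (noise_index l P')"
    and \<pi>: "bij_betw \<pi> P P'" and s: "\<And>p q. p \<in> P \<Longrightarrow> q \<in> P \<Longrightarrow> s' (\<pi> p) (\<pi> q) = s p q"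
    and P: "finite P" "P \<noteq> {}" and uv: "a < k" "b < k" "u \<in> P" "v \<in> P"
  shows "moment_entry M' g' P' s' r (a, \<pi> u) (b, \<pi> v) = moment_entry M g P s r (a,u) (b,v)"
proof -
  have inj: "inj_on \<pi> P" "\<pi> ` P \<subseteq> P'" using \<pi> by (auto simp: bij_betw_def)
  let ?h = "\<lambda>(a,u). (a, \<pi> u)"
  have h: "bij_betw ?h (block_index k P) (block_index k P')"
    using \<pi> by (auto simp: block_index_def bij_betw_def inj_on_def)
  note G = gaussian_family_relabel[OF g(2) inj]
  have "mpow (block_index k P') (XX P' (\<lambda>e. entry_scale s' e * g' e \<omega>)) r (a, \<pi> u) (b, \<pi> v)
     = mpow (block_index k P) (XX P (\<lambda>e. entry_scale s e * g' (relabel \<pi> e) \<omega>)) r (a,u) (b,v)" for \<omega>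
  proof -
    have "mpow (block_index k P') (XX P' (\<lambda>e. entry_scale s' e * g' e \<omega>)) r (?h (a,u)) (?h (b,v))
      = mpow (block_index k P) (XX P (\<lambda>e. entry_scale s e * g' (relabel \<pi> e) \<omega>)) r (a,u) (b,v)"
    proof (rule mpow_reindex[OF h])
      fix i j assume ij: "i \<in> block_index k P" "j \<in> block_index k P"
      obtain a u b v where ij': "i = (a,u)" "j = (b,v)" by (cases i, cases j) auto
      have uv: "u \<in> P" "v \<in> P" using ij by (auto simp: ij' block_index_def)
      have "XX P' (\<lambda>e. entry_scale s' e * g' e \<omega>) (a, \<pi> u) (b, \<pi> v) = XX P (\<lambda>e. entry_scale s' (relabel \<pi> e) * g' (relabel \<pi> e) \<omega>) (a,u) (b,v)"
        by (rule gauss_mat_relabel) (use inj uv in auto)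
      also have "\<dots> = XX P (\<lambda>e. entry_scale s e * g' (relabel \<pi> e) \<omega>) (a,u) (b,v)"
        using uv s by (simp add: gauss_mat_simp relabel_def entry_scale_def)
      finally show "XX P' (\<lambda>e. entry_scale s' e * g' e \<omega>) (?h i) (?h j) = XX P (\<lambda>e. entry_scale s e * g' (relabel \<pi> e) \<omega>) i j"
        by (simp add: ij')
    qed (use uv in \<open>auto simp: block_index_def\<close>)
    then show ?thesis by simp
  qed
  then have "moment_entry M' g' P' s' r (a, \<pi> u) (b, \<pi> v) = integral\<^sup>L M' (\<lambda>\<omega>. mpow (block_index k P) (XX P (\<lambda>e. entry_scale s e * g' (relabel \<pi> e) \<omega>)) r (a,u) (b,v))"
    by (simp add: moment_entry_def)
  also have "\<dots> = moment_entry M g P s r (a,u) (b,v)"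
    unfolding moment_entry_def by (rule gaussian_family_expectation_eq(2)[OF G g(1) poly_moment_entry[OF P]])
  finally show ?thesis .
qed

end

section \<open>Interpolation between independent copies and one large matrix\<close>

text \<open>The matrix whose trace against \<open>Y\<close> is the partial trace over the positions in \<open>J\<close> of the block \<open>(b, c)\<close> of \<open>Y\<close>.\<close>

definition block_unit :: "nat \<Rightarrow> nat \<Rightarrow> 'p set \<Rightarrow> nat \<times> 'p \<Rightarrow> nat \<times> 'p \<Rightarrow> real" where
  "block_unit b c J = (\<lambda>(c',u) (b',v). kdelta c c' * (kdelta b b' * (kdelta u v * (if u \<in> J then 1 else 0))))"

lemma mtrace_block_unit:
  assumes P: "finite P" "J \<subseteq> P" and bc: "b < k" "c < k"
  shows "mtrace (block_index k P) (mmult (block_index k P) (block_unit b c J) Y) = (\<Sum>u\<in>J. Y (b,u) (c,u))"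
proof -
  have "mmult (block_index k P) (block_unit b c J) Y (c',u) h = kdelta c c' * ((if u \<in> J then 1 else 0) * Y (b,u) h)" if "u \<in> P" for c' u h
  proof -
    have "mmult (block_index k P) (block_unit b c J) Y (c',u) h
      = (\<Sum>b'<k. \<Sum>v\<in>P. kdelta c c' * (kdelta b b' * (kdelta u v * ((if u \<in> J then 1 else 0) * Y (b',v) h))))"
      unfolding mmult_def sum_block_index by (intro sum.cong refl) (simp add: block_unit_def)
    also have "\<dots> = kdelta c c' * ((if u \<in> J then 1 else 0) * Y (b,u) h)"
      using P that bc by (simp only: sum_distrib_left[symmetric] sum_delta_l if_True finite_lessThan lessThan_iff)
    finally show ?thesis .
  qed
  then have "mtrace (block_index k P) (mmult (block_index k P) (block_unit b c J) Y) = (\<Sum>c'<k. \<Sum>u\<in>P. kdelta c c' * ((if u \<in> J then 1 else 0) * Y (b,u) (c',u)))"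
    unfolding mtrace_def sum_block_index by (intro sum.cong refl) auto
  also have "\<dots> = (\<Sum>u\<in>P. (if u \<in> J then 1 else 0) * Y (b,u) (c,u))"
    using bc by (simp only: sum_distrib_left[symmetric] sum_delta_l if_True finite_lessThan lessThan_iff)
  also have "\<dots> = (\<Sum>u\<in>J. Y (b,u) (c,u))"
    using P by (intro sum.mono_neutral_cong_right) auto
  finally show ?thesis .
qed

lemma hs_block_unit:
  assumes P: "finite P" "J \<subseteq> P" and bc: "b < k" "c < k"
  shows "hs_sq (block_index k P) (block_unit b c J) = real (card J)"
proof -
  have i2: "(kdelta x y)^2 = kdelta x y" for x y :: 'b by (simp add: kdelta_def)
  have i3: "(kdelta x y)^2 = kdelta x y" for x y :: nat by (simp add: kdelta_def)
  have "hs_sq (block_index k P) (block_unit b c J)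
      = (\<Sum>c'<k. \<Sum>u\<in>P. \<Sum>b'<k. \<Sum>v\<in>P. kdelta c c' * (kdelta b b' * (kdelta u v * (if u \<in> J then 1 else 0))))"
    unfolding hs_sq_def sum_block_index by (intro sum.cong refl) (simp add: block_unit_def power_mult_distrib i2 i3)
  also have "\<dots> = (\<Sum>c'<k. \<Sum>u\<in>P. kdelta c c' * (\<Sum>b'<k. kdelta b b' * (\<Sum>v\<in>P. kdelta u v * (if u \<in> J then 1 else 0))))"
    by (simp only: sum_distrib_left)
  also have "\<dots> = (\<Sum>c'<k. \<Sum>u\<in>P. kdelta c c' * (\<Sum>b'<k. kdelta b b' * (if u \<in> J then 1 else 0)))"
    using P by (intro sum.cong refl) (simp only: sum_delta_l if_True)
  also have "\<dots> = (\<Sum>u\<in>P. (if u \<in> J then 1 else 0))"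
    using bc by (simp only: sum_distrib_left[symmetric] sum_delta_l if_True finite_lessThan lessThan_iff)
  also have "\<dots> = real (card J)" using P by (simp add: sum.If_cases Int_absorb1)
  finally show ?thesis .
qed

lemma mpow_block:
  assumes I: "finite I" "J \<subseteq> I" and z: "\<And>i j. i \<in> J \<Longrightarrow> j \<in> I - J \<Longrightarrow> X i j = 0" and ij: "i \<in> J"
  shows "mpow I X r i j = mpow J X r i j"
  using ij
proof (induction r arbitrary: i)
  case (Suc r)
  have "(\<Sum>l\<in>I. X i l * mpow I X r l j) = (\<Sum>l\<in>J. X i l * mpow J X r l j)"
    using I z Suc by (intro sum.mono_neutral_cong_right) auto
  then show ?case by (simp add: mmult_def)
qed simp

definition grid :: "nat \<Rightarrow> nat \<Rightarrow> (nat \<times> nat) set" where "grid N n = {..<N} \<times> {..<n}"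

definition wt :: "nat \<Rightarrow> nat \<Rightarrow> nat \<times> nat \<Rightarrow> nat \<times> nat \<Rightarrow> real" where
  "wt N n p q = 1 / (real n * real N) - (if fst p = fst q then 1 / real n else 0)"

text \<open>A variance profile on \<open>N\<close> groups of \<open>n\<close> positions. At \<open>t = 0\<close> the variance is \<open>1 / n\<close> inside the groups and \<open>0\<close> between
  them, giving \<open>N\<close> independent copies of the model of size \<open>n\<close>; at \<open>t = 1\<close> it is \<open>1 / (n * N)\<close> everywhere, giving the model of size \<open>n * N\<close>.
  Each row sum is \<open>1\<close> for all \<open>t\<close>; \<open>wt\<close> is the derivative in \<open>t\<close>, whose row sums vanish.\<close>

definition vt :: "nat \<Rightarrow> nat \<Rightarrow> real \<Rightarrow> nat \<times> nat \<Rightarrow> nat \<times> nat \<Rightarrow> real" where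
  "vt N n t p q = t / (real n * real N) + (if fst p = fst q then (1 - t) / real n else 0)"

definition st :: "nat \<Rightarrow> nat \<Rightarrow> real \<Rightarrow> nat \<times> nat \<Rightarrow> nat \<times> nat \<Rightarrow> real" where
  "st N n t p q = sqrt (vt N n t p q)"

lemma sum_singleton_times: "(\<Sum>u\<in>{j}\<times>S. h u) = (\<Sum>r\<in>S. h (j,r))"
proof -
  have "{j}\<times>S = Pair j ` S" by auto
  then show ?thesis by (simp add: sum.reindex inj_on_def)
qed

lemma sum_wt:
  assumes n: "n \<ge> 1" "N \<ge> 1"
  shows "(\<Sum>p\<in>grid N n. \<Sum>q\<in>grid N n. wt N n p q * (f q * h p)) =
     (1 / (real n * real N)) * ((\<Sum>q\<in>grid N n. f q) * (\<Sum>p\<in>grid N n. h p))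
     - (1 / real n) * (\<Sum>j<N. (\<Sum>u\<in>{j}\<times>{..<n}. f u) * (\<Sum>u\<in>{j}\<times>{..<n}. h u))"
proof -
  have "(\<Sum>q\<in>grid N n. (if fst p = fst q then 1 / real n else 0) * (f q * h p)) = (1 / real n) * ((\<Sum>u\<in>{fst p}\<times>{..<n}. f u) * h p)"
    if "p \<in> grid N n" for p
  proof -
    have "(\<Sum>q\<in>grid N n. (if fst p = fst q then 1 / real n else 0) * (f q * h p)) = (\<Sum>q\<in>{fst p}\<times>{..<n}. (1 / real n) * (f q * h p))"
      using that by (intro sum.mono_neutral_cong_right) (auto simp: grid_def)
    then show ?thesis by (simp only: sum_distrib_left sum_distrib_right)
  qed
  then have "(\<Sum>p\<in>grid N n. \<Sum>q\<in>grid N n. (if fst p = fst q then 1 / real n else 0) * (f q * h p))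
    = (\<Sum>p\<in>grid N n. (1 / real n) * ((\<Sum>u\<in>{fst p}\<times>{..<n}. f u) * h p))" by (intro sum.cong refl)
  also have "\<dots> = (\<Sum>j<N. \<Sum>r<n. (1 / real n) * ((\<Sum>u\<in>{j}\<times>{..<n}. f u) * h (j,r)))"
    unfolding grid_def by (simp add: sum.cartesian_product split_def)
  also have "\<dots> = (1 / real n) * (\<Sum>j<N. (\<Sum>u\<in>{j}\<times>{..<n}. f u) * (\<Sum>r<n. h (j,r)))"
    by (simp only: sum_distrib_left)
  also have "(\<lambda>j. \<Sum>r<n. h (j,r)) = (\<lambda>j. \<Sum>u\<in>{j}\<times>{..<n}. h u)"
    by (simp only: sum_singleton_times)
  finally have 1: "(\<Sum>p\<in>grid N n. \<Sum>q\<in>grid N n. (if fst p = fst q then 1 / real n else 0) * (f q * h p))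
     = (1 / real n) * (\<Sum>j<N. (\<Sum>u\<in>{j}\<times>{..<n}. f u) * (\<Sum>u\<in>{j}\<times>{..<n}. h u))" .
  have "(\<Sum>p\<in>grid N n. \<Sum>q\<in>grid N n. (1 / (real n * real N)) * (f q * h p)) = (1 / (real n * real N)) * (\<Sum>p\<in>grid N n. \<Sum>q\<in>grid N n. f q * h p)"
    by (simp only: sum_distrib_left)
  also have "(\<Sum>p\<in>grid N n. \<Sum>q\<in>grid N n. f q * h p) = (\<Sum>q\<in>grid N n. f q) * (\<Sum>p\<in>grid N n. h p)"
    by (subst sum.swap) (simp only: sum_product)
  finally show ?thesis
    unfolding wt_def left_diff_distrib sum_subtractf 1 by simp
qed

lemma sum_grid: "(\<Sum>u\<in>grid N n. h u) = (\<Sum>j<N. \<Sum>u\<in>{j}\<times>{..<n}. h u)"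
  by (simp add: grid_def sum_singleton_times sum.cartesian_product)

lemma abs_wt_le: "n \<ge> 1 \<Longrightarrow> N \<ge> 1 \<Longrightarrow> \<bar>wt N n p q\<bar> \<le> 1 / real n"
proof -
  assume n: "n \<ge> 1" "N \<ge> 1"
  have "1 / (real n * real N) \<le> 1 / real n" "0 \<le> 1 / (real n * real N)"
    using n by (auto simp: field_simps)
  then show ?thesis by (auto simp: wt_def)
qed

lemma vt_bounds:
  assumes "n \<ge> 1" "N \<ge> 1" "0 \<le> t" "t \<le> 1"
  shows "0 \<le> vt N n t p q" "vt N n t p q \<le> 1 / real n"
proof -
  show "0 \<le> vt N n t p q" using assms by (auto simp: vt_def)
  have "t / (real n * real N) \<le> t / real n" using assms by (intro divide_left_mono) (auto simp: field_simps)
  moreover have "t / real n + (1 - t) / real n = 1 / real n" by (simp add: add_divide_distrib[symmetric])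
  moreover have "0 \<le> (1 - t) / real n" using assms by simp
  ultimately show "vt N n t p q \<le> 1 / real n" by (auto simp: vt_def)
qed

lemma st_bound: "n \<ge> 1 \<Longrightarrow> N \<ge> 1 \<Longrightarrow> 0 \<le> t \<Longrightarrow> t \<le> 1 \<Longrightarrow> (st N n t p q)^2 \<le> 1 / real n"
  using vt_bounds[of n N t p q] by (simp add: st_def)

lemma st_DERIV:
  assumes "n \<ge> 1" "N \<ge> 1" "0 < t" "t < 1"
  shows "((\<lambda>t. st N n t p q) has_real_derivative wt N n p q / (2 * st N n t p q)) (at t)" "st N n t p q > 0"
proof -
  have pos: "vt N n t p q > 0" using assms by (auto simp: vt_def intro!: add_pos_nonneg)
  have "((\<lambda>t. vt N n t p q) has_real_derivative wt N n p q) (at t)"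
    unfolding vt_def wt_def using assms by (auto intro!: derivative_eq_intros)
  then show "((\<lambda>t. st N n t p q) has_real_derivative wt N n p q / (2 * st N n t p q)) (at t)"
    unfolding st_def using pos by (auto intro!: derivative_eq_intros simp: field_simps)
  show "st N n t p q > 0" using pos by (simp add: st_def)
qed

lemma st_continuous: "n \<ge> 1 \<Longrightarrow> N \<ge> 1 \<Longrightarrow> continuous_on T (\<lambda>t. st N n t p q)"
  unfolding st_def vt_def by (cases "fst p = fst q") (auto intro!: continuous_intros)

lemma grid_props: "finite (grid N n)" "n \<ge> 1 \<Longrightarrow> N \<ge> 1 \<Longrightarrow> grid N n \<noteq> {}" "card (grid N n) = N * n"
  by (auto simp: grid_def card_cartesian_product lessThan_empty_iff)

lemma pow_le_1_plus:
  fixes z :: real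
  assumes "0 \<le> z" "c \<le> d"
  shows "z ^ c \<le> 1 + z ^ d"
proof (cases "z \<le> 1")
  case True
  then have "z ^ c \<le> 1" using assms by (simp add: power_le_one)
  moreover have "0 \<le> z ^ d" using assms by simp
  ultimately show ?thesis by linarith
next
  case False
  then have "z ^ c \<le> z ^ d" using assms by (intro power_increasing) auto
  then show ?thesis by simp
qed

context gmat begin
lemma poly_quart:
  assumes "\<And>a b c d. polyfun E (\<lambda>x. F x a b c d)"
  shows "polyfun E (\<lambda>x. quart A l k (F x))"
  unfolding quart_def by (intro polyfun_sum polyfun_cmult assms)

lemma avg_quart:
  assumes "\<And>a b c d. polyfun E (\<lambda>x. F x a b c d)"
  shows "avg (\<lambda>x. quart A l k (F x)) = quart A l k (\<lambda>a b c d. avg (\<lambda>x. F x a b c d))"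
proof -
  note p = assms polyfun_cmult polyfun_sum
  show ?thesis unfolding quart_def
    by (simp add: avg_sum avg_cmult p)
qed

lemma avg_abs_le:
  assumes "polyfun E f" "polyfun E h" "\<And>x. \<bar>f x\<bar> \<le> h x"
  shows "\<bar>avg f\<bar> \<le> avg h"
proof -
  have "avg f \<le> avg h" by (rule avg_mono[OF assms(1,2)]) (use assms(3) in \<open>metis abs_le_D1\<close>)
  moreover have "- avg f = avg (\<lambda>x. - 1 * f x)" by (subst avg_cmult) simp
  moreover have "avg (\<lambda>x. - 1 * f x) \<le> avg h"
    by (rule avg_mono[OF polyfun_cmult[OF assms(1)] assms(2)]) (use assms(3) in \<open>metis abs_le_D2 mult_minus1\<close>)
  ultimately show ?thesis by linarith
qed
end

text \<open>The crossed index pattern prevents factorization but allows Cauchy-Schwarz, which gains a factor of the dimension.\<close>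

lemma sum_abs_le_hs:
  fixes M :: "nat \<times> 'p \<Rightarrow> nat \<times> 'p \<Rightarrow> real"
  assumes P: "finite P" and abcd: "a < k" "b < k" "c < k" "d < k" and w: "\<And>p q. \<bar>w p q\<bar> \<le> m"
  shows "\<bar>\<Sum>p\<in>P. \<Sum>q\<in>P. w p q * (M (b,q) (c,p) * N (d,q) (a,p))\<bar> \<le> m * sqrt (hs_sq (block_index k P) M * hs_sq (block_index k P) N)"
proof -
  have m0: "0 \<le> m" using w[of undefined undefined] by linarith
  have sub: "(\<Sum>x\<in>P\<times>P. (Y (b,snd x) (c,fst x))^2) \<le> hs_sq (block_index k P) Y" if "b < k" "c < k" for b c and Y :: "nat \<times> 'p \<Rightarrow> nat \<times> 'p \<Rightarrow> real"
  proof -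
    have "(\<Sum>x\<in>P\<times>P. (Y (b,snd x) (c,fst x))^2) = (\<Sum>p\<in>P. \<Sum>q\<in>P. (Y (b,q) (c,p))^2)"
      by (simp add: sum.cartesian_product split_def)
    also have "\<dots> = (\<Sum>q\<in>P. \<Sum>p\<in>P. (Y (b,q) (c,p))^2)" by (rule sum.swap)
    also have "\<dots> \<le> (\<Sum>q\<in>P. \<Sum>c'<k. \<Sum>p\<in>P. (Y (b,q) (c',p))^2)"
      using that by (intro sum_mono member_le_sum[of c "{..<k}" "\<lambda>c'. \<Sum>p\<in>P. (Y (b,_) (c',p))^2"]) (auto intro: sum_nonneg)
    also have "\<dots> \<le> (\<Sum>b'<k. \<Sum>q\<in>P. \<Sum>c'<k. \<Sum>p\<in>P. (Y (b',q) (c',p))^2)"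
      using that by (intro member_le_sum[of b "{..<k}" "\<lambda>b'. \<Sum>q\<in>P. \<Sum>c'<k. \<Sum>p\<in>P. (Y (b',q) (c',p))^2"]) (auto intro!: sum_nonneg)
    finally show ?thesis by (simp add: hs_sq_def sum_block_index)
  qed
  have "\<bar>\<Sum>p\<in>P. \<Sum>q\<in>P. w p q * (M (b,q) (c,p) * N (d,q) (a,p))\<bar> \<le> (\<Sum>p\<in>P. \<Sum>q\<in>P. m * (\<bar>M (b,q) (c,p)\<bar> * \<bar>N (d,q) (a,p)\<bar>))"
    by (intro order_trans[OF sum_abs] sum_mono) (auto simp: abs_mult intro!: mult_right_mono w)
  also have "\<dots> = m * (\<Sum>x\<in>P\<times>P. \<bar>M (b,snd x) (c,fst x)\<bar> * \<bar>N (d,snd x) (a,fst x)\<bar>)"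
    by (simp add: sum.cartesian_product split_def sum_distrib_left)
  also have "(\<Sum>x\<in>P\<times>P. \<bar>M (b,snd x) (c,fst x)\<bar> * \<bar>N (d,snd x) (a,fst x)\<bar>) \<le> sqrt (hs_sq (block_index k P) M * hs_sq (block_index k P) N)"
  proof (rule real_le_rsqrt)
    have "(\<Sum>x\<in>P\<times>P. \<bar>M (b,snd x) (c,fst x)\<bar> * \<bar>N (d,snd x) (a,fst x)\<bar>)^2
      \<le> (\<Sum>x\<in>P\<times>P. \<bar>M (b,snd x) (c,fst x)\<bar>^2) * (\<Sum>x\<in>P\<times>P. \<bar>N (d,snd x) (a,fst x)\<bar>^2)"
      by (rule Cauchy_Schwarz_ineq_sum)
    also have "\<dots> \<le> hs_sq (block_index k P) M * hs_sq (block_index k P) N"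
      unfolding power2_abs using abcd by (intro mult_mono sub) (auto intro: sum_nonneg hs_nonneg)
    finally show "(\<Sum>x\<in>P\<times>P. \<bar>M (b,snd x) (c,fst x)\<bar> * \<bar>N (d,snd x) (a,fst x)\<bar>)^2 \<le> hs_sq (block_index k P) M * hs_sq (block_index k P) N" .
  qed
  finally show ?thesis using m0 by (simp add: mult_left_mono)
qed

text \<open>The normalization of the trace that \<open>gmatm\<close> requires.\<close>

locale model2 = model +
  assumes trB: "real k \<le> (\<Sum>a<k. B a a)"
begin

definition trace_moment :: "'w measure \<Rightarrow> (nat \<times> 'p \<times> 'p \<Rightarrow> 'w \<Rightarrow> real) \<Rightarrow> 'p set \<Rightarrow> ('p \<Rightarrow> 'p \<Rightarrow> real) \<Rightarrow> nat \<Rightarrow> real" where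
  "trace_moment M g P s p = integral\<^sup>L M (\<lambda>\<omega>. mtrace (block_index k P) (mpow (block_index k P) (XX P (\<lambda>e. entry_scale s e * g e \<omega>)) (2*p)))"

lemma trace_moment_moment_entry:
  assumes g: "gaussian_family M g (noise_index l P)" and P: "finite P" "P \<noteq> {}"
  shows "trace_moment M g P s p = (\<Sum>a<k. \<Sum>u\<in>P. moment_entry M g P s (2*p) (a,u) (a,u))"
proof -
  have i: "integrable M (\<lambda>\<omega>. mpow (block_index k P) (XX P (\<lambda>e. entry_scale s e * g e \<omega>)) r i j)" for r i j
    by (rule gaussian_family_expectation_eq(1)[OF g g poly_moment_entry[OF P]])
  show ?thesis unfolding trace_moment_def mtrace_def sum_block_index moment_entry_def using i by simp
qed

lemma trace_moment_law:
  assumes g: "gaussian_family M g (noise_index l P)" "gaussian_family M' g' (noise_index l P')"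
    and \<pi>: "bij_betw \<pi> P P'" and s: "\<And>p q. p \<in> P \<Longrightarrow> q \<in> P \<Longrightarrow> s' (\<pi> p) (\<pi> q) = s p q"
    and P: "finite P" "P \<noteq> {}"
  shows "trace_moment M' g' P' s' p = trace_moment M g P s p"
proof -
  have P': "finite P'" "P' \<noteq> {}" using P \<pi> bij_betw_finite[OF \<pi>] by (auto simp: bij_betw_def)
  have "(\<Sum>u\<in>P'. moment_entry M' g' P' s' (2*p) (a,u) (a,u)) = (\<Sum>u\<in>P. moment_entry M g P s (2*p) (a,u) (a,u))" if "a < k" for a
    using sum.reindex_bij_betw[OF \<pi>, of "\<lambda>u. moment_entry M' g' P' s' (2*p) (a,u) (a,u)"]
      moment_entry_law[where s=s and s'=s' and \<pi>=\<pi>, OF g \<pi> s P, of a a] that by (simp cong: sum.cong)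
  then show ?thesis unfolding trace_moment_moment_entry[OF g(1) P] trace_moment_moment_entry[OF g(2) P'] by simp
qed

text \<open>At \<open>t = 0\<close> the matrix is block diagonal with \<open>N\<close> blocks of the same law.\<close>

lemma trace_moment_block:
  assumes g: "gaussian_family M g (noise_index l (grid N n))" and n: "n \<ge> 1" "N \<ge> 1"
    and g0: "gaussian_family M0 g0 (noise_index l Q)" and Q: "finite Q" "card Q = n"
  shows "trace_moment M g (grid N n) (st N n 0) p = real N * trace_moment M0 g0 Q (\<lambda>_ _. sqrt (1 / real n)) p"
proof -
  have Q0: "Q \<noteq> {}" using Q n by auto
  have J: "{j} \<times> {..<n} \<subseteq> grid N n" if "j < N" for j using that by (auto simp: grid_def)
  have gJ: "gaussian_family M g (noise_index l ({j} \<times> {..<n}))" if "j < N" for j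
    using gaussian_family_inj[OF g, of "\<lambda>e. e" "noise_index l ({j} \<times> {..<n})"] J[OF that] by (auto simp: noise_index_def)
  have EJ: "trace_moment M g ({j} \<times> {..<n}) (\<lambda>_ _. sqrt (1 / real n)) p = trace_moment M0 g0 Q (\<lambda>_ _. sqrt (1 / real n)) p" if "j < N" for j
  proof -
    have "finite ({j} \<times> {..<n})" "card ({j} \<times> {..<n}) = card Q" using Q by (auto simp: card_cartesian_product)
    then obtain \<pi> where "bij_betw \<pi> Q ({j} \<times> {..<n})" using finite_same_card_bij[of Q "{j} \<times> {..<n}"] Q by auto
    then show ?thesis by (intro trace_moment_law[OF g0 gJ[OF that]]) (use Q Q0 in auto)
  qed
  have path: "mpow (block_index k (grid N n)) (XX (grid N n) (\<lambda>e. entry_scale (st N n 0) e * g e \<omega>)) r (a,u) (b,v)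
     = mpow (block_index k ({j} \<times> {..<n})) (XX ({j} \<times> {..<n}) (\<lambda>e. entry_scale (\<lambda>_ _. sqrt (1 / real n)) e * g e \<omega>)) r (a,u) (b,v)"
    if "j < N" "u \<in> {j} \<times> {..<n}" "a < k" for j u a b v \<omega> r
  proof -
    have "mpow (block_index k (grid N n)) (XX (grid N n) (\<lambda>e. entry_scale (st N n 0) e * g e \<omega>)) r (a,u) (b,v)
      = mpow (block_index k ({j} \<times> {..<n})) (XX (grid N n) (\<lambda>e. entry_scale (st N n 0) e * g e \<omega>)) r (a,u) (b,v)"
    proof (rule mpow_block)
      show "finite (block_index k (grid N n))" "block_index k ({j} \<times> {..<n}) \<subseteq> block_index k (grid N n)" "(a,u) \<in> block_index k ({j} \<times> {..<n})"
        using that by (auto simp: block_index_def grid_def)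
      fix i i' assume i: "i \<in> block_index k ({j} \<times> {..<n})" "i' \<in> block_index k (grid N n) - block_index k ({j} \<times> {..<n})"
      obtain a u b v where ii: "i = (a,u)" "i' = (b,v)" by (cases i, cases i') auto
      have "fst u \<noteq> fst v" using i by (auto simp: ii block_index_def grid_def)
      then have "st N n 0 u v = 0" "st N n 0 v u = 0" "kdelta u v = 0" by (auto simp: st_def vt_def kdelta_def)
      then show "XX (grid N n) (\<lambda>e. entry_scale (st N n 0) e * g e \<omega>) i i' = 0" by (simp add: ii gauss_mat_simp entry_scale_def)
    qed
    also have "\<dots> = mpow (block_index k ({j} \<times> {..<n})) (XX ({j} \<times> {..<n}) (\<lambda>e. entry_scale (\<lambda>_ _. sqrt (1 / real n)) e * g e \<omega>)) r (a,u) (b,v)"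
      by (rule mpow_cong) (use that in \<open>auto simp: block_index_def grid_def gauss_mat_simp entry_scale_def st_def vt_def\<close>)
    finally show ?thesis .
  qed
  have "trace_moment M g (grid N n) (st N n 0) p = (\<Sum>a<k. \<Sum>j<N. \<Sum>u\<in>{j}\<times>{..<n}. moment_entry M g (grid N n) (st N n 0) (2*p) (a,u) (a,u))"
    unfolding trace_moment_moment_entry[OF g grid_props(1) grid_props(2)[OF n]]
    by (simp only: sum_grid)
  also have "\<dots> = (\<Sum>a<k. \<Sum>j<N. \<Sum>u\<in>{j}\<times>{..<n}. moment_entry M g ({j}\<times>{..<n}) (\<lambda>_ _. sqrt (1 / real n)) (2*p) (a,u) (a,u))"
    unfolding moment_entry_def by (intro sum.cong refl) (subst path, auto)
  also have "\<dots> = (\<Sum>j<N. \<Sum>a<k. \<Sum>u\<in>{j}\<times>{..<n}. moment_entry M g ({j}\<times>{..<n}) (\<lambda>_ _. sqrt (1 / real n)) (2*p) (a,u) (a,u))"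
    by (rule sum.swap)
  also have "\<dots> = (\<Sum>j<N. trace_moment M g ({j}\<times>{..<n}) (\<lambda>_ _. sqrt (1 / real n)) p)"
    using n gJ by (intro sum.cong refl, subst trace_moment_moment_entry) (auto simp: lessThan_empty_iff)
  also have "\<dots> = real N * trace_moment M0 g0 Q (\<lambda>_ _. sqrt (1 / real n)) p" using EJ by simp
  finally show ?thesis .
qed

definition interp_const :: "nat \<Rightarrow> nat \<Rightarrow> nat \<Rightarrow> real" where
  "interp_const N n p = real p * real (2*p-1) * ((real k)^2 * hsA k l A * (8 * bessel_const (1 / real n) * (real p)^2 * (1 + real N)
       + (2 / real n) * sqrt (real (k * (N * n)))))"

text \<open>In the leading term the two partial traces over groups have means that are the same for all groups, by exchangeability.
  As the row sums of \<open>wt\<close> vanish, the product of the means cancels and covariances remain, which are of relative order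
  \<open>p\<^sup>2 / n\<close>. The crossed term is small by Cauchy-Schwarz.\<close>

lemma interp_deriv_bound:
  assumes g: "gaussian_family M g (noise_index l (grid N n))" and n: "n \<ge> 1" "N \<ge> 1" and t: "0 \<le> t" "t \<le> 1"
    and p: "p \<ge> 2" and small: "16 * bessel_const (1 / real n) * (real p)^2 \<le> 1"
  defines "P \<equiv> grid N n"
  defines "Vp \<equiv> (\<lambda>x. mtrace (block_index k P) (mpow (block_index k P) (XX P x) (2*p)))"
  shows "\<bar>\<Sum>e\<in>noise_index l P. entry_scale (wt N n) e / 2 * integral\<^sup>L M (\<lambda>\<omega>. partial e (partial e Vp) (\<lambda>e. entry_scale (st N n t) e * g e \<omega>))\<bar>
     \<le> interp_const N n p * trace_moment M g P (st N n t) p"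
proof -
  note PP = grid_props(1)[of N n, folded P_def] grid_props(2)[OF n, folded P_def]
  interpret gmatm M g "noise_index l P" "block_index k P" "XX P" "noise_coeff A" "entry_scale (st N n t)" "bessel_const (1 / real n)"
    by (rule gmatm_model[OF trB g[folded P_def] PP]) (use st_bound n t in auto)
  let ?I = "block_index k P"
  have EVeq: "trace_moment M g P (st N n t) p = avg (V p)" by (simp add: trace_moment_def avg_def V_def scaled_def)
  have VpV: "Vp = V p" by (simp add: Vp_def V_def[abs_def])
  define W where "W = real (card P)"
  let ?Y = "\<lambda>x c. mpow ?I (XX P x) c"
  let ?F1 = "\<lambda>c x a b c' d. \<Sum>p'\<in>P. \<Sum>q\<in>P. wt N n p' q * (?Y x c (b,q) (c',q) * ?Y x (2*p-2-c) (d,p') (a,p'))"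
  let ?F2 = "\<lambda>c x a b c' d. \<Sum>p'\<in>P. \<Sum>q\<in>P. wt N n p' q * (?Y x c (b,q) (c',p') * ?Y x (2*p-2-c) (d,q) (a,p'))"
  have poly1: "polyfun (noise_index l P) (\<lambda>x. ?F1 c x a b c' d)" "polyfun (noise_index l P) (\<lambda>x. ?F2 c x a b c' d)" for c a b c' d
    by (intro polyfun_sum polyfun_cmult polyfun.mult poly_mpow)+
  have polyT: "polyfun (noise_index l P) (\<lambda>x. mtrace ?I (mmult ?I (noise_coeff A e) (mmult ?I (?Y x c) (mmult ?I (noise_coeff A e) (?Y x c')))))" for e c c'
    by (intro poly_mat)
  have expand: "(\<Sum>e\<in>noise_index l P. entry_scale (wt N n) e / 2 * integral\<^sup>L M (\<lambda>\<omega>. partial e (partial e Vp) (\<lambda>e. entry_scale (st N n t) e * g e \<omega>)))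
     = real p * (\<Sum>c<2*p-1. quart A l k (\<lambda>a b c' d. avg (\<lambda>x. ?F1 c x a b c' d)) + quart A l k (\<lambda>a b c' d. avg (\<lambda>x. ?F2 c x a b c' d)))"
  proof -
    have "(\<Sum>e\<in>noise_index l P. entry_scale (wt N n) e / 2 * integral\<^sup>L M (\<lambda>\<omega>. partial e (partial e Vp) (\<lambda>e. entry_scale (st N n t) e * g e \<omega>)))
      = (\<Sum>e\<in>noise_index l P. entry_scale (wt N n) e / 2 * avg (partial e (partial e Vp)))" by (simp add: avg_def scaled_def)
    also have "\<dots> = (\<Sum>e\<in>noise_index l P. \<Sum>c<2*p-1. avg (\<lambda>x. real p * (entry_scale (wt N n) e * mtrace ?I (mmult ?I (noise_coeff A e) (mmult ?I (?Y x c) (mmult ?I (noise_coeff A e) (?Y x (2*p-2-c))))))))"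
    proof (rule sum.cong[OF refl])
      fix e assume e: "e \<in> noise_index l P"
      have "partial e (partial e Vp) = (\<lambda>x. real (2*p) * (\<Sum>c<2*p-1. mtrace ?I (mmult ?I (noise_coeff A e) (mmult ?I (?Y x c) (mmult ?I (noise_coeff A e) (?Y x (2*p-2-c)))))))"
        unfolding Vp_def by (rule ext, rule partial_partial_mtrace_pow[OF e])
      then have "avg (partial e (partial e Vp)) = real (2*p) * (\<Sum>c<2*p-1. avg (\<lambda>x. mtrace ?I (mmult ?I (noise_coeff A e) (mmult ?I (?Y x c) (mmult ?I (noise_coeff A e) (?Y x (2*p-2-c)))))))"
        by (simp only: avg_cmult avg_sum[OF polyT])
      then show "entry_scale (wt N n) e / 2 * avg (partial e (partial e Vp)) = (\<Sum>c<2*p-1. avg (\<lambda>x. real p * (entry_scale (wt N n) e * mtrace ?I (mmult ?I (noise_coeff A e) (mmult ?I (?Y x c) (mmult ?I (noise_coeff A e) (?Y x (2*p-2-c))))))))"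
        by (simp add: avg_cmult sum_distrib_left mult_ac)
    qed
    also have "\<dots> = (\<Sum>c<2*p-1. \<Sum>e\<in>noise_index l P. avg (\<lambda>x. real p * (entry_scale (wt N n) e * mtrace ?I (mmult ?I (noise_coeff A e) (mmult ?I (?Y x c) (mmult ?I (noise_coeff A e) (?Y x (2*p-2-c))))))))"
      by (rule sum.swap)
    also have "\<dots> = (\<Sum>c<2*p-1. real p * (quart A l k (\<lambda>a b c' d. avg (\<lambda>x. ?F1 c x a b c' d)) + quart A l k (\<lambda>a b c' d. avg (\<lambda>x. ?F2 c x a b c' d))))"
    proof (rule sum.cong[OF refl])
      fix c
      have "(\<Sum>e\<in>noise_index l P. avg (\<lambda>x. real p * (entry_scale (wt N n) e * mtrace ?I (mmult ?I (noise_coeff A e) (mmult ?I (?Y x c) (mmult ?I (noise_coeff A e) (?Y x (2*p-2-c))))))))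
         = real p * (\<Sum>e\<in>noise_index l P. avg (\<lambda>x. entry_scale (wt N n) e * mtrace ?I (mmult ?I (noise_coeff A e) (mmult ?I (?Y x c) (mmult ?I (noise_coeff A e) (?Y x (2*p-2-c)))))))"
        by (simp only: avg_cmult sum_distrib_left)
      also have "(\<Sum>e\<in>noise_index l P. avg (\<lambda>x. entry_scale (wt N n) e * mtrace ?I (mmult ?I (noise_coeff A e) (mmult ?I (?Y x c) (mmult ?I (noise_coeff A e) (?Y x (2*p-2-c)))))))
        = avg (\<lambda>x. \<Sum>e\<in>noise_index l P. entry_scale (wt N n) e * mtrace ?I (mmult ?I (noise_coeff A e) (mmult ?I (?Y x c) (mmult ?I (noise_coeff A e) (?Y x (2*p-2-c))))))"
        by (rule avg_sum[symmetric]) (rule polyfun_cmult[OF polyT])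
      also have "\<dots> = avg (\<lambda>x. quart A l k (?F1 c x) + quart A l k (?F2 c x))"
      proof -
        have "(\<Sum>e\<in>noise_index l P. entry_scale (wt N n) e * mtrace ?I (mmult ?I (noise_coeff A e) (mmult ?I (?Y x c) (mmult ?I (noise_coeff A e) (?Y x (2*p-2-c))))))
          = quart A l k (?F1 c x) + quart A l k (?F2 c x)" for x
          unfolding sum_noise_index entry_scale_def prod.case by (rule sum_noise_coeff_noise_coeff[OF PP(1)]) (simp add: wt_def)
        then show ?thesis by simp
      qed
      also have "\<dots> = quart A l k (\<lambda>a b c' d. avg (\<lambda>x. ?F1 c x a b c' d)) + quart A l k (\<lambda>a b c' d. avg (\<lambda>x. ?F2 c x a b c' d))"
        by (subst avg_add[OF poly_quart poly_quart], rule poly1, rule poly1, subst avg_quart, rule poly1, subst avg_quart, rule poly1, rule refl)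
      finally show "(\<Sum>e\<in>noise_index l P. avg (\<lambda>x. real p * (entry_scale (wt N n) e * mtrace ?I (mmult ?I (noise_coeff A e) (mmult ?I (?Y x c) (mmult ?I (noise_coeff A e) (?Y x (2*p-2-c))))))))
        = real p * (quart A l k (\<lambda>a b c' d. avg (\<lambda>x. ?F1 c x a b c' d)) + quart A l k (\<lambda>a b c' d. avg (\<lambda>x. ?F2 c x a b c' d)))" .
    qed
    finally show ?thesis by (simp only: sum_distrib_left)
  qed
  \<comment> \<open>The leading terms \<open>?F1\<close> are bounded by \<open>m1\<close>, the crossed terms \<open>?F2\<close> by \<open>m2\<close>.\<close>
  define m1 where "m1 = 8 * bessel_const (1 / real n) * (real p)^2 * (1 + real N) * avg (V p)"
  define m2 where "m2 = (2 / real n) * sqrt (real (card ?I)) * avg (V p)"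
  have ev1: "1 \<le> avg (V p)" by (rule trace_moment_ge(2)[OF p])
  have m0: "0 \<le> m1" "0 \<le> m2" using ev1 kappa_nonneg by (auto simp: m1_def m2_def)
  have b1: "\<bar>avg (\<lambda>x. ?F1 c x a b c' d)\<bar> \<le> m1" if c: "c < 2*p-1" and abcd: "a < k" "b < k" "c' < k" "d < k" for c a b c' d
  proof -
    let ?S = "\<lambda>J x. mtrace ?I (mmult ?I (block_unit b c' J) (?Y x c))"
    let ?T = "\<lambda>J x. mtrace ?I (mmult ?I (block_unit d a J) (?Y x (2*p-2-c)))"
    have JP: "{j}\<times>{..<n} \<subseteq> P" if "j < N" for j using that by (auto simp: P_def grid_def)
    have S: "?S J x = (\<Sum>u\<in>J. ?Y x c (b,u) (c',u))" "?T J x = (\<Sum>u\<in>J. ?Y x (2*p-2-c) (d,u) (a,u))" if "J \<subseteq> P" for J x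
      using mtrace_block_unit[OF PP(1) that] abcd by auto
    have F1: "?F1 c x a b c' d = (1 / (real n * real N)) * (?S P x * ?T P x) - (1 / real n) * (\<Sum>j<N. ?S ({j}\<times>{..<n}) x * ?T ({j}\<times>{..<n}) x)" for x
      using sum_wt[OF n, of "\<lambda>q. ?Y x c (b,q) (c',q)" "\<lambda>p'. ?Y x (2*p-2-c) (d,p') (a,p')"] S JP
      by (simp add: P_def[symmetric])
    have pS: "polyfun (noise_index l P) (?S J)" "polyfun (noise_index l P) (?T J)" for J by (intro poly_mat)+
    have evF1: "avg (\<lambda>x. ?F1 c x a b c' d) = (1 / (real n * real N)) * avg (\<lambda>x. ?S P x * ?T P x) - (1 / real n) * (\<Sum>j<N. avg (\<lambda>x. ?S ({j}\<times>{..<n}) x * ?T ({j}\<times>{..<n}) x))"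
    proof -
      have 1: "polyfun (noise_index l P) (\<lambda>x. (1 / (real n * real N)) * (?S P x * ?T P x))"
        by (intro polyfun_cmult polyfun.mult pS)
      have 2: "polyfun (noise_index l P) (\<lambda>x. \<Sum>j<N. ?S ({j}\<times>{..<n}) x * ?T ({j}\<times>{..<n}) x)"
        by (intro polyfun_sum polyfun.mult pS)
      show ?thesis unfolding F1 avg_diff[OF 1 polyfun_cmult[OF 2]] avg_cmult
        by (subst avg_sum, rule polyfun.mult[OF pS], rule refl)
    qed
    have sh: "avg (\<lambda>x. mtrace ?I (mmult ?I (block_unit b c' ({j}\<times>{..<n})) (?Y x r))) = avg (\<lambda>x. mtrace ?I (mmult ?I (block_unit b c' ({0}\<times>{..<n})) (?Y x r)))"
      if j: "j < N" and bc: "b < k" "c' < k" for j b c' r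
    proof -
      have e: "avg (\<lambda>x. mtrace ?I (mmult ?I (block_unit b c' ({j}\<times>{..<n})) (?Y x r))) = (\<Sum>u<n. moment_entry M g P (st N n t) r (b,(j,u)) (c',(j,u)))" if "j < N" for j
      proof -
        have "avg (\<lambda>x. mtrace ?I (mmult ?I (block_unit b c' ({j}\<times>{..<n})) (?Y x r))) = avg (\<lambda>x. \<Sum>u\<in>{j}\<times>{..<n}. ?Y x r (b,u) (c',u))"
          using mtrace_block_unit[OF PP(1) JP[OF that] bc] by simp
        also have "\<dots> = (\<Sum>u\<in>{j}\<times>{..<n}. avg (\<lambda>x. ?Y x r (b,u) (c',u)))" by (rule avg_sum) (rule poly_mpow)
        also have "\<dots> = (\<Sum>u\<in>{j}\<times>{..<n}. moment_entry M g P (st N n t) r (b,u) (c',u))" by (simp add: avg_def moment_entry_def scaled_def)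
        finally show ?thesis by (simp only: sum_singleton_times)
      qed
      \<comment> \<open>Exchanging the groups \<open>0\<close> and \<open>j\<close> preserves the variance profile.\<close>
      define \<pi> where "\<pi> = (\<lambda>(i,r::nat). (Transposition.transpose 0 j i, r))"
      have 0: "(0::nat) < N" using n by simp
      have tr: "Transposition.transpose 0 j i < N" if "i < N" for i using that j 0 by (auto simp: Transposition.transpose_def)
      have \<pi>: "bij_betw \<pi> P P"
        by (rule bij_betw_byWitness[of _ \<pi>]) (auto simp: \<pi>_def P_def grid_def tr)
      have "moment_entry M g P (st N n t) r (b, \<pi> (0,u)) (c', \<pi> (0,u)) = moment_entry M g P (st N n t) r (b,(0,u)) (c',(0,u))" if "u < n" for u
        by (rule moment_entry_law[OF g[folded P_def] g[folded P_def] \<pi> _ PP])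
          (use that bc 0 in \<open>auto simp: P_def grid_def \<pi>_def st_def vt_def transpose_eq_iff\<close>)
      then have "moment_entry M g P (st N n t) r (b,(j,u)) (c',(j,u)) = moment_entry M g P (st N n t) r (b,(0,u)) (c',(0,u))" if "u < n" for u
        using that by (simp add: \<pi>_def)
      then show ?thesis unfolding e[OF j] e[OF 0] by simp
    qed
    define s0 where "s0 = avg (?S ({0}\<times>{..<n}))"
    define t0 where "t0 = avg (?T ({0}\<times>{..<n}))"
    have Sj: "avg (?S ({j}\<times>{..<n})) = s0" "avg (?T ({j}\<times>{..<n})) = t0" if "j < N" for j
      using sh[OF that] abcd by (auto simp: s0_def t0_def)
    have sumP: "(\<Sum>u\<in>P. f u) = (\<Sum>j<N. \<Sum>u\<in>{j}\<times>{..<n}. f u)" for f :: "nat \<times> nat \<Rightarrow> real"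
      by (simp only: P_def sum_grid)
    have SP: "avg (?S P) = real N * s0"
    proof -
      have "?S P x = (\<Sum>j<N. ?S ({j}\<times>{..<n}) x)" for x
        using S(1)[OF order_refl, of x] S(1)[OF JP, of _ x] by (simp add: sumP)
      then have "avg (?S P) = (\<Sum>j<N. avg (?S ({j}\<times>{..<n})))" by (simp only: avg_sum[OF pS(1)])
      then show ?thesis using Sj by simp
    qed
    have TP: "avg (?T P) = real N * t0"
    proof -
      have "?T P x = (\<Sum>j<N. ?T ({j}\<times>{..<n}) x)" for x
        using S(2)[OF order_refl, of x] S(2)[OF JP, of _ x] by (simp add: sumP)
      then have "avg (?T P) = (\<Sum>j<N. avg (?T ({j}\<times>{..<n})))" by (simp only: avg_sum[OF pS(2)])
      then show ?thesis using Sj by simp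
    qed
    have ab: "c + (2*p-2-c) = 2*p-2" using c by auto
    define e where "e = 8 * bessel_const (1 / real n) * (real p)^2 * avg (V p)"
    have covP: "\<bar>avg (\<lambda>x. ?S P x * ?T P x) - (real N * s0) * (real N * t0)\<bar> \<le> e * (real n * real N)"
      using cov_mtrace_le[OF p small ab, of "block_unit b c' P" "real n * real N" "block_unit d a P"] hs_block_unit[OF PP(1) order_refl] abcd
      unfolding SP TP by (simp add: e_def P_def grid_props mult_ac)
    have covJ: "\<bar>avg (\<lambda>x. ?S ({j}\<times>{..<n}) x * ?T ({j}\<times>{..<n}) x) - s0 * t0\<bar> \<le> e * real n" if "j < N" for j
      using cov_mtrace_le[OF p small ab, of "block_unit b c' ({j}\<times>{..<n})" "real n" "block_unit d a ({j}\<times>{..<n})"] hs_block_unit[OF PP(1) JP[OF that]] abcd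
      unfolding Sj[OF that] by (simp add: e_def card_cartesian_product mult_ac)
    define cP where "cP = avg (\<lambda>x. ?S P x * ?T P x) - (real N * s0) * (real N * t0)"
    define cJ where "cJ = (\<lambda>j. avg (\<lambda>x. ?S ({j}\<times>{..<n}) x * ?T ({j}\<times>{..<n}) x) - s0 * t0)"
    have "avg (\<lambda>x. ?F1 c x a b c' d) = (1 / (real n * real N)) * (cP + (real N * s0) * (real N * t0)) - (1 / real n) * (\<Sum>j<N. cJ j + s0 * t0)"
      unfolding evF1 cP_def cJ_def by simp
    also have "\<dots> = (1 / (real n * real N)) * cP - (1 / real n) * (\<Sum>j<N. cJ j)"
      using n by (simp add: sum.distrib field_simps)
    also have "\<bar>\<dots>\<bar> \<le> (1 / (real n * real N)) * \<bar>cP\<bar> + (1 / real n) * (\<Sum>j<N. \<bar>cJ j\<bar>)"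
      by (rule order_trans[OF abs_triangle_ineq4]) (auto simp: abs_mult intro!: divide_right_mono sum_abs)
    also have "\<dots> \<le> (1 / (real n * real N)) * (e * (real n * real N)) + (1 / real n) * (\<Sum>j<N. e * real n)"
      using covP covJ by (intro add_mono mult_left_mono sum_mono) (auto simp: cP_def cJ_def)
    also have "\<dots> = m1" using n by (simp add: m1_def e_def field_simps)
    finally show ?thesis .
  qed
  have b2: "\<bar>avg (\<lambda>x. ?F2 c x a b c' d)\<bar> \<le> m2" if c: "c < 2*p-1" and abcd: "a < k" "b < k" "c' < k" "d < k" for c a b c' d
  proof -
    have cp: "0 \<le> 1 / real n * sqrt (real (card ?I))" by simp
    have "\<bar>avg (\<lambda>x. ?F2 c x a b c' d)\<bar> \<le> avg (\<lambda>x. (1 / real n * sqrt (real (card ?I))) * (1 + V p x))"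
    proof (rule avg_abs_le[OF poly1(2)])
      show "polyfun (noise_index l P) (\<lambda>x. (1 / real n * sqrt (real (card ?I))) * (1 + V p x))"
        by (intro polyfun_cmult polyfun.add polyfun.const poly_V)
      fix x
      have "\<bar>?F2 c x a b c' d\<bar> \<le> 1 / real n * sqrt (hs_sq ?I (?Y x c) * hs_sq ?I (?Y x (2*p-2-c)))"
        by (rule sum_abs_le_hs[OF PP(1) abcd]) (rule abs_wt_le[OF n])
      also have "\<dots> \<le> 1 / real n * (sqrt (real (card ?I)) * (1 + V p x))"
      proof (rule mult_left_mono)
        have ab: "c + (2*p-2-c) = 2*p-2" using c by auto
        have "hs_sq ?I (?Y x c) * hs_sq ?I (?Y x (2*p-2-c)) \<le> real (card ?I) * (V p x * opnorm ?I (XX P x) ^ (2*p-4))"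
          using mtrace_even_bounds(5)[OF finI neI symX p ab, of x] by (simp add: hs_mpow[OF finI symX] V_def)
        also have "\<dots> \<le> real (card ?I) * ((1 + V p x) * (1 + V p x))"
        proof (intro mult_left_mono mult_mono)
          have "opnorm ?I (XX P x) ^ (2*p-4) \<le> 1 + opnorm ?I (XX P x) ^ (2*p)" by (rule pow_le_1_plus) auto
          then show "opnorm ?I (XX P x) ^ (2*p-4) \<le> 1 + V p x" using opnorm_pow_le_V[OF p, of x] by linarith
        qed (use V_nonneg[OF p, of x] in auto)
        finally have "sqrt (hs_sq ?I (?Y x c) * hs_sq ?I (?Y x (2*p-2-c))) \<le> sqrt (real (card ?I) * ((1 + V p x) * (1 + V p x)))"
          by (rule real_sqrt_le_mono)
        then show "sqrt (hs_sq ?I (?Y x c) * hs_sq ?I (?Y x (2*p-2-c))) \<le> sqrt (real (card ?I)) * (1 + V p x)"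
          using V_nonneg[OF p, of x] by (simp add: real_sqrt_mult)
      qed simp
      finally show "\<bar>?F2 c x a b c' d\<bar> \<le> (1 / real n * sqrt (real (card ?I))) * (1 + V p x)" by simp
    qed
    also have "\<dots> = (1 / real n * sqrt (real (card ?I))) * (1 + avg (V p))"
      by (simp only: avg_cmult avg_add[OF polyfun.const poly_V] avg_const)
    also have "\<dots> \<le> (1 / real n * sqrt (real (card ?I))) * (2 * avg (V p))"
      using ev1 by (intro mult_left_mono cp) auto
    also have "\<dots> = m2" by (simp add: m2_def)
    finally show ?thesis .
  qed
  have "\<bar>\<Sum>c<2*p-1. quart A l k (\<lambda>a b c' d. avg (\<lambda>x. ?F1 c x a b c' d)) + quart A l k (\<lambda>a b c' d. avg (\<lambda>x. ?F2 c x a b c' d))\<bar>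
    \<le> (\<Sum>c<2*p-1. (real k)^2 * hsA k l A * m1 + (real k)^2 * hsA k l A * m2)"
  proof (intro order_trans[OF sum_abs] sum_mono)
    fix c assume c: "c \<in> {..<2*p-1}"
    have "\<bar>quart A l k (\<lambda>a b c' d. avg (\<lambda>x. ?F1 c x a b c' d))\<bar> \<le> (real k)^2 * hsA k l A * m1"
      by (rule quart_bound) (use b1 c m0 in auto)
    moreover have "\<bar>quart A l k (\<lambda>a b c' d. avg (\<lambda>x. ?F2 c x a b c' d))\<bar> \<le> (real k)^2 * hsA k l A * m2"
      by (rule quart_bound) (use b2 c m0 in auto)
    ultimately show "\<bar>quart A l k (\<lambda>a b c' d. avg (\<lambda>x. ?F1 c x a b c' d)) + quart A l k (\<lambda>a b c' d. avg (\<lambda>x. ?F2 c x a b c' d))\<bar>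
      \<le> (real k)^2 * hsA k l A * m1 + (real k)^2 * hsA k l A * m2" by linarith
  qed
  also have "\<dots> = real (2*p-1) * ((real k)^2 * hsA k l A * (m1 + m2))" by (simp add: distrib_left)
  finally have fin: "\<bar>\<Sum>c<2*p-1. quart A l k (\<lambda>a b c' d. avg (\<lambda>x. ?F1 c x a b c' d)) + quart A l k (\<lambda>a b c' d. avg (\<lambda>x. ?F2 c x a b c' d))\<bar>
    \<le> real (2*p-1) * ((real k)^2 * hsA k l A * (m1 + m2))" .
  have "\<bar>\<Sum>e\<in>noise_index l P. entry_scale (wt N n) e / 2 * integral\<^sup>L M (\<lambda>\<omega>. partial e (partial e Vp) (\<lambda>e. entry_scale (st N n t) e * g e \<omega>))\<bar>
    \<le> real p * (real (2*p-1) * ((real k)^2 * hsA k l A * (m1 + m2)))"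
    unfolding expand abs_mult using fin by (simp add: mult_left_mono)
  also have "\<dots> = interp_const N n p * avg (V p)"
    unfolding interp_const_def m1_def m2_def by (simp add: card_block_index P_def grid_props algebra_simps)
  finally show ?thesis unfolding EVeq .
qed

lemma trace_moment_ge1:
  assumes g: "gaussian_family M g (noise_index l P)" and P: "finite P" "P \<noteq> {}"
    and p: "p \<ge> 2"
  shows "1 \<le> trace_moment M g P s p"
proof -
  define b where "b = Max ((\<lambda>(p,q). (s p q)^2) ` (P \<times> P))"
  interpret gmatm M g "noise_index l P" "block_index k P" "XX P" "noise_coeff A" "entry_scale s" "bessel_const b"
  proof (rule gmatm_model[OF trB g P])
    fix p q assume "p \<in> P" "q \<in> P"
    then show "(s p q)^2 \<le> b" unfolding b_def using P by (intro Max_ge) auto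
  qed
  show ?thesis using trace_moment_ge(2)[OF p] by (simp add: trace_moment_def avg_def V_def[abs_def] scaled_def)
qed

text \<open>The derivative of the trace moment along the interpolation is at most \<open>interp_const\<close> times the trace moment; Gronwall.\<close>

lemma interp_ln:
  assumes g: "gaussian_family M g (noise_index l (grid N n))" and n: "n \<ge> 1" "N \<ge> 1"
    and g0: "gaussian_family M0 g0 (noise_index l Q)" and Q: "finite Q" "card Q = n"
    and p: "p \<ge> 2" and small: "16 * bessel_const (1 / real n) * (real p)^2 \<le> 1"
  shows "\<bar>ln (trace_moment M g (grid N n) (\<lambda>_ _. sqrt (1 / (real n * real N))) p)
     - ln (real N * trace_moment M0 g0 Q (\<lambda>_ _. sqrt (1 / real n)) p)\<bar> \<le> interp_const N n p"
proof -
  define P where "P = grid N n"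
  note PP = grid_props(1)[of N n, folded P_def] grid_props(2)[OF n, folded P_def]
  define Vp where "Vp = (\<lambda>x. mtrace (block_index k P) (mpow (block_index k P) (XX P x) (2*p)))"
  define \<phi> where "\<phi> = (\<lambda>t. trace_moment M g P (st N n t) p)"
  interpret prob_space M using g by (simp add: gaussian_family_def)
  interpret gaussians M g "noise_index l P" by unfold_locales (use g in \<open>simp add: P_def\<close>)
  have poly: "polyfun (noise_index l P) Vp"
    unfolding Vp_def by (intro affmat.poly_mtrace[OF affmat_model[OF PP]] affmat.poly_mpow[OF affmat_model[OF PP]])
  have \<phi>_ex: "\<phi> t = ex (\<lambda>x. Vp (\<lambda>e. entry_scale (st N n t) e * x e))" for t
    by (simp add: \<phi>_def trace_moment_def ex_def Vp_def)
  have ge1: "1 \<le> \<phi> t" for t unfolding \<phi>_def by (rule trace_moment_ge1[OF g[folded P_def] PP p])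
  have cont: "continuous_on {0..1} (\<lambda>t. ln (\<phi> t))"
  proof (intro continuous_on_ln)
    show "continuous_on {0..1} \<phi>" unfolding \<phi>_ex[abs_def]
      by (rule ex_scale_continuous[OF poly]) (auto simp: entry_scale_def st_continuous[OF n])
    show "\<forall>t\<in>{0..1}. \<phi> t \<noteq> 0" using ge1 by (metis not_one_le_zero)
  qed
  have der: "\<exists>d. ((\<lambda>t. ln (\<phi> t)) has_real_derivative d) (at t) \<and> \<bar>d\<bar> \<le> interp_const N n p" if t: "0 < t" "t < 1" for t
  proof -
    define s' where "s' = entry_scale (\<lambda>p q. wt N n p q / (2 * st N n t p q))"
    define D where "D = (\<Sum>e\<in>noise_index l P. s' e * entry_scale (st N n t) e * ex (\<lambda>x. partial e (partial e Vp) (\<lambda>e. entry_scale (st N n t) e * x e)))"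
    have "(\<phi> has_real_derivative D) (at t)"
      unfolding \<phi>_ex[abs_def] D_def
      by (rule ex_scale_DERIV[OF poly]) (auto simp: entry_scale_def s'_def intro!: st_DERIV(1)[OF n t])
    then have 1: "((\<lambda>t. ln (\<phi> t)) has_real_derivative D / \<phi> t) (at t)"
      using ge1[of t] by (auto intro!: derivative_eq_intros simp: divide_inverse)
    have "s' e * entry_scale (st N n t) e = entry_scale (wt N n) e / 2" for e
      using st_DERIV(2)[OF n t] by (cases e) (simp add: s'_def entry_scale_def less_imp_neq[symmetric])
    then have "D = (\<Sum>e\<in>noise_index l P. entry_scale (wt N n) e / 2 * integral\<^sup>L M (\<lambda>\<omega>. partial e (partial e Vp) (\<lambda>e. entry_scale (st N n t) e * g e \<omega>)))"
      unfolding D_def ex_def by (simp only:)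
    then have "\<bar>D\<bar> \<le> interp_const N n p * \<phi> t"
      using interp_deriv_bound[OF g n _ _ p small, of t] t by (simp add: \<phi>_def P_def Vp_def)
    then have "\<bar>D / \<phi> t\<bar> \<le> interp_const N n p" using ge1[of t] by (simp add: abs_divide divide_le_eq)
    with 1 show ?thesis by blast
  qed
  have "\<exists>d z. 0 < z \<and> z < 1 \<and> ((\<lambda>t. ln (\<phi> t)) has_real_derivative d) (at z) \<and> ln (\<phi> 1) - ln (\<phi> 0) = (1 - 0) * d"
    by (rule MVT) (use cont der in \<open>auto simp: real_differentiable_def\<close>)
  then obtain d z where z: "0 < z" "z < 1" "((\<lambda>t. ln (\<phi> t)) has_real_derivative d) (at z)" "ln (\<phi> 1) - ln (\<phi> 0) = d"
    by auto
  from der[OF z(1,2)] obtain d' where "((\<lambda>t. ln (\<phi> t)) has_real_derivative d') (at z)" "\<bar>d'\<bar> \<le> interp_const N n p" by blast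
  with z(3) DERIV_unique have "\<bar>d\<bar> \<le> interp_const N n p" by blast
  moreover have "\<phi> 1 = trace_moment M g (grid N n) (\<lambda>_ _. sqrt (1 / (real n * real N))) p"
  proof -
    have "st N n 1 = (\<lambda>_ _. sqrt (1 / (real n * real N)))" by (intro ext) (simp add: st_def vt_def)
    then show ?thesis by (simp add: \<phi>_def P_def)
  qed
  moreover have "\<phi> 0 = real N * trace_moment M0 g0 Q (\<lambda>_ _. sqrt (1 / real n)) p"
    unfolding \<phi>_def P_def by (rule trace_moment_block[OF g n g0 Q])
  ultimately show ?thesis using z(4) by simp
qed

end

section \<open>Convergence of the mean operator norm\<close>

lemma mtrace_le_opnorm:
  assumes "finite I" "I \<noteq> {}" "symm I X"
  shows "mtrace I X \<le> real (card I) * opnorm I X"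
proof -
  from eigenbasis_exists[OF assms(1,3)] obtain lam U where B: "eigenbasis I X lam U" by blast
  have "mtrace I X = (\<Sum>c\<in>I. lam c)"
    using eigenbasis_mtrace[OF assms(1) B, of 1] assms by (simp add: mtrace_def mmult_kdelta_right)
  also have "\<dots> \<le> (\<Sum>c\<in>I. opnorm I X)"
    using opnorm_eigen(1)[OF assms(1,2) B] by (intro sum_mono) (meson abs_le_D1)
  finally show ?thesis by simp
qed

lemma (in gmatm) mean_opnorm_ge1: "1 \<le> mean_opnorm"
proof -
  have pt: "polyfun E (\<lambda>x. mtrace I (X x))" by (intro poly_mtrace polyX)
  have "real (card I) \<le> avg (\<lambda>x. mtrace I (X x))" by (rule mean)
  also have "\<dots> \<le> expectation (\<lambda>\<omega>. real (card I) * opnorm I (X (scaled \<omega>)))"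
    unfolding avg_def by (rule integral_mono[OF integrable_scaled[OF pt] integrable_mult_right[OF integrable_opnorm]])
      (rule mtrace_le_opnorm[OF finI neI symX])
  also have "\<dots> = real (card I) * mean_opnorm" by (simp add: mean_opnorm_def)
  finally show ?thesis using card_pos by simp
qed

text \<open>A large power of the matrix is needed for the trace moment to see the norm: the dimension contributes a factor
  \<open>(2 * k * n) powr (1 / (2 * p))\<close>. The interpolation error is at most of order \<open>p\<^sup>4 / sqrt n\<close> and enters divided by \<open>2 * p\<close>; \<open>p = n powr (1 / 8)\<close> makes both small.\<close>

definition power_exponent :: "nat \<Rightarrow> nat" where "power_exponent n = nat \<lceil>real n powr (1/8)\<rceil> + 1"

lemma power_exponent_bounds:
  assumes "n \<ge> 1"
  shows "2 \<le> power_exponent n" "real n powr (1/8) \<le> real (power_exponent n)" "real (power_exponent n) \<le> 3 * real n powr (1/8)"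
proof -
  define x where "x = real n powr (1/8)"
  have x: "1 \<le> x" using assms by (simp add: x_def ge_one_powr_ge_zero)
  have c: "1 \<le> \<lceil>x\<rceil>" using x by linarith
  have e: "real (nat \<lceil>x\<rceil>) = of_int \<lceil>x\<rceil>" using c by simp
  have "1 \<le> nat \<lceil>x\<rceil>" using c by linarith
  then show "2 \<le> power_exponent n" by (simp add: power_exponent_def x_def)
  show "real n powr (1/8) \<le> real (power_exponent n)" "real (power_exponent n) \<le> 3 * real n powr (1/8)"
    unfolding power_exponent_def x_def[symmetric] of_nat_add e using x by linarith+
qed

context model2 begin

definition mean_norm :: "'w measure \<Rightarrow> (nat \<times> 'p \<times> 'p \<Rightarrow> 'w \<Rightarrow> real) \<Rightarrow> 'p set \<Rightarrow> ('p \<Rightarrow> 'p \<Rightarrow> real) \<Rightarrow> real" where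
  "mean_norm M g P s = integral\<^sup>L M (\<lambda>\<omega>. opnorm (block_index k P) (XX P (\<lambda>e. entry_scale s e * g e \<omega>)))"

definition err :: "nat \<Rightarrow> nat \<Rightarrow> real" where
  "err n p = ln (2 * real k * real n) / (2 * real p) + 128 * bessel_const (1 / real n) * (real p)^2"

abbreviation sc :: "nat \<Rightarrow> 'p \<Rightarrow> 'p \<Rightarrow> real" where "sc n \<equiv> (\<lambda>_ _. sqrt (1 / real n))"

lemma gmatm_sc:
  assumes g: "gaussian_family M g (noise_index l Q)" and Q: "finite Q" "card Q = n" and n: "n \<ge> 1"
  shows "gmatm M g (noise_index l Q) (block_index k Q) (XX Q) (noise_coeff A) (entry_scale (sc n)) (bessel_const (1 / real n))"
  by (rule gmatm_model[OF trB g Q(1)]) (use Q n in auto)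

lemma two_k_n: "n \<ge> 1 \<Longrightarrow> 1 \<le> 2 * real k * real n"
proof -
  assume "n \<ge> 1"
  then have "1 * 1 \<le> real k * real n" using k1 by (intro mult_mono) auto
  then show ?thesis by simp
qed

lemma bessel_const_nonneg: "0 \<le> b \<Longrightarrow> 0 \<le> bessel_const b" by (simp add: bessel_const_def hsA_nonneg)

lemma mean_norm_trace_moment:
  assumes g: "gaussian_family M g (noise_index l Q)" and Q: "finite Q" "card Q = n" and n: "n \<ge> 1"
    and p: "p \<ge> 2" and small: "128 * bessel_const (1 / real n) * (real p)^2 \<le> 1"
  shows "1 \<le> mean_norm M g Q (sc n)"
    "ln (mean_norm M g Q (sc n)) \<le> ln (trace_moment M g Q (sc n) p) / (2 * real p)"
    "ln (trace_moment M g Q (sc n) p) / (2 * real p) \<le> ln (mean_norm M g Q (sc n)) + err n p"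
proof -
  interpret gmatm M g "noise_index l Q" "block_index k Q" "XX Q" "noise_coeff A" "entry_scale (sc n)" "bessel_const (1 / real n)"
    by (rule gmatm_sc[OF g Q n])
  have E: "trace_moment M g Q (sc n) p = avg (V p)" by (simp add: trace_moment_def avg_def V_def[abs_def] scaled_def)
  have T: "mean_norm M g Q (sc n) = mean_opnorm" by (simp add: mean_norm_def mean_opnorm_def scaled_def)
  have th1: "1 \<le> mean_opnorm" by (rule mean_opnorm_ge1)
  show "1 \<le> mean_norm M g Q (sc n)" using th1 T by simp
  have E1: "1 \<le> avg (V p)" by (rule trace_moment_ge(2)[OF p])
  have p0: "0 < 2*p" using p by simp
  have "ln mean_opnorm \<le> ln (root (2*p) (avg (V p)))"
    using mean_opnorm_upper[OF p] th1 by (intro ln_mono) auto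
  also have "\<dots> = ln (avg (V p)) / real (2*p)" using E1 p0 by (intro ln_root) auto
  finally show "ln (mean_norm M g Q (sc n)) \<le> ln (trace_moment M g Q (sc n) p) / (2 * real p)" by (simp add: E T)
  define x where "x = 64 * bessel_const (1 / real n) * (real p)^2"
  have x: "0 \<le> x" "x \<le> 1/2" using small kappa_nonneg by (auto simp: x_def)
  have s16: "16 * bessel_const (1 / real n) * (real p)^2 \<le> 1" using x by (simp add: x_def)
  define c where "c = 2 * real (card (block_index k Q))"
  have c0: "0 < c" using card_pos by (simp add: c_def)
  define t where "t = root (2*p) (avg (V p) / c)"
  have t0: "0 < t" unfolding t_def using E1 c0 p0 by (intro real_root_gt_zero) auto
  have "(1 - x) * t \<le> mean_opnorm" using mean_opnorm_lower[OF p s16] by (simp add: x_def t_def c_def)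
  then have "ln ((1 - x) * t) \<le> ln mean_opnorm" using x t0 by (intro ln_mono) auto
  moreover have "ln ((1 - x) * t) = ln (1 - x) + ln t" using x t0 by (simp add: ln_mult)
  moreover have "ln t = (ln (avg (V p)) - ln c) / real (2*p)"
    unfolding t_def using E1 c0 p0 by (subst ln_root) (auto simp: ln_div)
  moreover have "- 2 * x \<le> ln (1 - x)"
  proof -
    have "- x - 2 * x^2 \<le> ln (1 - x)" by (rule ln_one_minus_pos_lower_bound[OF x])
    moreover have "2 * x^2 \<le> x" using mult_right_mono[OF x(2) x(1)] by (simp add: power2_eq_square)
    ultimately show ?thesis by linarith
  qed
  moreover have "c = 2 * real k * real n" by (simp add: c_def card_block_index Q)
  ultimately show "ln (trace_moment M g Q (sc n) p) / (2 * real p) \<le> ln (mean_norm M g Q (sc n)) + err n p"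
    by (simp add: E T err_def x_def diff_divide_distrib)
qed

definition law_error :: "nat \<Rightarrow> nat \<Rightarrow> real" where
  "law_error N n = 2 * err n (power_exponent n) + ln (real N) / (2 * real (power_exponent n)) + ln (real N) / (2 * real (power_exponent n)) + interp_const N n (power_exponent n) / (2 * real (power_exponent n))"

lemma smallness: "eventually (\<lambda>n. 128 * bessel_const (1 / real n) * (real (power_exponent n))^2 \<le> 1) sequentially"
proof -
  have "((\<lambda>n. (256 * hsA k l A * 9) * ((real n powr (1/8))^2 / real n)) \<longlongrightarrow> (256 * hsA k l A * 9) * 0) sequentially"
    by (intro tendsto_mult tendsto_const) real_asymp
  then have "((\<lambda>n. (256 * hsA k l A * 9) * ((real n powr (1/8))^2 / real n)) \<longlongrightarrow> 0) sequentially" by simp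
  then have "eventually (\<lambda>n. (256 * hsA k l A * 9) * ((real n powr (1/8))^2 / real n) < 1) sequentially"
    by (rule order_tendstoD(2)) simp
  then show ?thesis
    using eventually_ge_at_top[of 1]
  proof eventually_elim
    case (elim n)
    have "(real (power_exponent n))^2 \<le> (3 * real n powr (1/8))^2" using power_exponent_bounds[OF elim(2)] by (intro power_mono) auto
    then have "128 * bessel_const (1 / real n) * (real (power_exponent n))^2 \<le> 128 * bessel_const (1 / real n) * (3 * real n powr (1/8))^2"
      by (intro mult_left_mono) (auto intro!: mult_nonneg_nonneg bessel_const_nonneg)
    also have "\<dots> = (256 * hsA k l A * 9) * ((real n powr (1/8))^2 / real n)"
      by (simp add: bessel_const_def power_mult_distrib)
    finally show ?case using elim(1) by linarith
  qed
qed

lemma EB_small: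
  assumes N: "N \<ge> 1"
  shows "eventually (\<lambda>n. law_error N n \<le> real n powr (-1/16)) sequentially"
proof -
  define h where "h = hsA k l A"
  have h0: "0 \<le> h" by (simp add: h_def hsA_nonneg)
  let ?x = "\<lambda>n. real n powr (1/8)"
  define F where "F = (\<lambda>n. (ln (2 * real k) + ln (real N) + ln (real n)) / ?x n + (256 * h * 18) * ((?x n)^2 / real n)
     + (real k)^2 * h * ((3 * (16 * h * 9) * (1 + real N)) * ((?x n)^3 / real n) + (6 * sqrt (real k * real N)) * (?x n * sqrt (real n) / real n)))"
  have "((\<lambda>n. real n powr (1/16) * F n) \<longlongrightarrow> 0) sequentially"
  proof -
    have "((\<lambda>n. (ln (2 * real k) + ln (real N)) * (real n powr (1/16) / ?x n) + real n powr (1/16) * ln (real n) / ?x n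
       + (256 * h * 18) * (real n powr (1/16) * ((?x n)^2 / real n))
     + (real k)^2 * h * ((3 * (16 * h * 9) * (1 + real N)) * (real n powr (1/16) * ((?x n)^3 / real n))
        + (6 * sqrt (real k * real N)) * (real n powr (1/16) * (?x n * sqrt (real n) / real n))))
      \<longlongrightarrow> (ln (2 * real k) + ln (real N)) * 0 + 0 + (256 * h * 18) * 0
        + (real k)^2 * h * ((3 * (16 * h * 9) * (1 + real N)) * 0 + (6 * sqrt (real k * real N)) * 0)) sequentially"
    proof (intro tendsto_add tendsto_mult tendsto_const)
      show "(\<lambda>n. real n powr (1/16) / ?x n) \<longlonglongrightarrow> 0" by real_asymp
      show "(\<lambda>n. real n powr (1/16) * ln (real n) / ?x n) \<longlonglongrightarrow> 0" by real_asymp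
      show "(\<lambda>n. real n powr (1/16) * ((?x n)^2 / real n)) \<longlonglongrightarrow> 0" by real_asymp
      show "(\<lambda>n. real n powr (1/16) * ((?x n)^3 / real n)) \<longlonglongrightarrow> 0" by real_asymp
      show "(\<lambda>n. real n powr (1/16) * (?x n * sqrt (real n) / real n)) \<longlonglongrightarrow> 0" by real_asymp
    qed
    moreover have "real n powr (1/16) * F n = (ln (2 * real k) + ln (real N)) * (real n powr (1/16) / ?x n) + real n powr (1/16) * ln (real n) / ?x n
       + (256 * h * 18) * (real n powr (1/16) * ((?x n)^2 / real n))
     + (real k)^2 * h * ((3 * (16 * h * 9) * (1 + real N)) * (real n powr (1/16) * ((?x n)^3 / real n))
        + (6 * sqrt (real k * real N)) * (real n powr (1/16) * (?x n * sqrt (real n) / real n)))" for n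
      unfolding F_def by (simp add: algebra_simps add_divide_distrib)
    ultimately show ?thesis by simp
  qed
  then have "eventually (\<lambda>n. real n powr (1/16) * F n < 1) sequentially"
    by (rule order_tendstoD(2)) simp
  then show ?thesis
    using eventually_ge_at_top[of 1]
  proof eventually_elim
    case (elim n)
    define x where "x = ?x n"
    define q where "q = real (power_exponent n)"
    have n0: "0 < real n" using elim(2) by simp
    have x1: "1 \<le> x" using elim(2) by (simp add: x_def ge_one_powr_ge_zero)
    have q: "x \<le> q" "q \<le> 3 * x" "2 \<le> q" using power_exponent_bounds[OF elim(2)] by (auto simp: x_def q_def)
    have k0: "1 \<le> real k" using k1 by simp
    have lns: "0 \<le> ln (2 * real k)" "0 \<le> ln (real N)" "0 \<le> ln (real n)" using N k0 elim(2) by (auto intro!: ln_ge_zero)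
    have lnm: "ln (2 * real k * real n) = ln (2 * real k) + ln (real n)" using k0 n0 by (simp add: ln_mult)
    have e1: "2 * err n (power_exponent n) + ln (real N) / (2 * q) + ln (real N) / (2 * q)
       = (ln (2 * real k) + ln (real N) + ln (real n)) / q + 256 * bessel_const (1 / real n) * q^2"
    proof -
      have aux: "2 * ((a + b) / (2 * q) + 128 * z * w) + M / (2 * q) + M / (2 * q) = (a + M + b) / q + 256 * z * w" for a b z w M :: real
        using q by (simp add: field_simps)
      show ?thesis unfolding err_def q_def[symmetric] lnm by (rule aux)
    qed
    have e2: "(ln (2 * real k) + ln (real N) + ln (real n)) / q \<le> (ln (2 * real k) + ln (real N) + ln (real n)) / x"
      using lns q x1 by (intro divide_left_mono) auto
    have q2: "q^2 \<le> 9 * x^2" using power_mono[OF q(2), of 2] q by (simp add: power_mult_distrib)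
    have e3: "256 * bessel_const (1 / real n) * q^2 \<le> (256 * h * 18) * (x^2 / real n)"
    proof -
      have "256 * bessel_const (1 / real n) * q^2 \<le> 256 * bessel_const (1 / real n) * (9 * x^2)"
        using q2 by (intro mult_left_mono) (auto intro!: bessel_const_nonneg)
      then show ?thesis by (simp add: bessel_const_def h_def)
    qed
    have e4: "interp_const N n (power_exponent n) / (2 * q) \<le> (real k)^2 * h * ((3 * (16 * h * 9) * (1 + real N)) * (x^3 / real n) + (6 * sqrt (real k * real N)) * (x * sqrt (real n) / real n))"
    proof -
      have sq: "sqrt (real (k * (N * n))) = sqrt (real k * real N) * sqrt (real n)" by (simp add: real_sqrt_mult)
      define R where "R = (real k)^2 * h * (8 * bessel_const (1 / real n) * q^2 * (1 + real N) + (2 / real n) * sqrt (real (k * (N * n))))"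
      have R0: "0 \<le> R" unfolding R_def using h0 by (intro mult_nonneg_nonneg add_nonneg_nonneg) (auto intro!: bessel_const_nonneg)
      have r2: "real (2 * power_exponent n - 1) \<le> 2 * q" by (simp add: q_def)
      have "interp_const N n (power_exponent n) = q * real (2 * power_exponent n - 1) * R" by (simp add: interp_const_def R_def q_def h_def)
      also have "\<dots> \<le> q * (2 * q) * R" using r2 q R0 by (intro mult_right_mono mult_left_mono) auto
      finally have "interp_const N n (power_exponent n) / (2 * q) \<le> q * (2 * q) * R / (2 * q)" using q by (intro divide_right_mono) auto
      also have "\<dots> = q * R" using q by simp
      also have "\<dots> \<le> (3 * x) * ((real k)^2 * h * (8 * bessel_const (1 / real n) * (9 * x^2) * (1 + real N) + (2 / real n) * (sqrt (real k * real N) * sqrt (real n))))"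
        unfolding R_def sq using q q2 x1 h0
        by (intro mult_mono mult_left_mono add_mono mult_right_mono) (auto intro!: mult_nonneg_nonneg add_nonneg_nonneg bessel_const_nonneg)
      also have "\<dots> = (real k)^2 * h * ((3 * (16 * h * 9) * (1 + real N)) * (x^3 / real n) + (6 * sqrt (real k * real N)) * (x * sqrt (real n) / real n))"
        using n0 by (simp add: bessel_const_def h_def[symmetric] power2_eq_square power3_eq_cube) (simp add: field_simps)
      finally show ?thesis .
    qed
    have "law_error N n \<le> F n"
      using e1 e2 e3 e4 unfolding law_error_def F_def q_def[symmetric] x_def[symmetric] by linarith
    also have "F n \<le> real n powr (-1/16)"
    proof -
      have pos: "0 < real n powr (1/16)" using n0 by simp
      have "real n powr (-1/16) = 1 / real n powr (1/16)" using n0 by (simp add: powr_minus_divide)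
      moreover have "F n \<le> 1 / real n powr (1/16)" using elim(1) pos by (simp add: field_simps)
      ultimately show ?thesis by simp
    qed
    finally show ?case .
  qed
qed

lemma mean_norm_same_size:
  assumes g: "gaussian_family M g (noise_index l Q)" and Q: "finite Q" "card Q = n"
    and g': "gaussian_family M' g' (noise_index l Q')" and Q': "finite Q'" "card Q' = n" and n: "n \<ge> 1"
    and small: "128 * bessel_const (1 / real n) * (real (power_exponent n))^2 \<le> 1"
  shows "ln (mean_norm M g Q (sc n)) \<le> ln (mean_norm M' g' Q' (sc n)) + law_error 1 n"
proof -
  have p: "2 \<le> power_exponent n" by (rule power_exponent_bounds(1)[OF n])
  obtain \<pi> where \<pi>: "bij_betw \<pi> Q' Q" using finite_same_card_bij[of Q' Q] Q Q' by auto
  have eq: "trace_moment M g Q (sc n) (power_exponent n) = trace_moment M' g' Q' (sc n) (power_exponent n)"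
    by (rule trace_moment_law[OF g' g \<pi>]) (use Q' n in auto)
  have e0: "0 \<le> err n (power_exponent n)"
    unfolding err_def using k1 n by (intro add_nonneg_nonneg divide_nonneg_nonneg mult_nonneg_nonneg bessel_const_nonneg ln_ge_zero two_k_n) auto
  have K0: "0 \<le> interp_const 1 n (power_exponent n)"
    unfolding interp_const_def by (intro mult_nonneg_nonneg add_nonneg_nonneg bessel_const_nonneg hsA_nonneg) auto
  have "err n (power_exponent n) \<le> law_error 1 n" using e0 K0 by (simp add: law_error_def)
  with mean_norm_trace_moment(2)[OF g Q n p small] mean_norm_trace_moment(3)[OF g' Q' n p small] show ?thesis unfolding eq by linarith
qed

text \<open>The mean norms in dimensions \<open>n\<close> and \<open>n * N\<close> agree up to \<open>law_error\<close>: compare both with their trace moments and these by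
  interpolation.\<close>

lemma mean_norm_multiple:
  assumes g: "gaussian_family M g (noise_index l Q)" and Q: "finite Q" "card Q = n"
    and g': "gaussian_family M' g' (noise_index l Q')" and Q': "finite Q'" "card Q' = n * N" and n: "n \<ge> 1" "N \<ge> 1"
    and small: "128 * bessel_const (1 / real n) * (real (power_exponent n))^2 \<le> 1"
  shows "\<bar>ln (mean_norm M' g' Q' (sc (n * N))) - ln (mean_norm M g Q (sc n))\<bar> \<le> law_error N n"
proof -
  define p where "p = power_exponent n"
  have p: "2 \<le> p" unfolding p_def by (rule power_exponent_bounds(1)[OF n(1)])
  have nN: "n * N \<ge> 1" using n by simp
  have "bessel_const (1 / real (n * N)) \<le> bessel_const (1 / real n)"
    unfolding bessel_const_def using n hsA_nonneg by (intro mult_left_mono) (auto simp: field_simps)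
  then have "128 * bessel_const (1 / real (n * N)) * (real p)^2 \<le> 128 * bessel_const (1 / real n) * (real p)^2"
    by (intro mult_right_mono) auto
  then have smallN: "128 * bessel_const (1 / real (n * N)) * (real p)^2 \<le> 1" using small by (simp add: p_def)
  have small16: "16 * bessel_const (1 / real n) * (real p)^2 \<le> 1"
    using small bessel_const_nonneg[of "1 / real n"] by (simp add: p_def)
  obtain \<pi> where \<pi>: "bij_betw \<pi> (grid N n) Q'"
    using finite_same_card_bij[of "grid N n" Q'] Q' by (auto simp: grid_props mult.commute)
  have gl: "gaussian_family M' (\<lambda>e. g' (relabel \<pi> e)) (noise_index l (grid N n))"
    by (rule gaussian_family_relabel[OF g']) (use \<pi> in \<open>auto simp: bij_betw_def\<close>)
  have eq: "trace_moment M' g' Q' (sc (n * N)) p = trace_moment M' (\<lambda>e. g' (relabel \<pi> e)) (grid N n) (sc (n * N)) p"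
    by (rule trace_moment_law[OF gl g' \<pi>]) (use grid_props(1)[of N n] grid_props(2)[OF n] in auto)
  have I: "\<bar>ln (trace_moment M' g' Q' (sc (n * N)) p) - ln (real N * trace_moment M g Q (sc n) p)\<bar> \<le> interp_const N n p"
    using interp_ln[OF gl n g Q p small16] unfolding eq by simp
  have EVp: "1 \<le> trace_moment M g Q (sc n) p" by (rule trace_moment_ge1[OF g Q(1) _ p]) (use Q n in auto)
  have lnN: "ln (real N * trace_moment M g Q (sc n) p) = ln (real N) + ln (trace_moment M g Q (sc n) p)"
    using n EVp by (simp add: ln_mult)
  have I2: "\<bar>ln (trace_moment M' g' Q' (sc (n * N)) p) / (2 * real p) - ln (trace_moment M g Q (sc n) p) / (2 * real p) - ln (real N) / (2 * real p)\<bar> \<le> interp_const N n p / (2 * real p)"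
  proof -
    define d where "d = 2 * real p"
    have d: "0 < d" using p by (simp add: d_def)
    have div: "\<bar>u / d - v / d - w / d\<bar> \<le> z / d" if "\<bar>u - (w + v)\<bar> \<le> z" for u v w z
    proof -
      have "u / d - v / d - w / d = (u - (w + v)) / d" by (simp add: diff_divide_distrib add_divide_distrib)
      then have "\<bar>u / d - v / d - w / d\<bar> = \<bar>u - (w + v)\<bar> / d" using d by (simp only: abs_divide abs_of_pos)
      then show ?thesis using that d by (simp add: divide_right_mono)
    qed
    show ?thesis using lnN unfolding d_def[symmetric] using I by (intro div) simp
  qed
  note a = mean_norm_trace_moment(2,3)[OF g Q n(1) p small[folded p_def]]
  note b = mean_norm_trace_moment(2,3)[OF g' Q' nN p smallN]
  have errN: "err (n * N) p \<le> err n p + ln (real N) / (2 * real p)"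
  proof -
    have "ln (2 * real k * real (n * N)) = ln (2 * real k * real n) + ln (real N)"
      using n k1 by (simp add: ln_mult)
    then have "ln (2 * real k * real (n * N)) / (2 * real p) = ln (2 * real k * real n) / (2 * real p) + ln (real N) / (2 * real p)"
      by (simp add: add_divide_distrib)
    moreover have "128 * bessel_const (1 / real (n * N)) * (real p)^2 \<le> 128 * bessel_const (1 / real n) * (real p)^2" by fact
    ultimately show ?thesis unfolding err_def by linarith
  qed
  have e0: "0 \<le> err n p"
    unfolding err_def using k1 n by (intro add_nonneg_nonneg divide_nonneg_nonneg mult_nonneg_nonneg bessel_const_nonneg ln_ge_zero two_k_n) auto
  have l0: "0 \<le> ln (real N) / (2 * real p)" using n by simp
  show ?thesis unfolding law_error_def p_def[symmetric] using a b I2 errN e0 l0 by linarith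
qed

definition entry_sum :: real where "entry_sum = (\<Sum>a<k. \<Sum>b<k. \<bar>B a b\<bar>)"

lemma qform_B:
  assumes P: "finite P"
  shows "\<bar>qform (block_index k P) (\<lambda>(a,u) (b,v). B a b * kdelta u v) w\<bar> \<le> entry_sum * sqnorm (block_index k P) w"
proof -
  have 1: "qform (block_index k P) (\<lambda>(a,u) (b,v). B a b * kdelta u v) w = (\<Sum>a<k. \<Sum>u\<in>P. \<Sum>b<k. w (a,u) * B a b * w (b,u))"
  proof -
    have "qform (block_index k P) (\<lambda>(a,u) (b,v). B a b * kdelta u v) w
      = (\<Sum>a<k. \<Sum>u\<in>P. \<Sum>b<k. \<Sum>v\<in>P. kdelta u v * (w (a,u) * B a b * w (b,v)))"
      unfolding qform_def sum_block_index by (intro sum.cong refl) (simp add: mult_ac)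
    also have "\<dots> = (\<Sum>a<k. \<Sum>u\<in>P. \<Sum>b<k. w (a,u) * B a b * w (b,u))"
      using P by (intro sum.cong refl) (simp add: sum_delta_l)
    finally show ?thesis .
  qed
  have s1: "(\<Sum>u\<in>P. (w (a,u))^2) \<le> sqnorm (block_index k P) w" if "a < k" for a
    unfolding sqnorm_def sum_block_index using that
    by (intro member_le_sum[of a "{..<k}" "\<lambda>a. \<Sum>u\<in>P. (w (a,u))^2"]) (auto intro: sum_nonneg)
  have "\<bar>qform (block_index k P) (\<lambda>(a,u) (b,v). B a b * kdelta u v) w\<bar> \<le> (\<Sum>a<k. \<Sum>u\<in>P. \<Sum>b<k. \<bar>B a b\<bar> * (((w (a,u))^2 + (w (b,u))^2) / 2))"
    unfolding 1
  proof (intro order_trans[OF sum_abs] sum_mono)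
    fix a u b
    have "\<bar>w (a,u) * w (b,u)\<bar> \<le> ((w (a,u))^2 + (w (b,u))^2) / 2"
      using sum_squares_bound[of "\<bar>w (a,u)\<bar>" "\<bar>w (b,u)\<bar>"] by (simp add: abs_mult)
    then have "\<bar>B a b\<bar> * \<bar>w (a,u) * w (b,u)\<bar> \<le> \<bar>B a b\<bar> * (((w (a,u))^2 + (w (b,u))^2) / 2)"
      by (intro mult_left_mono) auto
    then show "\<bar>w (a,u) * B a b * w (b,u)\<bar> \<le> \<bar>B a b\<bar> * (((w (a,u))^2 + (w (b,u))^2) / 2)"
      by (simp add: abs_mult mult_ac)
  qed
  also have "\<dots> = (\<Sum>a<k. \<Sum>b<k. \<Sum>u\<in>P. \<bar>B a b\<bar> * (((w (a,u))^2 + (w (b,u))^2) / 2))"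
    by (intro sum.cong refl sum.swap)
  also have "\<dots> = (\<Sum>a<k. \<Sum>b<k. \<bar>B a b\<bar> * (((\<Sum>u\<in>P. (w (a,u))^2) + (\<Sum>u\<in>P. (w (b,u))^2)) / 2))"
    by (simp only: sum_distrib_left[symmetric] sum_divide_distrib[symmetric] sum.distrib)
  also have "\<dots> \<le> (\<Sum>a<k. \<Sum>b<k. \<bar>B a b\<bar> * sqnorm (block_index k P) w)"
  proof (intro sum_mono mult_left_mono)
    fix a b assume "a \<in> {..<k}" "b \<in> {..<k}"
    then show "((\<Sum>u\<in>P. (w (a,u))^2) + (\<Sum>u\<in>P. (w (b,u))^2)) / 2 \<le> sqnorm (block_index k P) w"
      using s1[of a] s1[of b] by simp
  qed simp
  finally show ?thesis by (simp add: entry_sum_def sum_distrib_right)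
qed

text \<open>Up to the deterministic part, the model of size \<open>n\<close> is a rescaled principal submatrix of the model of size \<open>m\<close>, and passing to
  a principal submatrix does not increase the norm.\<close>

lemma mean_norm_sub:
  assumes g: "gaussian_family M g (noise_index l {..<m})" and nm: "1 \<le> n" "n \<le> m"
  defines "r \<equiv> sqrt (real m / real n)"
  shows "mean_norm M g {..<n} (sc n) \<le> r * mean_norm M g {..<m} (sc m) + (r - 1) * entry_sum"
proof -
  have gn: "gaussian_family M g (noise_index l {..<n})"
  proof -
    have "noise_index l {..<n} \<subseteq> noise_index l {..<m}" using nm by (auto simp: noise_index_def)
    then show ?thesis using gaussian_family_inj[OF g, of "\<lambda>e. e" "noise_index l {..<n}"] by simp
  qed
  interpret m: gmatm M g "noise_index l {..<m}" "block_index k {..<m}" "XX {..<m}" "noise_coeff A" "entry_scale (sc m)" "bessel_const (1 / real m)"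
    by (rule gmatm_sc[OF g]) (use nm in auto)
  interpret n: gmatm M g "noise_index l {..<n}" "block_index k {..<n}" "XX {..<n}" "noise_coeff A" "entry_scale (sc n)" "bessel_const (1 / real n)"
    by (rule gmatm_sc[OF gn]) (use nm in auto)
  have r1: "1 \<le> r" using nm by (simp add: r_def)
  have rs: "sqrt (1 / real n) = r * sqrt (1 / real m)"
    using nm by (simp add: r_def real_sqrt_divide)
  define Bm where "Bm = (\<lambda>(a,u::nat) (b,v). B a b * kdelta u v)"
  have pw: "opnorm (block_index k {..<n}) (XX {..<n} (n.scaled \<omega>)) \<le> r * opnorm (block_index k {..<m}) (XX {..<m} (m.scaled \<omega>)) + (r - 1) * entry_sum" for \<omega>
  proof (rule opnorm_le[OF n.finI n.neI n.symX])
    fix v assume v: "sqnorm (block_index k {..<n}) v = 1"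
    have "qform (block_index k {..<n}) (XX {..<n} (n.scaled \<omega>)) v
      = qform (block_index k {..<n}) (\<lambda>i j. r * XX {..<m} (m.scaled \<omega>) i j + (1 - r) * Bm i j) v"
    proof (rule qform_cong)
      fix i j assume ij: "i \<in> block_index k {..<n}" "j \<in> block_index k {..<n}"
      obtain a u b v where e: "i = (a,u)" "j = (b,v)" by (cases i, cases j) auto
      have uv: "u < n" "v < n" "u < m" "v < m" using ij nm by (auto simp: e block_index_def)
      have "(\<Sum>i\<in>{1..l}. A i a b * ((n.scaled \<omega> (i,u,v) + n.scaled \<omega> (i,v,u)) / sqrt 2))
        = r * (\<Sum>i\<in>{1..l}. A i a b * ((m.scaled \<omega> (i,u,v) + m.scaled \<omega> (i,v,u)) / sqrt 2))"
      proof -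
        have nsx: "n.scaled \<omega> (i,u,v) = r * m.scaled \<omega> (i,u,v)" for i u v
          unfolding n.scaled_def m.scaled_def unfolding entry_scale_def prod.case rs mult.assoc ..
        show ?thesis unfolding sum_distrib_left nsx
          by (intro sum.cong refl) (simp add: distrib_left mult_ac)
      qed
      then show "XX {..<n} (n.scaled \<omega>) i j = r * XX {..<m} (m.scaled \<omega>) i j + (1 - r) * Bm i j"
        using uv by (simp add: e gauss_mat_simp Bm_def algebra_simps)
    qed
    also have "\<dots> = r * qform (block_index k {..<n}) (XX {..<m} (m.scaled \<omega>)) v + (1 - r) * qform (block_index k {..<n}) Bm v"
      by (simp only: qform_add qform_scale)
    finally have "\<bar>qform (block_index k {..<n}) (XX {..<n} (n.scaled \<omega>)) v\<bar> \<le> r * \<bar>qform (block_index k {..<n}) (XX {..<m} (m.scaled \<omega>)) v\<bar> + (r - 1) * \<bar>qform (block_index k {..<n}) Bm v\<bar>"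
      using r1 abs_triangle_ineq[of "r * qform (block_index k {..<n}) (XX {..<m} (m.scaled \<omega>)) v" "(1 - r) * qform (block_index k {..<n}) Bm v"]
      by (simp add: abs_mult)
    also have "\<dots> \<le> r * opnorm (block_index k {..<m}) (XX {..<m} (m.scaled \<omega>)) + (r - 1) * entry_sum"
    proof (intro add_mono mult_left_mono)
      have sub: "block_index k {..<n} \<subseteq> block_index k {..<m}" using nm by (auto simp: block_index_def)
      then have sy: "symm (block_index k {..<n}) (XX {..<m} (m.scaled \<omega>))" using m.symX[of "m.scaled \<omega>"] by (auto simp: symm_def)
      show "\<bar>qform (block_index k {..<n}) (XX {..<m} (m.scaled \<omega>)) v\<bar> \<le> opnorm (block_index k {..<m}) (XX {..<m} (m.scaled \<omega>))"
        using abs_qform_le[OF n.finI n.neI sy, of v] opnorm_subset[OF m.finI sub n.neI m.symX, of "m.scaled \<omega>"] v by simp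
      show "\<bar>qform (block_index k {..<n}) Bm v\<bar> \<le> entry_sum" using qform_B[of "{..<n}" v] v by (simp add: Bm_def)
    qed (use r1 in auto)
    finally show "\<bar>qform (block_index k {..<n}) (XX {..<n} (n.scaled \<omega>)) v\<bar> \<le> r * opnorm (block_index k {..<m}) (XX {..<m} (m.scaled \<omega>)) + (r - 1) * entry_sum" .
  qed
  have "mean_norm M g {..<n} (sc n) = integral\<^sup>L M (\<lambda>\<omega>. opnorm (block_index k {..<n}) (XX {..<n} (n.scaled \<omega>)))" by (simp add: mean_norm_def n.scaled_def)
  also have "\<dots> \<le> integral\<^sup>L M (\<lambda>\<omega>. r * opnorm (block_index k {..<m}) (XX {..<m} (m.scaled \<omega>)) + (r - 1) * entry_sum)"
    by (rule integral_mono[OF n.integrable_opnorm _ pw])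
      (intro Bochner_Integration.integrable_add integrable_mult_right m.integrable_opnorm, simp)
  also have "\<dots> = r * mean_norm M g {..<m} (sc m) + (r - 1) * entry_sum"
    using m.integrable_opnorm by (simp add: mean_norm_def m.scaled_def m.prob_space)
  finally show ?thesis .
qed

end

lemma dyadic_approx:
  assumes "N0 \<ge> (1::nat)" "m \<ge> N0"
  shows "\<exists>N b. N0 \<le> N \<and> N < 2 * N0 \<and> N * 2^b \<le> m \<and> m < (N + 1) * 2^b"
proof -
  define S where "S = {b::nat. N0 * 2^b \<le> m}"
  have b_le: "b \<le> m" if "b \<in> S" for b
  proof -
    have "b < 2^b" by simp
    also have "2^b \<le> N0 * 2^b" using assms by simp
    finally show ?thesis using that by (simp add: S_def)
  qed
  have fin: "finite S" by (rule finite_subset[of _ "{..m}"]) (use b_le in auto)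
  have "0 \<in> S" using assms by (simp add: S_def)
  then have ne: "S \<noteq> {}" by auto
  define b where "b = Max S"
  have bS: "b \<in> S" unfolding b_def by (rule Max_in[OF fin ne])
  have "Suc b \<notin> S" using Max_ge[OF fin, of "Suc b"] by (auto simp: b_def[symmetric])
  then have up: "m < N0 * 2^Suc b" by (simp add: S_def)
  define N where "N = m div 2^b"
  have "N0 \<le> N" unfolding N_def using bS by (simp add: S_def less_eq_div_iff_mult_less_eq)
  moreover have "N < 2 * N0" unfolding N_def using up by (simp add: div_less_iff_less_mult mult_ac)
  moreover have "N * 2^b \<le> m" unfolding N_def by simp
  moreover have "m < (N + 1) * 2^b" unfolding N_def
    using dividend_less_div_times[of "2^b" m] by (simp add: add.commute)
  ultimately show ?thesis by blast
qed

text \<open>The probability spaces for different \<open>n\<close> are unrelated; different dimensions are compared through moments only.\<close>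

locale gseq = model2 +
  fixes M :: "nat \<Rightarrow> 'w measure" and g :: "nat \<Rightarrow> nat \<times> nat \<times> nat \<Rightarrow> 'w \<Rightarrow> real"
  assumes gs: "\<And>n. n \<ge> 1 \<Longrightarrow> gaussian_family (M n) (g n) (noise_index l {..<n})"
begin

definition edge_seq :: "nat \<Rightarrow> real" where "edge_seq n = mean_norm (M n) (g n) {..<n} (sc n)"

lemma edge_seq_multiple:
  assumes N: "N \<ge> 1"
  shows "eventually (\<lambda>n. \<bar>ln (edge_seq (n * N)) - ln (edge_seq n)\<bar> \<le> real n powr (-1/16)) sequentially"
  using EB_small[OF N] smallness eventually_ge_at_top[of 1]
proof eventually_elim
  case (elim n)
  have nN: "n * N \<ge> 1" using elim N by simp
  have "\<bar>ln (edge_seq (n * N)) - ln (edge_seq n)\<bar> \<le> law_error N n"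
    unfolding edge_seq_def using mean_norm_multiple[OF gs[OF elim(3)] _ _ gs[OF nN] _ _ elim(3) N elim(2)] by simp
  then show ?case using elim by linarith
qed

lemma edge_seq_ge1: "eventually (\<lambda>n. 1 \<le> edge_seq n) sequentially"
  using smallness eventually_ge_at_top[of 1]
proof eventually_elim
  case (elim n)
  show ?case unfolding edge_seq_def
    by (rule mean_norm_trace_moment(1)[OF gs[OF elim(2)] _ _ elim(2) power_exponent_bounds(1)[OF elim(2)] elim(1)]) auto
qed

lemma edge_seq_sub:
  "eventually (\<lambda>n. \<forall>m\<ge>n. ln (edge_seq n) \<le> ln (edge_seq m) + real n powr (-1/16) + (sqrt (real m / real n) - 1) * (1 + entry_sum)) sequentially"
proof -
  obtain n1 where n1: "\<And>n. n \<ge> n1 \<Longrightarrow> 1 \<le> edge_seq n" using edge_seq_ge1 by (auto simp: eventually_sequentially)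
  show ?thesis
    using EB_small[OF order_refl] smallness eventually_ge_at_top[of "max 1 n1"]
  proof eventually_elim
    case (elim n)
    have n: "n \<ge> 1" using elim by simp
    show ?case
    proof (intro allI impI)
      fix m assume m: "m \<ge> n"
      define r where "r = sqrt (real m / real n)"
      have r1: "1 \<le> r" using n m by (simp add: r_def)
      have thm1: "1 \<le> edge_seq m" using n1 elim m by simp
      have gm: "gaussian_family (M m) (g m) (noise_index l {..<m})" using gs n m by simp
      have sub: "noise_index l {..<n} \<subseteq> noise_index l {..<m}" using m by (auto simp: noise_index_def)
      have gn: "gaussian_family (M m) (g m) (noise_index l {..<n})"
        using gaussian_family_inj[OF gm, of "\<lambda>e. e" "noise_index l {..<n}"] sub by simp
      define t where "t = mean_norm (M m) (g m) {..<n} (sc n)"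
      have t1: "1 \<le> t" unfolding t_def
        by (rule mean_norm_trace_moment(1)[OF gn _ _ n power_exponent_bounds(1)[OF n] elim(2)]) auto
      have 1: "ln (edge_seq n) \<le> ln t + law_error 1 n"
        unfolding edge_seq_def t_def by (rule mean_norm_same_size[OF gs[OF n] _ _ gn _ _ n elim(2)]) auto
      have bB0: "0 \<le> entry_sum" by (simp add: entry_sum_def sum_nonneg)
      have "t \<le> r * edge_seq m + (r - 1) * entry_sum"
        unfolding t_def edge_seq_def r_def by (rule mean_norm_sub[OF gm n m])
      also have "\<dots> \<le> r * edge_seq m + (r - 1) * (entry_sum * edge_seq m)"
        using r1 bB0 thm1 by (intro add_left_mono mult_left_mono) (auto simp: mult_le_cancel_left1)
      also have "\<dots> = edge_seq m * (1 + (r - 1) * (1 + entry_sum))" by (simp add: algebra_simps)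
      finally have tle: "t \<le> edge_seq m * (1 + (r - 1) * (1 + entry_sum))" .
      have p: "0 \<le> (r - 1) * (1 + entry_sum)" using r1 bB0 by simp
      have "ln t \<le> ln (edge_seq m * (1 + (r - 1) * (1 + entry_sum)))" using tle t1 by (intro ln_mono) auto
      also have "\<dots> = ln (edge_seq m) + ln (1 + (r - 1) * (1 + entry_sum))" using thm1 p by (simp add: ln_mult)
      also have "\<dots> \<le> ln (edge_seq m) + (r - 1) * (1 + entry_sum)" using ln_add_one_self_le_self[OF p] by simp
      finally show "ln (edge_seq n) \<le> ln (edge_seq m) + real n powr (-1/16) + (sqrt (real m / real n) - 1) * (1 + entry_sum)"
        using 1 elim(1) by (simp add: r_def)
    qed
  qed
qed

text \<open>The errors for successive doublings form a geometric series because the exponent \<open>- 1 / 16\<close> is negative.\<close>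

lemma edge_seq_dyadic:
  "\<exists>S. eventually (\<lambda>n. \<forall>b. \<bar>ln (edge_seq (n * 2^b)) - ln (edge_seq n)\<bar> \<le> S * real n powr (-1/16)) sequentially"
proof -
  obtain n0 where n0: "\<And>n. n \<ge> n0 \<Longrightarrow> \<bar>ln (edge_seq (n * 2)) - ln (edge_seq n)\<bar> \<le> real n powr (-1/16)"
    using edge_seq_multiple[of 2] by (auto simp: eventually_sequentially)
  define q :: real where "q = 2 powr (-1/16)"
  have q: "0 < q" "q < 1" by (auto simp: q_def powr_less_one)
  define S where "S = 1 / (1 - q)"
  have "\<bar>ln (edge_seq (n * 2^b)) - ln (edge_seq n)\<bar> \<le> S * (1 - q^b) * real n powr (-1/16)" if n: "n \<ge> n0" for n b
  proof (induction b)
    case 0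
    then show ?case by simp
  next
    case (Suc b)
    have ge: "n * 2^b \<ge> n0" using n by (metis le_trans mult.right_neutral mult_le_mono2 one_le_numeral one_le_power)
    have "\<bar>ln (edge_seq (n * 2^b * 2)) - ln (edge_seq (n * 2^b))\<bar> \<le> real (n * 2^b) powr (-1/16)" by (rule n0[OF ge])
    also have "\<dots> = q^b * real n powr (-1/16)"
      by (simp add: powr_mult q_def powr_realpow[symmetric] powr_powr mult_ac)
    finally have "\<bar>ln (edge_seq (n * 2^Suc b)) - ln (edge_seq n)\<bar> \<le> S * (1 - q^b) * real n powr (-1/16) + q^b * real n powr (-1/16)"
      using Suc.IH by (simp add: mult_ac)
    also have "\<dots> = S * (1 - q^Suc b) * real n powr (-1/16)"
    proof -
      have "S * (1 - q^b) + q^b = S * (1 - q^Suc b)" using q by (simp add: S_def field_simps)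
      then show ?thesis by (metis distrib_right)
    qed
    finally show ?case .
  qed
  then have "\<bar>ln (edge_seq (n * 2^b)) - ln (edge_seq n)\<bar> \<le> S * real n powr (-1/16)" if n: "n \<ge> n0" for n b
  proof -
    have "S * (1 - q^b) * real n powr (-1/16) \<le> S * 1 * real n powr (-1/16)"
      using q by (intro mult_right_mono mult_left_mono) (auto simp: S_def)
    with \<open>\<And>n b. n \<ge> n0 \<Longrightarrow> \<bar>ln (edge_seq (n * 2^b)) - ln (edge_seq n)\<bar> \<le> S * (1 - q^b) * real n powr (-1/16)\<close>[OF n, of b]
    show ?thesis by linarith
  qed
  then show ?thesis by (intro exI[of _ S]) (auto simp: eventually_sequentially)
qed

text \<open>Comparison along multiples is uniform only in a bounded factor, and along powers of two. A general factor \<open>m\<close> lies between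
  \<open>N * 2 ^ b\<close> and \<open>(N + 1) * 2 ^ b\<close> with \<open>N \<ge> N0\<close>; the ratio of these is close to \<open>1\<close>, and the submatrix inequality fills the gap.\<close>

lemma edge_seq_product:
  "\<exists>S. \<forall>N0\<ge>1. eventually (\<lambda>n. \<forall>m\<ge>N0. \<bar>ln (edge_seq (n * m)) - ln (edge_seq n)\<bar> \<le> S * real n powr (-1/16) + (1 + entry_sum) / real N0) sequentially"
proof -
  obtain S where S: "eventually (\<lambda>n. \<forall>b. \<bar>ln (edge_seq (n * 2^b)) - ln (edge_seq n)\<bar> \<le> S * real n powr (-1/16)) sequentially"
    using edge_seq_dyadic by blast
  obtain n1 where n1: "\<And>n b. n \<ge> n1 \<Longrightarrow> \<bar>ln (edge_seq (n * 2^b)) - ln (edge_seq n)\<bar> \<le> S * real n powr (-1/16)"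
    using S by (auto simp: eventually_sequentially)
  obtain n2 where n2: "\<And>n m. n \<ge> n2 \<Longrightarrow> m \<ge> n \<Longrightarrow> ln (edge_seq n) \<le> ln (edge_seq m) + real n powr (-1/16) + (sqrt (real m / real n) - 1) * (1 + entry_sum)"
    using edge_seq_sub by (auto simp: eventually_sequentially)
  have S0: "0 \<le> S"
  proof -
    have "\<bar>ln (edge_seq (Suc n1 * 2^0)) - ln (edge_seq (Suc n1))\<bar> \<le> S * real (Suc n1) powr (-1/16)" by (rule n1) simp
    then show ?thesis by (simp add: zero_le_mult_iff)
  qed
  have bB0: "0 \<le> entry_sum" by (simp add: entry_sum_def sum_nonneg)
  have main: "eventually (\<lambda>n. \<forall>m\<ge>N0. \<bar>ln (edge_seq (n * m)) - ln (edge_seq n)\<bar> \<le> (S + 2) * real n powr (-1/16) + (1 + entry_sum) / real N0) sequentially"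
    if N0: "N0 \<ge> 1" for N0
  proof -
    have "eventually (\<lambda>n. \<forall>N\<in>{1..2*N0}. \<bar>ln (edge_seq (n * N)) - ln (edge_seq n)\<bar> \<le> real n powr (-1/16)) sequentially"
      by (rule eventually_ball_finite, simp, rule ballI, rule edge_seq_multiple, simp)
    then show ?thesis using eventually_ge_at_top[of "max 1 (max n1 n2)"]
    proof eventually_elim
      case (elim n)
      have n: "n \<ge> 1" "n \<ge> n1" "n \<ge> n2" using elim by auto
      let ?d = "real n powr (-1/16)"
      show ?case
      proof (intro allI impI)
        fix m assume "m \<ge> N0"
        from dyadic_approx[OF N0 this] obtain N b where Nb: "N0 \<le> N" "N < 2 * N0" "N * 2^b \<le> m" "m < (N + 1) * 2^b" by blast
        have N1: "1 \<le> N" "0 < real N" using Nb N0 by auto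
        have m1: "1 \<le> m" using Nb(3) N1 by (metis \<open>N0 \<le> m\<close> N0 le_trans)
        define u where "u = n * N * 2^b"
        define w where "w = n * (N + 1) * 2^b"
        have un: "n \<le> u" using N1 by (simp add: u_def mult.assoc)
        have um: "u \<le> n * m" using Nb(3) by (simp add: u_def mult.assoc)
        have mw: "n * m \<le> w" using Nb(4) by (simp add: w_def mult.assoc del: mult_Suc_right)
        have dmono: "real v powr (-1/16) \<le> ?d" if "v \<ge> n" for v
          using that n by (intro powr_mono2') auto
        have close: "\<bar>ln (edge_seq (n * N' * 2^b)) - ln (edge_seq n)\<bar> \<le> (S + 1) * ?d" if N': "N' \<in> {1..2*N0}" for N'
        proof -
          have nN: "n \<le> n * N'" using N' by simp
          have "\<bar>ln (edge_seq (n * N' * 2^b)) - ln (edge_seq (n * N'))\<bar> \<le> S * real (n * N') powr (-1/16)"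
            by (rule n1) (use n nN in linarith)
          also have "\<dots> \<le> S * ?d" using dmono[OF nN] S0 by (intro mult_left_mono)
          finally have "\<bar>ln (edge_seq (n * N' * 2^b)) - ln (edge_seq (n * N'))\<bar> \<le> S * ?d" .
          moreover have "\<bar>ln (edge_seq (n * N')) - ln (edge_seq n)\<bar> \<le> ?d" using elim(1) N' by blast
          ultimately show ?thesis unfolding distrib_right by linarith
        qed
        have cu: "\<bar>ln (edge_seq u) - ln (edge_seq n)\<bar> \<le> (S + 1) * ?d" unfolding u_def by (rule close) (use Nb N1 in auto)
        have cw: "\<bar>ln (edge_seq w) - ln (edge_seq n)\<bar> \<le> (S + 1) * ?d" unfolding w_def by (rule close) (use Nb N1 in auto)
        have ratio: "(sqrt (real y / real x) - 1) * (1 + entry_sum) \<le> (1 + entry_sum) / real N0" if "real y / real x \<le> 1 + 1 / real N0" for x y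
        proof -
          have "sqrt (real y / real x) \<le> sqrt ((1 + 1 / real N0)^2)"
          proof (rule real_sqrt_le_mono)
            have "1 + 1 / real N0 \<le> (1 + 1 / real N0)^2" using self_le_power[of "1 + 1 / real N0" 2] by simp
            then show "real y / real x \<le> (1 + 1 / real N0)^2" using that by linarith
          qed
          also have "\<dots> = 1 + 1 / real N0" by simp
          finally have "(sqrt (real y / real x) - 1) * (1 + entry_sum) \<le> (1 / real N0) * (1 + entry_sum)" using bB0 by (intro mult_right_mono) auto
          then show ?thesis by simp
        qed
        have NN: "real (N + 1) / real N \<le> 1 + 1 / real N0"
        proof -
          have "real (N + 1) / real N = 1 + 1 / real N" using N1 by (simp add: field_simps)
          also have "1 / real N \<le> 1 / real N0" using Nb N0 by (intro divide_left_mono) auto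
          finally show ?thesis by simp
        qed
        have r1: "real (n * m) / real u \<le> 1 + 1 / real N0"
        proof -
          have "real (n * m) / real u = real m / (real N * 2^b)" using n by (simp add: u_def)
          also have "\<dots> \<le> (real (N + 1) * 2^b) / (real N * 2^b)"
          proof (rule divide_right_mono)
            have "real m \<le> real ((N + 1) * 2^b)" using Nb(4) by (simp only: of_nat_le_iff less_imp_le)
            then show "real m \<le> real (N + 1) * 2^b" by (simp add: distrib_right)
          qed simp
          also have "\<dots> = real (N + 1) / real N" by simp
          finally show ?thesis using NN by linarith
        qed
        have r2: "real w / real (n * m) \<le> 1 + 1 / real N0"
        proof -
          have "real w / real (n * m) = (real (N + 1) * 2^b) / real m"
          proof -
            have "real w = real n * (real (N + 1) * 2^b)"
              by (simp only: w_def of_nat_mult of_nat_power of_nat_numeral mult.assoc)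
            then show ?thesis using n by simp
          qed
          also have "\<dots> \<le> (real (N + 1) * 2^b) / (real N * 2^b)"
          proof (rule divide_left_mono)
            have "real (N * 2^b) \<le> real m" using Nb(3) by (simp only: of_nat_le_iff)
            then show "real N * 2^b \<le> real m" by simp
          qed (use N1 m1 in auto)
          also have "\<dots> = real (N + 1) / real N" by simp
          finally show ?thesis using NN by linarith
        qed
        have nnm: "n \<le> n * m" using un um by linarith
        have "ln (edge_seq u) \<le> ln (edge_seq (n * m)) + ?d + (1 + entry_sum) / real N0"
          using n2[of u "n * m"] um un n dmono[OF un] ratio[OF r1] by linarith
        moreover have "ln (edge_seq (n * m)) \<le> ln (edge_seq w) + ?d + (1 + entry_sum) / real N0"
          using n2[of "n * m" w] mw nnm n dmono[OF nnm] ratio[OF r2] by linarith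
        ultimately show "\<bar>ln (edge_seq (n * m)) - ln (edge_seq n)\<bar> \<le> (S + 2) * ?d + (1 + entry_sum) / real N0"
          using cu cw unfolding distrib_right by linarith
      qed
    qed
  qed
  show ?thesis by (intro exI[of _ "S + 2"] allI impI main)
qed

text \<open>For large \<open>m\<close> and \<open>n\<close>, both \<open>edge_seq m\<close> and \<open>edge_seq n\<close> are close to \<open>edge_seq (m * n)\<close>.\<close>

lemma edge_seq_convergent: "\<exists>\<alpha>. \<alpha> \<ge> 1 \<and> edge_seq \<longlonglongrightarrow> \<alpha>"
proof -
  obtain S where S: "\<And>N0. N0 \<ge> 1 \<Longrightarrow> eventually (\<lambda>n. \<forall>m\<ge>N0. \<bar>ln (edge_seq (n * m)) - ln (edge_seq n)\<bar> \<le> S * real n powr (-1/16) + (1 + entry_sum) / real N0) sequentially"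
    using edge_seq_product by blast
  have bB0: "0 \<le> entry_sum" by (simp add: entry_sum_def sum_nonneg)
  have "Cauchy (\<lambda>n. ln (edge_seq n))"
  proof (rule metric_CauchyI)
    fix e :: real assume e: "0 < e"
    obtain N0 :: nat where N0: "N0 \<ge> 1" "(1 + entry_sum) / real N0 < e / 4"
    proof -
      obtain N0 :: nat where N0: "max 1 ((1 + entry_sum) / (e / 4)) < real N0" using reals_Archimedean2 by blast
      then have pos: "1 < real N0" "(1 + entry_sum) / (e / 4) < real N0" by auto
      then have "(1 + entry_sum) < real N0 * (e / 4)" using e by (simp add: pos_divide_less_eq)
      then have "(1 + entry_sum) / real N0 < e / 4" using pos(1) by (simp add: pos_divide_less_eq mult.commute)
      then show ?thesis using that[of N0] pos(1) by simp
    qed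
    have "((\<lambda>n. S * real n powr (-1/16)) \<longlongrightarrow> S * 0) sequentially"
      by (intro tendsto_mult tendsto_const) real_asymp
    then have "eventually (\<lambda>n. S * real n powr (-1/16) < e / 4) sequentially"
      using e by (intro order_tendstoD(2)[of _ 0]) auto
    then have "eventually (\<lambda>n. \<forall>m\<ge>N0. \<bar>ln (edge_seq (n * m)) - ln (edge_seq n)\<bar> < e / 2) sequentially"
      using S[OF N0(1)]
    proof eventually_elim
      case (elim n)
      show ?case
      proof (intro allI impI)
        fix m assume "m \<ge> N0"
        then have "\<bar>ln (edge_seq (n * m)) - ln (edge_seq n)\<bar> \<le> S * real n powr (-1/16) + (1 + entry_sum) / real N0" using elim by blast
        then show "\<bar>ln (edge_seq (n * m)) - ln (edge_seq n)\<bar> < e / 2" using elim N0(2) by linarith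
      qed
    qed
    then obtain n0 where n0: "\<And>n m. n \<ge> n0 \<Longrightarrow> m \<ge> N0 \<Longrightarrow> \<bar>ln (edge_seq (n * m)) - ln (edge_seq n)\<bar> < e / 2"
      by (auto simp: eventually_sequentially)
    show "\<exists>M. \<forall>m\<ge>M. \<forall>n\<ge>M. dist (ln (edge_seq m)) (ln (edge_seq n)) < e"
    proof (intro exI[of _ "max n0 N0"] allI impI)
      fix m n assume "max n0 N0 \<le> m" "max n0 N0 \<le> n"
      then have "\<bar>ln (edge_seq (m * n)) - ln (edge_seq m)\<bar> < e / 2" "\<bar>ln (edge_seq (n * m)) - ln (edge_seq n)\<bar> < e / 2"
        using n0[of m n] n0[of n m] by simp_all
      then show "dist (ln (edge_seq m)) (ln (edge_seq n)) < e" unfolding dist_real_def mult.commute[of n m] by linarith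
    qed
  qed
  then obtain c where c: "(\<lambda>n. ln (edge_seq n)) \<longlonglongrightarrow> c" using Cauchy_convergent by (auto simp: convergent_def)
  have "(\<lambda>n. exp (ln (edge_seq n))) \<longlonglongrightarrow> exp c" by (intro tendsto_exp c)
  moreover have "eventually (\<lambda>n. exp (ln (edge_seq n)) = edge_seq n) sequentially"
    using edge_seq_ge1 by eventually_elim simp
  ultimately have lim: "edge_seq \<longlonglongrightarrow> exp c" by (rule Lim_transform_eventually)
  have "1 \<le> exp c" by (rule tendsto_lowerbound[OF lim edge_seq_ge1]) simp
  with lim show ?thesis by blast
qed

text \<open>The norm concentrates from above in every moment: the same trace moment that determines its mean bounds them.\<close>

lemma moments_upper:
  assumes lim: "edge_seq \<longlonglongrightarrow> \<alpha>" and \<alpha>: "\<alpha> \<ge> 1" and r: "r \<ge> 1"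
  shows "\<exists>h. h \<longlonglongrightarrow> \<alpha> ^ (2*r) \<and>
    eventually (\<lambda>n. integral\<^sup>L (M n) (\<lambda>\<omega>. opnorm (block_index k {..<n}) (XX {..<n} (\<lambda>e. entry_scale (sc n) e * g n e \<omega>)) ^ (2*r)) \<le> h n) sequentially"
proof -
  define h where "h = (\<lambda>n. exp (2 * real r * (ln (edge_seq n) + real n powr (-1/16))))"
  have "h \<longlonglongrightarrow> exp (2 * real r * (ln \<alpha> + 0))"
    unfolding h_def using \<alpha> by (intro tendsto_intros lim) (auto, real_asymp)
  moreover have "exp (2 * real r * (ln \<alpha> + 0)) = \<alpha> ^ (2*r)"
  proof -
    have "exp (2 * real r * (ln \<alpha> + 0)) = exp (ln \<alpha>) ^ (2*r)" by (simp add: exp_of_nat_mult[symmetric])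
    then show ?thesis using \<alpha> by simp
  qed
  moreover have "eventually (\<lambda>n. integral\<^sup>L (M n) (\<lambda>\<omega>. opnorm (block_index k {..<n}) (XX {..<n} (\<lambda>e. entry_scale (sc n) e * g n e \<omega>)) ^ (2*r)) \<le> h n) sequentially"
  proof -
    have "filterlim (\<lambda>n. real n powr (1/8)) at_top sequentially" by real_asymp
    then have "eventually (\<lambda>n. real r < real n powr (1/8)) sequentially"
      by (simp add: filterlim_at_top_dense)
    then show ?thesis
      using EB_small[OF order_refl] smallness eventually_ge_at_top[of 1]
    proof eventually_elim
      case (elim n)
      have n: "n \<ge> 1" by fact
      define p where "p = power_exponent n"
      have p: "2 \<le> p" "r < p" using power_exponent_bounds[OF n] elim(1) by (auto simp: p_def)
      interpret gmatm "M n" "g n" "noise_index l {..<n}" "block_index k {..<n}" "XX {..<n}" "noise_coeff A" "entry_scale (sc n)" "bessel_const (1 / real n)"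
        by (rule gmatm_sc[OF gs[OF n]]) (use n in auto)
      have E: "trace_moment (M n) (g n) {..<n} (sc n) p = avg (V p)" by (simp add: trace_moment_def avg_def V_def[abs_def] scaled_def)
      have E1: "1 \<le> avg (V p)" by (rule trace_moment_ge(2)[OF p(1)])
      have "integral\<^sup>L (M n) (\<lambda>\<omega>. opnorm (block_index k {..<n}) (XX {..<n} (\<lambda>e. entry_scale (sc n) e * g n e \<omega>)) ^ (2*r)) \<le> root p (avg (V p)) ^ r"
        using moment_le[OF p(1) r p(2)] by (simp add: scaled_def)
      also have "root p (avg (V p)) ^ r = exp (2 * real r * (ln (avg (V p)) / (2 * real p)))"
      proof -
        have "root p (avg (V p)) = exp (ln (avg (V p)) / real p)"
        proof -
          have "0 < root p (avg (V p))" using E1 p by (intro real_root_gt_zero) auto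
          moreover have "ln (root p (avg (V p))) = ln (avg (V p)) / real p" using E1 p by (intro ln_root) auto
          ultimately show ?thesis by (metis exp_ln)
        qed
        then show ?thesis by (simp add: exp_of_nat_mult[symmetric])
      qed
      also have "\<dots> \<le> h n"
      proof -
        have "ln (avg (V p)) / (2 * real p) \<le> ln (edge_seq n) + err n p"
          using mean_norm_trace_moment(3)[OF gs[OF n] _ _ n p(1) elim(3)[folded p_def]] by (simp add: E edge_seq_def)
        moreover have "err n p \<le> law_error 1 n"
        proof -
          have e0: "0 \<le> err n p"
            unfolding err_def using n by (intro add_nonneg_nonneg divide_nonneg_nonneg mult_nonneg_nonneg bessel_const_nonneg ln_ge_zero two_k_n) auto
          have "0 \<le> interp_const 1 n p" unfolding interp_const_def by (intro mult_nonneg_nonneg add_nonneg_nonneg bessel_const_nonneg hsA_nonneg) auto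
          with e0 show ?thesis by (simp add: law_error_def p_def)
        qed
        ultimately have "ln (avg (V p)) / (2 * real p) \<le> ln (edge_seq n) + real n powr (-1/16)" using elim(2) by linarith
        then have "2 * real r * (ln (avg (V p)) / (2 * real p)) \<le> 2 * real r * (ln (edge_seq n) + real n powr (-1/16))"
          by (rule mult_left_mono) simp
        then show ?thesis by (simp only: h_def exp_le_cancel_iff)
      qed
      finally show ?case .
    qed
  qed
  ultimately show ?thesis by (intro exI[of _ h]) simp
qed

end

section \<open>Limit moments and the Dyson equation\<close>

lemma mpow_entry_le:
  assumes I: "finite I" "I \<noteq> {}" and X: "symm I X" and ij: "i \<in> I" "j \<in> I"
  shows "\<bar>mpow I X r i j\<bar> \<le> opnorm I X ^ r"
proof -
  from eigenbasis_exists[OF I(1) X] obtain lam U where B: "eigenbasis I X lam U" by blast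
  have one: "(\<Sum>c\<in>I. (U c i)^2) = 1" if "i \<in> I" for i
    using B that by (simp add: eigenbasis_def kdelta_def power2_eq_square)
  have "\<bar>mpow I X r i j\<bar> \<le> (\<Sum>c\<in>I. opnorm I X ^ r * (((U c i)^2 + (U c j)^2) / 2))"
    unfolding eigenbasis_mpow[OF I(1) B ij]
  proof (intro order_trans[OF sum_abs] sum_mono)
    fix c assume "c \<in> I"
    have "\<bar>U c i * U c j\<bar> \<le> ((U c i)^2 + (U c j)^2) / 2"
      using sum_squares_bound[of "\<bar>U c i\<bar>" "\<bar>U c j\<bar>"] by (simp add: abs_mult)
    then have "\<bar>lam c ^ r\<bar> * \<bar>U c i * U c j\<bar> \<le> opnorm I X ^ r * (((U c i)^2 + (U c j)^2) / 2)"
      by (intro mult_mono power_le_opnorm[OF I B \<open>c \<in> I\<close>]) (auto intro: zero_le_power opnorm_nonneg[OF I X])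
    then show "\<bar>lam c ^ r * U c i * U c j\<bar> \<le> opnorm I X ^ r * (((U c i)^2 + (U c j)^2) / 2)"
      by (simp add: abs_mult mult.assoc)
  qed
  also have "\<dots> = opnorm I X ^ r * (((\<Sum>c\<in>I. (U c i)^2) + (\<Sum>c\<in>I. (U c j)^2)) / 2)"
    by (simp only: sum_distrib_left[symmetric] sum_divide_distrib[symmetric] sum.distrib)
  also have "\<dots> = opnorm I X ^ r" using one[OF ij(1)] one[OF ij(2)] by simp
  finally show ?thesis .
qed

lemma hs_kdelta: "finite I \<Longrightarrow> hs_sq I kdelta = real (card I)"
proof -
  assume I: "finite I"
  have "hs_sq I kdelta = (\<Sum>i\<in>I. \<Sum>j\<in>I. kdelta i j * kdelta i j)"
    unfolding hs_sq_def by (simp add: power2_eq_square)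
  also have "\<dots> = (\<Sum>i\<in>I. 1)"
    by (intro sum.cong refl) (simp add: sum_delta_l[OF I], simp add: kdelta_def)
  finally show ?thesis by simp
qed

lemma hs_mpow_le:
  assumes I: "finite I" "I \<noteq> {}" and X: "symm I X"
  shows "hs_sq I (mpow I X r) \<le> opnorm I X ^ (2*r) * real (card I)"
proof -
  have "hs_sq I (mpow I X r) = hs_sq I (mmult I (mpow I X r) (mmult I kdelta (mpow I X 0)))"
    unfolding hs_sq_def using I by (intro sum.cong refl arg_cong[where f="\<lambda>x. x^2"])
      (simp add: mmult_assoc_fun[symmetric] mmult_kdelta_right)
  then show ?thesis using hs_sandwich[OF I X, of r kdelta 0] by (simp add: hs_kdelta[OF I(1)])
qed

lemma mtrace_even_le:
  assumes I: "finite I" "I \<noteq> {}" and X: "symm I X"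
  shows "mtrace I (mpow I X (2*p)) \<le> real (card I) * opnorm I X ^ (2*p)"
  using hs_mpow_le[OF I X, of p] hs_mpow[OF I(1) X, of p] by (simp add: mult.commute)

context gmat begin

lemma ibp_scaled:
  assumes f: "polyfun E f" and e: "e \<in> E"
  shows "avg (\<lambda>x. x e * f x) = (s e)^2 * avg (partial e f)"
proof -
  have "avg (\<lambda>x. x e * f x) = ex (\<lambda>x. s e * (x e * f (\<lambda>e. s e * x e)))" by (simp add: avg_ex mult.assoc)
  also have "\<dots> = s e * ex (\<lambda>x. x e * f (\<lambda>e. s e * x e))" by (rule ex_cmult)
  also have "ex (\<lambda>x. x e * f (\<lambda>e. s e * x e)) = ex (partial e (\<lambda>x. f (\<lambda>e. s e * x e)))"
    by (rule ibp[OF poly_scale[OF f] e])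
  also have "\<dots> = s e * avg (partial e f)" by (simp only: partial_scale[OF f] ex_cmult avg_ex)
  finally show ?thesis by (simp add: power2_eq_square)
qed

end

lemma mmult_noise_coeff_mmult:
  assumes P: "finite P" "p \<in> P" "q \<in> P"
  shows "mmult (block_index k P) M (mmult (block_index k P) (noise_coeff A (i,p,q)) N) j h
     = (\<Sum>c<k. \<Sum>d<k. A i c d * (M j (c,p) * N (d,q) h + M j (c,q) * N (d,p) h)) / sqrt 2"
proof -
  have "mmult (block_index k P) M (mmult (block_index k P) (noise_coeff A (i,p,q)) N) j h
   = (\<Sum>c<k. \<Sum>u\<in>P. \<Sum>d<k. (A i c d / sqrt 2) * (kdelta p u * (M j (c,u) * N (d,q) h) + kdelta q u * (M j (c,u) * N (d,p) h)))"
    unfolding mmult_def[of "block_index k P" M] sum_block_index mmult_noise_coeff[OF P]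
    by (intro sum.cong refl) (simp add: sum_divide_distrib sum_distrib_left sum.distrib add_divide_distrib algebra_simps)
  also have "\<dots> = (\<Sum>c<k. \<Sum>d<k. \<Sum>u\<in>P. (A i c d / sqrt 2) * (kdelta p u * (M j (c,u) * N (d,q) h) + kdelta q u * (M j (c,u) * N (d,p) h)))"
    by (intro sum.cong refl sum.swap)
  also have "\<dots> = (\<Sum>c<k. \<Sum>d<k. (A i c d / sqrt 2) * (M j (c,p) * N (d,q) h + M j (c,q) * N (d,p) h))"
    using P by (simp only: sum_distrib_left[symmetric] sum.distrib sum_delta_l if_True)
  finally show ?thesis by (simp add: sum_divide_distrib)
qed

text \<open>For \<open>F c e d = Q c e * Q' d b\<close> this is the entry \<open>(a, b)\<close> of \<open>\<Sum>i. A i * Q * A i * Q'\<close>.\<close>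

definition bil :: "(nat \<Rightarrow> nat \<Rightarrow> nat \<Rightarrow> real) \<Rightarrow> nat \<Rightarrow> nat \<Rightarrow> nat \<Rightarrow> (nat \<Rightarrow> nat \<Rightarrow> nat \<Rightarrow> real) \<Rightarrow> real" where
  "bil A l k a F = (\<Sum>i\<in>{1..l}. \<Sum>c<k. \<Sum>e<k. \<Sum>d<k. A i a c * A i e d * F c e d)"

context model2 begin

text \<open>The blocks of \<open>X ^ r\<close> after the normalized partial trace over the positions and expectation; a \<open>k \<times> k\<close> matrix.\<close>

definition block_moment :: "'w measure \<Rightarrow> (nat \<times> 'p \<times> 'p \<Rightarrow> 'w \<Rightarrow> real) \<Rightarrow> 'p set \<Rightarrow> nat \<Rightarrow> nat \<Rightarrow> nat \<Rightarrow> real" where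
  "block_moment M g P r a b = (1 / real (card P)) * (\<Sum>u\<in>P. moment_entry M g P (sc (card P)) r (a,u) (b,u))"

definition norm_moment :: "'w measure \<Rightarrow> (nat \<times> 'p \<times> 'p \<Rightarrow> 'w \<Rightarrow> real) \<Rightarrow> 'p set \<Rightarrow> nat \<Rightarrow> real" where
  "norm_moment M g P r = integral\<^sup>L M (\<lambda>\<omega>. opnorm (block_index k P) (XX P (\<lambda>e. entry_scale (sc (card P)) e * g e \<omega>)) ^ r)"

text \<open>Integration by parts in one factor of \<open>X ^ (r + 1)\<close> gives the recursion of the operator-valued semicircle law. The errors
  are the covariance of two partial traces, of order \<open>1 / n\<close>, and the crossed contraction, of order \<open>1 / n\<close>.\<close>

lemma block_moment_recursion:
  assumes g: "gaussian_family M g (noise_index l P)" and P: "finite P" "P \<noteq> {}" and ab: "a < k" "b < k"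
  defines "n \<equiv> real (card P)"
  shows "\<bar>block_moment M g P (Suc r) a b - ((\<Sum>c<k. B a c * block_moment M g P r c b)
      + (\<Sum>t<r. bil A l k a (\<lambda>c e d. block_moment M g P t c e * block_moment M g P (r - 1 - t) d b)))\<bar>
    \<le> (\<Sum>t<r. bil (\<lambda>i a b. \<bar>A i a b\<bar>) l k a (\<lambda>c e d.
        hsA k l A / n^2 * (real t^2 * (1 + real k * n * norm_moment M g P (4*t)) + real (r-1-t)^2 * (1 + real k * n * norm_moment M g P (4*(r-1-t))))
        + real k / n * norm_moment M g P (r-1)))"
proof -
  have c1: "card P \<ge> 1" using P by (simp add: Suc_leI card_gt_0_iff)
  then have n1: "1 \<le> n" by (simp add: n_def)
  interpret gmatm M g "noise_index l P" "block_index k P" "XX P" "noise_coeff A" "entry_scale (sc (card P))" "bessel_const (1 / real (card P))"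
    by (rule gmatm_sc[OF g P(1) refl c1])
  let ?I = "block_index k P"
  let ?Y = "\<lambda>x t. mpow ?I (XX P x) t"
  have pY: "polyfun (noise_index l P) (\<lambda>x. ?Y x t i j)" for t i j by (rule poly_mpow)
  have s2: "(entry_scale (sc (card P)) e)^2 = 1 / n" for e by (cases e) (simp add: entry_scale_def n_def)
  have moment_entry: "moment_entry M g P (sc (card P)) r i j = avg (\<lambda>x. ?Y x r i j)" for r i j by (simp add: moment_entry_def avg_def scaled_def)
  define m where "m = (\<lambda>t c e x. (1 / n) * (\<Sum>v\<in>P. ?Y x t (c,v) (e,v)))"
  have pm: "polyfun (noise_index l P) (m t c e)" for t c e unfolding m_def by (intro polyfun_cmult polyfun_sum pY)
  have evm: "avg (m t c e) = block_moment M g P t c e" for t c e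
    unfolding m_def block_moment_def moment_entry n_def by (simp only: avg_cmult avg_sum[OF pY])
  define T where "T = (\<lambda>t t' c e d x. (1 / n^2) * (\<Sum>u\<in>P. \<Sum>v\<in>P. ?Y x t (c,v) (e,u) * ?Y x t' (d,v) (b,u)))"
  have pT: "polyfun (noise_index l P) (T t t' c e d)" for t t' c e d
    unfolding T_def by (intro polyfun_cmult polyfun_sum polyfun.mult pY)
  have exact: "block_moment M g P (Suc r) a b = (\<Sum>c<k. B a c * block_moment M g P r c b)
      + (\<Sum>t<r. bil A l k a (\<lambda>c e d. avg (\<lambda>x. m t c e x * m (r-1-t) d b x) + avg (T t (r-1-t) c e d)))"
  proof -
    define Z where "Z = (\<lambda>i c u v t. \<Sum>e<k. \<Sum>d<k. A i e d * (avg (\<lambda>x. ?Y x t (c,v) (e,u) * ?Y x (r-1-t) (d,v) (b,u)) + avg (\<lambda>x. ?Y x t (c,v) (e,v) * ?Y x (r-1-t) (d,u) (b,u))))"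
    have half: "avg (\<lambda>x. x e' * ?Y x r (c,v) (b,u)) = (1 / n) * (\<Sum>t<r. Z i c u v t) / sqrt 2"
      if e': "e' = (i,u,v) \<or> e' = (i,v,u)" and i: "i \<in> {1..l}" and uv: "u \<in> P" "v \<in> P" and c: "c < k" for e' i u v c
    proof -
      have eE: "e' \<in> noise_index l P" using e' i uv by (auto simp: noise_index_def)
      have "avg (\<lambda>x. x e' * ?Y x r (c,v) (b,u)) = (1 / n) * avg (partial e' (\<lambda>x. ?Y x r (c,v) (b,u)))"
        unfolding ibp_scaled[OF pY eE] s2 ..
      also have "partial e' (\<lambda>x. ?Y x r (c,v) (b,u)) = (\<lambda>x. \<Sum>t<r. (\<Sum>e<k. \<Sum>d<k. A i e d * (?Y x t (c,v) (e,u) * ?Y x (r-1-t) (d,v) (b,u) + ?Y x t (c,v) (e,v) * ?Y x (r-1-t) (d,u) (b,u))) / sqrt 2)"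
      proof
        fix x
        have cv: "(c,v) \<in> ?I" using c uv by (simp add: block_index_def)
        have D: "mmult ?I (?Y x t) (mmult ?I (noise_coeff A e') (?Y x (r-1-t))) (c,v) (b,u)
          = (\<Sum>e<k. \<Sum>d<k. A i e d * (?Y x t (c,v) (e,u) * ?Y x (r-1-t) (d,v) (b,u) + ?Y x t (c,v) (e,v) * ?Y x (r-1-t) (d,u) (b,u))) / sqrt 2" for t
        proof (cases "e' = (i,u,v)")
          case True
          then show ?thesis using mmult_noise_coeff_mmult[OF P(1) uv] by simp
        next
          case False
          with e' have "e' = (i,v,u)" by simp
          then show ?thesis using mmult_noise_coeff_mmult[OF P(1) uv(2,1)] by (simp add: add.commute)
        qed
        show "partial e' (\<lambda>x. ?Y x r (c,v) (b,u)) x = (\<Sum>t<r. (\<Sum>e<k. \<Sum>d<k. A i e d * (?Y x t (c,v) (e,u) * ?Y x (r-1-t) (d,v) (b,u) + ?Y x t (c,v) (e,v) * ?Y x (r-1-t) (d,u) (b,u))) / sqrt 2)"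
          unfolding partial_mpow[OF eE cv] D ..
      qed
      also have "avg \<dots> = (\<Sum>t<r. Z i c u v t / sqrt 2)"
      proof -
        have q1: "polyfun (noise_index l P) (\<lambda>x. ?Y x t (c,v) (e,u) * ?Y x (r-1-t) (d,v) (b,u))" "polyfun (noise_index l P) (\<lambda>x. ?Y x t (c,v) (e,v) * ?Y x (r-1-t) (d,u) (b,u))" for t e d
          by (intro polyfun.mult pY)+
        have q2: "polyfun (noise_index l P) (\<lambda>x. A i e d * (?Y x t (c,v) (e,u) * ?Y x (r-1-t) (d,v) (b,u) + ?Y x t (c,v) (e,v) * ?Y x (r-1-t) (d,u) (b,u)))" for t e d
          by (intro polyfun_cmult polyfun.add q1)
        have q3: "polyfun (noise_index l P) (\<lambda>x. \<Sum>d<k. A i e d * (?Y x t (c,v) (e,u) * ?Y x (r-1-t) (d,v) (b,u) + ?Y x t (c,v) (e,v) * ?Y x (r-1-t) (d,u) (b,u)))" for t e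
          by (intro polyfun_sum q2)
        have q4: "polyfun (noise_index l P) (\<lambda>x. \<Sum>e<k. \<Sum>d<k. A i e d * (?Y x t (c,v) (e,u) * ?Y x (r-1-t) (d,v) (b,u) + ?Y x t (c,v) (e,v) * ?Y x (r-1-t) (d,u) (b,u)))" for t
          by (intro polyfun_sum q3)
        have dv: "avg (\<lambda>x. f x / sqrt 2) = avg f / sqrt 2" for f using avg_cmult[of "1 / sqrt 2" f] by simp
        show ?thesis unfolding Z_def
          by (simp only: avg_sum[OF polyfun_divide[OF q4]] dv avg_sum[OF q3] avg_sum[OF q2] avg_cmult avg_add[OF q1])
      qed
      finally show ?thesis by (simp add: sum_divide_distrib mult.commute)
    qed
    have entry: "avg (\<lambda>x. XX P x (a,u) (c,v) * ?Y x r (c,v) (b,u)) = B a c * kdelta u v * avg (\<lambda>x. ?Y x r (c,v) (b,u))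
       + (\<Sum>i\<in>{1..l}. A i a c * ((1 / n) * (\<Sum>t<r. Z i c u v t)))" if uv: "u \<in> P" "v \<in> P" and c: "c < k" for u v c
    proof -
      have eE: "(i,u,v) \<in> noise_index l P" "(i,v,u) \<in> noise_index l P" if "i \<in> {1..l}" for i using that uv by (auto simp: noise_index_def)
      have q1: "polyfun (noise_index l P) (\<lambda>x. x (i,u,v) * ?Y x r (c,v) (b,u))" "polyfun (noise_index l P) (\<lambda>x. x (i,v,u) * ?Y x r (c,v) (b,u))" if "i \<in> {1..l}" for i
        by (rule polyfun.mult[OF polyfun.var[OF eE(1)[OF that]] pY], rule polyfun.mult[OF polyfun.var[OF eE(2)[OF that]] pY])
      have q2: "polyfun (noise_index l P) (\<lambda>x. (A i a c / sqrt 2) * (x (i,u,v) * ?Y x r (c,v) (b,u) + x (i,v,u) * ?Y x r (c,v) (b,u)))" if "i \<in> {1..l}" for i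
        by (intro polyfun_cmult polyfun.add q1 that)
      have "XX P x (a,u) (c,v) * ?Y x r (c,v) (b,u) = (B a c * kdelta u v) * ?Y x r (c,v) (b,u)
        + (\<Sum>i\<in>{1..l}. (A i a c / sqrt 2) * (x (i,u,v) * ?Y x r (c,v) (b,u) + x (i,v,u) * ?Y x r (c,v) (b,u)))" for x
        using uv by (simp add: gauss_mat_simp distrib_right sum_distrib_right) (intro sum.cong refl, simp add: field_simps)
      then have "avg (\<lambda>x. XX P x (a,u) (c,v) * ?Y x r (c,v) (b,u)) = avg (\<lambda>x. (B a c * kdelta u v) * ?Y x r (c,v) (b,u)
        + (\<Sum>i\<in>{1..l}. (A i a c / sqrt 2) * (x (i,u,v) * ?Y x r (c,v) (b,u) + x (i,v,u) * ?Y x r (c,v) (b,u))))" by simp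
      also have "\<dots> = (B a c * kdelta u v) * avg (\<lambda>x. ?Y x r (c,v) (b,u))
        + (\<Sum>i\<in>{1..l}. (A i a c / sqrt 2) * (avg (\<lambda>x. x (i,u,v) * ?Y x r (c,v) (b,u)) + avg (\<lambda>x. x (i,v,u) * ?Y x r (c,v) (b,u))))"
        using q1 q2 by (simp only: avg_add[OF polyfun_cmult[OF pY] polyfun_sum[OF q2]] avg_sum[OF q2] avg_cmult) (simp add: avg_add)
      also have "(\<Sum>i\<in>{1..l}. (A i a c / sqrt 2) * (avg (\<lambda>x. x (i,u,v) * ?Y x r (c,v) (b,u)) + avg (\<lambda>x. x (i,v,u) * ?Y x r (c,v) (b,u))))
         = (\<Sum>i\<in>{1..l}. A i a c * ((1 / n) * (\<Sum>t<r. Z i c u v t)))"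
      proof (rule sum.cong[OF refl])
        fix i assume i: "i \<in> {1..l}"
        have hy: "y / sqrt 2 * (z / sqrt 2 + z / sqrt 2) = y * z" for y z :: real by (simp add: field_simps)
        then show "(A i a c / sqrt 2) * (avg (\<lambda>x. x (i,u,v) * ?Y x r (c,v) (b,u)) + avg (\<lambda>x. x (i,v,u) * ?Y x r (c,v) (b,u))) = A i a c * ((1 / n) * (\<Sum>t<r. Z i c u v t))"
        proof -
          have h1: "avg (\<lambda>x. x (i,u,v) * ?Y x r (c,v) (b,u)) = ((1 / n) * (\<Sum>t<r. Z i c u v t)) / sqrt 2"
            using half[of "(i,u,v)" i u v c] i uv c by simp
          have h2: "avg (\<lambda>x. x (i,v,u) * ?Y x r (c,v) (b,u)) = ((1 / n) * (\<Sum>t<r. Z i c u v t)) / sqrt 2"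
            using half[of "(i,v,u)" i u v c] i uv c by simp
          show ?thesis unfolding h1 h2 by (rule hy)
        qed
      qed
      finally show ?thesis .
    qed
    have "block_moment M g P (Suc r) a b = (1 / n) * (\<Sum>u\<in>P. \<Sum>c<k. \<Sum>v\<in>P. avg (\<lambda>x. XX P x (a,u) (c,v) * ?Y x r (c,v) (b,u)))"
    proof -
      have "avg (\<lambda>x. ?Y x (Suc r) (a,u) (b,u)) = (\<Sum>c<k. \<Sum>v\<in>P. avg (\<lambda>x. XX P x (a,u) (c,v) * ?Y x r (c,v) (b,u)))" for u
        by (simp add: mmult_def sum_block_index avg_sum polyfun_sum polyfun.mult polyX pY)
      then show ?thesis by (simp add: block_moment_def moment_entry n_def)
    qed
    also have "\<dots> = (1 / n) * (\<Sum>u\<in>P. \<Sum>c<k. \<Sum>v\<in>P. B a c * kdelta u v * avg (\<lambda>x. ?Y x r (c,v) (b,u))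
       + (\<Sum>i\<in>{1..l}. A i a c * ((1 / n) * (\<Sum>t<r. Z i c u v t))))"
      using entry by (intro arg_cong[where f="\<lambda>z. (1 / n) * z"] sum.cong refl) auto
    also have "\<dots> = (1 / n) * (\<Sum>u\<in>P. \<Sum>c<k. \<Sum>v\<in>P. kdelta u v * (B a c * avg (\<lambda>x. ?Y x r (c,v) (b,u))))
       + (1 / n) * (\<Sum>u\<in>P. \<Sum>c<k. \<Sum>v\<in>P. \<Sum>i\<in>{1..l}. A i a c * ((1 / n) * (\<Sum>t<r. Z i c u v t)))"
      by (simp only: sum.distrib distrib_left mult_ac)
    also have "(1 / n) * (\<Sum>u\<in>P. \<Sum>c<k. \<Sum>v\<in>P. kdelta u v * (B a c * avg (\<lambda>x. ?Y x r (c,v) (b,u)))) = (\<Sum>c<k. B a c * block_moment M g P r c b)"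
    proof -
      have "(\<Sum>u\<in>P. \<Sum>c<k. \<Sum>v\<in>P. kdelta u v * (B a c * avg (\<lambda>x. ?Y x r (c,v) (b,u)))) = (\<Sum>u\<in>P. \<Sum>c<k. B a c * avg (\<lambda>x. ?Y x r (c,u) (b,u)))"
        by (intro sum.cong refl) (simp add: sum_delta_l[OF P(1)])
      also have "\<dots> = (\<Sum>c<k. B a c * (\<Sum>u\<in>P. avg (\<lambda>x. ?Y x r (c,u) (b,u))))"
        by (subst sum.swap) (simp only: sum_distrib_left)
      finally show ?thesis by (simp add: block_moment_def moment_entry n_def sum_distrib_left mult_ac)
    qed
    also have "(1 / n) * (\<Sum>u\<in>P. \<Sum>c<k. \<Sum>v\<in>P. \<Sum>i\<in>{1..l}. A i a c * ((1 / n) * (\<Sum>t<r. Z i c u v t)))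
       = (\<Sum>t<r. bil A l k a (\<lambda>c e d. avg (\<lambda>x. m t c e x * m (r-1-t) d b x) + avg (T t (r-1-t) c e d)))"
    proof -
      have fin: "avg (\<lambda>x. m t c e x * m (r-1-t) d b x) + avg (T t (r-1-t) c e d)
        = (\<Sum>u\<in>P. \<Sum>v\<in>P. (1 / n^2) * (avg (\<lambda>x. ?Y x t (c,v) (e,u) * ?Y x (r-1-t) (d,v) (b,u)) + avg (\<lambda>x. ?Y x t (c,v) (e,v) * ?Y x (r-1-t) (d,u) (b,u))))" for t c e d
      proof -
        have q1: "polyfun (noise_index l P) (\<lambda>x. ?Y x t (c,v) (e,u) * ?Y x (r-1-t) (d,v') (b,u'))" for u v u' v'
          by (intro polyfun.mult pY)
        have "m t c e x * m (r-1-t) d b x = (1 / n^2) * (\<Sum>u\<in>P. \<Sum>v\<in>P. ?Y x t (c,v) (e,v) * ?Y x (r-1-t) (d,u) (b,u))" for x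
          unfolding m_def by (subst sum.swap) (simp add: sum_product power2_eq_square)
        then have 1: "avg (\<lambda>x. m t c e x * m (r-1-t) d b x) = (1 / n^2) * (\<Sum>u\<in>P. \<Sum>v\<in>P. avg (\<lambda>x. ?Y x t (c,v) (e,v) * ?Y x (r-1-t) (d,u) (b,u)))"
          using q1 by (simp only: avg_cmult avg_sum[OF polyfun_sum[OF q1]] avg_sum[OF q1])
        have 2: "avg (T t (r-1-t) c e d) = (1 / n^2) * (\<Sum>u\<in>P. \<Sum>v\<in>P. avg (\<lambda>x. ?Y x t (c,v) (e,u) * ?Y x (r-1-t) (d,v) (b,u)))"
          unfolding T_def using q1 by (simp only: avg_cmult avg_sum[OF polyfun_sum[OF q1]] avg_sum[OF q1])
        show ?thesis unfolding 1 2 by (simp only: sum_distrib_left[symmetric] sum.distrib distrib_left[symmetric] add.commute)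
      qed
      define G where "G = (\<lambda>t c e d u v. avg (\<lambda>x. ?Y x t (c,v) (e,u) * ?Y x (r-1-t) (d,v) (b,u)) + avg (\<lambda>x. ?Y x t (c,v) (e,v) * ?Y x (r-1-t) (d,u) (b,u)))"
      have "(1 / n) * (\<Sum>u\<in>P. \<Sum>c<k. \<Sum>v\<in>P. \<Sum>i\<in>{1..l}. A i a c * ((1 / n) * (\<Sum>t<r. Z i c u v t)))
        = (\<Sum>u\<in>P. \<Sum>c<k. \<Sum>v\<in>P. \<Sum>i\<in>{1..l}. \<Sum>t<r. \<Sum>e<k. \<Sum>d<k. A i a c * A i e d * ((1 / n^2) * G t c e d u v))"
        unfolding Z_def G_def sum_distrib_left by (intro sum.cong refl) (simp add: power2_eq_square)
      also have "\<dots> = (\<Sum>t<r. \<Sum>i\<in>{1..l}. \<Sum>c<k. \<Sum>e<k. \<Sum>d<k. \<Sum>u\<in>P. \<Sum>v\<in>P. A i a c * A i e d * ((1 / n^2) * G t c e d u v))"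
      proof -
        have "(\<Sum>u\<in>P. \<Sum>c<k. \<Sum>v\<in>P. \<Sum>i\<in>{1..l}. \<Sum>t<r. \<Sum>e<k. \<Sum>d<k. H t i c e d u v)
          = (\<Sum>t<r. \<Sum>i\<in>{1..l}. \<Sum>c<k. \<Sum>e<k. \<Sum>d<k. \<Sum>u\<in>P. \<Sum>v\<in>P. H t i c e d u v)" for H :: "nat \<Rightarrow> nat \<Rightarrow> nat \<Rightarrow> nat \<Rightarrow> nat \<Rightarrow> _ \<Rightarrow> _ \<Rightarrow> real"
        proof -
          have "(\<Sum>u\<in>P. \<Sum>c<k. \<Sum>v\<in>P. \<Sum>i\<in>{1..l}. \<Sum>t<r. \<Sum>e<k. \<Sum>d<k. H t i c e d u v)
            = (\<Sum>u\<in>P. \<Sum>v\<in>P. \<Sum>c<k. \<Sum>i\<in>{1..l}. \<Sum>t<r. \<Sum>e<k. \<Sum>d<k. H t i c e d u v)"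
            by (intro sum.cong refl sum.swap)
          also have "\<dots> = (\<Sum>c<k. \<Sum>u\<in>P. \<Sum>v\<in>P. \<Sum>i\<in>{1..l}. \<Sum>t<r. \<Sum>e<k. \<Sum>d<k. H t i c e d u v)" by (rule sum_rotate3)
          also have "\<dots> = (\<Sum>c<k. \<Sum>i\<in>{1..l}. \<Sum>t<r. \<Sum>e<k. \<Sum>d<k. \<Sum>u\<in>P. \<Sum>v\<in>P. H t i c e d u v)"
            by (rule sum.cong[OF refl], subst sum_rotate3, rule sum.cong[OF refl], subst sum_rotate3, rule sum.cong[OF refl],
              subst sum_rotate3, rule sum.cong[OF refl], subst sum_rotate3, rule refl)
          also have "\<dots> = (\<Sum>t<r. \<Sum>c<k. \<Sum>i\<in>{1..l}. \<Sum>e<k. \<Sum>d<k. \<Sum>u\<in>P. \<Sum>v\<in>P. H t i c e d u v)" by (rule sum_rotate3)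
          also have "\<dots> = (\<Sum>t<r. \<Sum>i\<in>{1..l}. \<Sum>c<k. \<Sum>e<k. \<Sum>d<k. \<Sum>u\<in>P. \<Sum>v\<in>P. H t i c e d u v)"
            by (rule sum.cong[OF refl], rule sum.swap)
          finally show ?thesis .
        qed
        then show ?thesis .
      qed
      also have "\<dots> = (\<Sum>t<r. bil A l k a (\<lambda>c e d. avg (\<lambda>x. m t c e x * m (r-1-t) d b x) + avg (T t (r-1-t) c e d)))"
        unfolding bil_def fin G_def by (simp only: sum_distrib_left)
      finally show ?thesis .
    qed
    finally show ?thesis .
  qed
  have nm0: "0 \<le> norm_moment M g P s" for s
    unfolding norm_moment_def using nrmX_nonneg by (intro Bochner_Integration.integral_nonneg) (auto simp: scaled_def[symmetric])
  have nme: "norm_moment M g P s = expectation (\<lambda>\<omega>. opnorm ?I (XX P (scaled \<omega>)) ^ s)" for s by (simp add: norm_moment_def scaled_def)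
  have varm: "var (m t c e) \<le> 2 * (hsA k l A / n^2 * (real t^2 * (1 + real k * n * norm_moment M g P (4*t))))" if ce: "c < k" "e < k" for t c e
  proof -
    define C where "C = (\<lambda>i j. (1 / n) * block_unit c e P i j)"
    have mC: "m t c e = (\<lambda>x. mtrace ?I (mmult ?I C (?Y x t)))"
    proof
      fix x
      have "mtrace ?I (mmult ?I C (?Y x t)) = (1 / n) * mtrace ?I (mmult ?I (block_unit c e P) (?Y x t))"
        unfolding mtrace_def mmult_def C_def by (simp only: sum_distrib_left mult.assoc)
      then show "m t c e x = mtrace ?I (mmult ?I C (?Y x t))" using mtrace_block_unit[OF P(1) order_refl ce] by (simp add: m_def)
    qed
    have hC: "hs_sq ?I C = 1 / n"
    proof -
      have "hs_sq ?I C = (1 / n)^2 * hs_sq ?I (block_unit c e P)" unfolding hs_sq_def C_def by (simp only: power_mult_distrib sum_distrib_left)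
      then show ?thesis using hs_block_unit[OF P(1) order_refl ce] n1 by (simp add: n_def power2_eq_square)
    qed
    have w: "opnorm ?I (XX P x) ^ (2*t-2) \<le> 1 + V (2*t) x" for x
    proof (cases "t = 0")
      case True
      have "0 \<le> V 0 x" by (simp add: V_def mtrace_def kdelta_def)
      then show ?thesis using True by simp
    next
      case False
      have "opnorm ?I (XX P x) ^ (2*t-2) \<le> 1 + opnorm ?I (XX P x) ^ (2*(2*t))" by (rule pow_le_1_plus) auto
      also have "opnorm ?I (XX P x) ^ (2*(2*t)) \<le> V (2*t) x" using False by (intro opnorm_pow_le_V) auto
      finally show ?thesis by simp
    qed
    have pw: "polyfun (noise_index l P) (\<lambda>x. 1 + V (2*t) x)" by (intro polyfun.add polyfun.const poly_V)
    have "var (m t c e) \<le> bessel_const (1 / real (card P)) * (real t)^2 * hs_sq ?I C * avg (\<lambda>x. 1 + V (2*t) x)"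
      unfolding mC by (rule var_mtrace_le[OF pw w])
    also have "\<dots> = 2 * (hsA k l A / n^2) * ((real t)^2 * avg (\<lambda>x. 1 + V (2*t) x))"
      unfolding hC bessel_const_def n_def by (simp add: power2_eq_square)
    also have "\<dots> \<le> 2 * (hsA k l A / n^2) * ((real t)^2 * (1 + real k * n * norm_moment M g P (4*t)))"
    proof (intro mult_left_mono)
      have "avg (V (2*t)) \<le> expectation (\<lambda>\<omega>. real (card ?I) * opnorm ?I (XX P (scaled \<omega>)) ^ (4*t))"
        unfolding avg_def
      proof (rule integral_mono[OF integrable_scaled[OF poly_V] integrable_mult_right[OF integrable_opnorm_pow]])
        fix \<omega> show "V (2*t) (scaled \<omega>) \<le> real (card ?I) * opnorm ?I (XX P (scaled \<omega>)) ^ (4*t)"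
          using mtrace_even_le[OF finI neI symX, of "scaled \<omega>" "2*t"] by (simp add: V_def)
      qed
      also have "\<dots> = real k * n * norm_moment M g P (4*t)" by (simp add: nme card_block_index n_def)
      finally show "avg (\<lambda>x. 1 + V (2*t) x) \<le> 1 + real k * n * norm_moment M g P (4*t)"
        by (simp add: avg_add[OF polyfun.const poly_V])
    qed (auto simp: hsA_nonneg)
    finally show ?thesis by simp
  qed
  have b1: "\<bar>avg (\<lambda>x. m t c e x * m (r-1-t) d b x) - block_moment M g P t c e * block_moment M g P (r-1-t) d b\<bar>
     \<le> hsA k l A / n^2 * (real t^2 * (1 + real k * n * norm_moment M g P (4*t)) + real (r-1-t)^2 * (1 + real k * n * norm_moment M g P (4*(r-1-t))))"
    if "c < k" "e < k" "d < k" for t c e d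
    using cov_le[OF pm pm, of 1 t c e "r-1-t" d b] varm[OF that(1,2), of t] varm[OF that(3) ab(2), of "r-1-t"]
    unfolding evm distrib_left by simp
  have b2: "\<bar>avg (T t (r-1-t) c e d)\<bar> \<le> real k / n * norm_moment M g P (r-1)" if t: "t < r" and cc: "c < k" "e < k" "d < k" for t c e d
  proof -
    have pt: "\<bar>T t (r-1-t) c e d x\<bar> \<le> real k / n * opnorm ?I (XX P x) ^ (r-1)" for x
    proof -
      have "\<bar>T t (r-1-t) c e d x\<bar> = \<bar>\<Sum>u\<in>P. \<Sum>v\<in>P. (1 / n^2) * (?Y x t (c,v) (e,u) * ?Y x (r-1-t) (d,v) (b,u))\<bar>"
        by (simp only: T_def sum_distrib_left)
      also have "\<dots> \<le> (1 / n^2) * sqrt (hs_sq ?I (?Y x t) * hs_sq ?I (?Y x (r-1-t)))"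
        by (rule sum_abs_le_hs[OF P(1) ab(2) cc]) simp
      also have "\<dots> \<le> (1 / n^2) * (real k * n * opnorm ?I (XX P x) ^ (r-1))"
      proof (intro mult_left_mono real_le_lsqrt)
        let ?N = "opnorm ?I (XX P x)"
        have "hs_sq ?I (?Y x t) * hs_sq ?I (?Y x (r-1-t)) \<le> (?N ^ (2*t) * real (card ?I)) * (?N ^ (2*(r-1-t)) * real (card ?I))"
          by (intro mult_mono hs_mpow_le[OF finI neI symX] hs_nonneg mult_nonneg_nonneg) auto
        also have "\<dots> = ?N ^ (2*t + 2*(r-1-t)) * (real (card ?I))^2" by (simp add: power_add power2_eq_square)
        also have "2*t + 2*(r-1-t) = (r-1)*2" using t by auto
        also have "?N ^ ((r-1)*2) * (real (card ?I))^2 = (real k * n * ?N ^ (r-1))^2"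
          by (simp only: power_mult power_mult_distrib card_block_index n_def of_nat_mult mult_ac)
        finally show "hs_sq ?I (?Y x t) * hs_sq ?I (?Y x (r-1-t)) \<le> (real k * n * ?N ^ (r-1))^2" .
      qed (use n1 in \<open>auto intro!: mult_nonneg_nonneg hs_nonneg\<close>)
      also have "\<dots> = real k / n * opnorm ?I (XX P x) ^ (r-1)" using n1 by (simp add: power2_eq_square)
      finally show ?thesis .
    qed
    have "\<bar>avg (T t (r-1-t) c e d)\<bar> \<le> expectation (\<lambda>\<omega>. \<bar>T t (r-1-t) c e d (scaled \<omega>)\<bar>)"
      unfolding avg_def by (rule integral_abs_bound)
    also have "\<dots> \<le> expectation (\<lambda>\<omega>. real k / n * opnorm ?I (XX P (scaled \<omega>)) ^ (r-1))"
      by (rule integral_mono[OF integrable_abs[OF integrable_scaled[OF pT]] integrable_mult_right[OF integrable_opnorm_pow]]) (rule pt)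
    also have "\<dots> = real k / n * norm_moment M g P (r-1)" by (simp add: nme)
    finally show ?thesis .
  qed
  have "\<bar>block_moment M g P (Suc r) a b - ((\<Sum>c<k. B a c * block_moment M g P r c b)
      + (\<Sum>t<r. bil A l k a (\<lambda>c e d. block_moment M g P t c e * block_moment M g P (r - 1 - t) d b)))\<bar>
    = \<bar>\<Sum>t<r. bil A l k a (\<lambda>c e d. (avg (\<lambda>x. m t c e x * m (r-1-t) d b x) - block_moment M g P t c e * block_moment M g P (r - 1 - t) d b) + avg (T t (r-1-t) c e d))\<bar>"
  proof -
    have bd: "bil A l k a F - bil A l k a F' = bil A l k a (\<lambda>c e d. F c e d - F' c e d)" for F F'
      unfolding bil_def by (simp only: sum_subtractf[symmetric] right_diff_distrib[symmetric])
    have "(\<Sum>t<r. bil A l k a (\<lambda>c e d. avg (\<lambda>x. m t c e x * m (r-1-t) d b x) + avg (T t (r-1-t) c e d)))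
       - (\<Sum>t<r. bil A l k a (\<lambda>c e d. block_moment M g P t c e * block_moment M g P (r - 1 - t) d b))
      = (\<Sum>t<r. bil A l k a (\<lambda>c e d. (avg (\<lambda>x. m t c e x * m (r-1-t) d b x) - block_moment M g P t c e * block_moment M g P (r - 1 - t) d b) + avg (T t (r-1-t) c e d)))"
      unfolding sum_subtractf[symmetric] bd by (simp only: add_diff_eq diff_add_eq)
    then show ?thesis unfolding exact by (simp only: add_diff_cancel_left)
  qed
  also have "\<dots> \<le> (\<Sum>t<r. bil (\<lambda>i a b. \<bar>A i a b\<bar>) l k a (\<lambda>c e d.
        hsA k l A / n^2 * (real t^2 * (1 + real k * n * norm_moment M g P (4*t)) + real (r-1-t)^2 * (1 + real k * n * norm_moment M g P (4*(r-1-t))))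
        + real k / n * norm_moment M g P (r-1)))"
    unfolding bil_def
  proof (intro order_trans[OF sum_abs] sum_mono)
    fix t i c e d assume "t \<in> {..<r}" "c \<in> {..<k}" "e \<in> {..<k}" "d \<in> {..<k}"
    then have *: "t < r" "c < k" "e < k" "d < k" by auto
    have "\<bar>(avg (\<lambda>x. m t c e x * m (r-1-t) d b x) - block_moment M g P t c e * block_moment M g P (r - 1 - t) d b) + avg (T t (r-1-t) c e d)\<bar>
      \<le> hsA k l A / n^2 * (real t^2 * (1 + real k * n * norm_moment M g P (4*t)) + real (r-1-t)^2 * (1 + real k * n * norm_moment M g P (4*(r-1-t)))) + real k / n * norm_moment M g P (r-1)"
      using b1[OF *(2-4), of t] b2[OF *] by linarith
    then show "\<bar>A i a c * A i e d * ((avg (\<lambda>x. m t c e x * m (r-1-t) d b x) - block_moment M g P t c e * block_moment M g P (r - 1 - t) d b) + avg (T t (r-1-t) c e d))\<bar>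
      \<le> \<bar>A i a c\<bar> * \<bar>A i e d\<bar> * (hsA k l A / n^2 * (real t^2 * (1 + real k * n * norm_moment M g P (4*t)) + real (r-1-t)^2 * (1 + real k * n * norm_moment M g P (4*(r-1-t))))
        + real k / n * norm_moment M g P (r-1))"
      unfolding abs_mult by (intro mult_left_mono) auto
  qed
  finally show ?thesis .
qed

definition coeff_form :: "(nat \<Rightarrow> nat \<Rightarrow> real) \<Rightarrow> (nat \<Rightarrow> real) \<Rightarrow> real" where
  "coeff_form Q w = (\<Sum>a<k. \<Sum>b<k. w a * Q a b * w b)"

text \<open>The last item is the averaged form of \<open>\<lambda> ^ (2 * r + 1) \<ge> - opnorm * \<lambda> ^ (2 * r)\<close>. The random norm is replaced by the constant \<open>\<alpha>\<close>; the
  price is its second moment around \<open>\<alpha>\<close>, separated by the parameter \<open>\<epsilon>\<close> from a bound on the square of the quadratic form.\<close>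

lemma block_moment_facts:
  assumes g: "gaussian_family M g (noise_index l P)" and P: "finite P" "P \<noteq> {}"
  shows "a < k \<Longrightarrow> b < k \<Longrightarrow> (block_moment M g P r a b)^2 \<le> norm_moment M g P (2*r)"
    and "a < k \<Longrightarrow> b < k \<Longrightarrow> block_moment M g P r a b = block_moment M g P r b a"
    and "block_moment M g P 0 a b = kdelta a b"
    and "0 \<le> norm_moment M g P r"
    and "norm_moment M g P r \<le> 1 + norm_moment M g P (2*(r+1))"
    and "0 \<le> coeff_form (block_moment M g P (2*r)) w"
    and "0 < \<epsilon> \<Longrightarrow> - \<alpha> * coeff_form (block_moment M g P (2*r)) w - (1 / (2*\<epsilon>)) * (norm_moment M g P 2 - 2 * \<alpha> * norm_moment M g P 1 + \<alpha>^2)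
        - (\<epsilon> / 2) * ((\<Sum>a<k. (w a)^2)^2 * norm_moment M g P (4*r)) \<le> coeff_form (block_moment M g P (2*r+1)) w"
proof -
  define n where "n = real (card P)"
  have c1: "card P \<ge> 1" using P by (simp add: Suc_leI card_gt_0_iff)
  then have n1: "1 \<le> n" by (simp add: n_def)
  interpret gmatm M g "noise_index l P" "block_index k P" "XX P" "noise_coeff A" "entry_scale (sc (card P))" "bessel_const (1 / real (card P))"
    by (rule gmatm_sc[OF g P(1) refl c1])
  let ?I = "block_index k P"
  let ?N = "\<lambda>\<omega>. opnorm ?I (XX P (scaled \<omega>))"
  let ?Y = "\<lambda>x t. mpow ?I (XX P x) t"
  have iY: "integrable M (\<lambda>\<omega>. ?Y (scaled \<omega>) t i j)" for t i j by (rule integrable_scaled[OF poly_mpow])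
  have moment_entry: "moment_entry M g P (sc (card P)) r i j = expectation (\<lambda>\<omega>. ?Y (scaled \<omega>) r i j)" for r i j by (simp add: moment_entry_def scaled_def)
  have nme: "norm_moment M g P s = expectation (\<lambda>\<omega>. ?N \<omega> ^ s)" for s by (simp add: norm_moment_def scaled_def)
  have iN: "integrable M (\<lambda>\<omega>. ?N \<omega> ^ s)" for s by (rule integrable_opnorm_pow)
  show nm0: "0 \<le> norm_moment M g P r" for r unfolding nme by (intro Bochner_Integration.integral_nonneg) auto
  show "norm_moment M g P r \<le> 1 + norm_moment M g P (2*(r+1))"
  proof -
    have "norm_moment M g P r \<le> expectation (\<lambda>\<omega>. 1 + ?N \<omega> ^ (2*(r+1)))"
      unfolding nme by (rule integral_mono[OF iN]) (auto intro: iN intro!: pow_le_1_plus simp del: power_Suc mult_Suc_right add_Suc_right)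
    then show ?thesis using iN[of "2*(r+1)"] by (simp add: nme prob_space)
  qed
  have sq: "(norm_moment M g P r)^2 \<le> norm_moment M g P (2*r)" for r
  proof -
    have "0 \<le> expectation (\<lambda>\<omega>. (?N \<omega> ^ r - norm_moment M g P r)^2)" by simp
    also have "\<dots> = expectation (\<lambda>\<omega>. ?N \<omega> ^ (2*r) - 2 * norm_moment M g P r * ?N \<omega> ^ r + (norm_moment M g P r)^2)"
      by (simp add: power2_diff power_mult[symmetric] mult.commute algebra_simps)
    also have "\<dots> = norm_moment M g P (2*r) - 2 * norm_moment M g P r * norm_moment M g P r + (norm_moment M g P r)^2"
      using iN[of r] iN[of "2*r"] by (simp add: nme prob_space)
    finally show ?thesis by (simp add: power2_eq_square)
  qed
  show "(block_moment M g P r a b)^2 \<le> norm_moment M g P (2*r)" if ab: "a < k" "b < k"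
  proof -
    have one: "\<bar>moment_entry M g P (sc (card P)) r (a,u) (b,u)\<bar> \<le> norm_moment M g P r" if u: "u \<in> P" for u
    proof -
      have "\<bar>moment_entry M g P (sc (card P)) r (a,u) (b,u)\<bar> \<le> expectation (\<lambda>\<omega>. \<bar>?Y (scaled \<omega>) r (a,u) (b,u)\<bar>)"
        unfolding moment_entry by (rule integral_abs_bound)
      also have "\<dots> \<le> norm_moment M g P r" unfolding nme
        by (rule integral_mono[OF integrable_abs[OF iY] iN]) (rule mpow_entry_le[OF finI neI symX], use ab u in \<open>auto simp: block_index_def\<close>)
      finally show ?thesis .
    qed
    have "\<bar>block_moment M g P r a b\<bar> = (1 / n) * \<bar>\<Sum>u\<in>P. moment_entry M g P (sc (card P)) r (a,u) (b,u)\<bar>"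
      unfolding block_moment_def n_def abs_mult by simp
    also have "\<dots> \<le> (1 / n) * (\<Sum>u\<in>P. norm_moment M g P r)"
      by (rule mult_left_mono[OF order_trans[OF sum_abs sum_mono[OF one]]]) (simp_all add: n_def)
    also have "\<dots> = norm_moment M g P r" using n1 by (simp add: n_def)
    finally have "\<bar>block_moment M g P r a b\<bar>^2 \<le> (norm_moment M g P r)^2" by (intro power_mono) auto
    then show ?thesis using sq[of r] by simp
  qed
  show "block_moment M g P r a b = block_moment M g P r b a" if ab: "a < k" "b < k"
  proof -
    have "?Y x r (a,u) (b,u) = ?Y x r (b,u) (a,u)" if "u \<in> P" for u x
      using mpow_sym[OF finI symX, of x r] ab that unfolding symm_def block_index_def by blast
    then show ?thesis unfolding block_moment_def moment_entry by simp
  qed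
  show "block_moment M g P 0 a b = kdelta a b"
    using n1 unfolding block_moment_def moment_entry n_def by (simp add: kdelta_def prob_space)
  define wu where "wu = (\<lambda>u (a,v). w a * kdelta u (v::'b))"
  define Q where "Q = (\<lambda>r \<omega>. (1 / n) * (\<Sum>u\<in>P. qform ?I (?Y (scaled \<omega>) r) (wu u)))"
  define W where "W = (\<Sum>a<k. (w a)^2)"
  have qform_wu: "qform ?I Y (wu u) = (\<Sum>a<k. \<Sum>b<k. w a * Y (a,u) (b,u) * w b)" if u: "u \<in> P" for Y u
  proof -
    have "qform ?I Y (wu u) = (\<Sum>a<k. \<Sum>v\<in>P. \<Sum>b<k. \<Sum>v'\<in>P. kdelta u v * (kdelta u v' * (w a * Y (a,v) (b,v') * w b)))"
      unfolding qform_def sum_block_index wu_def by (intro sum.cong refl) (simp add: mult_ac)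
    also have "\<dots> = (\<Sum>a<k. \<Sum>v\<in>P. kdelta u v * (\<Sum>b<k. \<Sum>v'\<in>P. kdelta u v' * (w a * Y (a,v) (b,v') * w b)))"
      by (simp only: sum_distrib_left)
    also have "\<dots> = (\<Sum>a<k. \<Sum>b<k. w a * Y (a,u) (b,u) * w b)"
      using u by (simp only: sum_delta_l[OF P(1)] if_True)
    finally show ?thesis .
  qed
  have sqnorm_wu: "sqnorm ?I (wu u) = W" if u: "u \<in> P" for u
  proof -
    have "sqnorm ?I (wu u) = (\<Sum>a<k. \<Sum>v\<in>P. kdelta u v * (w a)^2)"
      unfolding sqnorm_def sum_block_index wu_def by (intro sum.cong refl) (simp add: kdelta_def)
    then show ?thesis using u by (simp add: sum_delta_l[OF P(1)] W_def)
  qed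
  have iQ: "integrable M (Q r)" for r
    unfolding Q_def qform_def by (intro integrable_mult_right Bochner_Integration.integrable_sum integrable_mult_left iY)
  have qkQ: "coeff_form (block_moment M g P r) w = expectation (Q r)" for r
  proof -
    have "expectation (Q r) = (1 / n) * (\<Sum>u\<in>P. \<Sum>a<k. \<Sum>b<k. w a * moment_entry M g P (sc (card P)) r (a,u) (b,u) * w b)"
      unfolding Q_def moment_entry using iY by (simp add: qform_wu cong: sum.cong)
    also have "\<dots> = (1 / n) * (\<Sum>a<k. \<Sum>b<k. \<Sum>u\<in>P. w a * moment_entry M g P (sc (card P)) r (a,u) (b,u) * w b)"
      by (subst sum_rotate3[symmetric]) simp
    also have "\<dots> = coeff_form (block_moment M g P r) w"
      by (simp add: coeff_form_def block_moment_def n_def sum_distrib_left sum_distrib_right mult_ac)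
    finally show ?thesis by simp
  qed
  have Q0: "0 \<le> Q (2*r) \<omega>" for \<omega>
    unfolding Q_def using qform_mpow_bounds(1)[OF finI neI symX] n1 by (intro mult_nonneg_nonneg sum_nonneg) auto
  show "0 \<le> coeff_form (block_moment M g P (2*r)) w" unfolding qkQ using Q0 by simp
  have Qup: "Q (2*r) \<omega> \<le> ?N \<omega> ^ (2*r) * W" for \<omega>
  proof -
    have "Q (2*r) \<omega> \<le> (1 / n) * (\<Sum>u\<in>P. ?N \<omega> ^ (2*r) * W)"
      unfolding Q_def
    proof (intro mult_left_mono sum_mono)
      fix u assume u: "u \<in> P"
      show "qform ?I (?Y (scaled \<omega>) (2*r)) (wu u) \<le> ?N \<omega> ^ (2*r) * W"
        using qform_mpow_bounds(3)[OF finI neI symX[of "scaled \<omega>"], of "2*r" "wu u"] sqnorm_wu[OF u] by simp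
    qed (use n1 in auto)
    then show ?thesis using n1 by (simp add: n_def)
  qed
  have Qodd: "- ?N \<omega> * Q (2*r) \<omega> \<le> Q (2*r+1) \<omega>" for \<omega>
  proof -
    have "- ?N \<omega> * Q (2*r) \<omega> = (1 / n) * (\<Sum>u\<in>P. - ?N \<omega> * qform ?I (?Y (scaled \<omega>) (2*r)) (wu u))"
      by (simp add: Q_def sum_distrib_left mult_ac)
    also have "\<dots> \<le> Q (2*r+1) \<omega>"
      unfolding Q_def by (intro mult_left_mono sum_mono qform_mpow_bounds(2)[OF finI neI symX]) (use n1 in auto)
    finally show ?thesis .
  qed
  show "- \<alpha> * coeff_form (block_moment M g P (2*r)) w - (1 / (2*\<epsilon>)) * (norm_moment M g P 2 - 2 * \<alpha> * norm_moment M g P 1 + \<alpha>^2)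
        - (\<epsilon> / 2) * ((\<Sum>a<k. (w a)^2)^2 * norm_moment M g P (4*r)) \<le> coeff_form (block_moment M g P (2*r+1)) w" if e: "0 < \<epsilon>"
  proof -
    define R where "R = (\<lambda>\<omega>. - \<alpha> * Q (2*r) \<omega> - (1 / (2*\<epsilon>)) * (?N \<omega> ^ 2 - 2 * \<alpha> * ?N \<omega> ^ 1 + \<alpha>^2) - (\<epsilon> / 2) * (W^2 * ?N \<omega> ^ (4*r)))"
    have iR: "integrable M R" unfolding R_def
      by (intro Bochner_Integration.integrable_diff Bochner_Integration.integrable_add integrable_mult_right iQ iN) auto
    have le: "R \<omega> \<le> Q (2*r+1) \<omega>" for \<omega>
    proof -
      let ?q = "Q (2*r) \<omega>" and ?d = "?N \<omega> - \<alpha>"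
      have "?d * ?q \<le> (1 / (2*\<epsilon>)) * ?d^2 + (\<epsilon> / 2) * ?q^2"
      proof -
        have "0 \<le> (?d - \<epsilon> * ?q)^2 / (2*\<epsilon>)" using e by simp
        also have "\<dots> = (1 / (2*\<epsilon>)) * ?d^2 + (\<epsilon> / 2) * ?q^2 - ?d * ?q"
          using e by (simp add: power2_eq_square field_simps)
        finally show ?thesis by simp
      qed
      moreover have "?q^2 \<le> W^2 * ?N \<omega> ^ (4*r)"
      proof -
        have "?q^2 \<le> (?N \<omega> ^ (2*r) * W)^2" using Q0 Qup by (intro power_mono) auto
        also have "\<dots> = W^2 * ?N \<omega> ^ (4*r)" by (simp add: power_mult_distrib power_mult[symmetric] mult.commute)
        finally show ?thesis .
      qed
      then have "(\<epsilon> / 2) * ?q^2 \<le> (\<epsilon> / 2) * (W^2 * ?N \<omega> ^ (4*r))" using e by (intro mult_left_mono) auto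
      moreover have "(1 / (2*\<epsilon>)) * ?d^2 = (1 / (2*\<epsilon>)) * (?N \<omega> ^ 2 - 2 * \<alpha> * ?N \<omega> ^ 1 + \<alpha>^2)" by (simp add: power2_eq_square algebra_simps)
      moreover have "- ?N \<omega> * ?q = - \<alpha> * ?q - ?d * ?q" by (simp add: algebra_simps)
      ultimately show ?thesis using Qodd[of \<omega>] unfolding R_def by linarith
    qed
    have "expectation R \<le> coeff_form (block_moment M g P (2*r+1)) w" unfolding qkQ by (rule integral_mono[OF iR iQ le])
    moreover have "expectation R = - \<alpha> * coeff_form (block_moment M g P (2*r)) w - (1 / (2*\<epsilon>)) * (norm_moment M g P 2 - 2 * \<alpha> * norm_moment M g P 1 + \<alpha>^2)
        - (\<epsilon> / 2) * (W^2 * norm_moment M g P (4*r))"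
      unfolding R_def qkQ nme using iQ iN[of 2] iN[of 1] iN[of "4*r"] by (simp add: prob_space)
    ultimately show ?thesis by (simp add: W_def)
  qed
qed

end

context gseq begin

definition bmom :: "nat \<Rightarrow> nat \<Rightarrow> nat \<Rightarrow> nat \<Rightarrow> real" where "bmom n r a b = block_moment (M n) (g n) {..<n} r a b"
definition nmom :: "nat \<Rightarrow> nat \<Rightarrow> real" where "nmom n r = norm_moment (M n) (g n) {..<n} r"

lemma lt_ne: "n \<ge> 1 \<Longrightarrow> {..<n} \<noteq> ({} :: nat set)"
proof -
  assume "n \<ge> 1"
  then have "0 \<in> {..<n}" by simp
  then show ?thesis by blast
qed

lemma nmom_upper:
  assumes "edge_seq \<longlonglongrightarrow> \<alpha>" "\<alpha> \<ge> 1" "r \<ge> 1"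
  shows "\<exists>h. h \<longlonglongrightarrow> \<alpha> ^ (2*r) \<and> eventually (\<lambda>n. nmom n (2*r) \<le> h n) sequentially"
  using moments_upper[OF assms] by (simp add: nmom_def norm_moment_def)

lemma edge_seq_nm: "edge_seq n = nmom n 1" by (simp add: edge_seq_def nmom_def norm_moment_def mean_norm_def)

lemma nmom_bounded:
  assumes "edge_seq \<longlonglongrightarrow> \<alpha>" "\<alpha> \<ge> 1"
  shows "\<exists>H. eventually (\<lambda>n. 0 \<le> nmom n s \<and> nmom n s \<le> H) sequentially"
proof -
  obtain h where h: "h \<longlonglongrightarrow> \<alpha> ^ (2*(s+1))" "eventually (\<lambda>n. nmom n (2*(s+1)) \<le> h n) sequentially"
    using nmom_upper[OF assms, of "s+1"] by auto
  have "eventually (\<lambda>n. h n < \<alpha> ^ (2*(s+1)) + 1) sequentially"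
    using h(1) by (rule order_tendstoD(2)) simp
  then have "eventually (\<lambda>n. 0 \<le> nmom n s \<and> nmom n s \<le> 1 + (\<alpha> ^ (2*(s+1)) + 1)) sequentially"
    using h(2) eventually_ge_at_top[of 1]
  proof eventually_elim
    case (elim n)
    note F = block_moment_facts(4,5)[OF gs[OF elim(3)] finite_lessThan lt_ne[OF elim(3)], of s, folded nmom_def]
    show ?case using F elim(1,2) by linarith
  qed
  then show ?thesis by blast
qed

lemma nmom_over_n:
  assumes "edge_seq \<longlonglongrightarrow> \<alpha>" "\<alpha> \<ge> 1"
  shows "(\<lambda>n. nmom n s / real n) \<longlonglongrightarrow> 0"
proof -
  obtain H where H: "eventually (\<lambda>n. 0 \<le> nmom n s \<and> nmom n s \<le> H) sequentially" using nmom_bounded[OF assms] by blast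
  have "(\<lambda>n. H * (1 / real n)) \<longlonglongrightarrow> H * 0" by (intro tendsto_mult tendsto_const) real_asymp
  then have L: "(\<lambda>n. H / real n) \<longlonglongrightarrow> 0" by simp
  show ?thesis
    by (rule tendsto_sandwich[OF _ _ tendsto_const L]) (use H in \<open>eventually_elim, auto intro: divide_right_mono\<close>)+
qed

lemma bmom_error:
  assumes "edge_seq \<longlonglongrightarrow> \<alpha>" "\<alpha> \<ge> 1" and ab: "a < k" "b < k"
  shows "(\<lambda>n. bmom n (Suc r) a b - ((\<Sum>c<k. B a c * bmom n r c b)
      + (\<Sum>t<r. bil A l k a (\<lambda>c e d. bmom n t c e * bmom n (r - 1 - t) d b)))) \<longlonglongrightarrow> 0"
proof -
  define F where "F = (\<lambda>t n. hsA k l A / (real n)^2 * (real t^2 * (1 + real k * real n * nmom n (4*t)) + real (r-1-t)^2 * (1 + real k * real n * nmom n (4*(r-1-t))))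
        + real k / real n * nmom n (r-1))"
  have F: "F t \<longlonglongrightarrow> 0" for t
  proof -
    have z: "(\<lambda>n. 1 / (real n)^2) \<longlonglongrightarrow> 0" by real_asymp
    have "(\<lambda>n. hsA k l A * (real t^2 * (1 / (real n)^2 + real k * (nmom n (4*t) / real n)) + real (r-1-t)^2 * (1 / (real n)^2 + real k * (nmom n (4*(r-1-t)) / real n)))
        + real k * (nmom n (r-1) / real n)) \<longlonglongrightarrow> hsA k l A * (real t^2 * (0 + real k * 0) + real (r-1-t)^2 * (0 + real k * 0)) + real k * 0"
      by (intro tendsto_add tendsto_mult tendsto_const z nmom_over_n[OF assms(1,2)])
    moreover have "eventually (\<lambda>n. hsA k l A * (real t^2 * (1 / (real n)^2 + real k * (nmom n (4*t) / real n)) + real (r-1-t)^2 * (1 / (real n)^2 + real k * (nmom n (4*(r-1-t)) / real n)))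
        + real k * (nmom n (r-1) / real n) = F t n) sequentially"
      using eventually_ge_at_top[of 1]
    proof eventually_elim
      case (elim n)
      have id: "h * (u * (1 / N^2 + kk * (x / N)) + v * (1 / N^2 + kk * (y / N))) + kk * (z / N)
          = h / N^2 * (u * (1 + kk * N * x) + v * (1 + kk * N * y)) + kk / N * z" if "N \<noteq> 0" for h u v kk x y z N :: real
        using that by (simp add: field_simps power2_eq_square)
      show ?case unfolding F_def by (rule id) (use elim in simp)
    qed
    ultimately have "F t \<longlonglongrightarrow> hsA k l A * (real t^2 * (0 + real k * 0) + real (r-1-t)^2 * (0 + real k * 0)) + real k * 0"
      by (rule Lim_transform_eventually)
    then show ?thesis by simp
  qed
  have "(\<lambda>n. \<Sum>t<r. bil (\<lambda>i a b. \<bar>A i a b\<bar>) l k a (\<lambda>c e d. F t n)) \<longlonglongrightarrow> (\<Sum>t<r. bil (\<lambda>i a b. \<bar>A i a b\<bar>) l k a (\<lambda>c e d. 0))"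
    unfolding bil_def by (intro tendsto_sum tendsto_mult tendsto_const F)
  then have L: "(\<lambda>n. \<Sum>t<r. bil (\<lambda>i a b. \<bar>A i a b\<bar>) l k a (\<lambda>c e d. F t n)) \<longlonglongrightarrow> 0" by (simp add: bil_def)
  show ?thesis
  proof (rule Lim_null_comparison[OF _ L])
    show "eventually (\<lambda>n. norm (bmom n (Suc r) a b - ((\<Sum>c<k. B a c * bmom n r c b)
      + (\<Sum>t<r. bil A l k a (\<lambda>c e d. bmom n t c e * bmom n (r - 1 - t) d b)))) \<le> (\<Sum>t<r. bil (\<lambda>i a b. \<bar>A i a b\<bar>) l k a (\<lambda>c e d. F t n))) sequentially"
      using eventually_ge_at_top[of 1]
    proof eventually_elim
      case (elim n)
      show ?case unfolding F_def real_norm_def bmom_def nmom_def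
        using block_moment_recursion[OF gs[OF elim] finite_lessThan lt_ne[OF elim] ab, of r] by (simp only: card_lessThan)
    qed
  qed
qed

definition lim_moment :: "nat \<Rightarrow> nat \<Rightarrow> nat \<Rightarrow> real" where "lim_moment r a b = lim (\<lambda>n. bmom n r a b)"

lemma bmom_lim:
  assumes "edge_seq \<longlonglongrightarrow> \<alpha>" "\<alpha> \<ge> 1" and ab: "a < k" "b < k"
  shows "(\<lambda>n. bmom n r a b) \<longlonglongrightarrow> lim_moment r a b"
  using ab
proof (induction r arbitrary: a b rule: less_induct)
  case (less r)
  show ?case
  proof (cases r)
    case 0
    have "eventually (\<lambda>n. kdelta a b = bmom n r a b) sequentially"
      using eventually_ge_at_top[of 1]
    proof eventually_elim
      case (elim n)
      show ?case using block_moment_facts(3)[OF gs[OF elim] finite_lessThan lt_ne[OF elim], of a b] by (simp add: bmom_def 0)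
    qed
    then have "(\<lambda>n. bmom n r a b) \<longlonglongrightarrow> kdelta a b" by (rule Lim_transform_eventually[OF tendsto_const])
    then show ?thesis unfolding lim_moment_def by (simp add: limI)
  next
    case (Suc r')
    have "(\<lambda>n. (\<Sum>c<k. B a c * bmom n r' c b) + (\<Sum>t<r'. bil A l k a (\<lambda>c e d. bmom n t c e * bmom n (r' - 1 - t) d b)))
      \<longlonglongrightarrow> (\<Sum>c<k. B a c * lim_moment r' c b) + (\<Sum>t<r'. bil A l k a (\<lambda>c e d. lim_moment t c e * lim_moment (r' - 1 - t) d b))"
      unfolding bil_def using less.prems Suc
      by (intro tendsto_add tendsto_sum tendsto_mult tendsto_const less.IH) auto
    from tendsto_add[OF bmom_error[OF assms(1,2) less.prems, of r'] this]
    have "(\<lambda>n. bmom n r a b) \<longlonglongrightarrow> 0 + ((\<Sum>c<k. B a c * lim_moment r' c b) + (\<Sum>t<r'. bil A l k a (\<lambda>c e d. lim_moment t c e * lim_moment (r' - 1 - t) d b)))"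
      by (simp add: Suc)
    note conv = this
    have "convergent (\<lambda>n. bmom n r a b)" by (rule convergentI[OF conv])
    then show ?thesis unfolding lim_moment_def convergent_LIMSEQ_iff .
  qed
qed

lemma lim_moment_rec:
  assumes "edge_seq \<longlonglongrightarrow> \<alpha>" "\<alpha> \<ge> 1" and ab: "a < k" "b < k"
  shows "lim_moment (Suc r) a b = (\<Sum>c<k. B a c * lim_moment r c b) + (\<Sum>t<r. bil A l k a (\<lambda>c e d. lim_moment t c e * lim_moment (r - 1 - t) d b))"
proof -
  have "(\<lambda>n. bmom n (Suc r) a b - ((\<Sum>c<k. B a c * bmom n r c b) + (\<Sum>t<r. bil A l k a (\<lambda>c e d. bmom n t c e * bmom n (r - 1 - t) d b))))
    \<longlonglongrightarrow> lim_moment (Suc r) a b - ((\<Sum>c<k. B a c * lim_moment r c b) + (\<Sum>t<r. bil A l k a (\<lambda>c e d. lim_moment t c e * lim_moment (r - 1 - t) d b)))"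
    unfolding bil_def using ab by (intro tendsto_diff tendsto_add tendsto_sum tendsto_mult tendsto_const bmom_lim[OF assms(1,2)]) auto
  from LIMSEQ_unique[OF this bmom_error[OF assms]] show ?thesis by simp
qed

lemma lim_moment_0:
  assumes "edge_seq \<longlonglongrightarrow> \<alpha>" "\<alpha> \<ge> 1" and ab: "a < k" "b < k"
  shows "lim_moment 0 a b = kdelta a b"
proof -
  have "eventually (\<lambda>n. bmom n 0 a b = kdelta a b) sequentially"
    using eventually_ge_at_top[of 1]
    by eventually_elim (simp add: bmom_def block_moment_facts(3)[OF gs finite_lessThan lt_ne])
  then have "(\<lambda>n. bmom n 0 a b) \<longlonglongrightarrow> kdelta a b" by (rule tendsto_eventually)
  with bmom_lim[OF assms, of 0] show ?thesis using LIMSEQ_unique by blast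
qed

lemma lim_moment_bound:
  assumes "edge_seq \<longlonglongrightarrow> \<alpha>" "\<alpha> \<ge> 1" and ab: "a < k" "b < k"
  shows "\<bar>lim_moment r a b\<bar> \<le> \<alpha> ^ r"
proof (cases "r = 0")
  case True
  then show ?thesis using lim_moment_0[OF assms] by (simp add: kdelta_def)
next
  case False
  then obtain h where h: "h \<longlonglongrightarrow> \<alpha> ^ (2*r)" "eventually (\<lambda>n. nmom n (2*r) \<le> h n) sequentially"
    using nmom_upper[OF assms(1,2), of r] by auto
  have "(lim_moment r a b)^2 \<le> \<alpha> ^ (2*r)"
  proof (rule tendsto_le[OF sequentially_bot h(1) tendsto_power[OF bmom_lim[OF assms]]])
    show "eventually (\<lambda>n. (bmom n r a b)^2 \<le> h n) sequentially"
      using h(2) eventually_ge_at_top[of 1]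
    proof eventually_elim
      case (elim n)
      show ?case using block_moment_facts(1)[OF gs[OF elim(2)] finite_lessThan lt_ne[OF elim(2)] ab, of r] elim(1)
        by (simp add: bmom_def nmom_def)
    qed
  qed
  also have "\<alpha> ^ (2*r) = (\<alpha> ^ r)^2" by (simp add: power_mult[symmetric] mult.commute)
  finally have "\<bar>lim_moment r a b\<bar>^2 \<le> (\<alpha> ^ r)^2" by simp
  then show ?thesis using assms(2) by (intro power2_le_imp_le[of "\<bar>lim_moment r a b\<bar>"]) auto
qed

lemma lim_moment_sym:
  assumes "edge_seq \<longlonglongrightarrow> \<alpha>" "\<alpha> \<ge> 1" and ab: "a < k" "b < k"
  shows "lim_moment r a b = lim_moment r b a"
proof -
  have "eventually (\<lambda>n. bmom n r a b = bmom n r b a) sequentially"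
    using eventually_ge_at_top[of 1]
  proof eventually_elim
    case (elim n)
    show ?case using block_moment_facts(2)[OF gs[OF elim] finite_lessThan lt_ne[OF elim] ab, of r] by (simp add: bmom_def)
  qed
  then have "(\<lambda>n. bmom n r b a) \<longlonglongrightarrow> lim_moment r a b" by (rule Lim_transform_eventually[OF bmom_lim[OF assms]])
  then show ?thesis using LIMSEQ_unique bmom_lim[OF assms(1,2) ab(2,1)] by blast
qed

lemma coeff_form_lim:
  assumes "edge_seq \<longlonglongrightarrow> \<alpha>" "\<alpha> \<ge> 1"
  shows "(\<lambda>n. coeff_form (bmom n r) w) \<longlonglongrightarrow> coeff_form (lim_moment r) w"
  unfolding coeff_form_def by (intro tendsto_sum tendsto_mult tendsto_const bmom_lim[OF assms]) auto

text \<open>As \<open>opnorm\<close> converges to \<open>\<alpha>\<close> in mean square, the first error in the averaged inequality vanishes for each \<open>\<epsilon>\<close>, and then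
  \<open>\<epsilon>\<close> tends to \<open>0\<close>.\<close>

lemma lim_moment_pos:
  assumes "edge_seq \<longlonglongrightarrow> \<alpha>" "\<alpha> \<ge> 1"
  shows "0 \<le> coeff_form (lim_moment (2*r)) w" "- \<alpha> * coeff_form (lim_moment (2*r)) w \<le> coeff_form (lim_moment (2*r+1)) w"
proof -
  have mnf: "block_moment (M n) (g n) {..<n} r = bmom n r" for n r by (intro ext) (simp add: bmom_def)
  show "0 \<le> coeff_form (lim_moment (2*r)) w"
  proof (rule tendsto_lowerbound[OF coeff_form_lim[OF assms]])
    show "eventually (\<lambda>n. 0 \<le> coeff_form (bmom n (2*r)) w) sequentially"
      using eventually_ge_at_top[of 1]
    proof eventually_elim
      case (elim n)
      show ?case using block_moment_facts(6)[OF gs[OF elim] finite_lessThan lt_ne[OF elim], of r w] by (simp add: mnf)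
    qed
  qed simp
  obtain H where H: "eventually (\<lambda>n. 0 \<le> nmom n (4*r) \<and> nmom n (4*r) \<le> H) sequentially" using nmom_bounded[OF assms] by blast
  obtain h where h: "h \<longlonglongrightarrow> \<alpha> ^ 2" "eventually (\<lambda>n. nmom n 2 \<le> h n) sequentially"
    using nmom_upper[OF assms, of 1] by auto
  define W where "W = (\<Sum>a<k. (w a)^2)"
  have key: "- \<alpha> * coeff_form (lim_moment (2*r)) w - (\<epsilon> / 2) * (W^2 * H) \<le> coeff_form (lim_moment (2*r+1)) w" if e: "0 < \<epsilon>" for \<epsilon>
  proof -
    have L: "(\<lambda>n. - \<alpha> * coeff_form (bmom n (2*r)) w - (1 / (2*\<epsilon>)) * (h n - 2 * \<alpha> * edge_seq n + \<alpha>^2) - (\<epsilon> / 2) * (W^2 * H))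
      \<longlonglongrightarrow> - \<alpha> * coeff_form (lim_moment (2*r)) w - (1 / (2*\<epsilon>)) * (\<alpha>^2 - 2 * \<alpha> * \<alpha> + \<alpha>^2) - (\<epsilon> / 2) * (W^2 * H)"
      by (intro tendsto_intros coeff_form_lim[OF assms] h(1) assms(1))
    have "- \<alpha> * coeff_form (lim_moment (2*r)) w - (1 / (2*\<epsilon>)) * (\<alpha>^2 - 2 * \<alpha> * \<alpha> + \<alpha>^2) - (\<epsilon> / 2) * (W^2 * H) \<le> coeff_form (lim_moment (2*r+1)) w"
    proof (rule tendsto_le[OF sequentially_bot coeff_form_lim[OF assms] L])
      show "eventually (\<lambda>n. - \<alpha> * coeff_form (bmom n (2*r)) w - (1 / (2*\<epsilon>)) * (h n - 2 * \<alpha> * edge_seq n + \<alpha>^2) - (\<epsilon> / 2) * (W^2 * H) \<le> coeff_form (bmom n (2*r+1)) w) sequentially"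
        using H h(2) eventually_ge_at_top[of 1]
      proof eventually_elim
        case (elim n)
        have "- \<alpha> * coeff_form (bmom n (2*r)) w - (1 / (2*\<epsilon>)) * (nmom n 2 - 2 * \<alpha> * edge_seq n + \<alpha>^2) - (\<epsilon> / 2) * (W^2 * nmom n (4*r)) \<le> coeff_form (bmom n (2*r+1)) w"
          using block_moment_facts(7)[OF gs[OF elim(3)] finite_lessThan lt_ne[OF elim(3)] e, of \<alpha> r w]
          by (simp only: mnf W_def nmom_def edge_seq_nm)
        moreover have "(1 / (2*\<epsilon>)) * (nmom n 2 - 2 * \<alpha> * edge_seq n + \<alpha>^2) \<le> (1 / (2*\<epsilon>)) * (h n - 2 * \<alpha> * edge_seq n + \<alpha>^2)"
          using elim(2) e by (intro mult_left_mono) auto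
        moreover have "(\<epsilon> / 2) * (W^2 * nmom n (4*r)) \<le> (\<epsilon> / 2) * (W^2 * H)"
          using elim(1) e by (intro mult_left_mono) auto
        ultimately show ?case by linarith
      qed
    qed
    then show ?thesis by (simp add: power2_eq_square)
  qed
  show "- \<alpha> * coeff_form (lim_moment (2*r)) w \<le> coeff_form (lim_moment (2*r+1)) w"
  proof (rule field_le_epsilon)
    fix e :: real assume e: "0 < e"
    define d where "d = \<bar>W^2 * H\<bar> + 1"
    have d: "0 < d" by (simp add: d_def)
    have "- \<alpha> * coeff_form (lim_moment (2*r)) w - (2 * e / d / 2) * (W^2 * H) \<le> coeff_form (lim_moment (2*r+1)) w"
      by (rule key) (use e d in simp)
    moreover have "(2 * e / d / 2) * (W^2 * H) \<le> (e / d) * d"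
    proof -
      have "2 * e / d / 2 = e / d" by simp
      moreover have "(e / d) * (W^2 * H) \<le> (e / d) * d"
        using e d by (intro mult_left_mono) (auto simp: d_def)
      ultimately show ?thesis by (simp only:)
    qed
    moreover have "(e / d) * d = e" using d by simp
    ultimately show "- \<alpha> * coeff_form (lim_moment (2*r)) w \<le> coeff_form (lim_moment (2*r+1)) w + e" by linarith
  qed
qed

text \<open>\<open>Q = \<Sum>r. lim_moment r / z ^ (r + 1)\<close>, the limit of the partially traced resolvent. It converges because the moments grow at most
  like \<open>\<alpha> ^ r\<close>, the moment recursion is the equation coefficientwise, and grouping the terms \<open>2 * r\<close> and \<open>2 * r + 1\<close> shows that it is positive
  definite.\<close>

theorem dyson_solution:
  assumes edge_seq: "edge_seq \<longlonglongrightarrow> \<alpha>" "\<alpha> \<ge> 1" and z: "z > \<alpha>"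
  shows "\<exists>Q. (\<forall>a<k. \<forall>b<k. Q a b = Q b a) \<and> (\<forall>w. (\<exists>a<k. w a \<noteq> 0) \<longrightarrow> 0 < coeff_form Q w) \<and>
    (\<forall>a<k. \<forall>b<k. z * Q a b = kdelta a b + (\<Sum>c<k. B a c * Q c b) + bil A l k a (\<lambda>c e d. Q c e * Q d b))"
proof -
  define f where "f = (\<lambda>a b r. lim_moment r a b / z ^ (r+1))"
  have z1: "z > 1" using edge_seq z by linarith
  have qz: "\<alpha> / z < 1" "0 \<le> \<alpha> / z" using edge_seq z z1 by auto
  have fb: "norm (f a b r) \<le> (1 / z) * (\<alpha> / z) ^ r" if "a < k" "b < k" for a b r
  proof -
    have "norm (f a b r) = \<bar>lim_moment r a b\<bar> / z ^ (r+1)" using z1 by (simp add: f_def)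
    also have "\<dots> \<le> \<alpha> ^ r / z ^ (r+1)" using lim_moment_bound[OF edge_seq that, of r] z1 by (intro divide_right_mono) auto
    also have "\<dots> = (1 / z) * (\<alpha> / z) ^ r" by (simp add: power_divide)
    finally show ?thesis .
  qed
  have geo: "summable (\<lambda>r. (1 / z) * (\<alpha> / z) ^ r)" using qz by (intro summable_mult summable_geometric) auto
  have sumn: "summable (\<lambda>r. norm (f a b r))" if "a < k" "b < k" for a b
    by (rule summable_comparison_test'[OF geo, of 0]) (use fb[OF that] in simp)
  have sumf: "summable (f a b)" if "a < k" "b < k" for a b by (rule summable_norm_cancel[OF sumn[OF that]])
  define Q where "Q = (\<lambda>a b. suminf (f a b))"
  have fs: "f a b sums Q a b" if "a < k" "b < k" for a b
    using sumf[OF that] by (simp add: Q_def summable_sums)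
  have sym: "Q a b = Q b a" if "a < k" "b < k" for a b
    unfolding Q_def f_def using lim_moment_sym[OF edge_seq that] by simp
  have cau: "(\<lambda>s. \<Sum>t\<le>s. f c e t * f d b (s - t)) sums (Q c e * Q d b)" if "c < k" "e < k" "d < k" "b < k" for b c d e
    using Cauchy_product_sums[OF sumn[OF that(1,2)] sumn[OF that(3,4)]] by (simp add: Q_def)
  have eq: "z * Q a b = kdelta a b + (\<Sum>c<k. B a c * Q c b) + bil A l k a (\<lambda>c e d. Q c e * Q d b)" if ab: "a < k" "b < k" for a b
  proof -
    define G where "G = (\<lambda>r. \<Sum>t<r. bil A l k a (\<lambda>c e d. f c e t * f d b (r - 1 - t)))"
    have fS: "z * f a b (Suc r) = (\<Sum>c<k. B a c * f c b r) + G r" for r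
    proof -
      have "z * f a b (Suc r) = lim_moment (Suc r) a b / z ^ (r+1)" using z1 by (simp add: f_def)
      also have "\<dots> = (\<Sum>c<k. B a c * f c b r) + (\<Sum>t<r. bil A l k a (\<lambda>c e d. lim_moment t c e * lim_moment (r - 1 - t) d b / z ^ (r+1)))"
      proof -
        have p1: "(\<Sum>c<k. B a c * lim_moment r c b) / z ^ (r+1) = (\<Sum>c<k. B a c * f c b r)"
          unfolding f_def by (simp only: sum_divide_distrib times_divide_eq_right)
        have p2: "(\<Sum>t<r. bil A l k a (\<lambda>c e d. lim_moment t c e * lim_moment (r - 1 - t) d b)) / z ^ (r+1)
           = (\<Sum>t<r. bil A l k a (\<lambda>c e d. lim_moment t c e * lim_moment (r - 1 - t) d b / z ^ (r+1)))"
          unfolding bil_def by (simp only: sum_divide_distrib times_divide_eq_right)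
        show ?thesis unfolding lim_moment_rec[OF edge_seq ab] add_divide_distrib p1 p2 ..
      qed
      also have "(\<Sum>t<r. bil A l k a (\<lambda>c e d. lim_moment t c e * lim_moment (r - 1 - t) d b / z ^ (r+1))) = G r"
        unfolding G_def
      proof (rule sum.cong[OF refl])
        fix t assume "t \<in> {..<r}"
        then have "r + 1 = (t + 1) + (r - 1 - t + 1)" by auto
        then have zz: "z ^ (r+1) = z ^ (t+1) * z ^ (r - 1 - t + 1)" by (metis power_add)
        show "bil A l k a (\<lambda>c e d. lim_moment t c e * lim_moment (r - 1 - t) d b / z ^ (r+1)) = bil A l k a (\<lambda>c e d. f c e t * f d b (r - 1 - t))"
          unfolding f_def zz times_divide_times_eq ..
      qed
      finally show ?thesis .
    qed
    have G0: "G 0 = 0" by (simp add: G_def)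
    have GS: "G (Suc s) = bil A l k a (\<lambda>c e d. \<Sum>t\<le>s. f c e t * f d b (s - t))" for s
    proof -
      have "G (Suc s) = (\<Sum>t\<le>s. bil A l k a (\<lambda>c e d. f c e t * f d b (s - t)))"
        unfolding G_def lessThan_Suc_atMost by simp
      also have "\<dots> = bil A l k a (\<lambda>c e d. \<Sum>t\<le>s. f c e t * f d b (s - t))"
        unfolding bil_def sum_distrib_left
        by (subst sum.swap, rule sum.cong[OF refl], subst sum.swap, rule sum.cong[OF refl],
            subst sum.swap, rule sum.cong[OF refl], subst sum.swap, rule refl)
      finally show ?thesis .
    qed
    have "(\<lambda>s. G (Suc s)) sums (bil A l k a (\<lambda>c e d. Q c e * Q d b))"
      unfolding GS bil_def using ab by (intro sums_sum sums_mult cau) auto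
    from sums_Suc[OF this] have Gs: "G sums (bil A l k a (\<lambda>c e d. Q c e * Q d b))" by (simp only: G0 add_0_right)
    have "(\<lambda>r. (\<Sum>c<k. B a c * f c b r) + G r) sums ((\<Sum>c<k. B a c * Q c b) + bil A l k a (\<lambda>c e d. Q c e * Q d b))"
      by (rule sums_add[OF sums_sum[OF sums_mult[OF fs]] Gs]) (use ab in simp_all)
    then have "(\<lambda>r. z * f a b (Suc r)) sums ((\<Sum>c<k. B a c * Q c b) + bil A l k a (\<lambda>c e d. Q c e * Q d b))"
      unfolding fS[symmetric] .
    from sums_Suc[OF this] have s1: "(\<lambda>r. z * f a b r) sums ((\<Sum>c<k. B a c * Q c b) + bil A l k a (\<lambda>c e d. Q c e * Q d b) + z * f a b 0)" .
    have s2: "(\<lambda>r. z * f a b r) sums (z * Q a b)" by (rule sums_mult[OF fs[OF ab]])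
    have "z * Q a b - z * f a b 0 = (\<Sum>c<k. B a c * Q c b) + bil A l k a (\<lambda>c e d. Q c e * Q d b)"
      using sums_unique2[OF s1 s2] by linarith
    moreover have "z * f a b 0 = kdelta a b" using lim_moment_0[OF edge_seq ab] z1 by (simp add: f_def)
    ultimately show ?thesis by linarith
  qed
  have pos: "0 < coeff_form Q w" if w: "\<exists>a<k. w a \<noteq> 0" for w
  proof -
    define W where "W = (\<Sum>a<k. (w a)^2)"
    have W0: "0 < W"
    proof -
      obtain a where a: "a < k" "w a \<noteq> 0" using w by blast
      then show ?thesis unfolding W_def by (intro sum_pos2[of _ a]) auto
    qed
    have qs: "(\<lambda>r. coeff_form (lim_moment r) w / z ^ (r+1)) sums coeff_form Q w"
    proof -
      have "(\<lambda>r. \<Sum>a<k. \<Sum>b<k. w a * f a b r * w b) sums coeff_form Q w"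
        unfolding coeff_form_def by (intro sums_sum sums_mult2 sums_mult fs) auto
      then show ?thesis by (simp add: coeff_form_def f_def sum_divide_distrib)
    qed
    have q0: "coeff_form (lim_moment 0) w = W"
    proof -
      have "coeff_form (lim_moment 0) w = (\<Sum>a<k. \<Sum>b<k. kdelta a b * (w a * w b))"
        unfolding coeff_form_def using lim_moment_0[OF edge_seq] by (intro sum.cong refl) (simp add: mult_ac)
      then show ?thesis by (simp add: sum_delta_l W_def power2_eq_square)
    qed
    define c where "c = (1 - \<alpha> / z) * (W / z)"
    \<comment> \<open>Each odd term is at least \<open>- \<alpha> / z\<close> times the even term before it.\<close>
    have pair: "(1 - \<alpha> / z) * (coeff_form (lim_moment (2*r)) w / z ^ (2*r+1)) \<le> coeff_form (lim_moment (2*r)) w / z ^ (2*r+1) + coeff_form (lim_moment (2*r+1)) w / z ^ (2*r+1+1)" for r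
    proof -
      have "- \<alpha> * coeff_form (lim_moment (2*r)) w / z ^ (2*r+1+1) \<le> coeff_form (lim_moment (2*r+1)) w / z ^ (2*r+1+1)"
        using lim_moment_pos(2)[OF edge_seq, of r w] z1 by (intro divide_right_mono) auto
      moreover have "(1 - \<alpha> / z) * (coeff_form (lim_moment (2*r)) w / z ^ (2*r+1)) = coeff_form (lim_moment (2*r)) w / z ^ (2*r+1) + - \<alpha> * coeff_form (lim_moment (2*r)) w / z ^ (2*r+1+1)"
        using z1 by (simp add: field_simps)
      ultimately show ?thesis by linarith
    qed
    have part: "c \<le> (\<Sum>r<2*Suc N. coeff_form (lim_moment r) w / z ^ (r+1))" for N
    proof (induction N)
      case 0
      have "c = (1 - \<alpha> / z) * (coeff_form (lim_moment (2*0)) w / z ^ (2*0+1))" by (simp add: c_def q0)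
      also have "\<dots> \<le> coeff_form (lim_moment (2*0)) w / z ^ (2*0+1) + coeff_form (lim_moment (2*0+1)) w / z ^ (2*0+1+1)" by (rule pair)
      also have "\<dots> = (\<Sum>r<2*Suc 0. coeff_form (lim_moment r) w / z ^ (r+1))" by (simp add: numeral_2_eq_2)
      finally show ?case .
    next
      case (Suc N)
      have "0 \<le> (1 - \<alpha> / z) * (coeff_form (lim_moment (2*Suc N)) w / z ^ (2*Suc N+1))"
        using qz z1 lim_moment_pos(1)[OF edge_seq, of "Suc N" w] by (intro mult_nonneg_nonneg divide_nonneg_nonneg) auto
      also have "\<dots> \<le> coeff_form (lim_moment (2*Suc N)) w / z ^ (2*Suc N+1) + coeff_form (lim_moment (2*Suc N+1)) w / z ^ (2*Suc N+1+1)" by (rule pair)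
      finally have "0 \<le> coeff_form (lim_moment (2*Suc N)) w / z ^ (2*Suc N+1) + coeff_form (lim_moment (2*Suc N+1)) w / z ^ (2*Suc N+1+1)" .
      moreover have "(\<Sum>r<2*Suc (Suc N). coeff_form (lim_moment r) w / z ^ (r+1)) = (\<Sum>r<2*Suc N. coeff_form (lim_moment r) w / z ^ (r+1))
         + (coeff_form (lim_moment (2*Suc N)) w / z ^ (2*Suc N+1) + coeff_form (lim_moment (2*Suc N+1)) w / z ^ (2*Suc N+1+1))"
      proof -
        have "sum h {..<2*Suc (Suc N)} = sum h {..<2*Suc N} + (h (2*Suc N) + h (2*Suc N+1))" for h :: "nat \<Rightarrow> real" by simp
        from this[of "\<lambda>r. coeff_form (lim_moment r) w / z ^ (r+1)"] show ?thesis .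
      qed
      ultimately show ?case using Suc.IH by linarith
    qed
    have "(\<lambda>N. \<Sum>r<2*Suc N. coeff_form (lim_moment r) w / z ^ (r+1)) \<longlonglongrightarrow> coeff_form Q w"
    proof -
      have "filterlim (\<lambda>N. 2*Suc N) at_top sequentially"
        by (rule filterlim_at_top_mono[OF filterlim_ident]) auto
      then show ?thesis using qs unfolding sums_def by (rule filterlim_compose[rotated])
    qed
    then have "c \<le> coeff_form Q w" by (rule tendsto_lowerbound) (use part in auto)
    moreover have "0 < c" unfolding c_def using qz z1 W0 by (intro mult_pos_pos divide_pos_pos) auto
    ultimately show ?thesis by linarith
  qed
  show ?thesis by (intro exI[of _ Q] conjI allI impI sym eq pos)
qed

end

section \<open>From the operator norm to the largest eigenvalue\<close>

text \<open>For a large shift \<open>K\<close> the norm of \<open>X + K\<close> is \<open>K\<close> plus the largest eigenvalue \<open>\<mu>\<close>, except when the negative part of the spectrum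
  dominates; in that case the norm of \<open>X\<close> is at least of order \<open>K\<close>, which the quadratic error term absorbs.\<close>

lemma opnorm_shift_bounds:
  assumes I: "finite I" "I \<noteq> {}" and X: "symm I X" and K: "0 < K"
    and Y: "\<And>i j. i \<in> I \<Longrightarrow> j \<in> I \<Longrightarrow> Y i j = X i j + K * kdelta i j"
    and top: "\<And>v. qform I X v \<le> \<mu> * sqnorm I v" and att: "\<exists>v. sqnorm I v = 1 \<and> qform I X v = \<mu>"
  shows "0 \<le> opnorm I Y - K - \<mu>" "opnorm I Y - K - \<mu> \<le> (opnorm I X)^2 / (2*K)" "\<bar>\<mu>\<bar> \<le> opnorm I X"
proof -
  have sY: "symm I Y" using X Y by (simp add: symm_def kdelta_def eq_commute)
  have qY: "qform I Y v = qform I X v + K * sqnorm I v" for v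
  proof -
    have "qform I Y v = qform I (\<lambda>i j. X i j + K * kdelta i j) v" by (rule qform_cong) (rule Y)
    then show ?thesis by (simp only: qform_add qform_scale qform_kdelta[OF I(1)])
  qed
  obtain v where v: "sqnorm I v = 1" "qform I X v = \<mu>" using att by blast
  show lim_moment: "\<bar>\<mu>\<bar> \<le> opnorm I X" using abs_qform_le[OF I X, of v] v by simp
  show "0 \<le> opnorm I Y - K - \<mu>" using abs_qform_le[OF I sY, of v] v by (simp add: qY)
  have amgm: "2 * opnorm I X \<le> 2 * K + (opnorm I X)^2 / (2*K)"
  proof -
    have "0 \<le> (opnorm I X - 2*K)^2 / (2*K)" using K by simp
    also have "\<dots> = 2 * K + (opnorm I X)^2 / (2*K) - 2 * opnorm I X"
      using K by (simp add: power2_diff add_divide_distrib diff_divide_distrib) (simp add: power2_eq_square)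
    finally show ?thesis by simp
  qed
  obtain u where u: "sqnorm I u = 1" "opnorm I Y = \<bar>qform I Y u\<bar>" using opnorm_attained[OF I sY] by blast
  have "qform I X u \<le> \<mu>" using top[of u] u by simp
  moreover have "- opnorm I X \<le> qform I X u" using abs_qform_le[OF I X, of u] u by simp
  moreover have "0 \<le> (opnorm I X)^2 / (2*K)" using K by simp
  moreover have "opnorm I Y = \<bar>qform I X u + K\<bar>" using u by (simp add: qY)
  ultimately show "opnorm I Y - K - \<mu> \<le> (opnorm I X)^2 / (2*K)" using amgm lim_moment by linarith
qed

context gseq begin

lemma edge_seq_eq: "edge_seq n = integral\<^sup>L (M n) (\<lambda>\<omega>. opnorm (block_index k {..<n}) (gauss_mat l A B {..<n} (\<lambda>e. sqrt (1 / real n) * g n e \<omega>)))"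
  by (simp add: edge_seq_def mean_norm_def entry_scale_def split_def)

lemma limit_and_dyson:
  "\<exists>\<alpha>. (\<lambda>n. integral\<^sup>L (M n) (\<lambda>\<omega>. opnorm (block_index k {..<n}) (gauss_mat l A B {..<n} (\<lambda>e. sqrt (1 / real n) * g n e \<omega>)))) \<longlonglongrightarrow> \<alpha> \<and>
    (\<exists>C. eventually (\<lambda>n. integral\<^sup>L (M n) (\<lambda>\<omega>. opnorm (block_index k {..<n}) (gauss_mat l A B {..<n} (\<lambda>e. sqrt (1 / real n) * g n e \<omega>)) ^ 2) \<le> C) sequentially) \<and>
    (\<forall>z>\<alpha>. \<exists>Q. (\<forall>a<k. \<forall>b<k. Q a b = Q b a) \<and> (\<forall>w. (\<exists>a<k. w a \<noteq> 0) \<longrightarrow> 0 < qform {..<k} Q w) \<and>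
      (\<forall>a<k. \<forall>b<k. z * Q a b = kdelta a b + (\<Sum>c<k. B a c * Q c b) + bil A l k a (\<lambda>c e d. Q c e * Q d b)))"
proof -
  obtain \<alpha> where \<alpha>: "\<alpha> \<ge> 1" "edge_seq \<longlonglongrightarrow> \<alpha>" using edge_seq_convergent by blast
  have t: "edge_seq = (\<lambda>n. integral\<^sup>L (M n) (\<lambda>\<omega>. opnorm (block_index k {..<n}) (gauss_mat l A B {..<n} (\<lambda>e. sqrt (1 / real n) * g n e \<omega>))))"
    by (rule ext) (rule edge_seq_eq)
  obtain h where h: "h \<longlonglongrightarrow> \<alpha> ^ (2*1)"
    "eventually (\<lambda>n. integral\<^sup>L (M n) (\<lambda>\<omega>. opnorm (block_index k {..<n}) (XX {..<n} (\<lambda>e. entry_scale (sc n) e * g n e \<omega>)) ^ (2*1)) \<le> h n) sequentially"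
    using moments_upper[OF \<alpha>(2,1) order_refl] by blast
  have "eventually (\<lambda>n. h n < \<alpha> ^ (2*1) + 1) sequentially" by (rule order_tendstoD(2)[OF h(1)]) simp
  with h(2) have "eventually (\<lambda>n. integral\<^sup>L (M n) (\<lambda>\<omega>. opnorm (block_index k {..<n}) (gauss_mat l A B {..<n} (\<lambda>e. sqrt (1 / real n) * g n e \<omega>)) ^ 2) \<le> \<alpha>^(2*1) + 1) sequentially"
    by eventually_elim (simp add: entry_scale_def split_def)
  then show ?thesis using \<alpha>(2) dyson_solution[OF \<alpha>(2,1), unfolded coeff_form_def, folded qform_def] unfolding t by blast
qed

end

text \<open>For each shift \<open>K\<close> the mean of \<open>opnorm (X + K) - K\<close> converges, and it differs from the mean of the largest eigenvalue by
  \<open>O (1 / K)\<close>, uniformly in large \<open>n\<close>. So the means of the largest eigenvalue form a Cauchy sequence, and the lower bound \<open>\<rho>\<close>, valid for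
  every \<open>K\<close>, passes to the limit. The premise on \<open>\<rho>\<close> states that a positive definite solution of the Dyson equation at
  \<open>z\<close> yields \<open>\<rho> \<le> z - K\<close>.\<close>

lemma edge_limit:
  fixes A :: "nat \<Rightarrow> nat \<Rightarrow> nat \<Rightarrow> real" and B :: "nat \<Rightarrow> nat \<Rightarrow> real"
    and M :: "nat \<Rightarrow> 'w measure" and g :: "nat \<Rightarrow> nat \<times> nat \<times> nat \<Rightarrow> 'w \<Rightarrow> real" and lm :: "nat \<Rightarrow> 'w \<Rightarrow> real"
  assumes k1: "k \<ge> 1"
    and symA: "\<And>i a b. i \<in> {1..l} \<Longrightarrow> a < k \<Longrightarrow> b < k \<Longrightarrow> A i a b = A i b a"
    and symB: "\<And>a b. a < k \<Longrightarrow> b < k \<Longrightarrow> B a b = B b a"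
    and gs: "\<And>n. n \<ge> 1 \<Longrightarrow> gaussian_family (M n) (g n) (noise_index l {..<n})"
    and top: "\<And>n \<omega> v. n \<ge> 1 \<Longrightarrow> \<omega> \<in> space (M n) \<Longrightarrow>
      qform (block_index k {..<n}) (gauss_mat l A B {..<n} (\<lambda>e. sqrt (1 / real n) * g n e \<omega>)) v \<le> lm n \<omega> * sqnorm (block_index k {..<n}) v"
    and att: "\<And>n \<omega>. n \<ge> 1 \<Longrightarrow> \<omega> \<in> space (M n) \<Longrightarrow>
      \<exists>v. sqnorm (block_index k {..<n}) v = 1 \<and> qform (block_index k {..<n}) (gauss_mat l A B {..<n} (\<lambda>e. sqrt (1 / real n) * g n e \<omega>)) v = lm n \<omega>"
    and rho: "\<And>z K Q. (\<And>a b. a < k \<Longrightarrow> b < k \<Longrightarrow> Q a b = Q b a) \<Longrightarrow> (\<And>w. \<exists>a<k. w a \<noteq> 0 \<Longrightarrow> 0 < qform {..<k} Q w) \<Longrightarrow>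
      (\<And>a b. a < k \<Longrightarrow> b < k \<Longrightarrow> z * Q a b = kdelta a b + (\<Sum>c<k. (B a c + K * kdelta a c) * Q c b) + bil A l k a (\<lambda>c e d. Q c e * Q d b)) \<Longrightarrow>
      \<rho> \<le> z - K"
  shows "\<exists>L. (\<lambda>n. integral\<^sup>L (M n) (lm n)) \<longlonglongrightarrow> L \<and> \<rho> \<le> L"
proof -
  define BK where "BK = (\<lambda>K a b. B a b + K * kdelta a b)"
  define X where "X = (\<lambda>K n \<omega>. gauss_mat l A (BK K) {..<n} (\<lambda>e. sqrt (1 / real n) * g n e \<omega>))"
  let ?I = "\<lambda>n. block_index k {..<n::nat}"
  define N where "N = (\<lambda>K n \<omega>. opnorm (?I n) (X K n \<omega>))"
  have modelK: "model k l A (BK K)" for K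
    by unfold_locales (use k1 symA symB in \<open>auto simp: BK_def kdelta_def\<close>)
  have B0: "BK 0 = B" by (simp add: BK_def fun_eq_iff)
  have X0: "X 0 n \<omega> = gauss_mat l A B {..<n} (\<lambda>e. sqrt (1 / real n) * g n e \<omega>)" for n \<omega> by (simp add: X_def B0)
  have finI: "finite (?I n)" for n by (simp add: block_index_def)
  have neI: "?I n \<noteq> {}" if "n \<ge> 1" for n
  proof -
    have "(0,0) \<in> ?I n" using that k1 by (simp add: block_index_def)
    then show ?thesis by blast
  qed
  have XK: "X K n \<omega> i j = X 0 n \<omega> i j + K * kdelta i j" if "i \<in> ?I n" "j \<in> ?I n" for K n \<omega> i j
    using that by (cases i; cases j) (auto simp: X_def gauss_mat_simp BK_def block_index_def kdelta_def algebra_simps)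
  have gm: "gmat (M n) (g n) (noise_index l {..<n}) (?I n) (gauss_mat l A (BK K) {..<n}) (noise_coeff A) (model.entry_scale (\<lambda>_ _. sqrt (1 / real n))) (model.bessel_const k l A (1 / real n))"
    if n: "n \<ge> 1" for n K
  proof (rule model.gmat_model[OF modelK gs[OF n]])
    show "{..<n} \<noteq> {}" using n by (auto simp: lessThan_empty_iff bot_nat_def)
  qed auto
  have scaled: "gmat.scaled (g n) (model.entry_scale (\<lambda>_ _. sqrt (1 / real n))) \<omega> = (\<lambda>e. sqrt (1 / real n) * g n e \<omega>)" if "n \<ge> 1" for n \<omega>
    by (subst gmat.scaled_def[OF gm[OF that]]) (simp add: model.entry_scale_def[OF modelK] split_def)
  have symX: "symm (?I n) (X K n \<omega>)" if "n \<ge> 1" for K n \<omega>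
    unfolding X_def by (rule model.symXm[OF modelK])
  have ps: "prob_space (M n)" if "n \<ge> 1" for n using gs[OF that] by (simp add: gaussian_family_def)
  have mN: "N K n \<in> borel_measurable (M n)" if n: "n \<ge> 1" for K n
    using gmat.measurable_opnorm[OF gm[OF n, of K]] unfolding scaled[OF n] N_def X_def .
  have iN: "integrable (M n) (\<lambda>\<omega>. N K n \<omega> ^ r)" if n: "n \<ge> 1" for K n r
    using gmat.integrable_opnorm_pow[OF gm[OF n, of K], of r] unfolding scaled[OF n] N_def X_def .
  have iN1: "integrable (M n) (N K n)" if n: "n \<ge> 1" for K n using iN[OF n, of K 1] by simp
  have path: "0 \<le> N K n \<omega> - K - lm n \<omega>" "N K n \<omega> - K - lm n \<omega> \<le> (N 0 n \<omega>)^2 / (2*K)"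
    if "0 < K" "n \<ge> 1" "\<omega> \<in> space (M n)" for K n \<omega>
    using opnorm_shift_bounds(1,2)[OF finI neI[OF that(2)] symX[OF that(2), of 0 \<omega>] that(1) XK[of _ n _ K \<omega>], of "lm n \<omega>"]
      top[OF that(2,3)] att[OF that(2,3)] unfolding N_def X0 by blast+
  have one: "(0::real) < 1" by simp
  have lmb: "\<bar>lm n \<omega>\<bar> \<le> N 0 n \<omega>" if "n \<ge> 1" "\<omega> \<in> space (M n)" for n \<omega>
    using opnorm_shift_bounds(3)[OF finI neI[OF that(1)] symX[OF that(1), of 0 \<omega>] one XK[of _ n _ 1 \<omega>], of "lm n \<omega>"]
      top[OF that] att[OF that] unfolding N_def X0 by blast
  have mlm: "lm n \<in> borel_measurable (M n)" if n: "n \<ge> 1" for n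
  proof (rule borel_measurable_LIMSEQ_real)
    show "(\<lambda>\<omega>. N (real (Suc j)) n \<omega> - real (Suc j)) \<in> borel_measurable (M n)" for j
      using mN[OF n] by measurable
    fix \<omega> assume w: "\<omega> \<in> space (M n)"
    have "(\<lambda>j. ((N 0 n \<omega>)^2 / 2) * inverse (real (Suc j))) \<longlonglongrightarrow> ((N 0 n \<omega>)^2 / 2) * 0"
      by (intro tendsto_mult tendsto_const LIMSEQ_inverse_real_of_nat)
    moreover have "(N 0 n \<omega>)^2 / (2 * real (Suc j)) = ((N 0 n \<omega>)^2 / 2) * inverse (real (Suc j))" for j
      by (simp only: divide_inverse inverse_mult_distrib mult.assoc)
    ultimately have z: "(\<lambda>j. (N 0 n \<omega>)^2 / (2 * real (Suc j))) \<longlonglongrightarrow> 0" by (simp only: mult_zero_right)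
    have "(\<lambda>j. N (real (Suc j)) n \<omega> - real (Suc j) - lm n \<omega>) \<longlonglongrightarrow> 0"
    proof (rule tendsto_sandwich[OF _ _ tendsto_const z])
      have "(0::real) < real (Suc j)" for j by (rule of_nat_0_less_iff[THEN iffD2]) (rule zero_less_Suc)
      note p = path[OF this n w]
      show "eventually (\<lambda>j. 0 \<le> N (real (Suc j)) n \<omega> - real (Suc j) - lm n \<omega>) sequentially"
        by (rule always_eventually) (intro allI p(1))
      show "eventually (\<lambda>j. N (real (Suc j)) n \<omega> - real (Suc j) - lm n \<omega> \<le> (N 0 n \<omega>)^2 / (2 * real (Suc j))) sequentially"
        by (rule always_eventually) (intro allI p(2))
    qed
    then show "(\<lambda>j. N (real (Suc j)) n \<omega> - real (Suc j)) \<longlonglongrightarrow> lm n \<omega>" by (rule LIM_zero_cancel)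
  qed
  have ilm: "integrable (M n) (lm n)" if n: "n \<ge> 1" for n
    by (rule Bochner_Integration.integrable_bound[OF iN1[OF n, of 0] mlm[OF n]])
      (use lmb[OF n] in \<open>auto intro!: AE_I2 order_trans[OF _ abs_ge_self]\<close>)
  have Ebound: "\<bar>integral\<^sup>L (M n) (lm n) - (integral\<^sup>L (M n) (N K n) - K)\<bar> \<le> integral\<^sup>L (M n) (\<lambda>\<omega>. N 0 n \<omega> ^ 2) / (2*K)"
    if K: "0 < K" and n: "n \<ge> 1" for K n
  proof -
    interpret prob_space "M n" by (rule ps[OF n])
    have i: "integrable (M n) (\<lambda>\<omega>. N K n \<omega> - K - lm n \<omega>)" using iN1[OF n] ilm[OF n] by auto
    have e: "expectation (\<lambda>\<omega>. N K n \<omega> - K - lm n \<omega>) = expectation (N K n) - K - expectation (lm n)"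
      using iN1[OF n] ilm[OF n] by (simp add: prob_space)
    have "0 \<le> expectation (\<lambda>\<omega>. N K n \<omega> - K - lm n \<omega>)"
      by (rule Bochner_Integration.integral_nonneg_AE) (use path(1)[OF K n] in \<open>auto intro!: AE_I2\<close>)
    moreover have "expectation (\<lambda>\<omega>. N K n \<omega> - K - lm n \<omega>) \<le> expectation (\<lambda>\<omega>. N 0 n \<omega> ^ 2 / (2*K))"
      by (rule Bochner_Integration.integral_mono[OF i]) (use path(2)[OF K n] iN[OF n, of 0 2] in auto)
    ultimately show ?thesis unfolding e by simp
  qed
  \<comment> \<open>From \<open>K0\<close> on, the shifted deterministic part has normalized trace at least \<open>1\<close>.\<close>
  define K0 where "K0 = 1 + \<bar>\<Sum>a<k. B a a\<bar>"
  have gq: "gseq k l A (BK K) M g" if "K \<ge> K0" for K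
  proof -
    have "real k \<le> (\<Sum>a<k. BK K a a)"
    proof -
      have "(\<Sum>a<k. BK K a a) = (\<Sum>a<k. B a a) + real k * K" by (simp add: BK_def sum.distrib kdelta_def)
      moreover have "real k * K \<ge> real k * K0" using that by (intro mult_left_mono) auto
      moreover have "real k * K0 \<ge> real k + \<bar>\<Sum>a<k. B a a\<bar>"
        using k1 by (simp add: K0_def distrib_left mult_le_cancel_right1)
      ultimately show ?thesis by linarith
    qed
    then show ?thesis
      using modelK gs by (simp add: gseq_def gseq_axioms_def model2_def model2_axioms_def)
  qed
  have lims: "\<exists>\<alpha>. (\<lambda>n. integral\<^sup>L (M n) (N K n)) \<longlonglongrightarrow> \<alpha> \<and>
    (\<exists>C. eventually (\<lambda>n. integral\<^sup>L (M n) (\<lambda>\<omega>. N K n \<omega> ^ 2) \<le> C) sequentially) \<and> \<rho> \<le> \<alpha> - K" if K: "K \<ge> K0" for K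
  proof -
    obtain \<alpha> where a: "(\<lambda>n. integral\<^sup>L (M n) (N K n)) \<longlonglongrightarrow> \<alpha>"
      "\<exists>C. eventually (\<lambda>n. integral\<^sup>L (M n) (\<lambda>\<omega>. N K n \<omega> ^ 2) \<le> C) sequentially"
      and Q: "\<And>z. z > \<alpha> \<Longrightarrow> \<exists>Q. (\<forall>a<k. \<forall>b<k. Q a b = Q b a) \<and> (\<forall>w. (\<exists>a<k. w a \<noteq> 0) \<longrightarrow> 0 < qform {..<k} Q w) \<and>
      (\<forall>a<k. \<forall>b<k. z * Q a b = kdelta a b + (\<Sum>c<k. BK K a c * Q c b) + bil A l k a (\<lambda>c e d. Q c e * Q d b))"
      using gseq.limit_and_dyson[OF gq[OF K]] unfolding N_def X_def by blast
    have "\<rho> \<le> \<alpha> - K + e" if e: "0 < e" for e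
    proof -
      obtain Q where "\<forall>a<k. \<forall>b<k. Q a b = Q b a" "\<forall>w. (\<exists>a<k. w a \<noteq> 0) \<longrightarrow> 0 < qform {..<k} Q w"
        "\<forall>a<k. \<forall>b<k. (\<alpha> + e) * Q a b = kdelta a b + (\<Sum>c<k. BK K a c * Q c b) + bil A l k a (\<lambda>c e d. Q c e * Q d b)"
        using Q[of "\<alpha> + e"] e by auto
      then have "\<rho> \<le> (\<alpha> + e) - K" unfolding BK_def by (intro rho[of Q]) blast+
      then show ?thesis by simp
    qed
    then have "\<rho> \<le> \<alpha> - K" by (rule field_le_epsilon)
    then show ?thesis using a by blast
  qed
  obtain C where C: "eventually (\<lambda>n. integral\<^sup>L (M n) (\<lambda>\<omega>. N K0 n \<omega> ^ 2) \<le> C) sequentially"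
    using lims[OF order_refl] by blast
  define D where "D = 2 * \<bar>C\<bar> + 2 * K0^2 + 1"
  have D0: "0 < D" by (simp add: D_def add_nonneg_pos)
  have K01: "1 \<le> K0" by (simp add: K0_def)
  have Dn: "eventually (\<lambda>n. integral\<^sup>L (M n) (\<lambda>\<omega>. N 0 n \<omega> ^ 2) \<le> D) sequentially"
    using C eventually_ge_at_top[of 1]
  proof eventually_elim
    case (elim n)
    note n = elim(2)
    interpret prob_space "M n" by (rule ps[OF n])
    have pw: "N 0 n \<omega> ^ 2 \<le> 2 * N K0 n \<omega> ^ 2 + 2 * K0^2" for \<omega>
    proof -
      have "opnorm (?I n) (X 0 n \<omega>) \<le> opnorm (?I n) (X K0 n \<omega>) + K0"
      proof (rule opnorm_le[OF finI neI[OF n] symX[OF n]])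
        fix v assume v: "sqnorm (?I n) v = 1"
        have "qform (?I n) (X K0 n \<omega>) v = qform (?I n) (\<lambda>i j. X 0 n \<omega> i j + K0 * kdelta i j) v" by (rule qform_cong) (rule XK)
        then have "qform (?I n) (X K0 n \<omega>) v = qform (?I n) (X 0 n \<omega>) v + K0"
          by (simp only: qform_add qform_scale qform_kdelta[OF finI] v mult_1_right)
        then show "\<bar>qform (?I n) (X 0 n \<omega>) v\<bar> \<le> opnorm (?I n) (X K0 n \<omega>) + K0"
          using abs_qform_le[OF finI neI[OF n] symX[OF n], of K0 \<omega> v] v K01 by simp
      qed
      then have "(N 0 n \<omega>)^2 \<le> (N K0 n \<omega> + K0)^2"
        unfolding N_def using opnorm_nonneg[OF finI neI[OF n] symX[OF n]] by (intro power_mono) auto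
      also have "\<dots> \<le> 2 * N K0 n \<omega> ^ 2 + 2 * K0^2"
        using sum_squares_bound[of "N K0 n \<omega>" K0] by (simp add: power2_sum)
      finally show ?thesis .
    qed
    have "expectation (\<lambda>\<omega>. N 0 n \<omega> ^ 2) \<le> expectation (\<lambda>\<omega>. 2 * N K0 n \<omega> ^ 2 + 2 * K0^2)"
      by (rule integral_mono[OF iN[OF n]]) (use iN[OF n, of K0 2] pw in auto)
    also have "\<dots> = 2 * expectation (\<lambda>\<omega>. N K0 n \<omega> ^ 2) + 2 * K0^2"
      using iN[OF n, of K0 2] by (simp add: prob_space)
    also have "\<dots> \<le> D" using elim(1) by (simp add: D_def)
    finally show ?case .
  qed
  define e where "e = (\<lambda>n. integral\<^sup>L (M n) (lm n))"
  have near: "\<exists>c. \<rho> \<le> c \<and> eventually (\<lambda>n. \<bar>e n - c\<bar> < \<epsilon>) sequentially" if ep: "0 < \<epsilon>" for \<epsilon>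
  proof -
    \<comment> \<open>The shift is chosen so that the error \<open>D / (2 * K)\<close> is at most \<open>\<epsilon> / 2\<close>.\<close>
    define K where "K = max K0 (D / \<epsilon>)"
    have K: "K \<ge> K0" "K > 0" "D / (2*K) \<le> \<epsilon> / 2"
      using K01 ep D0 by (auto simp: K_def field_simps max_def split: if_splits)
    obtain \<alpha> where a: "(\<lambda>n. integral\<^sup>L (M n) (N K n)) \<longlonglongrightarrow> \<alpha>" "\<rho> \<le> \<alpha> - K" using lims[OF K(1)] by blast
    have "eventually (\<lambda>n. dist (integral\<^sup>L (M n) (N K n)) \<alpha> < \<epsilon> / 2) sequentially"
      using tendstoD[OF a(1), of "\<epsilon> / 2"] ep by simp
    then have "eventually (\<lambda>n. \<bar>e n - (\<alpha> - K)\<bar> < \<epsilon>) sequentially"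
      using Dn eventually_ge_at_top[of 1]
    proof eventually_elim
      case (elim n)
      have "integral\<^sup>L (M n) (\<lambda>\<omega>. N 0 n \<omega> ^ 2) / (2*K) \<le> D / (2*K)"
        using elim(2) K(2) by (intro divide_right_mono) auto
      then show ?case using Ebound[OF K(2) elim(3)] elim(1) K(3) unfolding e_def dist_real_def by linarith
    qed
    then show ?thesis using a(2) by blast
  qed
  have "Cauchy e"
  proof (rule metric_CauchyI)
    fix \<epsilon> :: real assume "0 < \<epsilon>"
    then obtain c where "eventually (\<lambda>n. \<bar>e n - c\<bar> < \<epsilon> / 2) sequentially" using near[of "\<epsilon> / 2"] by auto
    then obtain n0 where n0: "\<And>n. n \<ge> n0 \<Longrightarrow> \<bar>e n - c\<bar> < \<epsilon> / 2" by (auto simp: eventually_sequentially)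
    have "dist (e m) (e n) < \<epsilon>" if "m \<ge> n0" "n \<ge> n0" for m n
      using n0[OF that(1)] n0[OF that(2)] unfolding dist_real_def by linarith
    then show "\<exists>M. \<forall>m\<ge>M. \<forall>n\<ge>M. dist (e m) (e n) < \<epsilon>" by blast
  qed
  then obtain L where L: "e \<longlonglongrightarrow> L" using real_Cauchy_convergent unfolding convergent_def by blast
  have "\<rho> \<le> L + \<epsilon>" if ep: "0 < \<epsilon>" for \<epsilon>
  proof -
    obtain c where c: "\<rho> \<le> c" "eventually (\<lambda>n. \<bar>e n - c\<bar> < \<epsilon>) sequentially" using near[OF ep] by blast
    have "eventually (\<lambda>n. c - \<epsilon> \<le> e n) sequentially" using c(2) by eventually_elim linarith
    then have "c - \<epsilon> \<le> L" by (rule tendsto_lowerbound[OF L]) simp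
    then show ?thesis using c(1) by linarith
  qed
  then have "\<rho> \<le> L" by (rule field_le_epsilon)
  then show ?thesis using L unfolding e_def by blast
qed

section \<open>Matrices of varying dimension and the largest eigenvalue\<close>

lemma mat_mult_entry:
  fixes A B :: "real mat"
  assumes "A \<in> carrier_mat m k" "B \<in> carrier_mat k n" "i < m" "j < n"
  shows "(A * B) $$ (i,j) = (\<Sum>c<k. A $$ (i,c) * B $$ (c,j))"
  using assms by (auto simp: scalar_prod_def lessThan_atLeast0 intro!: sum.cong)

lemma mat_mult3_entry:
  fixes A B C :: "real mat"
  assumes "A \<in> carrier_mat k k" "B \<in> carrier_mat k k" "C \<in> carrier_mat k k" "i < k" "j < k"
  shows "(A * B * C) $$ (i,j) = (\<Sum>c<k. \<Sum>e<k. A $$ (i,c) * B $$ (c,e) * C $$ (e,j))"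
proof -
  have "(A * B * C) $$ (i,j) = (\<Sum>e<k. (A * B) $$ (i,e) * C $$ (e,j))"
    by (rule mat_mult_entry[of _ k k _ k]) (use assms in auto)
  also have "\<dots> = (\<Sum>e<k. \<Sum>c<k. A $$ (i,c) * B $$ (c,e) * C $$ (e,j))"
    by (intro sum.cong refl) (simp add: mat_mult_entry[OF assms(1,2,4)] sum_distrib_right)
  finally show ?thesis by (subst sum.swap)
qed

lemma scalar_prod_qform:
  fixes Z :: "real mat"
  assumes "Z \<in> carrier_mat k k" "v \<in> carrier_vec k"
  shows "scalar_prod v (Z *\<^sub>v v) = qform {..<k} (\<lambda>a b. Z $$ (a,b)) (\<lambda>a. v $ a)"
  using assms by (simp add: scalar_prod_def qform_def lessThan_atLeast0 sum_distrib_left mult.assoc)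

lemma symmetric_mat_entry:
  "symmetric_mat k A \<Longrightarrow> a < k \<Longrightarrow> b < k \<Longrightarrow> A $$ (a,b) = A $$ (b,a)"
  unfolding symmetric_mat_def using index_transpose_mat(1)[of b A a] by auto

lemma symmetric_matI:
  "A \<in> carrier_mat k k \<Longrightarrow> (\<And>a b. a < k \<Longrightarrow> b < k \<Longrightarrow> A $$ (a,b) = A $$ (b,a)) \<Longrightarrow> symmetric_mat k A"
  unfolding symmetric_mat_def by (auto intro!: eq_matI)

text \<open>All elements of an eigenbasis are eigenvectors, so the library's spectrum contains the eigenvalues of the decomposition, and
  the maximum is one of its elements.\<close>

lemma max_eigenvalue_lessThan:
  assumes M: "symmetric_mat m M" and m: "m \<ge> 1"
  shows "qform {..<m} (\<lambda>i j. M $$ (i,j)) v \<le> max_eigenvalue M * sqnorm {..<m} v"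
    and "\<exists>v. sqnorm {..<m} v = 1 \<and> qform {..<m} (\<lambda>i j. M $$ (i,j)) v = max_eigenvalue M"
proof -
  let ?X = "\<lambda>i j. M $$ (i,j)" and ?I = "{..<m}"
  have C: "M \<in> carrier_mat m m" using M by (simp add: symmetric_mat_def)
  have fin: "finite (spectrum M)" by (rule card_finite_spectrum[OF C])
  have symm: "symm ?I ?X" using symmetric_mat_entry[OF M] by (simp add: symm_def)
  obtain lam U where U: "eigenbasis ?I ?X lam U" using eigenbasis_exists[OF _ symm] by auto
  have lam: "lam c \<in> spectrum M" if c: "c < m" for c
  proof -
    have "M *\<^sub>v vec m (U c) = lam c \<cdot>\<^sub>v vec m (U c)"
    proof (rule eq_vecI)
      fix i assume i: "i < dim_vec (lam c \<cdot>\<^sub>v vec m (U c))"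
      then have i: "i < m" by simp
      have "(M *\<^sub>v vec m (U c)) $ i = (\<Sum>j<m. M $$ (i,j) * U c j)"
        using C i by (auto simp: scalar_prod_def lessThan_atLeast0 intro!: sum.cong)
      also have "\<dots> = (\<Sum>j<m. (\<Sum>d<m. lam d * U d i * U d j) * U c j)"
        using U i by (intro sum.cong refl) (auto simp: eigenbasis_def)
      also have "\<dots> = (\<Sum>d<m. lam d * U d i * (\<Sum>j<m. U d j * U c j))"
        unfolding sum_distrib_left sum_distrib_right by (subst sum.swap) (simp only: mult.assoc)
      also have "\<dots> = (\<Sum>d<m. lam d * U d i * kdelta d c)"
        using U c by (intro sum.cong refl) (auto simp: eigenbasis_def)
      also have "\<dots> = lam c * U c i" using c by (simp add: kdelta_def if_distrib[of "(*) _"] cong: if_cong)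
      finally show "(M *\<^sub>v vec m (U c)) $ i = (lam c \<cdot>\<^sub>v vec m (U c)) $ i" using i by simp
    qed (use C in simp)
    moreover have "vec m (U c) \<noteq> 0\<^sub>v m"
    proof
      assume 0: "vec m (U c) = 0\<^sub>v m"
      have "U c i = 0" if "i < m" for i using arg_cong[OF 0, of "\<lambda>v. v $ i"] that by simp
      then have "sqnorm ?I (U c) = 0" by (simp add: sqnorm_def)
      then show False using eigenbasis_eigvec(1)[OF _ U, of c] c by simp
    qed
    ultimately show ?thesis using C unfolding spectrum_def eigenvalue_def eigenvector_def
      by (auto intro!: exI[of _ "vec m (U c)"])
  qed
  have "qform ?I ?X v = (\<Sum>c<m. lam c * (\<Sum>i<m. U c i * v i)^2)" by (rule eigenbasis_quad1[OF _ U]) simp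
  also have "\<dots> \<le> (\<Sum>c<m. max_eigenvalue M * (\<Sum>i<m. U c i * v i)^2)"
    using lam fin by (intro sum_mono mult_right_mono) (auto simp: max_eigenvalue_def)
  also have "\<dots> = max_eigenvalue M * sqnorm ?I v"
    by (simp only: eigenbasis_sqnorm[OF finite_lessThan U] sum_distrib_left)
  finally show "qform ?I ?X v \<le> max_eigenvalue M * sqnorm ?I v" .
  have "spectrum M \<noteq> {}" using lam[of 0] m by auto
  then have "max_eigenvalue M \<in> spectrum M" unfolding max_eigenvalue_def by (rule Max_in[OF fin])
  then obtain w where w: "w \<in> carrier_vec m" "w \<noteq> 0\<^sub>v m" "M *\<^sub>v w = max_eigenvalue M \<cdot>\<^sub>v w"
    using C by (auto simp: spectrum_def eigenvalue_def eigenvector_def)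
  define s where "s = sqnorm ?I (\<lambda>i. w $ i)"
  have s0: "0 < s"
  proof -
    obtain i where "i < m" "w $ i \<noteq> 0" using w(1,2) by (auto simp: vec_eq_iff)
    then show ?thesis unfolding s_def sqnorm_def by (intro sum_pos2[of _ i]) auto
  qed
  have q: "qform ?I ?X (\<lambda>i. w $ i) = max_eigenvalue M * s"
    using scalar_prod_qform[OF C w(1)] w(1) unfolding w(3)
    by (simp add: scalar_prod_def s_def sqnorm_def sum_distrib_left power2_eq_square lessThan_atLeast0 mult_ac)
  have "sqnorm ?I (\<lambda>i. w $ i / sqrt s) = 1"
    using s0 by (simp add: sqnorm_def power_divide sum_divide_distrib[symmetric]) (simp add: s_def sqnorm_def)
  moreover have "qform ?I ?X (\<lambda>i. w $ i / sqrt s) = qform ?I ?X (\<lambda>i. w $ i) / s"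
  proof -
    have "a / sqrt s * x * (b / sqrt s) = a * x * b / s" for a b x :: real
      using s0 by (simp add: field_simps)
    then show ?thesis unfolding qform_def by (simp only: sum_divide_distrib)
  qed
  ultimately show "\<exists>v. sqnorm ?I v = 1 \<and> qform ?I ?X v = max_eigenvalue M" using q s0 by auto
qed

lemma max_eigenvalue_reindex:
  assumes M: "symmetric_mat m M" and m: "m \<ge> 1" and h: "bij_betw h I {..<m}"
    and X: "\<And>i j. i \<in> I \<Longrightarrow> j \<in> I \<Longrightarrow> X i j = M $$ (h i, h j)"
  shows "qform I X v \<le> max_eigenvalue M * sqnorm I v"
    and "\<exists>v. sqnorm I v = 1 \<and> qform I X v = max_eigenvalue M"
proof -
  have q: "qform {..<m} (\<lambda>i j. M $$ (i,j)) w = qform I X (\<lambda>i. w (h i))" for w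
    unfolding qform_def sum.reindex_bij_betw[OF h, symmetric] using X by (intro sum.cong refl) simp
  have s: "sqnorm {..<m} w = sqnorm I (\<lambda>i. w (h i))" for w
    unfolding sqnorm_def sum.reindex_bij_betw[OF h, symmetric] ..
  let ?w = "\<lambda>j. v (inv_into I h j)"
  have inv: "inv_into I h (h i) = i" if "i \<in> I" for i
    using that h by (simp add: bij_betw_def)
  have "qform I X (\<lambda>i. ?w (h i)) = qform I X v" unfolding qform_def by (intro sum.cong refl) (simp add: inv)
  moreover have "sqnorm I (\<lambda>i. ?w (h i)) = sqnorm I v" unfolding sqnorm_def by (intro sum.cong refl) (simp add: inv)
  ultimately show "qform I X v \<le> max_eigenvalue M * sqnorm I v"
    using max_eigenvalue_lessThan(1)[OF M m, of ?w] unfolding q s by simp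
  obtain w where "sqnorm {..<m} w = 1" "qform {..<m} (\<lambda>i j. M $$ (i,j)) w = max_eigenvalue M"
    using max_eigenvalue_lessThan(2)[OF M m] by blast
  then show "\<exists>v. sqnorm I v = 1 \<and> qform I X v = max_eigenvalue M" unfolding q s by blast
qed

lemma bij_betw_block_index: "bij_betw (\<lambda>(a,u). a * n + u) (block_index k {..<n}) {..<k * n}"
proof (rule bij_betw_byWitness[where f' = "\<lambda>i. (i div n, i mod n)"])
  show "\<forall>a\<in>block_index k {..<n}. (\<lambda>i. (i div n, i mod n)) ((\<lambda>(a,u). a * n + u) a) = a" by (auto simp: block_index_def)
  show "\<forall>i\<in>{..<k * n}. (\<lambda>(a,u). a * n + u) (i div n, i mod n) = i" by auto
  have "a * n + u < k * n" if "a < k" "u < n" for a u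
  proof -
    have "a * n + u < Suc a * n" using that by simp
    also have "\<dots> \<le> k * n" using that by (intro mult_right_mono) auto
    finally show ?thesis .
  qed
  then show "(\<lambda>(a,u). a * n + u) ` block_index k {..<n} \<subseteq> {..<k * n}" by (auto simp: block_index_def)
  show "(\<lambda>i. (i div n, i mod n)) ` {..<k * n} \<subseteq> block_index k {..<n}"
    by (cases "n = 0") (auto simp: block_index_def less_mult_imp_div_less)
qed

lemma H_mat_entry:
  assumes A: "\<And>i. i \<le> l \<Longrightarrow> A i \<in> carrier_mat k k" and G: "\<And>i. i \<in> {1..l} \<Longrightarrow> G i \<in> carrier_mat n n"
    and ab: "a < k" "b < k" and uv: "u < n" "v < n"
  shows "H_mat k l A n G $$ (a * n + u, b * n + v)
    = gauss_mat l (\<lambda>i a b. A i $$ (a,b)) (\<lambda>a b. A 0 $$ (a,b)) {..<n} (\<lambda>(i,p,q). sqrt (1 / real n) * G i $$ (p,q)) (a,u) (b,v)"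
proof -
  have i: "a * n + u < k * n" "b * n + v < k * n"
    using bij_betw_block_index[of n k] ab uv by (auto simp: bij_betw_def block_index_def)
  have A0: "A 0 \<in> carrier_mat k k" by (rule A) simp
  have kr: "kronecker (A i) (symmetrized (G i)) $$ (a * n + u, b * n + v) = A i $$ (a,b) * ((G i $$ (u,v) + G i $$ (v,u)) / sqrt 2)"
    if "i \<in> {1..l}" for i
    using A[of i] G[OF that] that i ab uv by (auto simp: kronecker_def symmetrized_def)
  have "H_mat k l A n G $$ (a * n + u, b * n + v) = A 0 $$ (a,b) * kdelta u v
     + (1 / sqrt (real n)) * (\<Sum>i\<in>{1..l}. A i $$ (a,b) * ((G i $$ (u,v) + G i $$ (v,u)) / sqrt 2))"
  proof -
    have k0: "kronecker (A 0) (1\<^sub>m n) $$ (a * n + u, b * n + v) = A 0 $$ (a,b) * kdelta u v"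
      using A0 i ab uv by (simp add: kronecker_def kdelta_def)
    define S where "S = sum_of_mats (k * n) (\<lambda>i. kronecker (A i) (symmetrized (G i))) {1..l}"
    have S: "S \<in> carrier_mat (k * n) (k * n)" by (simp add: S_def sum_of_mats_def)
    have "S $$ (a * n + u, b * n + v) = (\<Sum>i\<in>{1..l}. kronecker (A i) (symmetrized (G i)) $$ (a * n + u, b * n + v))"
      unfolding S_def sum_of_mats_def using i by simp
    also have "\<dots> = (\<Sum>i\<in>{1..l}. A i $$ (a,b) * ((G i $$ (u,v) + G i $$ (v,u)) / sqrt 2))"
      by (rule sum.cong[OF refl kr])
    finally show ?thesis unfolding H_mat_def S_def[symmetric] using S i k0 by simp
  qed
  also have "(1 / sqrt (real n)) * (\<Sum>i\<in>{1..l}. A i $$ (a,b) * ((G i $$ (u,v) + G i $$ (v,u)) / sqrt 2))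
    = (\<Sum>i\<in>{1..l}. A i $$ (a,b) * ((sqrt (1 / real n) * G i $$ (u,v) + sqrt (1 / real n) * G i $$ (v,u)) / sqrt 2))"
  proof -
    have "c * (x * ((y + z) / q)) = x * ((c * y + c * z) / q)" for c x y z q :: real
      by (simp add: algebra_simps add_divide_distrib)
    then show ?thesis unfolding sum_distrib_left real_sqrt_divide real_sqrt_one by (intro sum.cong refl)
  qed
  finally show ?thesis using uv by (simp add: gauss_mat_simp)
qed

lemma H_mat_symmetric:
  assumes A: "\<And>i. i \<le> l \<Longrightarrow> symmetric_mat k (A i)" and G: "\<And>i. i \<in> {1..l} \<Longrightarrow> G i \<in> carrier_mat n n"
  shows "symmetric_mat (k * n) (H_mat k l A n G)"
proof (rule symmetric_matI)
  have Ac: "A i \<in> carrier_mat k k" if "i \<le> l" for i using A[OF that] by (simp add: symmetric_mat_def)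
  show "H_mat k l A n G \<in> carrier_mat (k * n) (k * n)"
    using Ac[of 0] by (auto simp: H_mat_def sum_of_mats_def kronecker_def)
  fix i j assume ij: "i < k * n" "j < k * n"
  then have n: "0 < n" by (cases n) auto
  define a u b v where "a = i div n" and "u = i mod n" and "b = j div n" and "v = j mod n"
  then have i: "i = a * n + u" "a < k" "u < n" and j: "j = b * n + v" "b < k" "v < n"
    using ij n by (simp_all add: less_mult_imp_div_less)
  have "gauss_mat l (\<lambda>i a b. A i $$ (a,b)) (\<lambda>a b. A 0 $$ (a,b)) {..<n} (\<lambda>(i,p,q). sqrt (1 / real n) * G i $$ (p,q)) (a,u) (b,v)
      = gauss_mat l (\<lambda>i a b. A i $$ (a,b)) (\<lambda>a b. A 0 $$ (a,b)) {..<n} (\<lambda>(i,p,q). sqrt (1 / real n) * G i $$ (p,q)) (b,v) (a,u)"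
  proof -
    have "(\<Sum>i\<in>{1..l}. A i $$ (a,b) * ((sqrt (1 / real n) * G i $$ (u,v) + sqrt (1 / real n) * G i $$ (v,u)) / sqrt 2))
       = (\<Sum>i\<in>{1..l}. A i $$ (b,a) * ((sqrt (1 / real n) * G i $$ (v,u) + sqrt (1 / real n) * G i $$ (u,v)) / sqrt 2))"
      by (rule sum.cong[OF refl]) (use symmetric_mat_entry[OF A i(2) j(2)] in \<open>simp add: add.commute\<close>)
    moreover have "A 0 $$ (a,b) * kdelta u v = A 0 $$ (b,a) * kdelta v u"
      using symmetric_mat_entry[OF A i(2) j(2), of 0] by (simp add: kdelta_def)
    ultimately show ?thesis
      unfolding gauss_mat_simp using i(3) j(3) by (simp only: lessThan_iff simp_thms if_True case_prod_conv)
  qed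
  then show "H_mat k l A n G $$ (i,j) = H_mat k l A n G $$ (j,i)"
    using H_mat_entry[where k=k and l=l and A=A and G=G, OF Ac G i(2) j(2) i(3) j(3)]
      H_mat_entry[where k=k and l=l and A=A and G=G, OF Ac G j(2) i(2) j(3) i(3)] unfolding i(1) j(1) by presburger
qed

lemma gaussian_moment:
  assumes P: "prob_space M" and D: "distributed M lborel X (\<lambda>x. ennreal (std_normal_density x))"
  shows "has_bochner_integral M (\<lambda>\<omega>. X \<omega> ^ r) (gauss_moment r)"
proof -
  have even: "gauss_moment (2*j) = fact (2*j) / (2^j * fact j)" for j
  proof (induction j)
    case (Suc j)
    have "gauss_moment (2 * Suc j) = real (Suc (2*j)) * gauss_moment (2*j)" by simp
    also have "\<dots> = fact (2 * Suc j) / (2 ^ Suc j * fact (Suc j))"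
      unfolding Suc by (simp add: field_simps del: of_nat_Suc) (simp add: algebra_simps)
    finally show ?case .
  qed simp
  have odd: "gauss_moment (2*j+1) = 0" for j by (induction j) simp_all
  have "integral\<^sup>L lborel (\<lambda>x. std_normal_density x * x ^ r) = gauss_moment r"
  proof (cases "even r")
    case True
    then obtain j where "r = 2*j" by (elim evenE)
    then show ?thesis by (simp only: integral_std_normal_moment_even even)
  next
    case False
    then obtain j where "r = 2*j+1" by (elim oddE)
    then show ?thesis by (simp only: integral_std_normal_moment_odd odd)
  qed
  moreover have "integral\<^sup>L lborel (\<lambda>x. std_normal_density x * x ^ r) = integral\<^sup>L M (\<lambda>\<omega>. X \<omega> ^ r)"
    by (rule distributed_integral[OF D]) auto
  moreover have "integrable M (\<lambda>\<omega>. X \<omega> ^ r)"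
    using distributed_integrable[OF D, of "\<lambda>x. x ^ r"] integrable_std_normal_moment[of r] by auto
  ultimately show ?thesis by (simp add: has_bochner_integral_iff)
qed

lemma gaussian_family_of_mats:
  assumes "indep_std_gaussian_mats M l n G"
  shows "gaussian_family M (\<lambda>(i,p,q) \<omega>. G i \<omega> $$ (p,q)) (noise_index l {..<n})"
proof -
  let ?g = "\<lambda>(i,p,q) \<omega>. G i \<omega> $$ (p,q)"
  interpret prob_space M using assms by (simp add: indep_std_gaussian_mats_def)
  have ind: "indep_vars (\<lambda>_. borel) ?g (noise_index l {..<n})"
    using assms by (simp add: indep_std_gaussian_mats_def noise_index_def)
  have mom: "has_bochner_integral M (\<lambda>\<omega>. ?g e \<omega> ^ r) (gauss_moment r)" if "e \<in> noise_index l {..<n}" for e r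
    using that assms by (auto simp: noise_index_def indep_std_gaussian_mats_def intro!: gaussian_moment prob_space_axioms)
  have fin: "finite (noise_index l {..<n})" by (simp add: noise_index_def)
  have "has_bochner_integral M (\<lambda>\<omega>. monomial (noise_index l {..<n}) k (\<lambda>e. ?g e \<omega>)) (\<Prod>e\<in>noise_index l {..<n}. gauss_moment (k e))" for k
  proof -
    have i: "indep_vars (\<lambda>_. borel) (\<lambda>e \<omega>. ?g e \<omega> ^ k e) (noise_index l {..<n})"
      by (rule indep_vars_compose2[OF ind]) auto
    have int: "integrable M (\<lambda>\<omega>. ?g e \<omega> ^ k e)" "expectation (\<lambda>\<omega>. ?g e \<omega> ^ k e) = gauss_moment (k e)" if "e \<in> noise_index l {..<n}" for e
      using mom[OF that, of "k e"] by (simp_all add: has_bochner_integral_iff)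
    show ?thesis unfolding monomial_def has_bochner_integral_iff
      using indep_vars_integrable[OF fin i int(1)] indep_vars_lebesgue_integral[OF fin i int(1)] int(2) by simp
  qed
  then show ?thesis using fin prob_space_axioms by (simp add: gaussian_family_def)
qed

lemma max_eigenvalue_smult_one:
  assumes "k \<ge> 1"
  shows "max_eigenvalue (c \<cdot>\<^sub>m 1\<^sub>m k) = c"
proof -
  have "symmetric_mat k (c \<cdot>\<^sub>m 1\<^sub>m k)" by (rule symmetric_matI) auto
  then obtain v where v: "sqnorm {..<k} v = 1" "qform {..<k} (\<lambda>i j. (c \<cdot>\<^sub>m 1\<^sub>m k) $$ (i,j)) v = max_eigenvalue (c \<cdot>\<^sub>m 1\<^sub>m k)"
    using max_eigenvalue_lessThan(2)[OF _ assms] by blast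
  have "qform {..<k} (\<lambda>i j. (c \<cdot>\<^sub>m 1\<^sub>m k) $$ (i,j)) v = qform {..<k} (\<lambda>i j. c * kdelta i j) v"
    by (rule qform_cong) (auto simp: kdelta_def)
  then show ?thesis using v by (simp add: qform_scale qform_kdelta)
qed

lemma pos_def_mat_inverse:
  assumes Z: "pos_def_mat k Z"
  obtains Y where "mat_inverse Z = Some Y" "symmetric_mat k Y" "Z * Y = 1\<^sub>m k" "Y * Z = 1\<^sub>m k"
    "\<And>w. 0 \<le> qform {..<k} (\<lambda>a b. Y $$ (a,b)) w"
proof -
  have C: "Z \<in> carrier_mat k k" and T: "transpose_mat Z = Z"
    and pos: "\<And>v. v \<in> carrier_vec k \<Longrightarrow> v \<noteq> 0\<^sub>v k \<Longrightarrow> scalar_prod v (Z *\<^sub>v v) > 0"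
    using Z by (auto simp: pos_def_mat_def symmetric_mat_def)
  have "det Z \<noteq> 0"
  proof
    assume "det Z = 0"
    then obtain v where v: "v \<in> carrier_vec k" "v \<noteq> 0\<^sub>v k" "Z *\<^sub>v v = 0\<^sub>v k"
      using det_0_iff_vec_prod_zero_field[OF C] by blast
    then show False using pos[OF v(1,2)] by simp
  qed
  then have "Z \<in> Units (ring_mat TYPE(real) k ())" by (rule det_non_zero_imp_unit[OF C])
  then obtain Y where Y: "mat_inverse Z = Some Y" using mat_inverse(1)[OF C, where b="()"] by (cases "mat_inverse Z") auto
  from mat_inverse(2)[OF C Y] have ZY: "Z * Y = 1\<^sub>m k" and YZ: "Y * Z = 1\<^sub>m k" and CY: "Y \<in> carrier_mat k k" by auto
  have TY: "transpose_mat Y = Y"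
  proof -
    have "transpose_mat Y * Z = transpose_mat (Z * Y)" using transpose_mult[OF C CY] T by simp
    then have t: "transpose_mat Y * Z = 1\<^sub>m k" by (simp add: ZY)
    have "transpose_mat Y = transpose_mat Y * (Z * Y)" using CY by (simp add: ZY)
    also have "\<dots> = (transpose_mat Y * Z) * Y" using CY C by (simp add: assoc_mult_mat[of _ k k _ k _ k])
    also have "\<dots> = Y" using CY by (simp add: t)
    finally show ?thesis .
  qed
  have "0 \<le> qform {..<k} (\<lambda>a b. Y $$ (a,b)) w" for w
  proof -
    define v where "v = vec k w"
    have v: "v \<in> carrier_vec k" by (simp add: v_def)
    define x where "x = Y *\<^sub>v v"
    have x: "x \<in> carrier_vec k" using CY v by (simp add: x_def)
    have Zx: "Z *\<^sub>v x = v" unfolding x_def using assoc_mult_mat_vec[OF C CY v] v by (simp add: ZY)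
    have "qform {..<k} (\<lambda>a b. Y $$ (a,b)) w = qform {..<k} (\<lambda>a b. Y $$ (a,b)) (\<lambda>a. v $ a)"
      unfolding qform_def v_def by (intro sum.cong refl) simp
    also have "\<dots> = scalar_prod v (Y *\<^sub>v v)" by (rule scalar_prod_qform[OF CY v, symmetric])
    also have "\<dots> = scalar_prod x (Z *\<^sub>v x)" unfolding Zx x_def[symmetric] by (rule comm_scalar_prod[OF v x])
    also have "\<dots> \<ge> 0"
    proof (cases "x = 0\<^sub>v k")
      case True
      then show ?thesis using C x by simp
    next
      case False
      then show ?thesis using pos[OF x] by simp
    qed
    finally show ?thesis .
  qed
  then show ?thesis using that[OF Y _ ZY YZ] CY TY by (simp add: symmetric_mat_def)
qed

text \<open>The infimum is over a set bounded below: \<open>Z\<close> and \<open>A i Z\<^sup>-\<^sup>1 A i\<close> are positive semidefinite, so the largest eigenvalue is at least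
  the \<open>(0, 0)\<close> entry of \<open>A 0\<close>.\<close>

lemma rho_edge_le:
  assumes k: "k \<ge> 1" and A: "\<And>i. i \<le> l \<Longrightarrow> symmetric_mat k (A i)" and Z: "pos_def_mat k Z"
  shows "rho_edge k l A \<le> max_eigenvalue (A 0 + Z + sum_of_mats k (\<lambda>i. A i * the (mat_inverse Z) * A i) {1..l})"
proof -
  let ?f = "\<lambda>Z. A 0 + Z + sum_of_mats k (\<lambda>i. A i * the (mat_inverse Z) * A i) {1..l}"
  have Ac: "A i \<in> carrier_mat k k" if "i \<le> l" for i using A[OF that] by (simp add: symmetric_mat_def)
  have "A 0 $$ (0,0) \<le> max_eigenvalue (?f W)" if W: "pos_def_mat k W" for W
  proof -
    obtain Y where Y: "mat_inverse W = Some Y" "symmetric_mat k Y" "\<And>w. 0 \<le> qform {..<k} (\<lambda>a b. Y $$ (a,b)) w"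
      using pos_def_mat_inverse[OF W] by blast
    have CY: "Y \<in> carrier_mat k k" using Y(2) by (simp add: symmetric_mat_def)
    have sW: "symmetric_mat k W" and CW: "W \<in> carrier_mat k k" using W by (auto simp: pos_def_mat_def symmetric_mat_def)
    have e: "?f W $$ (a,d) = A 0 $$ (a,d) + W $$ (a,d) + (\<Sum>i\<in>{1..l}. \<Sum>c<k. \<Sum>e<k. A i $$ (a,c) * Y $$ (c,e) * A i $$ (e,d))"
      if "a < k" "d < k" for a d
    proof -
      have "(\<Sum>i\<in>{1..l}. (A i * Y * A i) $$ (a,d)) = (\<Sum>i\<in>{1..l}. \<Sum>c<k. \<Sum>e<k. A i $$ (a,c) * Y $$ (c,e) * A i $$ (e,d))"
        by (intro sum.cong refl mat_mult3_entry Ac CY that) auto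
      then show ?thesis using that Ac[of 0] CW Y(1) by (simp add: sum_of_mats_def)
    qed
    have C: "?f W \<in> carrier_mat k k" using Ac[of 0] CW by (simp add: sum_of_mats_def)
    have "symmetric_mat k (?f W)"
    proof (rule symmetric_matI[OF C])
      fix a d assume ad: "a < k" "d < k"
      have "(\<Sum>c<k. \<Sum>e<k. A i $$ (a,c) * Y $$ (c,e) * A i $$ (e,d)) = (\<Sum>c<k. \<Sum>e<k. A i $$ (d,c) * Y $$ (c,e) * A i $$ (e,a))"
        if "i \<in> {1..l}" for i
      proof (subst sum.swap, intro sum.cong refl)
        fix c e assume ce: "c \<in> {..<k}" "e \<in> {..<k}"
        have "A i $$ (a,e) = A i $$ (e,a)" "A i $$ (c,d) = A i $$ (d,c)" "Y $$ (e,c) = Y $$ (c,e)"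
          using symmetric_mat_entry[OF A] symmetric_mat_entry[OF Y(2)] that ce ad by auto
        then show "A i $$ (a,e) * Y $$ (e,c) * A i $$ (c,d) = A i $$ (d,c) * Y $$ (c,e) * A i $$ (e,a)"
          by (simp only: mult.commute mult.left_commute)
      qed
      then have "(\<Sum>i\<in>{1..l}. \<Sum>c<k. \<Sum>e<k. A i $$ (a,c) * Y $$ (c,e) * A i $$ (e,d))
        = (\<Sum>i\<in>{1..l}. \<Sum>c<k. \<Sum>e<k. A i $$ (d,c) * Y $$ (c,e) * A i $$ (e,a))" by (rule sum.cong[OF refl])
      moreover have "A 0 $$ (a,d) = A 0 $$ (d,a)" "W $$ (a,d) = W $$ (d,a)"
        using symmetric_mat_entry[OF A ad] symmetric_mat_entry[OF sW ad] by auto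
      ultimately show "?f W $$ (a,d) = ?f W $$ (d,a)" unfolding e[OF ad] e[OF ad(2,1)] by simp
    qed
    note top = max_eigenvalue_lessThan(1)[OF this k, of "kdelta 0"]
    have "sqnorm {..<k} (kdelta 0) = 1" using k by (simp add: sqnorm_def kdelta_def if_distrib[of "\<lambda>x. x^2"] cong: if_cong)
    moreover have "qform {..<k} F (kdelta 0) = F 0 0" for F
      unfolding qform_def mult.assoc sum_distrib_left[symmetric] using k by (simp add: sum_delta_l) (simp add: kdelta_def if_distrib[of "(*) _"] cong: if_cong)
    ultimately have "?f W $$ (0,0) \<le> max_eigenvalue (?f W)" using top by (simp only: mult_1_right)
    moreover have "0 \<le> (\<Sum>c<k. \<Sum>e<k. A i $$ (0,c) * Y $$ (c,e) * A i $$ (e,0))" if "i \<in> {1..l}" for i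
    proof -
      have "(\<Sum>c<k. \<Sum>e<k. A i $$ (0,c) * Y $$ (c,e) * A i $$ (e,0)) = qform {..<k} (\<lambda>a b. Y $$ (a,b)) (\<lambda>c. A i $$ (0,c))"
        unfolding qform_def using that k symmetric_mat_entry[OF A, of i 0] by (intro sum.cong refl) auto
      then show ?thesis using Y(3) by simp
    qed
    then have "0 \<le> (\<Sum>i\<in>{1..l}. \<Sum>c<k. \<Sum>e<k. A i $$ (0,c) * Y $$ (c,e) * A i $$ (e,0))" by (rule sum_nonneg)
    moreover have "0 \<le> W $$ (0,0)"
    proof -
      have "unit_vec k 0 \<noteq> (0\<^sub>v k :: real vec)" using k by (auto simp: vec_eq_iff)
      then have "0 < scalar_prod (unit_vec k 0) (W *\<^sub>v unit_vec k 0)" using W by (auto simp: pos_def_mat_def)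
      then show ?thesis using CW k by (simp add: scalar_prod_left_unit[of _ k])
    qed
    ultimately show ?thesis using e[of 0 0] k by simp
  qed
  then have "bdd_below ((\<lambda>Z. max_eigenvalue (?f Z)) ` {Z. pos_def_mat k Z})" by (auto intro!: bdd_belowI)
  then show ?thesis unfolding rho_edge_def using Z by (intro cINF_lower) auto
qed

text \<open>\<open>Z = z - K - A 0 - \<Sum>i. A i Q A i\<close> is the inverse of \<open>Q\<close> by the Dyson equation, hence positive definite, and for this \<open>Z\<close> the matrix
  \<open>A 0 + Z + \<Sum>i. A i Z\<^sup>-\<^sup>1 A i\<close> is \<open>(z - K)\<close> times the identity.\<close>

lemma rho_edge_le_of_dyson:
  assumes k: "k \<ge> 1" and A: "\<And>i. i \<le> l \<Longrightarrow> symmetric_mat k (A i)"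
    and symQ: "\<And>a b. a < k \<Longrightarrow> b < k \<Longrightarrow> Q a b = Q b a"
    and posQ: "\<And>w. \<exists>a<k. w a \<noteq> 0 \<Longrightarrow> 0 < qform {..<k} Q w"
    and dyson: "\<And>a b. a < k \<Longrightarrow> b < k \<Longrightarrow> z * Q a b = kdelta a b + (\<Sum>c<k. (A 0 $$ (a,c) + K * kdelta a c) * Q c b)
      + bil (\<lambda>i a b. A i $$ (a,b)) l k a (\<lambda>c e d. Q c e * Q d b)"
  shows "rho_edge k l A \<le> z - K"
proof -
  have Ac: "A i \<in> carrier_mat k k" if "i \<le> l" for i using A[OF that] by (simp add: symmetric_mat_def)
  define Y where "Y = mat k k (\<lambda>(a,b). Q a b)"
  have Y: "Y \<in> carrier_mat k k" and Ye: "\<And>a b. a < k \<Longrightarrow> b < k \<Longrightarrow> Y $$ (a,b) = Q a b" by (simp_all add: Y_def)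
  define \<eta> where "\<eta> = (\<lambda>a d. \<Sum>i\<in>{1..l}. \<Sum>c<k. \<Sum>e<k. A i $$ (a,c) * Q c e * A i $$ (e,d))"
  define S where "S = sum_of_mats k (\<lambda>i. A i * Y * A i) {1..l}"
  have S: "S \<in> carrier_mat k k" by (simp add: S_def sum_of_mats_def)
  have Se: "S $$ (a,d) = \<eta> a d" if "a < k" "d < k" for a d
  proof -
    have "S $$ (a,d) = (\<Sum>i\<in>{1..l}. (A i * Y * A i) $$ (a,d))" using that by (simp add: S_def sum_of_mats_def)
    also have "\<dots> = (\<Sum>i\<in>{1..l}. \<Sum>c<k. \<Sum>e<k. A i $$ (a,c) * Y $$ (c,e) * A i $$ (e,d))"
      by (intro sum.cong refl mat_mult3_entry Ac Y that) auto
    finally show ?thesis by (simp add: \<eta>_def Ye)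
  qed
  define Z where "Z = mat k k (\<lambda>(a,b). (z - K) * kdelta a b - A 0 $$ (a,b) - \<eta> a b)"
  have Z: "Z \<in> carrier_mat k k" and Ze: "\<And>a b. a < k \<Longrightarrow> b < k \<Longrightarrow> Z $$ (a,b) = (z - K) * kdelta a b - A 0 $$ (a,b) - \<eta> a b"
    by (simp_all add: Z_def)
  have ZY: "Z * Y = 1\<^sub>m k"
  proof (rule eq_matI)
    fix a b assume "a < dim_row (1\<^sub>m k :: real mat)" "b < dim_col (1\<^sub>m k :: real mat)"
    then have ab: "a < k" "b < k" by auto
    have dl: "(\<Sum>c<k. x * kdelta a c * Q c b) = x * Q a b" for x
      unfolding mult.assoc sum_distrib_left[symmetric] using ab by (simp add: sum_delta_l)
    have et: "(\<Sum>d<k. \<eta> a d * Q d b) = bil (\<lambda>i a b. A i $$ (a,b)) l k a (\<lambda>c e d. Q c e * Q d b)"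
    proof -
      have "(\<Sum>d<k. \<eta> a d * Q d b) = (\<Sum>d<k. \<Sum>i\<in>{1..l}. \<Sum>c<k. \<Sum>e<k. A i $$ (a,c) * A i $$ (e,d) * (Q c e * Q d b))"
        unfolding \<eta>_def sum_distrib_right by (intro sum.cong refl) simp
      also have "\<dots> = bil (\<lambda>i a b. A i $$ (a,b)) l k a (\<lambda>c e d. Q c e * Q d b)"
        unfolding bil_def by (subst sum.swap, rule sum.cong[OF refl], subst sum.swap, rule sum.cong[OF refl], subst sum.swap, rule refl)
      finally show ?thesis .
    qed
    have "(Z * Y) $$ (a,b) = (\<Sum>c<k. Z $$ (a,c) * Y $$ (c,b))" by (rule mat_mult_entry[OF Z Y ab])
    also have "\<dots> = (\<Sum>c<k. (z - K) * kdelta a c * Q c b - A 0 $$ (a,c) * Q c b - \<eta> a c * Q c b)"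
      using ab by (intro sum.cong refl) (simp add: Ze Ye left_diff_distrib)
    also have "\<dots> = (z - K) * Q a b - (\<Sum>c<k. A 0 $$ (a,c) * Q c b) - bil (\<lambda>i a b. A i $$ (a,b)) l k a (\<lambda>c e d. Q c e * Q d b)"
      by (simp only: sum_subtractf dl et)
    also have "\<dots> = kdelta a b"
    proof -
      have "(\<Sum>c<k. (A 0 $$ (a,c) + K * kdelta a c) * Q c b) = (\<Sum>c<k. A 0 $$ (a,c) * Q c b) + K * Q a b"
        by (simp only: distrib_right sum.distrib dl)
      then show ?thesis using dyson[OF ab] by (simp add: left_diff_distrib)
    qed
    finally show "(Z * Y) $$ (a,b) = 1\<^sub>m k $$ (a,b)" using ab by (simp add: kdelta_def)
  qed (use Z Y in auto)
  have YZ: "Y * Z = 1\<^sub>m k" by (rule mat_mult_left_right_inverse[OF Z Y ZY])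
  have symZ: "symmetric_mat k Z"
  proof (rule symmetric_matI[OF Z])
    fix a d assume ad: "a < k" "d < k"
    have "\<eta> a d = \<eta> d a" unfolding \<eta>_def
    proof (rule sum.cong[OF refl], subst sum.swap, intro sum.cong refl)
      fix i c e assume i: "i \<in> {1..l}" "c \<in> {..<k}" "e \<in> {..<k}"
      have "A i $$ (a,e) = A i $$ (e,a)" "A i $$ (c,d) = A i $$ (d,c)" "Q e c = Q c e"
        using symmetric_mat_entry[OF A] symQ i ad by auto
      then show "A i $$ (a,e) * Q e c * A i $$ (c,d) = A i $$ (d,c) * Q c e * A i $$ (e,a)"
        by (simp only: mult.commute mult.left_commute)
    qed
    moreover have "A 0 $$ (a,d) = A 0 $$ (d,a)" by (rule symmetric_mat_entry[OF A ad]) simp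
    ultimately show "Z $$ (a,d) = Z $$ (d,a)" using ad by (simp add: Ze kdelta_def)
  qed
  have pdZ: "pos_def_mat k Z" unfolding pos_def_mat_def
  proof (intro conjI ballI impI symZ)
    fix v :: "real vec" assume v: "v \<in> carrier_vec k" "v \<noteq> 0\<^sub>v k"
    define x where "x = Z *\<^sub>v v"
    have x: "x \<in> carrier_vec k" using Z v by (simp add: x_def)
    have Yx: "Y *\<^sub>v x = v" unfolding x_def using assoc_mult_mat_vec[OF Y Z v(1)] v(1) by (simp add: YZ)
    have "x \<noteq> 0\<^sub>v k" using Yx v(2) Y by auto
    then have "\<exists>a<k. x $ a \<noteq> 0" using x by (auto simp: vec_eq_iff)
    then have "0 < qform {..<k} Q (\<lambda>a. x $ a)" by (rule posQ)
    also have "qform {..<k} Q (\<lambda>a. x $ a) = qform {..<k} (\<lambda>a b. Y $$ (a,b)) (\<lambda>a. x $ a)" by (rule qform_cong) (simp add: Ye)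
    also have "\<dots> = scalar_prod x (Y *\<^sub>v x)" by (rule scalar_prod_qform[OF Y x, symmetric])
    also have "\<dots> = scalar_prod v (Z *\<^sub>v v)" unfolding Yx x_def[symmetric] by (rule comm_scalar_prod[OF x v(1)])
    finally show "0 < scalar_prod v (Z *\<^sub>v v)" .
  qed
  obtain Y' where Y': "mat_inverse Z = Some Y'" "symmetric_mat k Y'" "Y' * Z = 1\<^sub>m k"
    using pos_def_mat_inverse[OF pdZ] by blast
  have CY': "Y' \<in> carrier_mat k k" using Y'(2) by (simp add: symmetric_mat_def)
  have "Y' = Y' * (Z * Y)" using CY' by (simp add: ZY)
  also have "\<dots> = (Y' * Z) * Y" using CY' Z Y by (simp add: assoc_mult_mat[of _ k k _ k _ k])
  also have "\<dots> = Y" using Y by (simp add: Y'(3))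
  finally have inv: "the (mat_inverse Z) = Y" by (simp add: Y'(1))
  have "A 0 + Z + S = (z - K) \<cdot>\<^sub>m 1\<^sub>m k"
    by (rule eq_matI) (use Ac[of 0] Z S in \<open>auto simp: Ze Se kdelta_def\<close>)
  then show ?thesis using rho_edge_le[where A=A and l=l, OF k A pdZ] unfolding inv S_def[symmetric] by (simp add: max_eigenvalue_smult_one[OF k])
qed

theorem mainTheorem1:
  fixes k l :: nat
    and A :: "nat \<Rightarrow> real mat"
    and M :: "nat \<Rightarrow> 'w measure"
    and G :: "nat \<Rightarrow> nat \<Rightarrow> 'w \<Rightarrow> real mat"
  assumes "k \<ge> 1"
    and "\<And>i. i \<le> l \<Longrightarrow> symmetric_mat k (A i)"
    and "\<And>n. n \<ge> 1 \<Longrightarrow> indep_std_gaussian_mats (M n) l n (G n)"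
  shows "\<exists>L. (\<lambda>n. integral\<^sup>L (M n) (\<lambda>\<omega>. max_eigenvalue (H_mat k l A n (\<lambda>i. G n i \<omega>))))
               \<longlonglongrightarrow> L \<and> L \<ge> rho_edge k l A"
proof (rule edge_limit[where k = k and l = l and A = "\<lambda>i a b. A i $$ (a,b)" and B = "\<lambda>a b. A 0 $$ (a,b)"
      and g = "\<lambda>n (i,p,q) \<omega>. G n i \<omega> $$ (p,q)"])
  let ?A = "\<lambda>i a b. A i $$ (a,b)" and ?B = "\<lambda>a b. A 0 $$ (a,b)"
  show "k \<ge> 1" by fact
  show "?A i a b = ?A i b a" if "i \<in> {1..l}" "a < k" "b < k" for i a b
    using symmetric_mat_entry[OF assms(2) that(2,3)] that(1) by simp
  show "?B a b = ?B b a" if "a < k" "b < k" for a b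
    using symmetric_mat_entry[OF assms(2) that, of 0] by simp
  show "gaussian_family (M n) (\<lambda>(i,p,q) \<omega>. G n i \<omega> $$ (p,q)) (noise_index l {..<n})" if "n \<ge> 1" for n
    by (rule gaussian_family_of_mats[OF assms(3)[OF that]])
  have Ac: "A i \<in> carrier_mat k k" if "i \<le> l" for i using assms(2)[OF that] by (simp add: symmetric_mat_def)
  fix n \<omega> assume n: "n \<ge> 1" and w: "\<omega> \<in> space (M n)"
  let ?H = "H_mat k l A n (\<lambda>i. G n i \<omega>)"
  have G: "G n i \<omega> \<in> carrier_mat n n" if "i \<in> {1..l}" for i
    using assms(3)[OF n] that w by (simp add: indep_std_gaussian_mats_def)
  have sym: "symmetric_mat (k * n) ?H" by (rule H_mat_symmetric[OF assms(2) G])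
  have kn: "1 \<le> k * n" using \<open>k \<ge> 1\<close> n by simp
  have e: "gauss_mat l ?A ?B {..<n} (\<lambda>e. sqrt (1 / real n) * (case e of (i,p,q) \<Rightarrow> \<lambda>\<omega>. G n i \<omega> $$ (p,q)) \<omega>) i j
      = ?H $$ ((\<lambda>(a,u). a * n + u) i, (\<lambda>(a,u). a * n + u) j)" if ij: "i \<in> block_index k {..<n}" "j \<in> block_index k {..<n}" for i j
  proof -
    obtain a u b v where i: "i = (a,u)" "a < k" "u < n" and j: "j = (b,v)" "b < k" "v < n"
      using ij by (auto simp: block_index_def)
    show ?thesis using H_mat_entry[where k=k and l=l and A=A and G="\<lambda>i. G n i \<omega>", OF Ac G i(2) j(2) i(3) j(3)]
      by (simp add: i(1) j(1) split_def)
  qed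
  show "qform (block_index k {..<n}) (gauss_mat l ?A ?B {..<n} (\<lambda>e. sqrt (1 / real n) * (case e of (i,p,q) \<Rightarrow> \<lambda>\<omega>. G n i \<omega> $$ (p,q)) \<omega>)) v
      \<le> max_eigenvalue ?H * sqnorm (block_index k {..<n}) v" for v
    by (rule max_eigenvalue_reindex(1)[OF sym kn bij_betw_block_index e])
  show "\<exists>v. sqnorm (block_index k {..<n}) v = 1 \<and> qform (block_index k {..<n}) (gauss_mat l ?A ?B {..<n} (\<lambda>e. sqrt (1 / real n) * (case e of (i,p,q) \<Rightarrow> \<lambda>\<omega>. G n i \<omega> $$ (p,q)) \<omega>)) v
      = max_eigenvalue ?H"
    by (rule max_eigenvalue_reindex(2)[OF sym kn bij_betw_block_index e])
next
  fix z K :: real and Q :: "nat \<Rightarrow> nat \<Rightarrow> real"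
  assume "\<And>a b. a < k \<Longrightarrow> b < k \<Longrightarrow> Q a b = Q b a" "\<And>w. \<exists>a<k. w a \<noteq> 0 \<Longrightarrow> 0 < qform {..<k} Q w"
    "\<And>a b. a < k \<Longrightarrow> b < k \<Longrightarrow> z * Q a b = kdelta a b + (\<Sum>c<k. (A 0 $$ (a,c) + K * kdelta a c) * Q c b)
      + bil (\<lambda>i a b. A i $$ (a,b)) l k a (\<lambda>c e d. Q c e * Q d b)"
  note Q = this
  show "rho_edge k l A \<le> z - K"
    by (rule rho_edge_le_of_dyson[where A=A and l=l and k=k and Q=Q and z=z and K=K, OF assms(1) assms(2) Q])
qed

end
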